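(* There exists an absolute constant $c>0$ such that if the Dirichlet $L$-function $L(s,\chi_D)$ has a real zero $\beta$ satisfying $\beta>1-\frac{c}{\log D}$, then \[ S\;\gg\;\frac{\widehat{f}(0)}{h}\,\frac{L(1,\chi_D)}{\log x}, \] with an absolute implied constant.
   Context: Let $D>3$ be a prime with $D\equiv3\pmod 4$, $K=\mathbf{Q}(\sqrt{-D})$, $h$ its class number, and $\chi_D(n)=\left(\frac{-D}{n}\right)$ the Kronecker symbol (a primitive real character of conductor $D$). Fix an ideal class $\mathcal{C}$ of $K$ and let $\lambda_{\mathcal{C}}(n)=\#\{\mathfrak{a}\in\mathcal{C}:\ \mathfrak{a}\subseteq\mathcal{O}_K \text{ integral},\ \mathrm{N}\mathfrak{a}=n\}$. Let $f\ge 0$ be a smooth function supported in $[1-\nu,1]$ with $\widehat{f}(0)>0$, where $\widehat{f}(\xi)=\int_{-\infty}^{\infty}f(u)e^{-2\pi i\xi u}\,du$ and $\nu>0$ is a small fixed number. Let $x$ be a large parameter and \[ S=\sum_{p}\frac{1}{p}\lambda_{\mathcal{C}}(p)f\Big(\frac{\log p}{\log x}\Big), \] the sum over rational primes. Throughout, $x$ is related to $D$ by $D=x^{\theta}$ where $\theta\in(0,1)$ is a suitable small absolute constant fixed in the course of the argument (so $x$ is a fixed power of $D$). *)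

theory Defs
  imports
    "HOL-Complex_Analysis.Complex_Analysis"
    "HOL-Number_Theory.Number_Theory"
begin

section \<open>The imaginary quadratic field of discriminant \<open>-D\<close>\<close>

text \<open>\<open>K = \<rat>(\<surd>-D)\<close>, embedded in the complex numbers.\<close>

definition quad_field :: "nat \<Rightarrow> complex set" where
  "quad_field D = {of_rat a + of_rat b * (\<i> * of_real (sqrt (real D))) | a b. True}"

definition quad_integers :: "nat \<Rightarrow> complex set" where
  "quad_integers D = {z \<in> quad_field D. algebraic_int z}"

text \<open>
  Fractional ideals are nonzero. Closure under negation follows from closure under
  multiplication by \<open>-1\<close>.
\<close>

definition fractional_ideal :: "nat \<Rightarrow> complex set \<Rightarrow> bool" where
  "fractional_ideal D I \<longleftrightarrow>
     I \<subseteq> quad_field D \<and> 0 \<in> I \<and> I \<noteq> {0} \<and>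
     (\<forall>x\<in>I. \<forall>y\<in>I. x + y \<in> I) \<and>
     (\<forall>a\<in>quad_integers D. \<forall>x\<in>I. a * x \<in> I) \<and>
     (\<exists>d\<in>quad_integers D - {0}. \<forall>x\<in>I. d * x \<in> quad_integers D)"

definition ideal_equiv :: "nat \<Rightarrow> (complex set \<times> complex set) set" where
  "ideal_equiv D =
     {(I, J). fractional_ideal D I \<and> fractional_ideal D J \<and>
              (\<exists>\<alpha>\<in>quad_field D - {0}. J = (*) \<alpha> ` I)}"

definition ideal_classes :: "nat \<Rightarrow> complex set set set" where
  "ideal_classes D = {I. fractional_ideal D I} // ideal_equiv D"

definition class_number :: "nat \<Rightarrow> nat" where
  "class_number D = card (ideal_classes D)"

text \<open>The norm of an integral ideal: its index in the ring of integers, counted by cosets.\<close>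

definition ideal_norm :: "nat \<Rightarrow> complex set \<Rightarrow> nat" where
  "ideal_norm D I = card ((\<lambda>z. (+) z ` I) ` quad_integers D)"

definition class_ideal_count :: "nat \<Rightarrow> complex set set \<Rightarrow> nat \<Rightarrow> nat" where
  "class_ideal_count D C n = card {I \<in> C. I \<subseteq> quad_integers D \<and> ideal_norm D I = n}"

section \<open>The Kronecker symbol and Dirichlet \<open>L\<close>-functions\<close>

text \<open>The Kronecker symbol \<open>(a/n)\<close> for a natural number \<open>n\<close>, extended from the primes by multiplicativity.\<close>

definition kronecker_prime :: "int \<Rightarrow> nat \<Rightarrow> int" where
  "kronecker_prime a p =
     (if p = 2 then (if even a then 0 else if a mod 8 \<in> {1, 7} then 1 else - 1)
      else Legendre a (int p))"

definition kronecker :: "int \<Rightarrow> nat \<Rightarrow> int" where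
  "kronecker a n =
     (if n = 0 then (if \<bar>a\<bar> = 1 then 1 else 0)
      else (\<Prod>p\<in>#prime_factorization n. kronecker_prime a p))"

definition chi :: "nat \<Rightarrow> nat \<Rightarrow> complex" where
  "chi D n = of_int (kronecker (- int D) n)"

text \<open>
  The entire function continuing the Dirichlet series of \<open>X\<close>. It is unique by the identity
  theorem, and exists whenever \<open>X\<close> is a non-principal Dirichlet character. The series is
  indexed from \<open>0\<close>, hence the \<open>Suc\<close>.
\<close>

definition dirichlet_L :: "(nat \<Rightarrow> complex) \<Rightarrow> complex \<Rightarrow> complex" where
  "dirichlet_L X = (THE F. F holomorphic_on UNIV \<and>
     (\<forall>s. Re s > 1 \<longrightarrow> (\<lambda>n. X (Suc n) * of_nat (Suc n) powr (- s)) sums F s))"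

section \<open>Weight functions and the sum over primes\<close>

definition smooth_real :: "(real \<Rightarrow> real) \<Rightarrow> bool" where
  "smooth_real f \<longleftrightarrow> (\<forall>k. (deriv ^^ k) f differentiable_on UNIV)"

definition fourier_transform :: "(real \<Rightarrow> real) \<Rightarrow> real \<Rightarrow> complex" where
  "fourier_transform f \<xi> =
     (LINT u|lborel. of_real (f u) * exp (- (2 * of_real pi * \<i> * of_real \<xi> * of_real u)))"

text \<open>
  Since \<open>fourier_transform f 0\<close> is the integral of the real function \<open>f\<close>, it is real, and
  \<open>Re\<close> below only changes its type.
\<close>

definition weight_function :: "real \<Rightarrow> (real \<Rightarrow> real) \<Rightarrow> bool" where
  "weight_function \<nu> f \<longleftrightarrow>
     smooth_real f \<and> (\<forall>u. f u \<ge> 0) \<and> (\<forall>u. u \<notin> {1 - \<nu>..1} \<longrightarrow> f u = 0) \<and>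
     Re (fourier_transform f 0) > 0"

text \<open>For \<open>x > 1\<close> and a weight function \<open>f\<close> only primes \<open>p \<le> x\<close> contribute.\<close>

definition prime_class_sum :: "nat \<Rightarrow> complex set set \<Rightarrow> (real \<Rightarrow> real) \<Rightarrow> real \<Rightarrow> real" where
  "prime_class_sum D C f x =
     (\<Sum>\<^sub>\<infinity>p | prime p. 1 / real p * real (class_ideal_count D C p) * f (ln (real p) / ln x))"

end

theory Submission
  imports Defs
begin

text \<open>
  The ideals of prime norm in the class correspond, up to sign, to the points where a binary
  quadratic form of discriminant \<open>-D\<close> takes a prime value. Sieve these values by the primes up to \<open>D^32\<close>.
  A composite value that survives has a prime factor \<open>p\<close> with \<open>D^32 < p \<le> \<surd>x\<close>. If \<open>p\<close> is inert, then \<open>p^2\<close>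
  divides the value and there are few of these. If \<open>p\<close> splits, then the point lies on one of two
  sublattices of index \<open>p\<close>, on which the form is \<open>p\<close> times another form of discriminant \<open>-D\<close>, and an upper
  bound sieve gives a saving of \<open>1/p\<close>. So it suffices that the sum of \<open>1/p\<close> over the split primes in the range is
  small, and this is what the exceptional zero gives: for \<open>\<lambda> = 1 * \<chi>\<close>, the zero removes the constant
  term from the asymptotics of \<open>\<Sum>n\<le>y. \<lambda> n / n powr \<beta>\<close>, which leaves a slowly growing main term, whereas
  multiplication of the \<open>n \<le> z\<close> by split primes beyond \<open>z\<close> would make it grow. Since \<open>\<lambda> n\<close> counts at most the
  ideals of norm \<open>n\<close>, lattice point counting gives \<open>L(1, \<chi>) = O(h / \<surd>D)\<close>, the bound that turns the count into
  the stated form.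
\<close>

section \<open>The Kronecker symbol as a periodic character\<close>

text \<open>A sieve by itself cannot separate primes from products of two primes; the zero lifts
  this obstacle by making large split primes rare. The exponent 32 is dictated by the proof of that
  rarity: for \<open>lam = 1 * X\<close> the error at y = U^2 has size D U^(-1/4) ln U, and U = D^16
  makes it smaller than 104 / D. From there up to powers of x the main term changes by about one
  percent, because 1 - \<beta> is at most 1 / (400 ln x). The numerical balance is this. The lower
  sieve keeps half of the expected mass. The upper sieve, with constant 3 / 2 on each of two
  sublattices and a sum of 1 / p of at most 1 / 12, removes a quarter, so a quarter is left.
  Densities of size 2 / p cost a factor (ln x)^(-2), while the weighted count of all points supplies
  a factor ln x; together they produce the 1 / ln x of the claim. Losses are allowed to be powers of
  D throughout: the level of the sieve is a fixed power of D, the lattice count saves a power of x,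
  and \<theta> is chosen last so that the saving wins.\<close>

lemma Legendre_cong: "[a = b] (mod m) ==> Legendre a m = Legendre b m"
 unfolding Legendre_def QuadRes_def by (auto dest: cong_sym cong_trans)

lemma Legendre_values: "Legendre a p \<in> {-1, 0, 1}"
 unfolding Legendre_def by auto

text \<open>Two values in {-1, 0, 1} differ by at most 2, so for p > 2 their congruence modulo p is
  equality. Multiplicativity and the value at -1 thereby reduce to congruences between
  powers.\<close>

lemma Legendre_unique:
 assumes "prime p" "2 < p" "[e = a ^ ((p - 1) div 2)] (mod int p)" "e \<in> {-1, 0, 1}"
 shows "Legendre a (int p) = e"
proof -
 have "[Legendre a p = e] (mod int p)"
  using euler_criterion[OF assms(1,2)] assms(3) cong_sym cong_trans by blast
 hence dv: "int p dvd Legendre a p - e" by (simp add: cong_iff_dvd_diff)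
 have "\<bar>Legendre a p - e\<bar> \<le> 2" using Legendre_values[of a p] assms(4) by auto
 hence "\<bar>Legendre a p - e\<bar> < int p" using assms(2) by linarith
 hence "Legendre a p - e = 0" using dv
  by (metis abs_of_nat dvd_imp_le_int linorder_not_less)
 thus ?thesis by simp
qed

lemma Legendre_mult:
 assumes "prime p" "2 < p"
 shows "Legendre (a * b) (int p) = Legendre a p * Legendre b p"
proof (rule Legendre_unique[OF assms])
 show "[Legendre a p * Legendre b p = (a * b) ^ ((p - 1) div 2)] (mod int p)"
  unfolding power_mult_distrib by (intro cong_mult euler_criterion assms)
 show "Legendre a p * Legendre b p \<in> {-1, 0, 1}"
  using Legendre_values[of a p] Legendre_values[of b p] by auto
qed

lemma Legendre_minus_one:
 assumes "prime p" "2 < p"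
 shows "Legendre (- 1) (int p) = (- 1) ^ ((p - 1) div 2)"
proof (rule Legendre_unique[OF assms])
 show "(- 1) ^ ((p - 1) div 2) \<in> {- 1, 0, 1 :: int}"
  by (cases "even ((p - 1) div 2)") auto
qed simp

lemma three_mod_four_cases:
 fixes p :: nat
 assumes "p mod 4 = 3"
 obtains k where "p = 8 * k + 3" | k where "p = 8 * k + 7"
proof -
 have p: "p = 4 * (p div 4) + 3" using assms by (metis mult_div_mod_eq)
 show ?thesis
 proof (cases "even (p div 4)")
  case True
  then obtain k where "p div 4 = 2 * k" by blast
  thus ?thesis using that(1)[of k] p by simp
 next
  case False
  then obtain k where "p div 4 = 2 * k + 1" by (blast elim: oddE)
  thus ?thesis using that(2)[of k] p by simp
 qed
qed

text \<open>Gauss's lemma: the doubled residues beyond (p - 1) / 2 number \<open>2 * k + 2\<close>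
  or \<open>2 * k + 1\<close>, and this parity is the sign. The class 3 modulo 4 is the one in which
  D lies.\<close>

lemma Legendre_two:
 assumes "prime p" "[p = 3] (mod 4)" "p > 3"
 shows "Legendre 2 (int p) = (if p mod 8 = 7 then 1 else - 1)"
proof -
 have "p mod 4 = 3" using assms(2) by (simp add: cong_def)
 then obtain k where k: "p = 8 * k + 3 \<or> p = 8 * k + 7"
  by (metis three_mod_four_cases)
 define h where "h = (int p - 1) div 2"
 have h: "int p = 2 * h + 1" unfolding h_def using k by auto
 have "\<not> [2 = 0] (mod int p)"
  using assms(3) by (simp add: cong_def)
 then interpret G: GAUSS p 2
  using assms by unfold_locales simp_all
 have B: "G.B = (\<lambda>x. x * 2) ` {0<..h}" unfolding G.B_def G.A_def h_def by simp
 \<comment> \<open>Doubles of residues up to (p - 1) / 2 stay below p, so the reduction modulo p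
   changes nothing.\<close>
 have C: "G.C = G.B" unfolding G.C_def B image_image
  by (intro image_cong refl mod_pos_pos_trivial) (use h in simp_all)
 have "h < x * 2 \<longleftrightarrow> h div 2 < x" for x by linarith
 moreover have "0 \<le> h" using h assms(3) by simp
 hence "0 < x" if "h div 2 < x" for x using that by linarith
 ultimately have E: "G.E = (\<lambda>x. x * 2) ` {h div 2<..h}"
  unfolding G.E_def C B h_def[symmetric] by (auto simp: image_iff)
 have "card G.E = nat (h - h div 2)"
  unfolding E by (subst card_image) (auto simp: inj_on_def)
 moreover have "nat (h - h div 2) = (if p mod 8 = 7 then 2 * k + 2 else 2 * k + 1)"
  using k
 proof
  assume p: "p = 8 * k + 3"
  hence "h = 4 * int k + 1" using h by simp
  thus ?thesis using p by simp
 next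
  assume p: "p = 8 * k + 7"
  hence "h = 4 * int k + 3" using h by simp
  thus ?thesis using p by simp
 qed
 ultimately have "card G.E = (if p mod 8 = 7 then 2 * k + 2 else 2 * k + 1)" by simp
 thus ?thesis unfolding G.gauss_lemma by simp
qed

text \<open>For odd p distinct from D the sign of \<open>Legendre (- 1) p\<close> cancels the sign
  of quadratic reciprocity, because (D - 1) / 2 is odd. The case p = 2 is the supplementary law, and
  at p = D both sides vanish.\<close>

lemma kronecker_prime_eq:
 assumes D: "prime D" "[D = 3] (mod 4)" "D > 3" and p: "prime p"
 shows "kronecker_prime (- int D) p = Legendre (int p) (int D)"
proof -
 have D4: "D mod 4 = 3" using D(2) by (simp add: cong_def)
 have "odd D" using D4 by presburger
 consider "p = 2" | "p = D" | "p ~= 2" "p ~= D" by blast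
 thus ?thesis
 proof cases
  case 1
  obtain k where k: "D = 8 * k + 3 \<or> D = 8 * k + 7"
   using D4 by (metis three_mod_four_cases)
  have "(- int D) mod 8 = (if D mod 8 = 7 then 1 else 5)"
   using k
  proof
   assume k: "D = 8 * k + 3"
   have "(- (8 * int k + 3)) mod 8 = 5" by presburger
   thus ?thesis using k by simp
  next
   assume k: "D = 8 * k + 7"
   have "(- (8 * int k + 7)) mod 8 = 1" by presburger
   thus ?thesis using k by simp
  qed
  thus ?thesis using 1 Legendre_two[OF D] \<open>odd D\<close> by (auto simp: kronecker_prime_def)
 next
  case 2
  thus ?thesis using D by (auto simp: kronecker_prime_def Legendre_def cong_def)
 next
  case 3
  have p2: "2 < p" using p 3 prime_ge_2_nat[of p] by linarith
  define e where "e = (p - 1) div 2"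
  have oddD: "odd ((D - 1) div 2)" using D4 D(3) by presburger
  have "Legendre (- int D) (int p) = Legendre (- 1) (int p) * Legendre (int D) (int p)"
   using Legendre_mult[OF p p2, of "-1" "int D"] by simp
  also have "Legendre (- 1) (int p) = (- 1) ^ e"
   unfolding e_def by (rule Legendre_minus_one[OF p p2])
  finally have 1: "Legendre (- int D) (int p) = (- 1) ^ e * Legendre (int D) (int p)" .
  have "Legendre (int p) (int D) * Legendre (int D) (int p) = ((- 1) ^ ((D - 1) div 2)) ^ e"
   using Quadratic_Reciprocity[of p D] p D p2 3
   by (simp add: e_def power_mult[symmetric] mult.commute)
  also have "(- 1 :: int) ^ ((D - 1) div 2) = - 1" using oddD by simp
  finally have 2: "Legendre (int p) (int D) * Legendre (int D) (int p) = (- 1) ^ e" .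
  have "Legendre (int D) (int p) ~= 0" using 2 by (metis mult_zero_right power_not_zero zero_neq_neg_one)
  hence "Legendre (int D) (int p) * Legendre (int D) (int p) = 1"
   using Legendre_values[of "int D" "int p"] by auto
  hence "Legendre (- int D) (int p) = Legendre (int p) (int D)"
   unfolding 1 2[symmetric] by (metis mult.assoc mult.right_neutral)
  thus ?thesis using 3 by (simp add: kronecker_prime_def)
 qed
qed

text \<open>Turned upside down, the symbol depends on n only modulo D. This makes the periodicity
  visible that the definition through prime factors hides.\<close>

lemma kronecker_eq_Legendre:
 assumes D: "prime D" "[D = 3] (mod 4)" "D > 3"
 shows "kronecker (- int D) n = Legendre (int n) (int D)"
proof (cases "n = 0")
 case True
 thus ?thesis using D by (simp add: kronecker_def Legendre_def)
next
 case False
 have one: "Legendre 1 (int D) = 1"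
 proof -
  have "QuadRes (int D) 1" unfolding QuadRes_def by (rule exI[of _ 1]) simp
  thus ?thesis using D by (simp add: Legendre_def cong_def)
 qed
 have "Legendre (int (prod_mset A)) (int D) = (\<Prod>p\<in>#A. kronecker_prime (- int D) p)"
  if "\<And>p. p \<in># A ==> prime p" for A
  using that
 proof (induction A)
  case empty
  thus ?case by (simp add: one)
 next
  case (add p A)
  have "2 < D" using D by simp
  thus ?case using add by (simp add: Legendre_mult[OF D(1)] kronecker_prime_eq[OF D])
 qed
 from this[of "prime_factorization n"] show ?thesis
  using False by (simp add: kronecker_def prod_mset_prime_factorization_nat in_prime_factors_iff)
qed

section \<open>Real periodic characters and the convolution \<open>lam\<close>\<close>

locale real_character =
 fixes X :: "nat => real" and N :: nat
 assumes X_mult: "X (a * b) = X a * X b"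
  and X_vals: "X n \<in> {- 1, 0, 1}"
  and X_one: "X 1 = 1"
  and X_period: "X (n + N) = X n"
  and X_sum: "(\<Sum>n<N. X n) = 0"
  and N_pos: "N > 0"
begin

lemma X_Suc_0: "X (Suc 0) = 1"
 using X_one by simp

lemma abs_X_le: "\<bar>X n\<bar> \<le> 1"
 using X_vals[of n] by auto

lemma X_power: "X (a ^ k) = X a ^ k"
 by (induction k) (simp_all add: X_Suc_0 X_mult)

lemma X_period_sum: "(\<Sum>n\<in>{m..<m + N}. X n) = 0"
proof (induction m)
 case 0
 show ?case using X_sum by (simp add: lessThan_atLeast0)
next
 case (Suc m)
 have "sum X {m..<Suc (m + N)} = X m + sum X {Suc m..<Suc m + N}"
  by (subst sum.atLeast_Suc_lessThan) auto
 moreover have "sum X {m..<Suc (m + N)} = sum X {m..<m + N} + X (m + N)"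
  by simp
 ultimately show ?case using Suc X_period[of m] by simp
qed

text \<open>Whole periods cancel and at most N terms remain. The factor N will be D, a power of x so
  small that the loss is affordable.\<close>

lemma abs_X_interval_sum_le: "\<bar>\<Sum>n\<in>{m..<k}. X n\<bar> \<le> real N"
proof (induction "k - m" arbitrary: m rule: less_induct)
 case less
 show ?case
 proof (cases "k - m \<le> N")
  case True
  have "\<bar>\<Sum>n\<in>{m..<k}. X n\<bar> \<le> (\<Sum>n\<in>{m..<k}. 1)"
   by (rule order_trans[OF sum_abs sum_mono]) (rule abs_X_le)
  thus ?thesis using True by simp
 next
  case False
  have "sum X {m..<m + N} + sum X {m + N..<k} = sum X {m..<k}"
   by (rule sum.atLeastLessThan_concat) (use False in auto)
  thus ?thesis using less[of "m + N"] False N_pos X_period_sum[of m] by simp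
 qed
qed

text \<open>Summation by parts: the partial sums are bounded by N, and the decrements of c telescope
  back to \<open>c m\<close>.\<close>

lemma abs_X_weighted_sum_le:
 fixes c :: "nat => real"
 assumes "\<And>n. m \<le> n ==> n < k ==> 0 \<le> c n"
  and "\<And>n. m \<le> n ==> Suc n < k ==> c (Suc n) \<le> c n"
  and "m < k"
 shows "\<bar>\<Sum>n\<in>{m..<k}. X n * c n\<bar> \<le> real N * c m"
proof -
 define S where "S j = (\<Sum>n\<in>{m..<j}. X n)" for j
 have S: "\<bar>S j\<bar> \<le> real N" for j unfolding S_def by (rule abs_X_interval_sum_le)
 have eq: "(\<Sum>n\<in>{m..<Suc j}. X n * c n) =
    S (Suc j) * c j + (\<Sum>n\<in>{m..<j}. S (Suc n) * (c n - c (Suc n)))" if "m \<le> j" for j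
  using that
 proof (induction j rule: dec_induct)
  case base
  show ?case by (simp add: S_def)
 next
  case (step j)
  have "S (Suc (Suc j)) = S (Suc j) + X (Suc j)" using step by (simp add: S_def)
  thus ?case using step by (simp add: algebra_simps)
 qed
 obtain j where j: "k = Suc j" "m \<le> j" using assms(3) by (cases k) auto
 have tel: "(\<Sum>n\<in>{m..<j}. c n - c (Suc n)) = c m - c j"
  using sum_Suc_diff'[of m j "\<lambda>n. - c n"] j by simp
 have "\<bar>\<Sum>n\<in>{m..<k}. X n * c n\<bar> \<le> \<bar>S k * c j\<bar> + \<bar>\<Sum>n\<in>{m..<j}. S (Suc n) * (c n - c (Suc n))\<bar>"
  using eq[OF j(2)] j(1) by (simp add: abs_triangle_ineq)
 also have "\<bar>S k * c j\<bar> \<le> real N * c j"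
  using S[of k] assms(1)[of j] j by (simp add: abs_mult mult_right_mono)
 also have "\<bar>\<Sum>n\<in>{m..<j}. S (Suc n) * (c n - c (Suc n))\<bar> \<le>
   (\<Sum>n\<in>{m..<j}. real N * (c n - c (Suc n)))"
 proof (rule order_trans[OF sum_abs sum_mono])
  fix n assume "n \<in> {m..<j}"
  hence "0 \<le> c n - c (Suc n)" using assms(2)[of n] j by auto
  thus "\<bar>S (Suc n) * (c n - c (Suc n))\<bar> \<le> real N * (c n - c (Suc n))"
   using S[of "Suc n"] by (simp add: abs_mult mult_right_mono)
 qed
 also have "... = real N * (c m - c j)"
  by (simp add: sum_distrib_left[symmetric] tel)
 finally show ?thesis by (simp add: algebra_simps)
qed

text \<open>For the Kronecker symbol of -D these are the coefficients of the Dedekind zeta function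
  of the field.\<close>

definition lam :: "nat => real" where
 "lam n = (\<Sum>d | d dvd n. X d)"

lemma lam_one: "lam 1 = 1"
 by (simp add: lam_def X_Suc_0)

lemma lam_prime_power:
 assumes "prime p"
 shows "lam (p ^ k) = (\<Sum>i\<le>k. X p ^ i)"
proof -
 have "{d. d dvd p ^ k} = (\<lambda>i. p ^ i) ` {..k}"
  using divides_primepow_nat[OF assms] by auto
 moreover have "inj_on (\<lambda>i. p ^ i) {..k}"
  using assms prime_gt_1_nat by (auto simp: inj_on_def power_inject_exp)
 ultimately show ?thesis
  unfolding lam_def by (simp add: sum.reindex X_power)
qed

text \<open>A divisor of \<open>a * b\<close> splits uniquely into a divisor of a and one of b,
  recovered as its gcds with the two factors.\<close>

lemma lam_mult:
 assumes "coprime a b"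
 shows "lam (a * b) = lam a * lam b"
proof (cases "a = 0 \<or> b = 0")
 case True
 \<comment> \<open>Zero is coprime only to 1, so the claim reduces to
   \<open>lam_one\<close>.\<close>
 hence "(a = 0 \<and> b = 1) \<or> (a = 1 \<and> b = 0)" using assms by auto
 thus ?thesis by (auto simp: lam_one[unfolded One_nat_def])
next
 case False
 have "lam a * lam b = (\<Sum>(d, e)\<in>{d. d dvd a} \<times> {e. e dvd b}. X (d * e))"
  unfolding lam_def by (simp add: sum_product sum.cartesian_product X_mult)
 also have "... = (\<Sum>d | d dvd a * b. X d)"
 proof (rule sum.reindex_bij_witness[of _ "\<lambda>d. (gcd d a, gcd d b)" "\<lambda>(d, e). d * e"])
  have gcds: "gcd (d * e) a = d" "gcd (d * e) b = e" if "d dvd a" "e dvd b" for d e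
  proof -
   have "coprime e a" "coprime d b"
    using assms that coprime_divisors[of e b a a] coprime_divisors[of d a b b]
    by (auto simp: coprime_commute)
   thus "gcd (d * e) a = d" "gcd (d * e) b = e" using that
    by (simp_all add: gcd_mult_right_right_cancel gcd_mult_left_right_cancel coprime_commute
      gcd.commute gcd_mult_left_left_cancel gcd_mult_right_left_cancel gcd_nat.absorb1)
  qed
  fix x assume "x \<in> {d. d dvd a} \<times> {e. e dvd b}"
  then obtain d e where x: "x = (d, e)" "d dvd a" "e dvd b" by auto
  thus "(gcd (case x of (d, e) => d * e) a, gcd (case x of (d, e) => d * e) b) = x"
   by (simp add: gcds)
  show "(case x of (d, e) => d * e) \<in> {d. d dvd a * b}" using x by (auto intro: mult_dvd_mono)
 next
  fix d assume "d \<in> {d. d dvd a * b}"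
  then obtain d1 d2 where d: "d = d1 * d2" "d1 dvd a" "d2 dvd b"
   using division_decomp[of d a b] by auto
  have "coprime d2 a" "coprime d1 b"
   using assms d coprime_divisors[of d2 b a a] coprime_divisors[of d1 a b b]
   by (auto simp: coprime_commute)
  hence "gcd d a = d1" "gcd d b = d2" using d
   by (simp_all add: gcd_mult_right_right_cancel gcd_mult_left_right_cancel coprime_commute
     gcd.commute gcd_mult_left_left_cancel gcd_mult_right_left_cancel gcd_nat.absorb1)
  thus "(case (gcd d a, gcd d b) of (d, e) => d * e) = d"
   using d by simp
  show "(gcd d a, gcd d b) \<in> {d. d dvd a} \<times> {e. e dvd b}" by simp
 qed auto
 finally show ?thesis by (simp add: lam_def)
qed

lemma lam_mult_prime:
 assumes "prime p" "\<not> p dvd n"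
 shows "lam (n * p) = lam n * (1 + X p)"
proof -
 have "coprime n p" using prime_imp_coprime[OF assms] by (simp add: coprime_commute)
 thus ?thesis using lam_prime_power[OF assms(1), of 1] by (simp add: lam_mult X_Suc_0)
qed

text \<open>By multiplicativity only prime powers matter, where the sum is k + 1, or 1, or an
  alternating sum equal to 0 or 1. Positivity later allows terms of \<open>lam_sum\<close> to be
  dropped.\<close>

lemma lam_nonneg:
 assumes "n > 0"
 shows "0 \<le> lam n"
 using assms
proof (induction n rule: less_induct)
 case (less n)
 show ?case
 proof (cases "n = 1")
  case True
  thus ?thesis using lam_one by simp
 next
  case False
  then obtain p where p: "prime p" "p dvd n" using prime_factor_nat by blast
  obtain m where m: "n = p ^ multiplicity p n * m" "\<not> p dvd m"
   using multiplicity_decompose'[of n p] p less.prems by (metis not_prime_unit neq0_conv)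
  define k where "k = multiplicity p n"
  have k: "k > 0" unfolding k_def using p less.prems by (simp add: prime_multiplicity_gt_zero_iff prime_elem_multiplicity_eq_zero_iff)
  have "coprime (p ^ k) m" using p(1) m(2) by (simp add: prime_imp_coprime)
  hence eq: "lam n = lam (p ^ k) * lam m" using m(1) lam_mult unfolding k_def by metis
  have "m > 0" using m less.prems by (cases m) auto
  have "p ^ k > 1" using k p(1) prime_gt_1_nat one_less_power by blast
  hence "m < n" using m(1) \<open>m > 0\<close> unfolding k_def by (metis mult_less_cancel2 nat_mult_1)
  moreover have "0 \<le> lam (p ^ k)"
  proof -
   consider "X p = -1" | "X p = 0" | "X p = 1" using X_vals[of p] by auto
   thus ?thesis
   proof cases
    case 1
    have "(\<Sum>i\<le>k. (- 1 :: real) ^ i) = (if even k then 1 else 0)"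
     by (induction k) auto
    thus ?thesis using 1 by (simp add: lam_prime_power[OF p(1)])
   qed (auto simp: lam_prime_power[OF p(1)] intro!: sum_nonneg)
  qed
  ultimately show ?thesis using less.IH[of m] \<open>m > 0\<close> eq by simp
 qed
qed

end

section \<open>The character of the field\<close>

definition kron :: "nat => nat => real" where
 "kron D n = of_int (kronecker (- int D) n)"

lemma chi_eq_kron: "chi D n = of_real (kron D n)"
 by (simp add: chi_def kron_def)

text \<open>The sum over a period vanishes because the character is odd: -1 is a nonresidue modulo
  D, so n and D - n cancel.\<close>

lemma real_character_kron:
 assumes D: "prime D" "[D = 3] (mod 4)" "D > 3"
 shows "real_character (kron D) D"
proof
 have eq: "kron D n = of_int (Legendre (int n) (int D))" for n
  using kronecker_eq_Legendre[OF assms] by (simp add: kron_def)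
 have D2: "2 < D" using D by simp
 show mult: "kron D (a * b) = kron D a * kron D b" for a b
  by (simp add: eq Legendre_mult[OF D(1) D2])
 show vals: "kron D n \<in> {- 1, 0, 1}" for n
  using Legendre_values[of "int n" "int D"] by (auto simp: eq)
 show "kron D 1 = 1" by (simp add: kron_def kronecker_def)
 show "kron D (n + D) = kron D n" for n
  unfolding eq by (subst Legendre_cong[of _ "int n"]) (auto simp: cong_def)
 show "D > 0" using D by simp
 have odd: "kron D (D - n) = - kron D n" if "n \<le> D" for n
 proof -
  have "odd ((D - 1) div 2)"
   using D(2,3) unfolding cong_def by presburger
  hence "Legendre (- 1) (int D) = - 1" using Legendre_minus_one[OF D(1) D2] by simp
  moreover have "[int (D - n) = - 1 * int n] (mod int D)"
   using that by (simp add: cong_def of_nat_diff mod_diff_left_eq[of "int D", symmetric])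
  ultimately show ?thesis
   unfolding eq using Legendre_cong Legendre_mult[OF D(1) D2, of "-1" "int n"] by simp
 qed
 have "(\<Sum>n\<in>{1..<D}. kron D n) = (\<Sum>n\<in>{1..<D}. kron D (D - n))"
  by (rule sum.reindex_bij_witness[of _ "\<lambda>n. D - n" "\<lambda>n. D - n"]) auto
 also have "... = - (\<Sum>n\<in>{1..<D}. kron D n)"
  using odd by (simp add: sum_negf)
 finally have "(\<Sum>n\<in>{1..<D}. kron D n) = 0" by simp
 moreover have "(\<Sum>n<D. kron D n) = kron D 0 + (\<Sum>n\<in>{1..<D}. kron D n)"
  using \<open>D > 0\<close> by (simp add: lessThan_atLeast0 sum.atLeast_Suc_lessThan)
 moreover have "kron D 0 = 0" using D by (simp add: kron_def kronecker_def)
 ultimately show "(\<Sum>n<D. kron D n) = 0" by simp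
qed

section \<open>The entire continuation of a periodic Dirichlet series\<close>

text \<open>Each difference of \<open>x powr (- s)\<close> gains a factor 1 / x, so repeated
  summation by parts against these differences moves the half-plane of convergence to the left one
  unit at a time.\<close>

fun fdiff :: "nat => real => complex => complex" where
 "fdiff 0 x s = of_real x powr (- s)"
| "fdiff (Suc j) x s = fdiff j x s - fdiff j (x + 1) s"

text \<open>Differentiation in x commutes with differencing and raises s by 1, which closes the
  induction of the norm estimate.\<close>

lemma fdiff_has_vector_derivative:
 "x > 0 ==> ((\<lambda>x. fdiff j x s) has_vector_derivative (- s * fdiff j x (s + 1))) (at x within S)"
proof (induction j arbitrary: x S)
 case 0
 have "((\<lambda>z. z powr (- s)) has_field_derivative (- s) * of_real x powr (- s - 1)) (at (of_real x))"
  using 0 by (intro has_field_derivative_powr) (auto simp: complex_nonpos_Reals_iff)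
 from has_vector_derivative_real_field[OF this, of S] show ?case by simp
next
 case (Suc j)
 have "((\<lambda>x. x + 1) has_vector_derivative 1) (at x within S)"
  by (rule has_vector_derivative_add_const[THEN iffD2, OF has_vector_derivative_id])
 moreover have "x + 1 > 0" using Suc.prems by simp
 ultimately have "((\<lambda>x. fdiff j (x + 1) s) has_vector_derivative 1 *\<^sub>R (- s * fdiff j (x + 1) (s + 1))) (at x within S)"
  using vector_diff_chain_within[of "\<lambda>x. x + 1" 1 x S "\<lambda>x. fdiff j x s"] Suc.IH[of "x + 1"]
  unfolding o_def by blast
 hence "((\<lambda>x. fdiff (Suc j) x s) has_vector_derivative
   - s * fdiff j x (s + 1) - - s * fdiff j (x + 1) (s + 1)) (at x within S)"
  unfolding fdiff.simps scaleR_one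
  by (intro has_vector_derivative_diff Suc.IH[OF Suc.prems])
 moreover have "- s * fdiff j x (s + 1) - - s * fdiff j (x + 1) (s + 1) = - s * fdiff (Suc j) x (s + 1)"
  by (simp only: fdiff.simps right_diff_distrib)
 ultimately show ?case by simp
qed

text \<open>Mean value inequality on [x, x + 1]: every difference contributes one factor of the
  rising factorial of s and one power of x.\<close>

lemma norm_fdiff_le:
 assumes "x > 0" "Re s + real j \<ge> 0"
 shows "norm (fdiff j x s) \<le> (\<Prod>i<j. norm (s + of_nat i)) * x powr (- (Re s + real j))"
 using assms
proof (induction j arbitrary: x s)
 case 0
 thus ?case by (simp add: norm_powr_real_powr)
next
 case (Suc j)
 define B where "B = (\<Prod>i<Suc j. norm (s + of_nat i)) * x powr (- (Re s + real (Suc j)))"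
 have "norm (fdiff j x s - fdiff j (x + 1) s) \<le> B * norm (x - (x + 1))"
 proof (rule differentiable_bound[of "{x..x + 1}" _ "\<lambda>y h. h *\<^sub>R (- s * fdiff j y (s + 1))"])
  fix y assume y: "y \<in> {x..x + 1}"
  show "((\<lambda>x. fdiff j x s) has_derivative (\<lambda>h. h *\<^sub>R (- s * fdiff j y (s + 1)))) (at y within {x..x + 1})"
   using fdiff_has_vector_derivative[of y j s] y Suc.prems(1)
   by (simp add: has_vector_derivative_def)
  have "norm (fdiff j y (s + 1)) \<le>
    (\<Prod>i<j. norm (s + 1 + of_nat i)) * y powr (- (Re (s + 1) + real j))"
   using Suc.IH[of y "s + 1"] Suc.prems y by simp
  also have "y powr (- (Re (s + 1) + real j)) \<le> x powr (- (Re (s + 1) + real j))"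
   using y Suc.prems by (intro powr_mono2') auto
  finally have le: "norm (fdiff j y (s + 1)) \<le>
    (\<Prod>i<j. norm (s + 1 + of_nat i)) * x powr (- (Re (s + 1) + real j))"
   by (simp add: mult_left_mono prod_nonneg)
  have "norm (- s * fdiff j y (s + 1)) \<le> norm s * ((\<Prod>i<j. norm (s + 1 + of_nat i)) * x powr (- (Re (s + 1) + real j)))"
   unfolding norm_mult norm_minus_cancel by (intro mult_left_mono le) auto
  also have "... = B"
  proof -
   have "(\<Prod>i<Suc j. norm (s + of_nat i)) = norm s * (\<Prod>i<j. norm (s + 1 + of_nat i))"
    by (subst prod.lessThan_Suc_shift) (simp add: add_ac)
   thus ?thesis unfolding B_def by (simp add: algebra_simps)
  qed
  finally have "norm (- s * fdiff j y (s + 1)) \<le> B" .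
  note le = \<open>norm (- s * fdiff j y (s + 1)) \<le> B\<close>
  show "onorm (\<lambda>h. h *\<^sub>R (- s * fdiff j y (s + 1))) \<le> B"
  proof (intro onorm_le)
   fix h :: real
   from mult_left_mono[OF le abs_ge_zero[of h]]
   show "norm (h *\<^sub>R (- s * fdiff j y (s + 1))) \<le> B * norm h"
    by (simp only: norm_scaleR real_norm_def mult.commute)
  qed
 qed auto
 thus ?case by (simp add: B_def)
qed

lemma holomorphic_fdiff: "x > 0 ==> (\<lambda>s. fdiff j x s) holomorphic_on S"
proof (induction j arbitrary: x)
 case 0
 have "fdiff 0 x = (\<lambda>s. exp (- s * Ln (of_real x)))"
  using 0 by (auto simp: powr_def fun_eq_iff)
 thus ?case by (auto intro!: holomorphic_intros)
next
 case (Suc j)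
 have "fdiff (Suc j) x = (\<lambda>s. fdiff j x s - fdiff j (x + 1) s)" by auto
 thus ?case using Suc by (auto intro!: holomorphic_intros)
qed

lemma periodic_bounded:
 fixes A :: "nat => complex"
 assumes "\<And>n. A (n + N) = A n" "N > 0"
 shows "norm (A n) \<le> (\<Sum>i<N. norm (A i))"
proof -
 have "A (m + k * N) = A m" for m k
 proof (induction k)
  case (Suc k)
  thus ?case using assms(1)[of "m + k * N"] by (simp add: ac_simps)
 qed simp
 from this[of "n mod N" "n div N"] have "A n = A (n mod N)" by simp
 thus ?thesis using assms(2) by (metis (no_types, lifting) finite_lessThan lessThan_iff member_le_sum mod_less_divisor norm_ge_zero)
qed

lemma bounded_fdiff_series:
 fixes A :: "nat => complex"
 assumes "\<And>n. norm (A n) \<le> K"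
 shows "\<exists>F. F holomorphic_on {s. Re s > 1 - real j} \<and>
  (\<forall>s. Re s > 1 - real j --> (\<lambda>n. A n * fdiff j (real (Suc n)) s) sums F s)"
proof -
 define S where "S = {s. Re s > 1 - real j}"
 have S: "open S" unfolding S_def by (rule open_halfspace_Re_gt)
 have K: "K \<ge> 0" using assms[of 0] norm_ge_zero order_trans by blast
 obtain g where g: "\<forall>x\<in>S. (\<lambda>n. A n * fdiff j (real (Suc n)) x) sums g x \<and> g field_differentiable at x"
 proof (rule series_differentiable_comparison_complex[OF S, of "\<lambda>n s. A n * fdiff j (real (Suc n)) s"])
  fix n x assume "x \<in> S"
  have "(\<lambda>s. A n * fdiff j (real (Suc n)) s) holomorphic_on UNIV"
   by (intro holomorphic_intros holomorphic_fdiff) auto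
  thus "(\<lambda>s. A n * fdiff j (real (Suc n)) s) field_differentiable at x"
   by (auto simp: holomorphic_on_def)
 next
  fix s0 assume "s0 \<in> S"
  \<comment> \<open>Half the distance to the boundary line, so that
    \<open>Re s + real j \<ge> 1 + d\<close> on the ball and the majorant is summable.\<close>
  define d where "d = (Re s0 - 1 + real j) / 2"
  have d: "d > 0" using \<open>s0 \<in> S\<close> by (simp add: d_def S_def)
  define R where "R = norm s0 + d + real j"
  define h where "h n = complex_of_real (K * R ^ j * real (Suc n) powr (- (1 + d)))" for n
  have "summable (\<lambda>n. real (Suc n) powr (- (1 + d)))"
   by (subst summable_Suc_iff) (use d in \<open>simp add: summable_real_powr_iff\<close>)
  hence "summable h" unfolding h_def by (intro summable_of_real summable_mult)
  moreover have R0: "R \<ge> 0" unfolding R_def using d by simp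
  hence "range h \<subseteq> \<real>\<^sub>\<ge>\<^sub>0" using K by (auto simp: h_def)
  moreover have "norm (A n * fdiff j (real (Suc n)) s) \<le> norm (h n)" if "s \<in> ball s0 d" for n s
  proof -
   have sd: "norm (s - s0) < d" using that by (simp add: dist_norm norm_minus_commute)
   have "\<bar>Re (s - s0)\<bar> < d" using abs_Re_le_cmod[of "s - s0"] sd by linarith
   hence "Re s > Re s0 - d" by simp
   moreover have "Re s0 + real j = 1 + 2 * d" by (simp add: d_def field_simps)
   ultimately have re: "Re s + real j \<ge> 1 + d" by linarith
   have "norm (fdiff j (real (Suc n)) s) \<le>
     (\<Prod>i<j. norm (s + of_nat i)) * real (Suc n) powr (- (Re s + real j))"
    using re d by (intro norm_fdiff_le) auto
   also have "... \<le> R ^ j * real (Suc n) powr (- (1 + d))"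
   proof (rule mult_mono)
    have "norm (s + of_nat i) \<le> R" if "i < j" for i
    proof -
     have "norm (s + of_nat i) \<le> norm (s - s0) + norm s0 + real i"
      using norm_triangle_ineq[of "s - s0" s0] norm_triangle_ineq[of s "of_nat i"] by simp
     thus ?thesis using sd that unfolding R_def by simp
    qed
    hence "(\<Prod>i<j. norm (s + of_nat i)) \<le> (\<Prod>i<j. R)" by (intro prod_mono) auto
    thus "(\<Prod>i<j. norm (s + of_nat i)) \<le> R ^ j" by simp
    show "real (Suc n) powr (- (Re s + real j)) \<le> real (Suc n) powr (- (1 + d))"
     using re by (intro powr_mono) auto
   qed (use R0 in auto)
   finally have "norm (A n) * norm (fdiff j (real (Suc n)) s) \<le> K * (R ^ j * real (Suc n) powr (- (1 + d)))"
    using assms[of n] K by (intro mult_mono) auto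
   moreover have "norm (h n) = K * (R ^ j * real (Suc n) powr (- (1 + d)))"
    unfolding h_def norm_of_real using K R0 by (simp add: abs_mult)
   ultimately show ?thesis by (simp add: norm_mult)
  qed
  ultimately show "\<exists>d h. 0 < d \<and> summable h \<and> range h \<subseteq> \<real>\<^sub>\<ge>\<^sub>0 \<and>
    (\<forall>\<^sub>F n in sequentially. \<forall>y\<in>ball s0 d \<inter> S. cmod (A n * fdiff j (real (Suc n)) y) \<le> cmod (h n))"
   using d by (intro exI[of _ d] exI[of _ h]) auto
 qed
 have "g holomorphic_on S" unfolding holomorphic_on_def
  using g field_differentiable_at_within by blast
 thus ?thesis using g unfolding S_def by auto
qed

text \<open>Supplies the vanishing boundary term when the series is summed by parts.\<close>

lemma fdiff_tendsto_0:
 assumes "Re s + real j > 0"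
 shows "(\<lambda>n. fdiff j (real (Suc n)) s) \<longlonglongrightarrow> 0"
proof (rule Lim_null_comparison)
 show "\<forall>\<^sub>F n in sequentially. norm (fdiff j (real (Suc n)) s) \<le>
   (\<Prod>i<j. norm (s + of_nat i)) * real (Suc n) powr (- (Re s + real j))"
  using assms by (intro always_eventually allI norm_fdiff_le) auto
 have "(\<lambda>n. real (Suc n) powr (- (Re s + real j))) \<longlonglongrightarrow> 0"
  using assms by (intro tendsto_neg_powr filterlim_compose[OF filterlim_real_sequentially filterlim_Suc]) auto
 from tendsto_mult_left[OF this, of "\<Prod>i<j. norm (s + of_nat i)"]
 show "(\<lambda>n. (\<Prod>i<j. norm (s + of_nat i)) * real (Suc n) powr (- (Re s + real j))) \<longlonglongrightarrow> 0" by simp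
qed

lemma periodic_sum_Suc:
 fixes A :: "nat => complex"
 assumes "\<And>n. A (n + N) = A n" "(\<Sum>n<N. A n) = 0"
 shows "(\<Sum>i\<le>n + N. A i) = (\<Sum>i\<le>n. A i)"
proof (induction n)
 case 0
 have "(\<Sum>i\<le>N. A i) = A N" using assms(2) by (simp add: lessThan_Suc_atMost[symmetric])
 thus ?case using assms(1)[of 0] by simp
next
 case (Suc n)
 thus ?case using assms(1)[of "Suc n"] by simp
qed

text \<open>Summation by parts replaces A by its partial sums B, again periodic because A sums to
  zero over a period. B need not have mean zero, so its mean \<mu> is split off: the constant
  sequence telescopes to the entire function \<open>\<mu> * fdiff j 1 s\<close>, and the induction
  hypothesis applies to \<open>B n - \<mu>\<close>. For positive k the series is claimed to converge
  only where Re s > - j, since there \<open>fdiff j\<close> tends to 0.\<close>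

lemma periodic_series_continuation:
 fixes A :: "nat => complex"
 assumes "\<And>n. A (n + N) = A n" "(\<Sum>n<N. A n) = 0" "N > 0"
 shows "\<exists>F. F holomorphic_on {s. Re s > 1 - real j - real k} \<and>
  (\<forall>s. Re s > 1 - real j - real k \<and> (k = 0 \<or> Re s > - real j) -->
   (\<lambda>n. A n * fdiff j (real (Suc n)) s) sums F s)"
 using assms
proof (induction k arbitrary: A j)
 case 0
 have "norm (A n) \<le> (\<Sum>i<N. norm (A i))" for n
  by (rule periodic_bounded) (use 0 in auto)
 from bounded_fdiff_series[of A, OF this, of j] show ?case by simp
next
 case (Suc k)
 define B where "B n = (\<Sum>i\<le>n. A i)" for n
 define \<mu> where "\<mu> = (\<Sum>n<N. B n) / of_nat N"
 have Bper: "B (n + N) = B n" for n unfolding B_def by (rule periodic_sum_Suc[OF Suc.prems(1,2)])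
 have "(\<Sum>n<N. B n - \<mu>) = 0"
  using Suc.prems(3) by (simp add: sum_subtractf \<mu>_def)
 moreover have "B (n + N) - \<mu> = B n - \<mu>" for n using Bper by simp
 ultimately obtain F where F: "F holomorphic_on {s. Re s > 1 - real (Suc j) - real k}"
  "\<And>s. Re s > 1 - real (Suc j) - real k ==> k = 0 \<or> Re s > - real (Suc j) ==>
   (\<lambda>n. (B n - \<mu>) * fdiff (Suc j) (real (Suc n)) s) sums F s"
  using Suc.IH[of "\<lambda>n. B n - \<mu>" "Suc j"] Suc.prems(3) by blast
 have Bsum: "norm (\<Sum>i<n. A i) \<le> (\<Sum>i<N. norm (B i))" for n
 proof (cases n)
  case 0
  thus ?thesis by (simp add: sum_nonneg)
 next
  case (Suc m)
  thus ?thesis using periodic_bounded[of B N m] Bper \<open>N > 0\<close>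
   by (simp add: B_def lessThan_Suc_atMost)
 qed
 have sums: "(\<lambda>n. A n * fdiff j (real (Suc n)) s) sums (F s + \<mu> * fdiff j 1 s)"
  if s: "Re s > 1 - real j - real (Suc k)" "Re s > - real j" for s
 proof -
  define d where "d n = fdiff j (real (Suc n)) s" for n
  have d0: "d \<longlonglongrightarrow> 0" unfolding d_def using fdiff_tendsto_0[of s j] s by simp
  have dS: "fdiff (Suc j) (real (Suc n)) s = d n - d (Suc n)" for n
   by (simp add: d_def add_ac)
  \<comment> \<open>Finite summation by parts; the middle term is the telescoped mean, the last one
    the boundary term with a bounded factor.\<close>
  have part: "(\<Sum>n<K. A n * d n) =
    (\<Sum>n<K. (B n - \<mu>) * (d n - d (Suc n))) + \<mu> * (d 0 - d K) + (\<Sum>i<K. A i) * d K" for K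
  proof (induction K)
   case (Suc K)
   define S where "S = (\<Sum>n<K. (B n - \<mu>) * (d n - d (Suc n)))"
   define T where "T = (\<Sum>i<K. A i)"
   have "B K = T + A K" by (simp add: B_def T_def lessThan_Suc_atMost[symmetric])
   moreover have "(\<Sum>n<K. A n * d n) = S + \<mu> * (d 0 - d K) + T * d K"
    using Suc by (simp add: S_def T_def)
   ultimately have "(\<Sum>n<K. A n * d n) + A K * d K =
     (S + (B K - \<mu>) * (d K - d (Suc K))) + \<mu> * (d 0 - d (Suc K)) + (T + A K) * d (Suc K)"
    by (simp add: algebra_simps)
   thus ?case unfolding S_def T_def sum.lessThan_Suc .
  qed simp
  have F1: "(\<lambda>K. \<Sum>n<K. (B n - \<mu>) * (d n - d (Suc n))) \<longlonglongrightarrow> F s"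
   using F(2)[of s] s unfolding sums_def dS by simp
  have "(\<lambda>K. (\<Sum>i<K. A i) * d K) \<longlonglongrightarrow> 0"
  proof (rule Lim_null_comparison)
   show "\<forall>\<^sub>F K in sequentially. norm ((\<Sum>i<K. A i) * d K) \<le> (\<Sum>i<N. norm (B i)) * norm (d K)"
    using Bsum by (auto simp: norm_mult mult_right_mono)
   show "(\<lambda>K. (\<Sum>i<N. norm (B i)) * norm (d K)) \<longlonglongrightarrow> 0"
    using tendsto_mult_left[OF tendsto_norm[OF d0], of "\<Sum>i<N. norm (B i)"] by simp
  qed
  from tendsto_add[OF tendsto_add[OF F1 tendsto_mult_left[OF tendsto_diff[OF tendsto_const d0]]] this]
  have "(\<lambda>K. \<Sum>n<K. A n * d n) \<longlonglongrightarrow> F s + \<mu> * (d 0 - 0) + 0"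
   unfolding part .
  thus ?thesis by (simp add: sums_def d_def)
 qed
 have "(\<lambda>s. F s + \<mu> * fdiff j 1 s) holomorphic_on {s. Re s > 1 - real j - real (Suc k)}"
  using F(1) by (intro holomorphic_intros holomorphic_fdiff) (simp_all add: algebra_simps)
 moreover have "\<forall>s. Re s > 1 - real j - real (Suc k) \<and> (Suc k = 0 \<or> Re s > - real j) -->
   (\<lambda>n. A n * fdiff j (real (Suc n)) s) sums (F s + \<mu> * fdiff j 1 s)"
  using sums by blast
 ultimately show ?case by blast
qed

text \<open>The continuations to the half-planes Re s > - k agree with the series on Re s > 0, hence
  with each other wherever both are defined, and can be glued.\<close>

lemma periodic_series_entire:
 fixes A :: "nat => complex"
 assumes "\<And>n. A (n + N) = A n" "(\<Sum>n<N. A n) = 0" "N > 0"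
 obtains F where "F holomorphic_on UNIV"
  "\<And>s. Re s > 0 ==> (\<lambda>n. A n * of_nat (Suc n) powr (- s)) sums F s"
proof -
 define P where "P k F \<longleftrightarrow> F holomorphic_on {s. Re s > - real k} \<and>
  (\<forall>s. Re s > 0 --> (\<lambda>n. A n * of_nat (Suc n) powr (- s)) sums F s)" for k F
 have "\<exists>F. P k F" for k
 proof -
  obtain F where F: "F holomorphic_on {s. Re s > 1 - real 0 - real (Suc k)}"
   "\<forall>s. Re s > 1 - real 0 - real (Suc k) \<and> (Suc k = 0 \<or> Re s > - real 0) -->
    (\<lambda>n. A n * fdiff 0 (real (Suc n)) s) sums F s"
   using periodic_series_continuation[OF assms, of 0 "Suc k"] by blast
  have "1 - real 0 - real (Suc k) = - real k" by simp
  hence "F holomorphic_on {s. Re s > - real k}" using F(1) by metis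
  moreover have "(\<lambda>n. A n * of_nat (Suc n) powr (- s)) sums F s" if "Re s > 0" for s
  proof -
   have "(\<lambda>n. A n * fdiff 0 (real (Suc n)) s) sums F s"
    using F(2)[rule_format, of s] that by simp
   thus ?thesis unfolding fdiff.simps of_real_of_nat_eq .
  qed
  ultimately show ?thesis unfolding P_def by blast
 qed
 then obtain G where G: "P k (G k)" for k by metis
 have agree: "G k s = G l s" if "k \<le> l" "Re s > - real k" for k l s
 proof (rule analytic_continuation_open[of "{s. Re s > 0}" "{s. Re s > - real k}" "G k" "G l"])
  show "G l holomorphic_on {s. Re s > - real k}"
   by (rule holomorphic_on_subset[of _ "{s. Re s > - real l}"])
     (use G[of l] that(1) in \<open>auto simp: P_def\<close>)
  show "G k holomorphic_on {s. Re s > - real k}" using G[of k] by (simp add: P_def)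
  show "G k z = G l z" if "z \<in> {s. Re s > 0}" for z
  proof (rule sums_unique2)
   show "(\<lambda>n. A n * of_nat (Suc n) powr (- z)) sums G k z" using G[of k] that unfolding P_def by blast
   show "(\<lambda>n. A n * of_nat (Suc n) powr (- z)) sums G l z" using G[of l] that unfolding P_def by blast
  qed
  have "1 \<in> {s. Re s > 0}" by simp
  thus "{s. Re s > 0} ~= {}" by blast
  show "connected {s. Re s > - real k}"
   by (intro convex_connected convex_halfspace_Re_gt)
 qed (use that in \<open>auto simp: open_halfspace_Re_gt\<close>)
 \<comment> \<open>An index whose half-plane contains s; by \<open>agree\<close> the value does not
   depend on which one is taken.\<close>
 define F where "F s = G (nat \<lceil>\<bar>Re s\<bar>\<rceil> + 1) s" for s
 have F: "F s = G k s" if "Re s > - real k" for s k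
 proof -
  define m where "m = nat \<lceil>\<bar>Re s\<bar>\<rceil> + 1"
  have "\<bar>Re s\<bar> < real m" using real_nat_ceiling_ge[of "\<bar>Re s\<bar>"] unfolding m_def of_nat_add by linarith
  hence "Re s > - real m" by linarith
  hence "G m s = G k s" using agree[of m k s] agree[of k m s] that by (metis nle_le)
  thus ?thesis unfolding F_def m_def .
 qed
 have "F holomorphic_on UNIV"
  unfolding holomorphic_on_open[OF open_UNIV]
 proof
  fix s :: complex
  obtain k :: nat where "- Re s < real k" using reals_Archimedean2 by blast
  hence k: "Re s > - real k" by linarith
  have "open {s. Re s > - real k}" by (rule open_halfspace_Re_gt)
  moreover have "F holomorphic_on {s. Re s > - real k}"
   using G[of k] holomorphic_cong[of _ "{s. Re s > - real k}" F "G k"] F unfolding P_def by auto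
  ultimately show "\<exists>f'. (F has_field_derivative f') (at s)"
   using k holomorphic_on_open[of "{s. Re s > - real k}" F] by blast
 qed
 moreover have "(\<lambda>n. A n * of_nat (Suc n) powr (- s)) sums F s" if "Re s > 0" for s
 proof -
  have "(\<lambda>n. A n * of_nat (Suc n) powr (- s)) sums G 0 s"
   using G[of 0] that unfolding P_def by blast
  moreover have "F s = G 0 s" by (rule F) (use that in simp)
  ultimately show ?thesis by metis
 qed
 ultimately show ?thesis using that by blast
qed

text \<open>The description of \<open>dirichlet_L\<close> mentions its series only for Re s > 1.
  Uniqueness of the continuation identifies it with the function built above, whose series converges
  for all \<sigma> > 0; this turns the value at 1 and the zero \<beta> into statements about real
  series.\<close>

lemma (in real_character) dirichlet_L_sums:
 assumes "\<sigma> > 0"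
 shows "(\<lambda>n. X (Suc n) * real (Suc n) powr (- \<sigma>)) sums
  Re (dirichlet_L (\<lambda>n. of_real (X n)) (of_real \<sigma>))"
  and "Im (dirichlet_L (\<lambda>n. of_real (X n)) (of_real \<sigma>)) = 0"
proof -
 have "(\<Sum>n<N. X (Suc n)) = 0"
  using X_period_sum[of "Suc 0"] by (simp add: lessThan_atLeast0 flip: sum.shift_bounds_Suc_ivl)
 hence "(\<Sum>n<N. complex_of_real (X (Suc n))) = 0" by (metis of_real_0 of_real_sum)
 moreover have "complex_of_real (X (Suc (n + N))) = of_real (X (Suc n))" for n
  using X_period[of "Suc n"] by simp
 ultimately obtain F where F: "F holomorphic_on UNIV"
  "\<And>s. Re s > 0 ==> (\<lambda>n. of_real (X (Suc n)) * of_nat (Suc n) powr (- s)) sums F s"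
  using periodic_series_entire[of "\<lambda>n. of_real (X (Suc n))" N] N_pos by blast
 have "dirichlet_L (\<lambda>n. of_real (X n)) = F"
  unfolding dirichlet_L_def
 proof (rule the_equality)
  fix H assume H: "H holomorphic_on UNIV \<and> (\<forall>s. Re s > 1 -->
    (\<lambda>n. of_real (X (Suc n)) * of_nat (Suc n) powr (- s)) sums H s)"
  show "H = F"
  proof
   fix z
   show "H z = F z"
   proof (rule analytic_continuation_open[of "{s. Re s > 1}" UNIV H F])
    have "2 \<in> {s. Re s > 1}" by simp
    thus "{s. Re s > 1} ~= {}" by blast
    show "H s = F s" if "s \<in> {s. Re s > 1}" for s
    proof -
     from that have "Re s > 1" "Re s > 0" by simp_all
     thus ?thesis using sums_unique2[OF _ F(2)[of s]] H by blast
    qed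
    show "H holomorphic_on UNIV" using H by blast
    show "F holomorphic_on UNIV" by (rule F(1))
    show "connected (UNIV :: complex set)" by (intro convex_connected convex_UNIV)
   qed (simp_all add: open_halfspace_Re_gt)
  qed
 next
  have "(\<lambda>n. of_real (X (Suc n)) * of_nat (Suc n) powr (- s)) sums F s" if "Re s > 1" for s
   using F(2)[of s] that by linarith
  thus "F holomorphic_on UNIV \<and> (\<forall>s. Re s > 1 -->
    (\<lambda>n. of_real (X (Suc n)) * of_nat (Suc n) powr (- s)) sums F s)"
   using F(1) by blast
 qed
 moreover have "(\<lambda>n. complex_of_real (X (Suc n) * real (Suc n) powr (- \<sigma>))) sums F (of_real \<sigma>)"
 proof -
  have "of_real (real m powr (- \<sigma>)) = of_nat m powr (- complex_of_real \<sigma>)" for m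
   using powr_of_real[of "real m" "- \<sigma>"] by simp
  moreover have "Re (complex_of_real \<sigma>) > 0" using assms by simp
  ultimately show ?thesis unfolding of_real_mult using F(2) by presburger
 qed
 ultimately have *: "(\<lambda>n. complex_of_real (X (Suc n) * real (Suc n) powr (- \<sigma>))) sums
   dirichlet_L (\<lambda>n. of_real (X n)) (of_real \<sigma>)" by simp
 show "(\<lambda>n. X (Suc n) * real (Suc n) powr (- \<sigma>)) sums
   Re (dirichlet_L (\<lambda>n. of_real (X n)) (of_real \<sigma>))"
  using sums_Re[OF *] unfolding Re_complex_of_real .
 have "(\<lambda>n. 0) sums Im (dirichlet_L (\<lambda>n. of_real (X n)) (of_real \<sigma>))"
  using sums_Im[OF *] unfolding Im_complex_of_real .
 thus "Im (dirichlet_L (\<lambda>n. of_real (X n)) (of_real \<sigma>)) = 0"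
  by (simp add: sums_iff)
qed

section \<open>Sparsity of the split primes in the presence of an exceptional zero\<close>

definition zsum :: "real => nat => real" where
 "zsum \<beta> k = (\<Sum>m\<in>{1..k}. real m powr (- \<beta>))"

definition zint :: "real => real => real" where
 "zint \<beta> w = (w powr (1 - \<beta>) - 1) / (1 - \<beta>)"

text \<open>The integrand \<open>t powr (- \<beta>)\<close> is decreasing on either side of \<beta>
  = 1, so the mean value theorem gives both bounds at once.\<close>

lemma zint_diff_bounds:
 assumes "\<beta> > 0" "\<beta> ~= 1" "1 \<le> v" "v \<le> w"
 shows "(w - v) * w powr (- \<beta>) \<le> zint \<beta> w - zint \<beta> v"
  and "zint \<beta> w - zint \<beta> v \<le> (w - v) * v powr (- \<beta>)"
proof -
 have "(w - v) * w powr (- \<beta>) \<le> zint \<beta> w - zint \<beta> v \<and>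
    zint \<beta> w - zint \<beta> v \<le> (w - v) * v powr (- \<beta>)"
 proof (cases "v = w")
  case False
  hence vw: "v < w" using assms by simp
  have der: "(zint \<beta> has_real_derivative t powr (- \<beta>)) (at t)" if "v \<le> t" for t
  proof -
   have "((\<lambda>w. w powr (1 - \<beta>)) has_real_derivative (1 - \<beta>) * t powr (1 - \<beta> - 1)) (at t)"
    using that assms by (intro has_real_derivative_powr) auto
   from DERIV_cdivide[OF DERIV_diff[OF this DERIV_const[of 1]], of "1 - \<beta>"]
   show ?thesis using assms(2) by (simp add: zint_def[abs_def])
  qed
  from MVT2[OF vw, of "zint \<beta>" "\<lambda>t. t powr (- \<beta>)", OF der]
  obtain t where t: "v < t" "t < w" "zint \<beta> w - zint \<beta> v = (w - v) * t powr (- \<beta>)"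
   by blast
  have "w powr (- \<beta>) \<le> t powr (- \<beta>)" "t powr (- \<beta>) \<le> v powr (- \<beta>)"
   using t assms by (intro powr_mono2'; simp)+
  thus ?thesis unfolding t(3) using vw by (auto intro!: mult_left_mono)
 qed simp
 thus "(w - v) * w powr (- \<beta>) \<le> zint \<beta> w - zint \<beta> v"
  "zint \<beta> w - zint \<beta> v \<le> (w - v) * v powr (- \<beta>)" by blast+
qed

text \<open>The excess of the sum over the integral decreases, and it increases once its last term
  is taken away; the common limit \<gamma> is zeta(\<beta>) + 1 / (1 - \<beta>). With the pole
  removed in this way it stays in [0, 1] as \<beta> tends to 1.\<close>

lemma zsum_approx:
 assumes "\<beta> > 0" "\<beta> ~= 1"
 obtains \<gamma> where "0 \<le> \<gamma>" "\<gamma> \<le> 1"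
  "\<And>k. k \<ge> 1 ==> 0 \<le> zsum \<beta> k - zint \<beta> (real k) - \<gamma>"
  "\<And>k. k \<ge> 1 ==> zsum \<beta> k - zint \<beta> (real k) - \<gamma> \<le> real k powr (- \<beta>)"
proof -
 define a where "a k = zsum \<beta> (Suc k) - zint \<beta> (real (Suc k))" for k
 define b where "b k = a k - real (Suc k) powr (- \<beta>)" for k
 have bnd: "real (Suc (Suc k)) powr (- \<beta>) \<le> zint \<beta> (real (Suc (Suc k))) - zint \<beta> (real (Suc k))"
  "zint \<beta> (real (Suc (Suc k))) - zint \<beta> (real (Suc k)) \<le> real (Suc k) powr (- \<beta>)" for k
  using zint_diff_bounds[OF assms, of "real (Suc k)" "real (Suc (Suc k))"] by simp_all
 have z: "zsum \<beta> (Suc (Suc k)) = zsum \<beta> (Suc k) + real (Suc (Suc k)) powr (- \<beta>)" for k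
  by (simp add: zsum_def)
 have dec: "decseq a"
 proof (rule decseq_SucI)
  show "a (Suc n) \<le> a n" for n unfolding a_def using bnd(1)[of n] z[of n] by linarith
 qed
 have inc: "incseq b"
 proof (rule incseq_SucI)
  show "b n \<le> b (Suc n)" for n unfolding a_def b_def using bnd(2)[of n] z[of n] by linarith
 qed
 have a0: "a 0 = 1" "b 0 = 0" by (simp_all add: a_def b_def zsum_def zint_def)
 have ab: "b k \<le> a k" for k by (simp add: b_def)
 have "a k \<ge> 0" for k
  using incseqD[OF inc, of 0 k] ab[of k] a0 by simp
 then obtain \<gamma> where \<gamma>: "a \<longlonglongrightarrow> \<gamma>" using decseq_convergent[OF dec, of 0] by blast
 have "(\<lambda>k. real (Suc k) powr (- \<beta>)) \<longlonglongrightarrow> 0"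
  using assms by (intro tendsto_neg_powr filterlim_compose[OF filterlim_real_sequentially filterlim_Suc]) auto
 from tendsto_diff[OF \<gamma> this] have \<gamma>b: "b \<longlonglongrightarrow> \<gamma>" unfolding b_def[abs_def] diff_0_right .
 have le: "\<gamma> \<le> a k" "b k \<le> \<gamma>" for k
  using decseq_ge[OF dec \<gamma>] incseq_le[OF inc \<gamma>b] by auto
 show ?thesis
 proof (rule that)
  show "0 \<le> \<gamma>" "\<gamma> \<le> 1" using le[of 0] a0 by auto
  fix k :: nat assume "k \<ge> 1"
  then obtain j where "k = Suc j" by (cases k) auto
  thus "0 \<le> zsum \<beta> k - zint \<beta> (real k) - \<gamma>"
   "zsum \<beta> k - zint \<beta> (real k) - \<gamma> \<le> real k powr (- \<beta>)"
   using le[of j] by (simp_all add: a_def b_def)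
 qed
qed

text \<open>The sum decreases in \<beta>, so the exponent 3 / 4 gives a bound uniform in
  \<beta>.\<close>

lemma zsum_le:
 assumes "\<beta> \<ge> 3 / 4"
 shows "zsum \<beta> k \<le> 4 * real k powr (1 / 4)"
proof (cases "k = 0")
 case False
 have "zsum \<beta> k \<le> zsum (3 / 4) k"
  unfolding zsum_def using assms by (intro sum_mono powr_mono) auto
 moreover obtain \<gamma> where \<gamma>: "0 \<le> \<gamma>" "\<gamma> \<le> 1"
  and "\<And>k. k \<ge> 1 ==> zsum (3 / 4) k - zint (3 / 4) (real k) - \<gamma> \<le> real k powr (- (3 / 4))"
  by (rule zsum_approx[of "3 / 4"]) auto
 hence "zsum (3 / 4) k - zint (3 / 4) (real k) - \<gamma> \<le> real k powr (- (3 / 4))"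
  using False by simp
 moreover have "real k powr (- (3 / 4)) \<le> real k powr 0" using False by (intro powr_mono) auto
 moreover note \<gamma>(2)
 moreover have "zint (3 / 4) (real k) = 4 * real k powr (1 / 4) - 4" by (simp add: zint_def)
 moreover have "real k powr 0 = 1" using False by simp
 ultimately show ?thesis by linarith
qed (simp add: zsum_def)

text \<open>The derivative has the sign of \<open>1 - \<xi> * ln t\<close>, and 5 exceeds exp (4 /
  3).\<close>

lemma ln_powr_antimono:
 fixes \<xi> :: real
 assumes "\<xi> \<ge> 3 / 4" "5 \<le> a" "a \<le> b"
 shows "ln b * b powr (- \<xi>) \<le> ln a * a powr (- \<xi>)"
proof (rule DERIV_nonpos_imp_nonincreasing[of a b "\<lambda>t. ln t * t powr (- \<xi>)"])
  fix t assume t: "a \<le> t" "t \<le> b"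
  have t5: "t \<ge> 5" using t assms by simp
  have "exp (4 / 3) \<le> (5 :: real)"
  proof -
   have "exp (1 / 3 :: real) \<le> 13 / 9"
    by (rule order_trans[OF exp_bound]) (auto simp: power2_eq_square)
   hence "exp (1 / 3 :: real) ^ 4 \<le> (13 / 9) ^ 4" by (intro power_mono) auto
   moreover have "exp (1 / 3 :: real) ^ 4 = exp (4 / 3)" by (simp flip: exp_of_nat_mult)
   moreover have "(13 / 9 :: real) ^ 4 \<le> 5" by (simp add: power4_eq_xxxx)
   ultimately show ?thesis by linarith
  qed
  hence "4 / 3 \<le> ln t" using t5 by (subst ln_ge_iff) auto
  hence "1 \<le> \<xi> * ln t" using mult_mono[of "3 / 4" \<xi> "4 / 3" "ln t"] assms by simp
  moreover have "((\<lambda>t. ln t * t powr (- \<xi>)) has_real_derivative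
    (1 - \<xi> * ln t) * t powr (- \<xi> - 1)) (at t)"
   by (rule derivative_eq_intros refl | use t5 in \<open>simp add: powr_diff field_simps\<close>)+
  ultimately show "\<exists>y. ((\<lambda>t. ln t * t powr (- \<xi>)) has_real_derivative y) (at t) \<and> y \<le> 0"
   by (intro exI[of _ "(1 - \<xi> * ln t) * t powr (- \<xi> - 1)"]) (auto intro: mult_nonpos_nonneg)
qed (use assms in simp)

section \<open>The summatory function of \<open>lam\<close>\<close>

context real_character
begin

lemma sum_lam:
 "(\<Sum>n\<in>{1..y}. lam n * f n) = (\<Sum>d\<in>{1..y}. X d * (\<Sum>m\<in>{1..y div d}. f (d * m)))"
proof -
 have "(\<Sum>n\<in>{1..y}. lam n * f n) = (\<Sum>(n, d)\<in>Sigma {1..y} (\<lambda>n. {d. d dvd n}). X d * f n)"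
  unfolding lam_def sum_distrib_right
  by (subst sum.Sigma) (auto intro: finite_divisors_nat)
 also have "... = (\<Sum>(d, m)\<in>Sigma {1..y} (\<lambda>d. {1..y div d}). X d * f (d * m))"
 proof (rule sum.reindex_bij_witness[of _ "\<lambda>(d, m). (d * m, d)" "\<lambda>(n, d). (d, n div d)"])
  fix x assume "x \<in> Sigma {1..y} (\<lambda>n. {d. d dvd n})"
  then obtain n d where x: "x = (n, d)" "1 \<le> n" "n \<le> y" "d dvd n" by auto
  then obtain m where m: "n = d * m" by auto
  have "d \<ge> 1" "m \<ge> 1" using x m by (auto simp: Suc_le_eq)
  moreover have "d \<le> d * m" using \<open>m \<ge> 1\<close> by simp
  hence "d \<le> y" using x m by linarith
  moreover have "m \<le> y div d" using x m \<open>d \<ge> 1\<close>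
   by (simp add: less_eq_div_iff_mult_less_eq mult.commute)
  ultimately show "(case x of (n, d) => (d, n div d)) \<in> Sigma {1..y} (\<lambda>d. {1..y div d})"
   using x m \<open>d \<le> y\<close> by auto
  show "(case case x of (n, d) => (d, n div d) of (d, m) => (d * m, d)) = x"
   using x by simp
  show "(case case x of (n, d) => (d, n div d) of (d, m) => X d * f (d * m)) =
    (case x of (n, d) => X d * f n)" using x by simp
 next
  fix x assume "x \<in> Sigma {1..y} (\<lambda>d. {1..y div d})"
  then obtain d m where x: "x = (d, m)" "1 \<le> d" "d \<le> y" "1 \<le> m" "m \<le> y div d" by auto
  hence "d * m \<le> y" by (simp add: less_eq_div_iff_mult_less_eq mult.commute)
  thus "(case x of (d, m) => (d * m, d)) \<in> Sigma {1..y} (\<lambda>n. {d. d dvd n})"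
   using x by auto
  show "(case case x of (d, m) => (d * m, d) of (n, d) => (d, n div d)) = x"
   using x by simp
 qed
 also have "... = (\<Sum>d\<in>{1..y}. X d * (\<Sum>m\<in>{1..y div d}. f (d * m)))"
  by (subst sum.Sigma[symmetric]) (auto simp: sum_distrib_left)
 finally show ?thesis .
qed

lemma sum_atLeastAtMost_eq: "(\<Sum>n\<in>{m..k}. f n) = (\<Sum>n\<in>{m..<Suc k}. f n)" for f :: "nat => real"
 by (simp add: atLeastLessThanSuc_atLeastAtMost)

text \<open>The bound for the sum between U and K does not depend on K, so it passes to the
  limit.\<close>

lemma L_tail:
 assumes "(\<lambda>n. X (Suc n) * real (Suc n) powr (- \<sigma>)) sums l" "\<sigma> > 0" "U \<ge> 1"
 shows "\<bar>(\<Sum>d\<in>{1..U}. X d * real d powr (- \<sigma>)) - l\<bar> \<le> real N * real U powr (- \<sigma>)"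
proof -
 have lim: "(\<lambda>K. \<Sum>d\<in>{1..K}. X d * real d powr (- \<sigma>)) \<longlonglongrightarrow> l"
 proof -
  have "(\<Sum>n<K. X (Suc n) * real (Suc n) powr (- \<sigma>)) = (\<Sum>d\<in>{1..K}. X d * real d powr (- \<sigma>))" for K
   by (induction K) auto
  thus ?thesis using assms(1) unfolding sums_def by (simp only:)
 qed
 have bound: "\<bar>(\<Sum>d\<in>{1..U}. X d * real d powr (- \<sigma>)) - (\<Sum>d\<in>{1..K}. X d * real d powr (- \<sigma>))\<bar>
   \<le> real N * real U powr (- \<sigma>)" if "K > U" for K
 proof -
  have "(\<Sum>d\<in>{1..<Suc U}. X d * real d powr (- \<sigma>)) + (\<Sum>d\<in>{Suc U..<Suc K}. X d * real d powr (- \<sigma>))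
    = (\<Sum>d\<in>{1..<Suc K}. X d * real d powr (- \<sigma>))"
   by (rule sum.atLeastLessThan_concat) (use that in auto)
  moreover have "\<bar>\<Sum>d\<in>{Suc U..<Suc K}. X d * real d powr (- \<sigma>)\<bar> \<le> real N * real (Suc U) powr (- \<sigma>)"
  proof (rule abs_X_weighted_sum_le)
   show "real (Suc n) powr (- \<sigma>) \<le> real n powr (- \<sigma>)" if "Suc U \<le> n" for n
    using that assms(2) by (intro powr_mono2') auto
  qed (use that in auto)
  moreover have "real (Suc U) powr (- \<sigma>) \<le> real U powr (- \<sigma>)"
   using assms by (intro powr_mono2') auto
  hence "real N * real (Suc U) powr (- \<sigma>) \<le> real N * real U powr (- \<sigma>)"
   by (intro mult_left_mono) auto
  ultimately show ?thesis unfolding sum_atLeastAtMost_eq by linarith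
 qed
 from tendsto_rabs[OF tendsto_diff[OF tendsto_const lim]]
 show ?thesis
 proof (rule tendsto_upperbound)
  show "\<forall>\<^sub>F K in sequentially. \<bar>(\<Sum>d\<in>{1..U}. X d * real d powr (- \<sigma>)) -
    (\<Sum>d\<in>{1..K}. X d * real d powr (- \<sigma>))\<bar> \<le> real N * real U powr (- \<sigma>)"
   using eventually_gt_at_top[of U] by eventually_elim (rule bound)
 qed simp
qed

lemma lam_sum_split:
 "(\<Sum>n\<in>{1..y}. lam n * real n powr (- \<beta>)) =
  (\<Sum>d\<in>{1..y}. X d * real d powr (- \<beta>) * zsum \<beta> (y div d))"
 unfolding sum_lam zsum_def
 by (intro sum.cong refl) (simp add: powr_mult sum_distrib_left mult.assoc)

end

context real_character
begin

text \<open>The mean value theorem in the exponent avoids a lower bound for \<open>1 - \<beta>\<close>.\<close>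

lemma zint_tail:
 assumes L1: "(\<lambda>n. X (Suc n) * real (Suc n) powr (- 1)) sums l1"
  and L\<beta>: "(\<lambda>n. X (Suc n) * real (Suc n) powr (- \<beta>)) sums l\<beta>"
  and \<beta>: "\<beta> \<ge> 3 / 4" "\<beta> ~= 1" and U: "U \<ge> 4"
 defines "y \<equiv> real U ^ 2"
 shows "\<bar>(y powr (1 - \<beta>) * ((\<Sum>d\<in>{1..U}. X d * real d powr (- 1)) - l1) -
   ((\<Sum>d\<in>{1..U}. X d * real d powr (- \<beta>)) - l\<beta>)) / (1 - \<beta>)\<bar>
  \<le> 4 * real N * real U powr (- (1 / 4)) * ln (real U)"
proof -
 define S where "S \<sigma> K = (\<Sum>d\<in>{1..K}. X d * real d powr (- \<sigma>))" for \<sigma> K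
 have lim: "S \<sigma> \<longlonglongrightarrow> l" if "(\<lambda>n. X (Suc n) * real (Suc n) powr (- \<sigma>)) sums l" for \<sigma> l
 proof -
  have "(\<Sum>n<K. X (Suc n) * real (Suc n) powr (- \<sigma>)) = S \<sigma> K" for K
   unfolding S_def by (induction K) auto
  thus ?thesis using that unfolding sums_def by (simp only:)
 qed
 have y: "y > 1" "ln y = 2 * ln (real U)" "y powr (1 / 4) = real U powr (1 / 2)"
  using U by (simp_all add: y_def ln_realpow powr_powr flip: powr_numeral)
 have bound: "\<bar>(y powr (1 - \<beta>) * (S 1 U - S 1 K) - (S \<beta> U - S \<beta> K)) / (1 - \<beta>)\<bar>
   \<le> 4 * real N * real U powr (- (1 / 4)) * ln (real U)" if K: "K > U" for K
 proof -
  \<comment> \<open>At \<sigma> = 1 this is the tail of the series at 1, scaled by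
    \<open>y powr (1 - \<beta>)\<close>, and at \<sigma> = \<beta> the tail of the other series. The
    quotient by 1 - \<beta> is therefore a value of the derivative of E, which stays bounded as
    \<beta> approaches 1.\<close>
  define E where "E \<sigma> = y powr (\<sigma> - \<beta>) * (\<Sum>d\<in>{Suc U..<Suc K}. X d * real d powr (- \<sigma>))" for \<sigma>
  define E' where "E' \<sigma> = y powr (\<sigma> - \<beta>) * (ln y * (\<Sum>d\<in>{Suc U..<Suc K}. X d * real d powr (- \<sigma>))
    - (\<Sum>d\<in>{Suc U..<Suc K}. X d * (ln (real d) * real d powr (- \<sigma>))))" for \<sigma>
  have SE: "S \<sigma> K - S \<sigma> U = (\<Sum>d\<in>{Suc U..<Suc K}. X d * real d powr (- \<sigma>))" for \<sigma>
  proof -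
   have "(\<Sum>d\<in>{1..<Suc U}. X d * real d powr (- \<sigma>)) + (\<Sum>d\<in>{Suc U..<Suc K}. X d * real d powr (- \<sigma>))
     = (\<Sum>d\<in>{1..<Suc K}. X d * real d powr (- \<sigma>))"
    by (rule sum.atLeastLessThan_concat) (use K in auto)
   thus ?thesis unfolding S_def sum_atLeastAtMost_eq by linarith
  qed
  have der: "(E has_real_derivative E' \<sigma>) (at \<sigma>)" for \<sigma>
  proof -
   have ds: "((\<lambda>\<sigma>. \<Sum>d\<in>{Suc U..<Suc K}. X d * real d powr (- \<sigma>)) has_real_derivative
     (\<Sum>d\<in>{Suc U..<Suc K}. X d * (- (ln (real d) * real d powr (- \<sigma>))))) (at \<sigma>)"
    by (intro DERIV_sum) (auto intro!: derivative_eq_intros)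
   have dy: "((\<lambda>\<sigma>. y powr (\<sigma> - \<beta>)) has_real_derivative y powr (\<sigma> - \<beta>) * ln y) (at \<sigma>)"
    using y(1) by (auto intro!: derivative_eq_intros)
   have "(E has_real_derivative
     y powr (\<sigma> - \<beta>) * ln y * (\<Sum>d\<in>{Suc U..<Suc K}. X d * real d powr (- \<sigma>)) +
     (\<Sum>d\<in>{Suc U..<Suc K}. X d * (- (ln (real d) * real d powr (- \<sigma>)))) * y powr (\<sigma> - \<beta>)) (at \<sigma>)"
    unfolding E_def[abs_def] by (rule DERIV_mult[OF dy ds])
   moreover have "y powr (\<sigma> - \<beta>) * ln y * (\<Sum>d\<in>{Suc U..<Suc K}. X d * real d powr (- \<sigma>)) +
     (\<Sum>d\<in>{Suc U..<Suc K}. X d * (- (ln (real d) * real d powr (- \<sigma>)))) * y powr (\<sigma> - \<beta>) = E' \<sigma>"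
    by (simp only: E'_def sum_negf mult_minus_right) (simp add: ring_distribs)
   ultimately show ?thesis by simp
  qed
  have E'le: "\<bar>E' \<xi>\<bar> \<le> 4 * real N * real U powr (- (1 / 4)) * ln (real U)"
   if \<xi>: "\<xi> \<ge> 3 / 4" "\<xi> - \<beta> \<le> 1 / 4" for \<xi>
  proof -
   define c where "c = real (Suc U) powr (- \<xi>)"
   have c: "c \<ge> 0" "c \<le> real U powr (- (3 / 4))"
   proof -
    have "c \<le> real U powr (- \<xi>)" unfolding c_def using U \<xi> by (intro powr_mono2') auto
    also have "... \<le> real U powr (- (3 / 4))" using U \<xi> by (intro powr_mono) auto
    finally show "c \<le> real U powr (- (3 / 4))" .
   qed (simp add: c_def)
   have A: "\<bar>\<Sum>d\<in>{Suc U..<Suc K}. X d * real d powr (- \<xi>)\<bar> \<le> real N * c"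
    unfolding c_def
   proof (rule abs_X_weighted_sum_le)
    show "real (Suc n) powr (- \<xi>) \<le> real n powr (- \<xi>)" if "Suc U \<le> n" for n
     using that \<xi> by (intro powr_mono2') auto
   qed (use K in auto)
   have B: "\<bar>\<Sum>d\<in>{Suc U..<Suc K}. X d * (ln (real d) * real d powr (- \<xi>))\<bar> \<le>
     real N * (ln (real (Suc U)) * c)"
    unfolding c_def
   proof (rule abs_X_weighted_sum_le)
    fix n assume n: "Suc U \<le> n"
    show "ln (real (Suc n)) * real (Suc n) powr (- \<xi>) \<le> ln (real n) * real n powr (- \<xi>)"
     using n U \<xi> by (intro ln_powr_antimono) auto
   qed (use K in auto)
   have ln: "ln (real (Suc U)) \<le> 2 * ln (real U)"
   proof -
    have "4 * U \<le> U * U" using U by simp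
    hence "Suc U \<le> U ^ 2" using U unfolding power2_eq_square by linarith
    hence "ln (real (Suc U)) \<le> ln (real (U ^ 2))"
     by (subst ln_le_cancel_iff) (use U in \<open>auto simp del: of_nat_Suc of_nat_power\<close>)
    thus ?thesis using U by (simp add: ln_realpow)
   qed
   have "\<bar>ln y * (\<Sum>d\<in>{Suc U..<Suc K}. X d * real d powr (- \<xi>))\<bar> \<le> 2 * ln (real U) * (real N * c)"
    unfolding abs_mult y(2) using A U by (intro mult_mono) auto
   moreover have "real N * (ln (real (Suc U)) * c) \<le> real N * (2 * ln (real U) * c)"
    using ln c by (intro mult_left_mono mult_right_mono) auto
   ultimately have "\<bar>ln y * (\<Sum>d\<in>{Suc U..<Suc K}. X d * real d powr (- \<xi>)) -
     (\<Sum>d\<in>{Suc U..<Suc K}. X d * (ln (real d) * real d powr (- \<xi>)))\<bar> \<le> 4 * real N * ln (real U) * c"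
    using B by (simp add: algebra_simps)
   moreover have "y powr (\<xi> - \<beta>) \<le> real U powr (1 / 2)"
    unfolding y(3)[symmetric] using y(1) \<xi> by (intro powr_mono) auto
   ultimately have "\<bar>E' \<xi>\<bar> \<le> real U powr (1 / 2) * (4 * real N * ln (real U) * c)"
    unfolding E'_def abs_mult by (intro mult_mono) auto
   also have "... \<le> real U powr (1 / 2) * (4 * real N * ln (real U) * real U powr (- (3 / 4)))"
    using c U by (intro mult_left_mono) auto
   also have "... = 4 * real N * (real U powr (1 / 2) * real U powr (- (3 / 4))) * ln (real U)" by simp
   also have "real U powr (1 / 2) * real U powr (- (3 / 4)) = real U powr (- (1 / 4))"
    by (simp flip: powr_add)
   finally show ?thesis .
  qed
  have eq: "(y powr (1 - \<beta>) * (S 1 U - S 1 K) - (S \<beta> U - S \<beta> K)) / (1 - \<beta>) = - ((E 1 - E \<beta>) / (1 - \<beta>))"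
  proof -
   have "E 1 = y powr (1 - \<beta>) * (S 1 K - S 1 U)" "E \<beta> = S \<beta> K - S \<beta> U"
    unfolding E_def SE using y(1) by simp_all
   hence "y powr (1 - \<beta>) * (S 1 U - S 1 K) - (S \<beta> U - S \<beta> K) = - (E 1 - E \<beta>)"
    by (simp add: right_diff_distrib)
   thus ?thesis by (simp only: minus_divide_left)
  qed
  \<comment> \<open>Whether \<beta> lies below 1 is decided only later, with the help of this
    estimate, so both orders of the endpoints occur.\<close>
  have "\<exists>\<xi>. \<xi> \<ge> 3 / 4 \<and> \<xi> - \<beta> \<le> 1 / 4 \<and> (E 1 - E \<beta>) / (1 - \<beta>) = E' \<xi>"
  proof (cases "\<beta> < 1")
   case True
   from MVT2[OF this, of E E', OF der] obtain \<xi> where "\<beta> < \<xi>" "\<xi> < 1" "E 1 - E \<beta> = (1 - \<beta>) * E' \<xi>" by blast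
   thus ?thesis using \<beta> by (intro exI[of _ \<xi>]) auto
  next
   case False
   hence "1 < \<beta>" using \<beta> by simp
   from MVT2[OF this, of E E', OF der] obtain \<xi> where \<xi>: "1 < \<xi>" "\<xi> < \<beta>" "E \<beta> - E 1 = (\<beta> - 1) * E' \<xi>" by blast
   have "(E 1 - E \<beta>) / (1 - \<beta>) = (E \<beta> - E 1) / (\<beta> - 1)"
    by (metis minus_diff_eq minus_divide_divide)
   thus ?thesis using \<xi> \<beta> by (intro exI[of _ \<xi>]) auto
  qed
  then obtain \<xi> where "\<xi> \<ge> 3 / 4" "\<xi> - \<beta> \<le> 1 / 4" "(E 1 - E \<beta>) / (1 - \<beta>) = E' \<xi>" by blast
  thus ?thesis unfolding eq abs_minus_cancel using E'le by simp
 qed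
 have "(\<lambda>K. (y powr (1 - \<beta>) * (S 1 U - S 1 K) - (S \<beta> U - S \<beta> K)) / (1 - \<beta>)) \<longlonglongrightarrow>
   (y powr (1 - \<beta>) * (S 1 U - l1) - (S \<beta> U - l\<beta>)) / (1 - \<beta>)"
  by (rule tendsto_divide[OF tendsto_diff[OF tendsto_mult_left[OF tendsto_diff[OF tendsto_const lim[OF L1]]]
     tendsto_diff[OF tendsto_const lim[OF L\<beta>]]] tendsto_const]) (use \<beta>(2) in simp)
 from tendsto_rabs[OF this]
 have "\<bar>(y powr (1 - \<beta>) * (S 1 U - l1) - (S \<beta> U - l\<beta>)) / (1 - \<beta>)\<bar> \<le>
   4 * real N * real U powr (- (1 / 4)) * ln (real U)"
 proof (rule tendsto_upperbound)
  show "\<forall>\<^sub>F K in sequentially. \<bar>(y powr (1 - \<beta>) * (S 1 U - S 1 K) - (S \<beta> U - S \<beta> K)) / (1 - \<beta>)\<bar>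
   \<le> 4 * real N * real U powr (- (1 / 4)) * ln (real U)"
   using eventually_gt_at_top[of U] by eventually_elim (rule bound)
 qed simp
 thus ?thesis unfolding S_def .
qed

definition lam_sum :: "real => nat => real" where
 "lam_sum \<beta> y = (\<Sum>n\<in>{1..y}. lam n * real n powr (- \<beta>))"

text \<open>Hyperbola method at the square root U. For d > U the inner sums decrease in d, so the
  character sums cancel. For d up to U the inner sum is the integral plus \<gamma> plus an error;
  the integral part is a difference of truncations of the two series divided by 1 - \<beta>, and the
  zero leaves only the term with l1. The constant 13 is 4 + 4 + 4 + 1, from large d, the error, the
  tails and \<gamma>.\<close>

lemma lam_sum_at_zero:
 assumes L1: "(\<lambda>n. X (Suc n) * real (Suc n) powr (- 1)) sums l1"
  and L\<beta>: "(\<lambda>n. X (Suc n) * real (Suc n) powr (- \<beta>)) sums 0"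
  and \<beta>: "\<beta> \<ge> 3 / 4" "\<beta> ~= 1" and U: "U \<ge> 4"
 shows "\<bar>lam_sum \<beta> (U ^ 2) - real (U ^ 2) powr (1 - \<beta>) * l1 / (1 - \<beta>)\<bar>
  \<le> 13 * real N * real U powr (- (1 / 4)) * ln (real U)"
proof -
 define y where "y = U ^ 2"
 define S where "S \<sigma> = (\<Sum>d\<in>{1..U}. X d * real d powr (- \<sigma>))" for \<sigma>
 define E where "E = real U powr (- (1 / 4)) * ln (real U)"
 have N: "real N \<ge> 1" using N_pos by simp
 have Uy: "U \<le> y" using U by (simp add: y_def power2_eq_square)
 have lnU: "ln (real U) \<ge> 1"
 proof -
  have "exp 1 \<le> real U" using U exp_le by linarith
  thus ?thesis using U by (subst ln_ge_iff) auto
 qed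
 have half: "real U powr (- (1 / 2)) \<le> E" "real U powr (- (3 / 4)) \<le> E"
 proof -
  have "real U powr (- (1 / 2)) \<le> real U powr (- (1 / 4)) * 1"
   "real U powr (- (3 / 4)) \<le> real U powr (- (1 / 4)) * 1"
   using U by (simp_all add: powr_mono)
  moreover have "real U powr (- (1 / 4)) * 1 \<le> E"
   unfolding E_def using lnU by (intro mult_left_mono) auto
  ultimately show "real U powr (- (1 / 2)) \<le> E" "real U powr (- (3 / 4)) \<le> E" by linarith+
 qed
 have c34: "real d powr (- \<beta>) \<le> real d powr (- (3 / 4))" if "d \<ge> 1" for d
  using that \<beta> by (intro powr_mono) auto
 have c34U: "real U powr (- \<beta>) \<le> real U powr (- (3 / 4))"
  by (rule c34) (use U in simp)
 have qq: "real U powr (- (3 / 4)) * (4 * real U powr (1 / 4)) = 4 * real U powr (- (1 / 2))"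
  by (simp flip: powr_add)
 have split: "lam_sum \<beta> y = (\<Sum>d\<in>{1..U}. X d * real d powr (- \<beta>) * zsum \<beta> (y div d)) +
   (\<Sum>d\<in>{Suc U..<Suc y}. X d * (real d powr (- \<beta>) * zsum \<beta> (y div d)))"
 proof -
  have "(\<Sum>d\<in>{1..<Suc U}. X d * real d powr (- \<beta>) * zsum \<beta> (y div d)) +
    (\<Sum>d\<in>{Suc U..<Suc y}. X d * real d powr (- \<beta>) * zsum \<beta> (y div d)) =
    (\<Sum>d\<in>{1..<Suc y}. X d * real d powr (- \<beta>) * zsum \<beta> (y div d))"
   by (rule sum.atLeastLessThan_concat) (use Uy in auto)
  thus ?thesis unfolding lam_sum_def lam_sum_split unfolding sum_atLeastAtMost_eq
   by (simp only: mult.assoc)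
 qed
 have zmono: "zsum \<beta> j \<le> zsum \<beta> k" if "j \<le> k" for j k
  unfolding zsum_def using that by (intro sum_mono2) auto
 have z0: "zsum \<beta> k \<ge> 0" for k unfolding zsum_def by (intro sum_nonneg) auto
 have A2: "\<bar>\<Sum>d\<in>{Suc U..<Suc y}. X d * (real d powr (- \<beta>) * zsum \<beta> (y div d))\<bar> \<le> 4 * real N * E"
 proof (cases "U < y")
  case True
  have "\<bar>\<Sum>d\<in>{Suc U..<Suc y}. X d * (real d powr (- \<beta>) * zsum \<beta> (y div d))\<bar> \<le>
    real N * (real (Suc U) powr (- \<beta>) * zsum \<beta> (y div Suc U))"
  proof (rule abs_X_weighted_sum_le)
   fix n assume n: "Suc U \<le> n"
   have "real (Suc n) powr (- \<beta>) \<le> real n powr (- \<beta>)" using n \<beta> by (intro powr_mono2') auto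
   moreover have "zsum \<beta> (y div Suc n) \<le> zsum \<beta> (y div n)"
    using n by (intro zmono div_le_mono2) auto
   ultimately show "real (Suc n) powr (- \<beta>) * zsum \<beta> (y div Suc n) \<le> real n powr (- \<beta>) * zsum \<beta> (y div n)"
    using z0 by (intro mult_mono) auto
  next
   fix n show "0 \<le> real n powr (- \<beta>) * zsum \<beta> (y div n)" using z0 by (intro mult_nonneg_nonneg) auto
  qed (use True in simp)
  also have "real (Suc U) powr (- \<beta>) * zsum \<beta> (y div Suc U) \<le>
    real U powr (- (3 / 4)) * (4 * real U powr (1 / 4))"
  proof (rule mult_mono)
   have "real (Suc U) powr (- \<beta>) \<le> real U powr (- \<beta>)" using U \<beta> by (intro powr_mono2') auto
   thus "real (Suc U) powr (- \<beta>) \<le> real U powr (- (3 / 4))" using c34U by linarith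
   have "y div Suc U \<le> U" unfolding y_def power2_eq_square
    by (metis div_le_mono2 nonzero_mult_div_cancel_left le_SucI order_refl zero_less_Suc U less_le_trans zero_less_numeral not_gr_zero)
   thus "zsum \<beta> (y div Suc U) \<le> 4 * real U powr (1 / 4)"
    using zmono zsum_le[OF \<beta>(1), of U] order_trans by blast
  qed (use z0 in auto)
  finally have "\<bar>\<Sum>d\<in>{Suc U..<Suc y}. X d * (real d powr (- \<beta>) * zsum \<beta> (y div d))\<bar> \<le>
    real N * (4 * real U powr (- (1 / 2)))" unfolding qq by (simp add: mult_left_mono)
  also have "... \<le> real N * (4 * E)" using half(1) by (intro mult_left_mono) auto
  finally show ?thesis by (simp only: mult_ac)
 next
  case False
  hence "{Suc U..<Suc y} = {}" by auto
  thus ?thesis using N half(1) by (simp add: order_trans[OF powr_ge_zero])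
 qed
 obtain \<gamma> where \<gamma>: "0 \<le> \<gamma>" "\<gamma> \<le> 1"
  "\<And>k. k \<ge> 1 ==> 0 \<le> zsum \<beta> k - zint \<beta> (real k) - \<gamma>"
  "\<And>k. k \<ge> 1 ==> zsum \<beta> k - zint \<beta> (real k) - \<gamma> \<le> real k powr (- \<beta>)"
  by (rule zsum_approx[of \<beta>]) (use \<beta> in auto)
 define e where "e d = zsum \<beta> (y div d) - zint \<beta> (real y / real d) - \<gamma>" for d
 have e: "\<bar>e d\<bar> \<le> real U powr (- (3 / 4))" if d: "d \<in> {1..U}" for d
 proof -
  define k where "k = y div d"
  have "U * d \<le> y" using d unfolding y_def power2_eq_square by simp
  hence kU: "U \<le> k" unfolding k_def using d by (simp add: less_eq_div_iff_mult_less_eq)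
  hence k1: "k \<ge> 1" using U by simp
  have kd: "real k \<le> real y / real d" "real y / real d \<le> real k + 1"
  proof -
   have d0: "d > 0" using d by simp
   have "k * d \<le> y" "y \<le> (k + 1) * d"
   proof -
    have "y = k * d + y mod d" "(k + 1) * d = k * d + d" by (simp_all add: k_def)
    thus "k * d \<le> y" "y \<le> (k + 1) * d" using mod_less_divisor[OF d0, of y] by linarith+
   qed
   hence "real (k * d) \<le> real y" "real y \<le> real ((k + 1) * d)" by (simp_all only: of_nat_le_iff)
   thus "real k \<le> real y / real d" "real y / real d \<le> real k + 1"
    using d0 by (simp_all add: field_simps)
  qed
  have zb: "zint \<beta> (real y / real d) - zint \<beta> (real k) \<le> (real y / real d - real k) * real k powr (- \<beta>)"
   "(real y / real d - real k) * (real y / real d) powr (- \<beta>) \<le> zint \<beta> (real y / real d) - zint \<beta> (real k)"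
   using zint_diff_bounds[of \<beta> "real k" "real y / real d"] kd k1 \<beta> by auto
  have "(real y / real d - real k) * real k powr (- \<beta>) \<le> 1 * real k powr (- \<beta>)"
   using kd by (intro mult_right_mono) auto
  moreover have "0 \<le> (real y / real d - real k) * (real y / real d) powr (- \<beta>)"
   using kd by (intro mult_nonneg_nonneg) auto
  ultimately have "\<bar>e d\<bar> \<le> real k powr (- \<beta>)"
   using \<gamma>(3,4)[OF k1] zb unfolding e_def k_def[symmetric] by linarith
  also have "... \<le> real U powr (- \<beta>)" using kU U \<beta> by (intro powr_mono2') auto
  also note c34U
  finally show ?thesis .
 qed
 have A1: "(\<Sum>d\<in>{1..U}. X d * real d powr (- \<beta>) * zsum \<beta> (y div d)) =
   (real y powr (1 - \<beta>) * S 1 - S \<beta>) / (1 - \<beta>) + \<gamma> * S \<beta> + (\<Sum>d\<in>{1..U}. X d * real d powr (- \<beta>) * e d)"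
 proof -
  have eq: "X d * real d powr (- \<beta>) * zsum \<beta> (y div d) =
    (real y powr (1 - \<beta>) * (X d * real d powr (- 1)) - X d * real d powr (- \<beta>)) / (1 - \<beta>) +
    \<gamma> * (X d * real d powr (- \<beta>)) + X d * real d powr (- \<beta>) * e d" if d: "d \<in> {1..U}" for d
  proof -
   have "zint \<beta> (real y / real d) = (real y powr (1 - \<beta>) * real d powr (\<beta> - 1) - 1) / (1 - \<beta>)"
    using d by (simp add: zint_def powr_divide divide_powr_uminus)
   moreover have "real d powr (- \<beta>) * real d powr (\<beta> - 1) = real d powr (- 1)"
    by (simp only: powr_add[symmetric]) simp
   ultimately have "real d powr (- \<beta>) * zint \<beta> (real y / real d) =
     (real y powr (1 - \<beta>) * real d powr (- 1) - real d powr (- \<beta>)) / (1 - \<beta>)"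
   proof -
    have "real d powr (- \<beta>) * (real y powr (1 - \<beta>) * real d powr (\<beta> - 1) - 1) =
      real y powr (1 - \<beta>) * (real d powr (- \<beta>) * real d powr (\<beta> - 1)) - real d powr (- \<beta>)"
     by (simp only: right_diff_distrib mult.left_commute mult_1_right)
    moreover note \<open>real d powr (- \<beta>) * real d powr (\<beta> - 1) = real d powr (- 1)\<close>
     \<open>zint \<beta> (real y / real d) = (real y powr (1 - \<beta>) * real d powr (\<beta> - 1) - 1) / (1 - \<beta>)\<close>
    ultimately show ?thesis by (simp only: times_divide_eq_right)
   qed
   moreover have "zsum \<beta> (y div d) = zint \<beta> (real y / real d) + \<gamma> + e d" by (simp add: e_def)
   ultimately have "X d * real d powr (- \<beta>) * zsum \<beta> (y div d) = X d *
     ((real y powr (1 - \<beta>) * real d powr (- 1) - real d powr (- \<beta>)) / (1 - \<beta>)) +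
    \<gamma> * (X d * real d powr (- \<beta>)) + X d * real d powr (- \<beta>) * e d"
    by (simp only: distrib_left mult.assoc) (simp only: mult_ac)
   thus ?thesis by (simp only: times_divide_eq_right right_diff_distrib mult.left_commute)
  qed
  have "(\<Sum>d\<in>{1..U}. X d * real d powr (- \<beta>) * zsum \<beta> (y div d)) = (\<Sum>d\<in>{1..U}.
    (real y powr (1 - \<beta>) * (X d * real d powr (- 1)) - X d * real d powr (- \<beta>)) / (1 - \<beta>) +
    \<gamma> * (X d * real d powr (- \<beta>)) + X d * real d powr (- \<beta>) * e d)"
   by (rule sum.cong[OF refl eq])
  thus ?thesis unfolding S_def
   by (simp only: sum.distrib sum_subtractf sum_divide_distrib[symmetric] sum_distrib_left[symmetric])
 qed
 have err: "\<bar>\<Sum>d\<in>{1..U}. X d * real d powr (- \<beta>) * e d\<bar> \<le> 4 * E"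
 proof -
  have "\<bar>\<Sum>d\<in>{1..U}. X d * real d powr (- \<beta>) * e d\<bar> \<le>
    (\<Sum>d\<in>{1..U}. real d powr (- \<beta>) * real U powr (- (3 / 4)))"
  proof (rule order_trans[OF sum_abs sum_mono])
   fix d assume d: "d \<in> {1..U}"
   have "\<bar>X d\<bar> * real d powr (- \<beta>) \<le> 1 * real d powr (- \<beta>)"
    using abs_X_le[of d] by (intro mult_right_mono) auto
   thus "\<bar>X d * real d powr (- \<beta>) * e d\<bar> \<le> real d powr (- \<beta>) * real U powr (- (3 / 4))"
    unfolding abs_mult using e[OF d] by (intro mult_mono) auto
  qed
  also have "... = real U powr (- (3 / 4)) * zsum \<beta> U"
   unfolding zsum_def sum_distrib_right[symmetric] by (rule mult.commute)
  also have "... \<le> real U powr (- (3 / 4)) * (4 * real U powr (1 / 4))"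
   by (intro mult_left_mono zsum_le \<beta>) auto
  finally show ?thesis unfolding qq using half(1) by linarith
 qed
 \<comment> \<open>Because the full series at \<beta> is 0, its truncation is itself a tail and
   hence small.\<close>
 have g: "\<bar>\<gamma> * S \<beta>\<bar> \<le> real N * E"
 proof -
  have "\<bar>S \<beta>\<bar> \<le> real N * real U powr (- \<beta>)"
   using L_tail[OF L\<beta>, of U] \<beta> U unfolding S_def by simp
  also have "... \<le> real N * E" using c34U half(2) by (intro mult_left_mono) linarith+
  finally have "\<bar>\<gamma>\<bar> * \<bar>S \<beta>\<bar> \<le> 1 * (real N * E)" using \<gamma> by (intro mult_mono) auto
  thus ?thesis by (simp add: abs_mult)
 qed
 have psi: "\<bar>(real y powr (1 - \<beta>) * S 1 - S \<beta>) / (1 - \<beta>) - real y powr (1 - \<beta>) * l1 / (1 - \<beta>)\<bar> \<le> 4 * real N * E"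
 proof -
  have "real y = real U ^ 2" by (simp add: y_def)
  hence bd: "\<bar>(real y powr (1 - \<beta>) * (S 1 - l1) - (S \<beta> - 0)) / (1 - \<beta>)\<bar> \<le> 4 * real N * E"
   using zint_tail[OF L1 L\<beta> \<beta> U] unfolding S_def E_def by (simp only: mult.assoc)
  have eq: "(real y powr (1 - \<beta>) * (S 1 - l1) - (S \<beta> - 0)) / (1 - \<beta>) =
    (real y powr (1 - \<beta>) * S 1 - S \<beta>) / (1 - \<beta>) - real y powr (1 - \<beta>) * l1 / (1 - \<beta>)"
   by (simp only: diff_divide_distrib[symmetric] right_diff_distrib) simp
  show ?thesis using bd unfolding eq .
 qed
 have "E \<ge> 0" unfolding E_def using lnU by simp
 hence "4 * E \<le> 4 * (real N * E)" using N by (simp add: mult_le_cancel_right1)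
 hence "\<bar>lam_sum \<beta> y - real y powr (1 - \<beta>) * l1 / (1 - \<beta>)\<bar> \<le> 13 * (real N * E)"
  using A2 err g psi unfolding split A1 by linarith
 thus ?thesis by (simp add: y_def E_def mult.assoc)
qed

text \<open>The products \<open>n * p\<close> with \<open>n \<le> z < p\<close> are pairwise distinct, so the split primes beyond \<open>z\<close>
 are controlled by the growth of \<open>lam_sum\<close>.\<close>

lemma split_primes_lam_sum:
 assumes "w \<ge> 1" "\<beta> \<le> 1"
 shows "lam_sum \<beta> z * (\<Sum>p | prime p \<and> z < p \<and> p \<le> w \<and> X p = 1. 1 / real p) \<le>
  lam_sum \<beta> (z * w) - lam_sum \<beta> z"
proof -
 define P where "P = {p. prime p \<and> z < p \<and> p \<le> w \<and> X p = 1}"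
 have finP: "finite P" unfolding P_def by (rule finite_subset[of _ "{..w}"]) auto
 define h where "h n = lam n * real n powr (- \<beta>)" for n
 have h0: "h n \<ge> 0" if "n \<ge> 1" for n unfolding h_def using lam_nonneg[of n] that by auto
 have inj: "inj_on (\<lambda>(n, p). n * p) ({1..z} \<times> P)"
 proof (rule inj_onI, clarsimp)
  fix n p n' p' assume *: "Suc 0 \<le> n" "n \<le> z" "Suc 0 \<le> n'" "n' \<le> z" "p \<in> P" "p' \<in> P" "n * p = n' * p'"
  have "p dvd n' * p'" using * by (metis dvd_triv_right)
  moreover have "\<not> p dvd n'" using * by (auto simp: P_def dest: dvd_imp_le)
  ultimately have "p dvd p'" using * by (simp add: P_def prime_dvd_mult_iff)
  hence "p = p'" using * by (simp add: P_def primes_dvd_imp_eq)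
  thus "n = n' \<and> p = p'" using * by (auto simp: P_def)
 qed
 have "(\<Sum>n\<in>{1..z}. h n) * (\<Sum>p\<in>P. 1 / real p) = (\<Sum>(n, p)\<in>{1..z} \<times> P. h n * (1 / real p))"
  by (simp add: sum_product sum.cartesian_product)
 also have "... \<le> (\<Sum>(n, p)\<in>{1..z} \<times> P. h (n * p))"
 proof (rule sum_mono, clarify)
  fix n p assume *: "n \<in> {1..z}" "p \<in> P"
  have p: "prime p" "X p = 1" "p > z" using * by (auto simp: P_def)
  have "\<not> p dvd n" using * p by (auto dest: dvd_imp_le)
  hence "lam (n * p) = 2 * lam n" using lam_mult_prime[OF p(1), of n] p(2) by simp
  hence "h (n * p) = 2 * (h n * real p powr (- \<beta>))"
   by (simp add: h_def powr_mult)
  moreover have "1 / real p \<le> real p powr (- \<beta>)"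
   using powr_mono[of "-1" "- \<beta>" "real p"] assms p by (simp add: powr_minus_divide)
  hence "h n * (1 / real p) \<le> h n * real p powr (- \<beta>)" using h0[of n] * by (intro mult_left_mono) auto
  moreover have "0 \<le> h n * real p powr (- \<beta>)" using h0[of n] * by simp
  ultimately show "h n * (1 / real p) \<le> h (n * p)" by linarith
 qed
 also have "... = (\<Sum>m\<in>(\<lambda>(n, p). n * p) ` ({1..z} \<times> P). h m)"
  by (subst sum.reindex[OF inj]) (simp add: case_prod_unfold)
 also have "... \<le> (\<Sum>m\<in>{1..z * w} - {1..z}. h m)"
 proof (rule sum_mono2)
  show "(\<lambda>(n, p). n * p) ` ({1..z} \<times> P) \<subseteq> {1..z * w} - {1..z}"
  proof
   fix m assume "m \<in> (\<lambda>(n, p). n * p) ` ({1..z} \<times> P)"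
   then obtain n p where *: "m = n * p" "1 \<le> n" "n \<le> z" "p \<in> P" by auto
   have zp: "z < p" "p \<le> w" using * by (auto simp: P_def)
   have "1 * p \<le> n * p" using * by (intro mult_le_mono1) auto
   hence "z < m" using zp * by linarith
   moreover have "m \<le> z * w" unfolding *(1) using * zp by (intro mult_le_mono) auto
   ultimately show "m \<in> {1..z * w} - {1..z}" by auto
  qed
 qed (use h0 in auto)
 also have "... \<le> lam_sum \<beta> (z * w) - lam_sum \<beta> z"
 proof -
  have "{1..z} \<subseteq> {1..z * w}" using assms(1) by (auto intro: order_trans)
  thus ?thesis unfolding lam_sum_def h_def[symmetric] by (subst sum_diff) auto
 qed
 finally show ?thesis unfolding lam_sum_def h_def[symmetric] P_def .
qed

text \<open>Between U^2 and (U V)^2 the main term grows only by the factor (V^2)^(1 - \<beta>). This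
  limits the contribution of the products n * p and with it the sum over split primes. The term n =
  1 gives \<open>lam_sum \<beta> (U ^ 2) \<ge> 1\<close>, so the absolute errors \<epsilon> are also
  relative ones. Squares occur because the hyperbola method splits at the square root.\<close>

lemma exceptional_zero_split_primes:
 assumes L1: "(\<lambda>n. X (Suc n) * real (Suc n) powr (- 1)) sums l1"
  and L\<beta>: "(\<lambda>n. X (Suc n) * real (Suc n) powr (- \<beta>)) sums 0"
  and \<beta>: "\<beta> \<ge> 3 / 4" and U: "U \<ge> 4" "V \<ge> 1" and l1: "l1 > 0" and \<epsilon>: "\<epsilon> < 1"
  and small: "13 * real N * real U powr (- (1 / 4)) * ln (real U) \<le> \<epsilon>"
   "13 * real N * real (U * V) powr (- (1 / 4)) * ln (real (U * V)) \<le> \<epsilon>"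
 shows "\<beta> < 1" "(\<Sum>p | prime p \<and> U ^ 2 < p \<and> p \<le> V ^ 2 \<and> X p = 1. 1 / real p) \<le>
  (1 + \<epsilon>) * (real (V ^ 2) powr (1 - \<beta>) - 1) + 2 * \<epsilon>"
proof -
 define M where "M y = y powr (1 - \<beta>) * l1 / (1 - \<beta>)" for y
 \<comment> \<open>For \<beta> = 1 the two series would coincide, although one of them sums to l1 >
   0.\<close>
 have "(\<lambda>n. X (Suc n) * real (Suc n) powr (- 1)) sums 0" if "\<beta> = 1" using L\<beta> that by simp
 hence \<beta>1: "\<beta> ~= 1" using L1 l1 sums_unique2 by blast
 have UV: "U * V \<ge> 4" using U by (metis mult.right_neutral mult_le_mono)
 have T1: "\<bar>lam_sum \<beta> (U ^ 2) - M (real (U ^ 2))\<bar> \<le> \<epsilon>"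
  using lam_sum_at_zero[OF L1 L\<beta> \<beta> \<beta>1 U(1)] small(1) unfolding M_def by linarith
 have T2: "\<bar>lam_sum \<beta> ((U * V) ^ 2) - M (real ((U * V) ^ 2))\<bar> \<le> \<epsilon>"
  using lam_sum_at_zero[OF L1 L\<beta> \<beta> \<beta>1 UV] small(2) unfolding M_def by linarith
 have T: "lam_sum \<beta> (U ^ 2) \<ge> 1"
 proof -
  have "(\<Sum>n\<in>{1}. lam n * real n powr (- \<beta>)) \<le> lam_sum \<beta> (U ^ 2)"
   unfolding lam_sum_def using U lam_nonneg by (intro sum_mono2) (auto simp: Suc_le_eq)
  thus ?thesis using lam_one by simp
 qed
 \<comment> \<open>A zero beyond 1 would make the main term nonpositive, against the contribution of
   n = 1.\<close>
 show b: "\<beta> < 1"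
 proof (rule ccontr)
  assume "\<not> \<beta> < 1"
  hence "M (real (U ^ 2)) \<le> 0" using \<beta>1 l1 unfolding M_def
   by (intro divide_nonneg_nonpos mult_nonneg_nonneg) auto
  thus False using T T1 \<epsilon> by linarith
 qed
 define W where "W = real (V ^ 2) powr (1 - \<beta>)"
 have W: "W \<ge> 1" unfolding W_def using U b by (intro ge_one_powr_ge_zero) auto
 have MM: "M (real ((U * V) ^ 2)) = M (real (U ^ 2)) * W"
  unfolding M_def W_def by (simp add: power_mult_distrib powr_mult)
 define Q where "Q = (\<Sum>p | prime p \<and> U ^ 2 < p \<and> p \<le> V ^ 2 \<and> X p = 1. 1 / real p)"
 have Q0: "Q \<ge> 0" unfolding Q_def by (intro sum_nonneg) auto
 have "lam_sum \<beta> (U ^ 2) * Q \<le> lam_sum \<beta> ((U * V) ^ 2) - lam_sum \<beta> (U ^ 2)"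
  using split_primes_lam_sum[where z = "U ^ 2" and w = "V ^ 2" and \<beta> = \<beta>] U b unfolding Q_def by (simp add: power_mult_distrib Suc_le_eq)
 also have "... \<le> M (real (U ^ 2)) * (W - 1) + 2 * \<epsilon>"
 proof -
  have "M (real (U ^ 2)) * (W - 1) = M (real (U ^ 2)) * W - M (real (U ^ 2))"
   by (simp add: right_diff_distrib)
  thus ?thesis using T1 T2 unfolding MM by linarith
 qed
 also have "M (real (U ^ 2)) * (W - 1) \<le> (lam_sum \<beta> (U ^ 2) + \<epsilon>) * (W - 1)"
  using T1 W by (intro mult_right_mono) auto
 finally have *: "lam_sum \<beta> (U ^ 2) * Q \<le> (lam_sum \<beta> (U ^ 2) + \<epsilon>) * (W - 1) + 2 * \<epsilon>" by simp
 have \<epsilon>0: "\<epsilon> \<ge> 0" using T1 by linarith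
 define t where "t = lam_sum \<beta> (U ^ 2)"
 have "t * Q \<le> t * ((1 + \<epsilon>) * (W - 1) + 2 * \<epsilon>)"
 proof -
  have a: "1 * (\<epsilon> * (W - 1)) \<le> t * (\<epsilon> * (W - 1))" "1 * (2 * \<epsilon>) \<le> t * (2 * \<epsilon>)"
   using T \<epsilon>0 W unfolding t_def by (intro mult_right_mono; simp)+
  have b: "t * ((1 + \<epsilon>) * (W - 1) + 2 * \<epsilon>) = t * (W - 1) + t * (\<epsilon> * (W - 1)) + t * (2 * \<epsilon>)"
   by (simp add: algebra_simps)
  have c: "(t + \<epsilon>) * (W - 1) = t * (W - 1) + \<epsilon> * (W - 1)" by (rule distrib_right)
  have "t * Q \<le> (t + \<epsilon>) * (W - 1) + 2 * \<epsilon>" using * by (simp add: t_def)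
  thus ?thesis unfolding b c using a by simp
 qed
 hence "Q \<le> (1 + \<epsilon>) * (W - 1) + 2 * \<epsilon>" using T unfolding t_def by simp
 thus "(\<Sum>p | prime p \<and> U ^ 2 < p \<and> p \<le> V ^ 2 \<and> X p = 1. 1 / real p) \<le>
  (1 + \<epsilon>) * (real (V ^ 2) powr (1 - \<beta>) - 1) + 2 * \<epsilon>" unfolding Q_def W_def .
qed

end

section \<open>A Brun--Hooley sieve\<close>

text \<open>One functional in two roles: with g the 0/1 indicator of the primes dividing a value it
  is the sieve weight of that value, with g a density it is a factor of the main term.\<close>

definition weight_sum :: "('p set => real) => ('p => real) => 'p set => real" where
 "weight_sum c g P = (\<Sum>T\<in>Pow P. c T * prod g T)"

definition truncated_moebius :: "nat => 'p set => real" where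
 "truncated_moebius b T = (if card T \<le> b then (- 1) ^ card T else 0)"

definition layer :: "nat => 'p set => real" where
 "layer b T = (if card T = b then 1 else 0)"

lemma weight_sum_insert:
 assumes "finite B" "x \<notin> B"
 shows "weight_sum c g (insert x B) = weight_sum c g B + g x * weight_sum (\<lambda>T. c (insert x T)) g B"
proof -
 have "(\<Sum>T\<in>insert x ` Pow B. c T * prod g T) = (\<Sum>T\<in>Pow B. c (insert x T) * prod g (insert x T))"
  by (rule sum.reindex_cong[of "insert x"]) (use assms(2) in \<open>auto simp: inj_on_def\<close>)
 also have "... = (\<Sum>T\<in>Pow B. g x * (c (insert x T) * prod g T))"
 proof (rule sum.cong[OF refl])
  fix T assume "T \<in> Pow B"
  hence "finite T" "x \<notin> T" using assms finite_subset by auto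
  thus "c (insert x T) * prod g (insert x T) = g x * (c (insert x T) * prod g T)" by simp
 qed
 finally have "(\<Sum>T\<in>insert x ` Pow B. c T * prod g T) = g x * weight_sum (\<lambda>T. c (insert x T)) g B"
  by (simp add: weight_sum_def sum_distrib_left)
 moreover have "Pow B \<inter> insert x ` Pow B = {}" using assms(2) by auto
 ultimately show ?thesis
  unfolding weight_sum_def Pow_insert using assms(1) by (subst sum.union_disjoint) auto
qed

lemma weight_sum_cong:
 "(\<And>T. T \<subseteq> B ==> c T = d T) ==> weight_sum c g B = weight_sum d g B"
 unfolding weight_sum_def by (rule sum.cong) auto

lemma weight_sum_minus: "weight_sum (\<lambda>T. - c T) g B = - weight_sum c g B"
 by (simp add: weight_sum_def sum_negf)

lemma truncated_moebius_insert:
 assumes "finite B" "x \<notin> B"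
 shows "weight_sum (truncated_moebius (Suc b)) g (insert x B) =
   weight_sum (truncated_moebius (Suc b)) g B - g x * weight_sum (truncated_moebius b) g B"
  and "weight_sum (truncated_moebius 0) g (insert x B) = weight_sum (truncated_moebius 0) g B"
  and "weight_sum (layer (Suc b)) g (insert x B) =
   weight_sum (layer (Suc b)) g B + g x * weight_sum (layer b) g B"
  and "weight_sum (layer 0) g (insert x B) = weight_sum (layer 0) g B"
proof -
 have c: "card (insert x T) = Suc (card T)" if "T \<subseteq> B" for T
  using that assms by (meson card_insert_disjoint finite_subset subsetD)
 have "weight_sum (\<lambda>T. truncated_moebius (Suc b) (insert x T)) g B =
   weight_sum (\<lambda>T. - truncated_moebius b T) g B"
  by (rule weight_sum_cong) (simp add: truncated_moebius_def c)
 thus "weight_sum (truncated_moebius (Suc b)) g (insert x B) =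
   weight_sum (truncated_moebius (Suc b)) g B - g x * weight_sum (truncated_moebius b) g B"
  by (simp add: weight_sum_insert[OF assms] weight_sum_minus)
 have "weight_sum (\<lambda>T. truncated_moebius 0 (insert x T)) g B = weight_sum (\<lambda>T. 0) g B"
  by (rule weight_sum_cong) (simp add: truncated_moebius_def c)
 thus "weight_sum (truncated_moebius 0) g (insert x B) = weight_sum (truncated_moebius 0) g B"
  by (simp add: weight_sum_insert[OF assms] weight_sum_def[of "\<lambda>T. 0"])
 have "weight_sum (\<lambda>T. layer (Suc b) (insert x T)) g B = weight_sum (layer b) g B"
  by (rule weight_sum_cong) (simp add: layer_def c)
 thus "weight_sum (layer (Suc b)) g (insert x B) =
   weight_sum (layer (Suc b)) g B + g x * weight_sum (layer b) g B"
  by (simp add: weight_sum_insert[OF assms])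
 have "weight_sum (\<lambda>T. layer 0 (insert x T)) g B = weight_sum (\<lambda>T. 0) g B"
  by (rule weight_sum_cong) (simp add: layer_def c)
 thus "weight_sum (layer 0) g (insert x B) = weight_sum (layer 0) g B"
  by (simp add: weight_sum_insert[OF assms] weight_sum_def[of "\<lambda>T. 0"])
qed

text \<open>Real values in [0, 1] cover indicators and densities at once. Adding x turns the error
  of order b into itself minus \<open>g x\<close> times the error of order b - 1, and these two have
  opposite signs.\<close>

lemma bonferroni:
 assumes "finite B" "\<And>p. p \<in> B ==> 0 \<le> g p \<and> g p \<le> 1"
 shows "0 \<le> (- 1) ^ b * (weight_sum (truncated_moebius b) g B - (\<Prod>p\<in>B. 1 - g p))"
 using assms
proof (induction B arbitrary: b rule: finite_induct)
 case empty
 show ?case by (simp add: weight_sum_def truncated_moebius_def)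
next
 case (insert x B)
 note IH = insert.IH[OF insert.prems[OF insertI2]]
 define V where "V = (\<Prod>p\<in>B. 1 - g p)"
 have gx: "0 \<le> g x" "g x \<le> 1" using insert.prems by auto
 have V0: "V \<ge> 0" unfolding V_def using insert.prems by (intro prod_nonneg) auto
 have Vi: "(\<Prod>p\<in>insert x B. 1 - g p) = V - g x * V"
  using insert.hyps by (simp add: V_def algebra_simps)
 show ?case
 proof (cases b)
  case 0
  have "0 \<le> weight_sum (truncated_moebius 0) g B - V" using IH[of 0] by (simp add: V_def)
  moreover have "0 \<le> g x * V" using gx V0 by simp
  ultimately show ?thesis unfolding 0 Vi truncated_moebius_insert(2)[OF insert.hyps] by simp
 next
  case (Suc c)
  define w where "w i = weight_sum (truncated_moebius i) g B" for i
  have *: "0 \<le> (- 1) ^ Suc c * (w (Suc c) - V)" "0 \<le> (- 1) ^ c * (w c - V)"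
   using IH[of "Suc c"] IH[of c] unfolding w_def V_def by auto
  have "0 \<le> (- 1) ^ Suc c * (w (Suc c) - V) + g x * ((- 1) ^ c * (w c - V))"
   by (rule add_nonneg_nonneg[OF *(1) mult_nonneg_nonneg[OF gx(1) *(2)]])
  also have "... = (- 1) ^ Suc c * (w (Suc c) - g x * w c - (V - g x * V))" by (simp add: algebra_simps)
  finally show ?thesis unfolding Suc Vi truncated_moebius_insert(1)[OF insert.hyps] w_def .
 qed
qed

lemma truncated_moebius_Suc:
 assumes "even b"
 shows "weight_sum (truncated_moebius (Suc b)) g B =
  weight_sum (truncated_moebius b) g B - weight_sum (layer (Suc b)) g B"
proof -
 have "truncated_moebius (Suc b) T = truncated_moebius b T - layer (Suc b) T" for T :: "'a set"
  using assms by (auto simp: truncated_moebius_def layer_def le_Suc_eq)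
 thus ?thesis by (simp add: weight_sum_def left_diff_distrib sum_subtractf)
qed

text \<open>The next, odd truncation lies below the product and differs from the even one by a
  single layer.\<close>

lemma truncated_moebius_bounds:
 assumes "finite B" "\<And>p. p \<in> B ==> 0 \<le> g p \<and> g p \<le> 1" "even b"
 shows "(\<Prod>p\<in>B. 1 - g p) \<le> weight_sum (truncated_moebius b) g B"
  and "weight_sum (truncated_moebius b) g B \<le> (\<Prod>p\<in>B. 1 - g p) + weight_sum (layer (Suc b)) g B"
proof -
 have *: "0 \<le> (- 1) ^ i * (weight_sum (truncated_moebius i) g B - (\<Prod>p\<in>B. 1 - g p))" for i
  by (rule bonferroni) (use assms in auto)
 show "(\<Prod>p\<in>B. 1 - g p) \<le> weight_sum (truncated_moebius b) g B"
  "weight_sum (truncated_moebius b) g B \<le> (\<Prod>p\<in>B. 1 - g p) + weight_sum (layer (Suc b)) g B"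
  using *[of b] *[of "Suc b"] assms(3) by (simp_all add: truncated_moebius_Suc)
qed

lemma weight_sum_layer_nonneg:
 assumes "\<And>p. p \<in> B ==> 0 \<le> g p"
 shows "0 \<le> weight_sum (layer b) g B"
 unfolding weight_sum_def layer_def using assms by (intro sum_nonneg) (auto intro!: prod_nonneg)

text \<open>The first two terms of the binomial expansion, as needed when one prime is added to a
  layer sum.\<close>

lemma power_Suc_add_le:
 fixes S t :: real
 assumes "0 \<le> S" "0 \<le> t"
 shows "S ^ Suc n + real (Suc n) * t * S ^ n \<le> (S + t) ^ Suc n"
proof (induction n)
 case (Suc n)
 have "S ^ Suc (Suc n) + real (Suc (Suc n)) * t * S ^ Suc n \<le>
   (S + t) * (S ^ Suc n + real (Suc n) * t * S ^ n)"
 proof -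
  have "(S + t) * (S ^ Suc n + real (Suc n) * t * S ^ n) =
    S ^ Suc (Suc n) + real (Suc (Suc n)) * t * S ^ Suc n + real (Suc n) * t * t * S ^ n"
   by (simp add: algebra_simps)
  moreover have "0 \<le> real (Suc n) * t * t * S ^ n" using assms by simp
  ultimately show ?thesis by linarith
 qed
 also have "... \<le> (S + t) * (S + t) ^ Suc n" using Suc assms by (intro mult_left_mono) auto
 finally show ?case by simp
qed simp

text \<open>The layer sum is the b-th elementary symmetric function, and each of its monomials
  occurs b! times in the expanded b-th power.\<close>

lemma weight_sum_layer_le:
 assumes "finite B" "\<And>p. p \<in> B ==> 0 \<le> g p"
 shows "weight_sum (layer b) g B \<le> sum g B ^ b / fact b"
 using assms
proof (induction B arbitrary: b rule: finite_induct)
 case empty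
 show ?case by (cases b) (simp_all add: weight_sum_def layer_def)
next
 case (insert x B)
 note IH = insert.IH[OF insert.prems[OF insertI2]]
 have S: "sum g B \<ge> 0" "g x \<ge> 0" using insert.prems by (auto intro: sum_nonneg)
 show ?case
 proof (cases b)
  case 0
  thus ?thesis using IH[of 0] by (simp add: truncated_moebius_insert(4)[OF insert.hyps])
 next
  case (Suc c)
  have "weight_sum (layer (Suc c)) g (insert x B) \<le>
    sum g B ^ Suc c / fact (Suc c) + g x * (sum g B ^ c / fact c)"
   unfolding truncated_moebius_insert(3)[OF insert.hyps]
   by (intro add_mono mult_left_mono IH S)
  also have "... = (sum g B ^ Suc c + real (Suc c) * g x * sum g B ^ c) / fact (Suc c)"
   by (simp add: field_simps del: of_nat_Suc power_Suc)
  also have "... \<le> (sum g B + g x) ^ Suc c / fact (Suc c)"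
   by (intro divide_right_mono power_Suc_add_le S) auto
  finally show ?thesis using insert.hyps Suc by (simp add: add.commute)
 qed
qed

section \<open>Gluing sieves on disjoint sets of primes\<close>

definition comb :: "('p set => real) => ('p set => real) => 'p set => 'p set => 'p set => real" where
 "comb c d P B T = (if T \<subseteq> P \<union> B then c (T \<inter> P) * d (T \<inter> B) else 0)"

text \<open>A subset of a disjoint union is a pair of subsets, so the sum factors.\<close>

lemma weight_sum_comb:
 assumes "finite P" "finite B" "P \<inter> B = {}"
 shows "weight_sum (comb c d P B) g (P \<union> B) = weight_sum c g P * weight_sum d g B"
proof -
 have "weight_sum c g P * weight_sum d g B =
   (\<Sum>(S, R)\<in>Pow P \<times> Pow B. (c S * prod g S) * (d R * prod g R))"
  unfolding weight_sum_def by (simp add: sum_product sum.cartesian_product)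
 also have "... = (\<Sum>T\<in>Pow (P \<union> B). comb c d P B T * prod g T)"
 proof (rule sum.reindex_bij_witness[of _ "\<lambda>T. (T \<inter> P, T \<inter> B)" "\<lambda>(S, R). S \<union> R"])
  fix x assume x: "x \<in> Pow P \<times> Pow B"
  obtain S R where xx: "x = (S, R)" "S \<subseteq> P" "R \<subseteq> B" using x by auto
  have I: "(S \<union> R) \<inter> P = S" "(S \<union> R) \<inter> B = R" "S \<inter> R = {}" using xx assms(3) by auto
  show "(case x of (S, R) => S \<union> R) \<in> Pow (P \<union> B)" using xx by auto
  show "((case x of (S, R) => S \<union> R) \<inter> P, (case x of (S, R) => S \<union> R) \<inter> B) = x" using xx I by simp
  have "prod g (S \<union> R) = prod g S * prod g R"
   using xx assms I(3) by (intro prod.union_disjoint) (auto intro: finite_subset)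
  moreover have "S \<union> R \<subseteq> P \<union> B" using xx by auto
  ultimately show "comb c d P B (case x of (S, R) => S \<union> R) * prod g (case x of (S, R) => S \<union> R) =
    (case x of (S, R) => (c S * prod g S) * (d R * prod g R))"
   using xx I by (simp add: comb_def)
 qed auto
 finally show ?thesis by (simp add: weight_sum_def)
qed

text \<open>Z is the level, and A measures the quality on the densities in G: A = 1 is perfect, and
  the lower bound is nontrivial as long as A < 2. The inequalities for all g with values in [0, 1]
  become the pointwise sieve inequalities when g is an indicator.\<close>

definition sieve_weights ::
 "(nat => real) set => nat set => real => real => (nat set => real) => (nat set => real) => bool" where
 "sieve_weights G P Z A U L \<longleftrightarrow> finite P \<and>
  (\<forall>T. U T ~= 0 \<or> L T ~= 0 --> T \<subseteq> P \<and> real (\<Prod>T) \<le> Z) \<and>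
  (\<forall>T. \<bar>U T\<bar> \<le> 1 \<and> \<bar>L T\<bar> \<le> 1) \<and>
  (\<forall>g. (\<forall>p\<in>P. 0 \<le> g p \<and> g p \<le> 1) -->
   weight_sum L g P \<le> (\<Prod>p\<in>P. 1 - g p) \<and> (\<Prod>p\<in>P. 1 - g p) \<le> weight_sum U g P) \<and>
  (\<forall>g\<in>G. weight_sum U g P \<le> A * (\<Prod>p\<in>P. 1 - g p) \<and>
   (2 - A) * (\<Prod>p\<in>P. 1 - g p) \<le> weight_sum L g P)"

text \<open>Hooley's composition. Upper weights multiply. For the lower weights the even truncation
  w overshoots the product over B by at most the layer e, and \<open>L * w - U * e\<close> is at
  most the product over P times w - e because L and U enclose that product. Recording the lower
  quality as 2 - A lets \<open>A * (1 + \<epsilon>)\<close> serve for both bounds. The level grows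
  by a factor z for each of at most b + 1 primes taken from B.\<close>

lemma sieve_weights_step:
 assumes sw: "sieve_weights G P Z A U L" and B: "finite B" "P \<inter> B = {}" and b: "even b"
  and z: "\<And>p. p \<in> B ==> 1 \<le> p \<and> real p \<le> z" "z \<ge> 1" "Z \<ge> 1"
  and G: "\<And>g p. g \<in> G ==> p \<in> P \<union> B ==> 0 \<le> g p \<and> g p \<le> 1"
  and \<epsilon>: "\<And>g. g \<in> G ==> weight_sum (layer (Suc b)) g B \<le> \<epsilon> * (\<Prod>p\<in>B. 1 - g p)"
  and A: "0 \<le> A" "A \<le> 2" "0 \<le> \<epsilon>"
 shows "\<exists>U L. sieve_weights G (P \<union> B) (Z * z ^ Suc b) (A * (1 + \<epsilon>)) U L"
proof -
 define U' where "U' = comb U (truncated_moebius b) P B"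
 define L' where "L' T = comb L (truncated_moebius b) P B T - comb U (layer (Suc b)) P B T" for T
 have P: "finite P" using sw by (simp add: sieve_weights_def)
 have U: "weight_sum U' g (P \<union> B) = weight_sum U g P * weight_sum (truncated_moebius b) g B" for g
  unfolding U'_def by (rule weight_sum_comb[OF P B])
 have L: "weight_sum L' g (P \<union> B) = weight_sum L g P * weight_sum (truncated_moebius b) g B -
   weight_sum U g P * weight_sum (layer (Suc b)) g B" for g
 proof -
  have "weight_sum L' g Q = weight_sum (comb L (truncated_moebius b) P B) g Q -
    weight_sum (comb U (layer (Suc b)) P B) g Q" for Q
   unfolding L'_def weight_sum_def by (simp add: left_diff_distrib sum_subtractf)
  thus ?thesis by (simp only: weight_sum_comb[OF P B])
 qed
 have V: "(\<Prod>p\<in>P \<union> B. 1 - g p) = (\<Prod>p\<in>P. 1 - g p) * (\<Prod>p\<in>B. 1 - g p)" for g :: "nat => real"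
  by (rule prod.union_disjoint[OF P B])
 have cardle: "card (T \<inter> B) \<le> Suc b" if "U' T ~= 0 \<or> L' T ~= 0" for T
  using that unfolding U'_def L'_def comb_def truncated_moebius_def layer_def by (auto split: if_splits)
 have supp: "T \<subseteq> P \<union> B \<and> real (\<Prod>T) \<le> Z * z ^ Suc b" if T: "U' T ~= 0 \<or> L' T ~= 0" for T
 proof -
  have TP: "T \<subseteq> P \<union> B" using T unfolding U'_def L'_def comb_def by (auto split: if_splits)
  have "U (T \<inter> P) ~= 0 \<or> L (T \<inter> P) ~= 0" using T unfolding U'_def L'_def comb_def by (auto split: if_splits)
  hence 1: "real (\<Prod>(T \<inter> P)) \<le> Z" using sw by (auto simp: sieve_weights_def)
  have "real (\<Prod>(T \<inter> B)) = (\<Prod>p\<in>T \<inter> B. real p)" by simp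
  also have "... \<le> (\<Prod>p\<in>T \<inter> B. z)" by (rule prod_mono) (use z in auto)
  also have "... \<le> z ^ Suc b" using cardle[OF T] z(2) by (simp only: prod_constant) (rule power_increasing)
  finally have 2: "real (\<Prod>(T \<inter> B)) \<le> z ^ Suc b" .
  have "T = (T \<inter> P) \<union> (T \<inter> B)" using TP by auto
  hence "\<Prod>T = \<Prod>((T \<inter> P) \<union> (T \<inter> B))" by (rule arg_cong[of _ _ "\<lambda>A. \<Prod>A"])
  also have "... = \<Prod>(T \<inter> P) * \<Prod>(T \<inter> B)"
   by (rule prod.union_disjoint) (use P B in auto)
  finally have "\<Prod>T = \<Prod>(T \<inter> P) * \<Prod>(T \<inter> B)" .
  hence "real (\<Prod>T) = real (\<Prod>(T \<inter> P)) * real (\<Prod>(T \<inter> B))" by (simp only: of_nat_mult)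
  also have "... \<le> Z * z ^ Suc b" using z(3) by (intro mult_mono 1 2) (auto intro: prod_nonneg)
  finally show ?thesis using TP by blast
 qed
 \<comment> \<open>The two parts of \<open>L'\<close> live on different cardinalities of
   \<open>T \<inter> B\<close>, so their difference never exceeds 1.\<close>
 have one: "\<bar>U' T\<bar> \<le> 1 \<and> \<bar>L' T\<bar> \<le> 1" for T
 proof -
  have u: "\<bar>U S\<bar> \<le> 1" "\<bar>L S\<bar> \<le> 1" for S using sw by (auto simp: sieve_weights_def)
  show ?thesis using u[of "T \<inter> P"]
   unfolding U'_def L'_def comb_def truncated_moebius_def layer_def by (auto simp: abs_mult power_abs)
 qed
 have general: "weight_sum L' g (P \<union> B) \<le> (\<Prod>p\<in>P \<union> B. 1 - g p) \<and>
   (\<Prod>p\<in>P \<union> B. 1 - g p) \<le> weight_sum U' g (P \<union> B)"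
  if g: "\<forall>p\<in>P \<union> B. 0 \<le> g p \<and> g p \<le> 1" for g
 proof -
  define VP where "VP = (\<Prod>p\<in>P. 1 - g p)"
  define VB where "VB = (\<Prod>p\<in>B. 1 - g p)"
  define w where "w = weight_sum (truncated_moebius b) g B"
  define e where "e = weight_sum (layer (Suc b)) g B"
  have v0: "VP \<ge> 0" "VB \<ge> 0" unfolding VP_def VB_def using g by (auto intro!: prod_nonneg)
  have w: "VB \<le> w" "w \<le> VB + e" unfolding w_def VB_def e_def
   using truncated_moebius_bounds[OF B(1) _ b, of g] g by auto
  have e0: "e \<ge> 0" unfolding e_def by (rule weight_sum_layer_nonneg) (use g in auto)
  have ul: "weight_sum L g P \<le> VP" "VP \<le> weight_sum U g P"
   using sw g unfolding sieve_weights_def VP_def by auto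
  have "weight_sum L g P * w - weight_sum U g P * e \<le> VP * w - VP * e"
   using ul w v0 e0 by (intro diff_mono mult_right_mono) auto
  also have "... = VP * (w - e)" by (simp add: algebra_simps)
  also have "... \<le> VP * VB" using w v0 by (intro mult_left_mono) auto
  finally have "weight_sum L g P * w - weight_sum U g P * e \<le> VP * VB" .
  moreover have "VP * VB \<le> weight_sum U g P * w" using ul w v0 by (intro mult_mono) auto
  ultimately show ?thesis unfolding U L V VP_def VB_def w_def e_def by simp
 qed
 have quant: "weight_sum U' g (P \<union> B) \<le> A * (1 + \<epsilon>) * (\<Prod>p\<in>P \<union> B. 1 - g p) \<and>
   (2 - A * (1 + \<epsilon>)) * (\<Prod>p\<in>P \<union> B. 1 - g p) \<le> weight_sum L' g (P \<union> B)"
  if gG: "g \<in> G" for g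
 proof -
  have g: "\<forall>p\<in>P \<union> B. 0 \<le> g p \<and> g p \<le> 1" using G gG by blast
  define VP where "VP = (\<Prod>p\<in>P. 1 - g p)"
  define VB where "VB = (\<Prod>p\<in>B. 1 - g p)"
  define w where "w = weight_sum (truncated_moebius b) g B"
  define e where "e = weight_sum (layer (Suc b)) g B"
  have v0: "VP \<ge> 0" "VB \<ge> 0" unfolding VP_def VB_def using g by (auto intro!: prod_nonneg)
  have w: "VB \<le> w" "w \<le> VB + e" unfolding w_def VB_def e_def
   using truncated_moebius_bounds[OF B(1) _ b, of g] g by auto
  have e: "0 \<le> e" "e \<le> \<epsilon> * VB" unfolding e_def VB_def
   using weight_sum_layer_nonneg[of B g] g \<epsilon>[OF gG] by auto
  have ul: "weight_sum U g P \<le> A * VP" "(2 - A) * VP \<le> weight_sum L g P"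
   using sw gG unfolding sieve_weights_def VP_def by auto
  have U0: "0 \<le> weight_sum U g P" using sw g v0(1) unfolding sieve_weights_def VP_def
   by (meson UnI1 order_trans)
  have "weight_sum U g P * w \<le> (A * VP) * (VB + \<epsilon> * VB)"
   using ul w v0 e U0 A by (intro mult_mono) auto
  also have "... = A * (1 + \<epsilon>) * (VP * VB)" by (simp add: algebra_simps)
  finally have 1: "weight_sum U g P * w \<le> A * (1 + \<epsilon>) * (VP * VB)" .
  have "((2 - A) * VP) * VB \<le> weight_sum L g P * w"
  proof -
   have p: "0 \<le> (2 - A) * VP" using A v0 by simp
   have "((2 - A) * VP) * VB \<le> ((2 - A) * VP) * w" using p w by (intro mult_left_mono) auto
   also have "... \<le> weight_sum L g P * w" using ul w v0 by (intro mult_right_mono) auto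
   finally show ?thesis .
  qed
  moreover have "weight_sum U g P * e \<le> (A * VP) * (\<epsilon> * VB)"
   using ul e v0 A by (intro mult_mono) auto
  moreover have "((2 - A) * VP) * VB - (A * VP) * (\<epsilon> * VB) = (2 - A * (1 + \<epsilon>)) * (VP * VB)"
   by (simp add: algebra_simps)
  ultimately have "(2 - A * (1 + \<epsilon>)) * (VP * VB) \<le> weight_sum L g P * w - weight_sum U g P * e"
   by linarith
  thus ?thesis using 1 unfolding U L V VP_def VB_def w_def e_def by simp
 qed
 have "sieve_weights G (P \<union> B) (Z * z ^ Suc b) (A * (1 + \<epsilon>)) U' L'"
  unfolding sieve_weights_def
 proof (intro conjI)
  show "finite (P \<union> B)" using P B(1) by simp
  show "\<forall>T. U' T ~= 0 \<or> L' T ~= 0 --> T \<subseteq> P \<union> B \<and> real (\<Prod>T) \<le> Z * z ^ Suc b"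
   by (intro allI impI supp)
  show "\<forall>T. \<bar>U' T\<bar> \<le> 1 \<and> \<bar>L' T\<bar> \<le> 1" by (intro allI one)
  show "\<forall>g. (\<forall>p\<in>P \<union> B. 0 \<le> g p \<and> g p \<le> 1) -->
   weight_sum L' g (P \<union> B) \<le> (\<Prod>p\<in>P \<union> B. 1 - g p) \<and>
   (\<Prod>p\<in>P \<union> B. 1 - g p) \<le> weight_sum U' g (P \<union> B)"
   by (intro allI impI general)
  show "\<forall>g\<in>G. weight_sum U' g (P \<union> B) \<le> A * (1 + \<epsilon>) * (\<Prod>p\<in>P \<union> B. 1 - g p) \<and>
   (2 - A * (1 + \<epsilon>)) * (\<Prod>p\<in>P \<union> B. 1 - g p) \<le> weight_sum L' g (P \<union> B)"
   by (intro ballI quant)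
 qed
 thus ?thesis by blast
qed

text \<open>Interchanging the summations gives X times \<open>weight_sum\<close> plus remainders. A
  set of primes is determined by its product, so at most Z sets carry a weight and the remainders
  add up to at most \<open>Z * R\<close>.\<close>

lemma sieve_weights_apply:
 fixes a :: "'a => real" and E :: "'a => nat set"
 assumes sw: "sieve_weights G P Z A U L" and g: "g \<in> G" and \<Omega>: "finite \<Omega>" "\<And>\<omega>. \<omega> \<in> \<Omega> ==> 0 \<le> a \<omega>"
  and E: "\<And>\<omega>. \<omega> \<in> \<Omega> ==> E \<omega> \<subseteq> P" and X: "X \<ge> 0" and R: "R \<ge> 0" and Z: "Z \<ge> 1"
  and P: "\<And>p. p \<in> P ==> prime p"
  and rem: "\<And>T. T \<subseteq> P ==> real (\<Prod>T) \<le> Z ==>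
   \<bar>(\<Sum>\<omega> | \<omega> \<in> \<Omega> \<and> T \<subseteq> E \<omega>. a \<omega>) - X * prod g T\<bar> \<le> R"
 shows "(\<Sum>\<omega> | \<omega> \<in> \<Omega> \<and> E \<omega> = {}. a \<omega>) \<le> A * X * (\<Prod>p\<in>P. 1 - g p) + Z * R"
  and "(2 - A) * X * (\<Prod>p\<in>P. 1 - g p) - Z * R \<le> (\<Sum>\<omega> | \<omega> \<in> \<Omega> \<and> E \<omega> = {}. a \<omega>)"
proof -
 have finP: "finite P" using sw by (simp add: sieve_weights_def)
 define ind where "ind \<omega> p = (if p \<in> E \<omega> then 1 else 0 :: real)" for \<omega> p
 define r where "r T = (\<Sum>\<omega> | \<omega> \<in> \<Omega> \<and> T \<subseteq> E \<omega>. a \<omega>) - X * prod g T" for T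
 have ind: "prod (ind \<omega>) T = (if T \<subseteq> E \<omega> then 1 else 0)" if "T \<subseteq> P" for T \<omega>
 proof (cases "T \<subseteq> E \<omega>")
  case True
  thus ?thesis by (auto simp: ind_def intro!: prod.neutral)
 next
  case False
  then obtain p where "p \<in> T" "p \<notin> E \<omega>" by auto
  moreover have "finite T" using that finP finite_subset by blast
  ultimately have "prod (ind \<omega>) T = 0" by (intro prod_zero) (auto simp: ind_def)
  thus ?thesis using False by simp
 qed
 have swap: "(\<Sum>\<omega>\<in>\<Omega>. a \<omega> * weight_sum c (ind \<omega>) P) = X * weight_sum c g P + (\<Sum>T\<in>Pow P. c T * r T)" for c
 proof -
  have "(\<Sum>\<omega>\<in>\<Omega>. a \<omega> * weight_sum c (ind \<omega>) P) = (\<Sum>\<omega>\<in>\<Omega>. \<Sum>T\<in>Pow P. c T * (if T \<subseteq> E \<omega> then a \<omega> else 0))"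
   unfolding weight_sum_def sum_distrib_left
   by (intro sum.cong refl) (auto simp: ind)
  also have "... = (\<Sum>T\<in>Pow P. c T * (\<Sum>\<omega>\<in>\<Omega>. if T \<subseteq> E \<omega> then a \<omega> else 0))"
   by (subst sum.swap) (simp add: sum_distrib_left)
  also have "... = (\<Sum>T\<in>Pow P. c T * (X * prod g T + r T))"
   unfolding r_def using \<Omega>(1) by (intro sum.cong refl) (simp add: sum.If_cases Int_def)
  also have "... = X * weight_sum c g P + (\<Sum>T\<in>Pow P. c T * r T)"
   unfolding weight_sum_def by (simp add: distrib_left sum.distrib sum_distrib_left mult.left_commute)
  finally show ?thesis .
 qed
 have count: "\<bar>\<Sum>T\<in>Pow P. c T * r T\<bar> \<le> Z * R"
  if c: "\<And>T. c T ~= 0 ==> T \<subseteq> P \<and> real (\<Prod>T) \<le> Z" "\<And>T. \<bar>c T\<bar> \<le> 1" for c :: "nat set => real"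
 proof -
  define S where "S = {T. T \<subseteq> P \<and> real (\<Prod>T) \<le> Z}"
  have finS: "finite S" unfolding S_def using finP by (auto intro: finite_subset[of _ "Pow P"])
  have "inj_on (\<lambda>T. \<Prod>T) S"
  proof (rule inj_onI)
   fix T T' assume T: "T \<in> S" "T' \<in> S" "\<Prod>T = \<Prod>T'"
   have mem: "p \<in> T \<longleftrightarrow> p dvd \<Prod>T" if "p \<in> P" "T \<in> S" for p T
   proof -
    have fin: "finite T" using that(2) finP finite_subset unfolding S_def by blast
    have 1: "p dvd \<Prod>T" if "p \<in> T" using dvd_prodI[OF fin that, of "\<lambda>x. x"] by simp
    have "p \<in> T" if dv: "p dvd \<Prod>T"
    proof -
    obtain q where "q \<in> T" "p dvd q"
     using prime_dvd_prod_iff[OF fin, of p "\<lambda>x. x"] P[OF \<open>p \<in> P\<close>] dv by auto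
    moreover have "prime q" using \<open>q \<in> T\<close> \<open>T \<in> S\<close> P unfolding S_def by blast
    ultimately show "p \<in> T" using P[OF \<open>p \<in> P\<close>] primes_dvd_imp_eq by blast
    qed
    thus ?thesis using 1 by blast
   qed
   show "T = T'" using mem[OF _ T(1)] mem[OF _ T(2)] T unfolding S_def by auto
  qed
  moreover have "(\<lambda>T. \<Prod>T) ` S \<subseteq> {1..nat \<lfloor>Z\<rfloor>}"
  proof clarify
   fix T assume T: "T \<in> S"
   have "\<And>p. p \<in> T ==> p > 0" using T P unfolding S_def using prime_gt_0_nat by blast
   hence "\<Prod>T > 0" by (intro prod_pos) auto
   moreover have "\<Prod>T \<le> nat \<lfloor>Z\<rfloor>" using T unfolding S_def by (intro le_nat_floor) blast
   ultimately show "\<Prod>T \<in> {1..nat \<lfloor>Z\<rfloor>}" by auto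
  qed
  ultimately have "card S \<le> card {1..nat \<lfloor>Z\<rfloor>}" by (intro card_inj_on_le) auto
  hence cS: "real (card S) \<le> Z" using Z by (simp add: le_nat_iff le_floor_iff)
  have "(\<Sum>T\<in>Pow P. c T * r T) = (\<Sum>T\<in>S. c T * r T)"
   by (rule sum.mono_neutral_right) (use c(1) finP in \<open>auto simp: S_def\<close>)
  also have "\<bar>...\<bar> \<le> (\<Sum>T\<in>S. R)"
  proof (rule order_trans[OF sum_abs sum_mono])
   fix T assume "T \<in> S"
   hence "\<bar>r T\<bar> \<le> R" unfolding r_def S_def using rem by auto
   thus "\<bar>c T * r T\<bar> \<le> R" using c(2)[of T] mult_mono[of "\<bar>c T\<bar>" 1 "\<bar>r T\<bar>" R] R by (simp add: abs_mult)
  qed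
  also have "... \<le> Z * R" using cS R by (simp add: mult_right_mono)
  finally show ?thesis .
 qed
 have V: "(\<Prod>p\<in>P. 1 - ind \<omega> p) = (if E \<omega> = {} then 1 else 0)" if "\<omega> \<in> \<Omega>" for \<omega>
 proof (cases "E \<omega> = {}")
  case True
  thus ?thesis by (auto simp: ind_def intro!: prod.neutral)
 next
  case False
  then obtain p where "p \<in> E \<omega>" by auto
  hence "(\<Prod>p\<in>P. 1 - ind \<omega> p) = 0" using E[OF that] finP by (intro prod_zero) (auto simp: ind_def)
  thus ?thesis using False by simp
 qed
 have main: "(\<Sum>\<omega> | \<omega> \<in> \<Omega> \<and> E \<omega> = {}. a \<omega>) = (\<Sum>\<omega>\<in>\<Omega>. a \<omega> * (\<Prod>p\<in>P. 1 - ind \<omega> p))"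
  using \<Omega>(1) by (simp add: V if_distrib sum.If_cases Int_def cong: if_cong sum.cong)
 have pt: "weight_sum L (ind \<omega>) P \<le> (\<Prod>p\<in>P. 1 - ind \<omega> p)" "(\<Prod>p\<in>P. 1 - ind \<omega> p) \<le> weight_sum U (ind \<omega>) P" for \<omega>
 proof -
  have "\<forall>p\<in>P. 0 \<le> ind \<omega> p \<and> ind \<omega> p \<le> 1" by (simp add: ind_def)
  thus "weight_sum L (ind \<omega>) P \<le> (\<Prod>p\<in>P. 1 - ind \<omega> p)" "(\<Prod>p\<in>P. 1 - ind \<omega> p) \<le> weight_sum U (ind \<omega>) P"
   using sw unfolding sieve_weights_def by blast+
 qed
 have U: "weight_sum U g P \<le> A * (\<Prod>p\<in>P. 1 - g p)" "(2 - A) * (\<Prod>p\<in>P. 1 - g p) \<le> weight_sum L g P"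
  using sw g unfolding sieve_weights_def by auto
 have cU: "\<bar>\<Sum>T\<in>Pow P. U T * r T\<bar> \<le> Z * R" by (rule count) (use sw in \<open>auto simp: sieve_weights_def\<close>)
 have cL: "\<bar>\<Sum>T\<in>Pow P. L T * r T\<bar> \<le> Z * R" by (rule count) (use sw in \<open>auto simp: sieve_weights_def\<close>)
 have "(\<Sum>\<omega>\<in>\<Omega>. a \<omega> * (\<Prod>p\<in>P. 1 - ind \<omega> p)) \<le> (\<Sum>\<omega>\<in>\<Omega>. a \<omega> * weight_sum U (ind \<omega>) P)"
  by (intro sum_mono mult_left_mono pt \<Omega>(2))
 also have "... \<le> X * (A * (\<Prod>p\<in>P. 1 - g p)) + Z * R"
  unfolding swap using cU U(1) X by (intro add_mono mult_left_mono) auto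
 finally show "(\<Sum>\<omega> | \<omega> \<in> \<Omega> \<and> E \<omega> = {}. a \<omega>) \<le> A * X * (\<Prod>p\<in>P. 1 - g p) + Z * R"
  unfolding main by (simp add: mult_ac)
 have "X * ((2 - A) * (\<Prod>p\<in>P. 1 - g p)) - Z * R \<le> X * weight_sum L g P + (\<Sum>T\<in>Pow P. L T * r T)"
  using cL mult_left_mono[OF U(2) X] by linarith
 also have "... = (\<Sum>\<omega>\<in>\<Omega>. a \<omega> * weight_sum L (ind \<omega>) P)" by (simp only: swap)
 also have "... \<le> (\<Sum>\<omega>\<in>\<Omega>. a \<omega> * (\<Prod>p\<in>P. 1 - ind \<omega> p))"
  by (intro sum_mono mult_left_mono pt \<Omega>(2))
 finally show "(2 - A) * X * (\<Prod>p\<in>P. 1 - g p) - Z * R \<le> (\<Sum>\<omega> | \<omega> \<in> \<Omega> \<and> E \<omega> = {}. a \<omega>)"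
  unfolding main by (simp add: mult_ac)
qed

section \<open>Elementary bounds for sums over primes\<close>

lemma sum_ln_prime_factors_le:
 assumes "m \<ge> 1"
 shows "(\<Sum>p\<in>prime_factors m. ln (real p)) \<le> ln (real m)"
proof -
 have pos: "p \<ge> 1" if "p \<in> prime_factors m" for p
  using that prime_ge_1_nat by (auto simp: in_prime_factors_iff)
 have "(\<Prod>p\<in>prime_factors m. p) \<le> (\<Prod>p\<in>prime_factors m. p ^ multiplicity p m)"
 proof (rule prod_mono)
  fix p assume p: "p \<in> prime_factors m"
  hence "multiplicity p m \<ge> 1"
   using assms by (auto simp: prime_factors_multiplicity)
  thus "0 \<le> p \<and> p \<le> p ^ multiplicity p m" using pos[OF p] by (simp add: self_le_power)
 qed
 also have "... = m" using prime_factorization_nat[of m] assms by simp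
 finally have le: "real (\<Prod>p\<in>prime_factors m. p) \<le> real m" by (simp only: of_nat_le_iff)
 have "(\<Sum>p\<in>prime_factors m. ln (real p)) = ln (\<Prod>p\<in>prime_factors m. real p)"
  by (rule ln_prod[symmetric]) (use pos in \<open>auto simp: Suc_le_eq\<close>)
 also have "... \<le> ln (real m)"
  using le pos assms by (subst ln_le_cancel_iff) (auto intro!: prod_pos simp: Suc_le_eq)
 finally show ?thesis .
qed

lemma card_multiples:
 assumes "p \<ge> 1"
 shows "card {m\<in>{1..n}. p dvd m} = n div p"
proof -
 have "{m\<in>{1..n}. p dvd m} = (\<lambda>k. p * k) ` {1..n div p}"
 proof (intro equalityI subsetI)
  fix m assume "m \<in> {m\<in>{1..n}. p dvd m}"
  then obtain k where k: "m = p * k" "1 \<le> m" "m \<le> n" by auto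
  have "k \<ge> 1" using k by (cases k) auto
  moreover have "k \<le> n div p" using k assms by (simp add: less_eq_div_iff_mult_less_eq mult.commute)
  ultimately show "m \<in> (\<lambda>k. p * k) ` {1..n div p}" using k by auto
 next
  fix m assume "m \<in> (\<lambda>k. p * k) ` {1..n div p}"
  then obtain k where "m = p * k" "k \<in> {1..n div p}" by blast
  hence k: "m = p * k" "1 \<le> k" "k \<le> n div p" by auto
  have "p * k \<le> n" using k assms by (simp add: less_eq_div_iff_mult_less_eq mult.commute)
  moreover have "1 \<le> p * k" using k assms by simp
  ultimately show "m \<in> {m\<in>{1..n}. p dvd m}" using k by auto
 qed
 moreover have "inj_on (\<lambda>k. p * k) {1..n div p}" using assms by (auto simp: inj_on_def)
 ultimately show ?thesis by (simp add: card_image)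
qed

text \<open>Count the prime factors of 1, ..., n with weight ln p: each p occurs n div p times,
  which is at least n / (2 p), while each m contributes at most ln n.\<close>

lemma sum_ln_over_prime_le:
 assumes "n \<ge> 1"
 shows "(\<Sum>p | prime p \<and> p \<le> n. ln (real p) / real p) \<le> 2 * ln (real n)"
proof -
 define P where "P = {p. prime p \<and> p \<le> n}"
 have finP: "finite P" unfolding P_def by (rule finite_subset[of _ "{..n}"]) auto
 have "real n / 2 * (\<Sum>p\<in>P. ln (real p) / real p) = (\<Sum>p\<in>P. ln (real p) * (real n / (2 * real p)))"
  by (simp add: sum_distrib_left mult_ac)
 also have "... \<le> (\<Sum>p\<in>P. ln (real p) * real (n div p))"
 proof (rule sum_mono)
  fix p assume p: "p \<in> P"
  hence p1: "p \<ge> 1" "p \<le> n" unfolding P_def using prime_ge_1_nat by auto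
  have "n div p \<ge> 1" using p1 by (simp add: less_eq_div_iff_mult_less_eq)
  hence "1 * p \<le> (n div p) * p" by (intro mult_right_mono) auto
  moreover have "n = (n div p) * p + n mod p" by simp
  moreover have "n mod p < p" using p1 by simp
  ultimately have "n \<le> 2 * ((n div p) * p)" by linarith
  hence "real n \<le> real (2 * ((n div p) * p))" by (simp only: of_nat_le_iff)
  hence "real n / (2 * real p) \<le> real (n div p)" using p1 by (simp add: field_simps)
  thus "ln (real p) * (real n / (2 * real p)) \<le> ln (real p) * real (n div p)"
   using p1 by (intro mult_left_mono) auto
 qed
 also have "... = (\<Sum>p\<in>P. \<Sum>m\<in>{m\<in>{1..n}. p dvd m}. ln (real p))"
  by (intro sum.cong refl) (use card_multiples prime_ge_1_nat in \<open>auto simp: P_def mult.commute\<close>)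
 also have "... = (\<Sum>p\<in>P. \<Sum>m\<in>{1..n}. if p dvd m then ln (real p) else 0)"
  by (intro sum.cong[OF refl] sum.inter_filter) simp
 also have "... = (\<Sum>m\<in>{1..n}. \<Sum>p\<in>P. if p dvd m then ln (real p) else 0)" by (rule sum.swap)
 also have "... \<le> (\<Sum>m\<in>{1..n}. ln (real n))"
 proof (rule sum_mono)
  fix m assume m: "m \<in> {1..n}"
  have "p \<le> n" if "p dvd m" for p using dvd_imp_le[OF that] m by auto
  hence "{p\<in>P. p dvd m} = prime_factors m"
   using m unfolding P_def by (auto simp: in_prime_factors_iff)
  hence "(\<Sum>p\<in>P. if p dvd m then ln (real p) else 0) = (\<Sum>p\<in>prime_factors m. ln (real p))"
   using sum.inter_filter[OF finP, of "\<lambda>p. ln (real p)" "\<lambda>p. p dvd m"] by simp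
  also have "... \<le> ln (real m)" using m by (intro sum_ln_prime_factors_le) auto
  also have "... \<le> ln (real n)" using m by simp
  finally show "(\<Sum>p\<in>P. if p dvd m then ln (real p) else 0) \<le> ln (real n)" .
 qed
 also have "... = real n * ln (real n)" by simp
 finally have "real n * ((\<Sum>p\<in>P. ln (real p) / real p) / 2) \<le> real n * ln (real n)" by simp
 hence "(\<Sum>p\<in>P. ln (real p) / real p) / 2 \<le> ln (real n)" using assms by simp
 thus ?thesis unfolding P_def by simp
qed

lemma one_minus_ge_exp:
 fixes t :: real
 assumes "0 \<le> t" "t \<le> 1 / 2"
 shows "exp (- t - 2 * t\<^sup>2) \<le> 1 - t"
proof -
 have "- t - 2 * t\<^sup>2 \<le> ln (1 - t)" using ln_one_minus_pos_lower_bound[of t] assms by simp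
 thus ?thesis using assms by (subst (asm) ln_ge_iff) auto
qed

lemma sum_inverse_squares_le:
 assumes "finite P" "\<And>p. p \<in> P ==> p \<ge> 2"
 shows "(\<Sum>p\<in>P. 1 / (real p)\<^sup>2) \<le> 1"
proof -
 have "P \<subseteq> {2..<Max P + 2}"
 proof
  fix p assume "p \<in> P"
  hence "p \<le> Max P" "2 \<le> p" using assms by auto
  thus "p \<in> {2..<Max P + 2}" by simp
 qed
 then obtain n where n: "P \<subseteq> {2..<n + 2}" by blast
 have "(\<Sum>p\<in>P. 1 / (real p)\<^sup>2) \<le> (\<Sum>p\<in>{2..<n + 2}. 1 / (real p)\<^sup>2)"
  using n by (intro sum_mono2) auto
 also have "... \<le> 1 - 1 / real (n + 1)"
 proof (induction n)
  case (Suc n)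
  have "{2..<Suc n + 2} = insert (n + 2) {2..<n + 2}" by auto
  hence "(\<Sum>p\<in>{2..<Suc n + 2}. 1 / (real p)\<^sup>2) = 1 / (real (n + 2))\<^sup>2 + (\<Sum>p\<in>{2..<n + 2}. 1 / (real p)\<^sup>2)"
   by simp
  also have "... \<le> 1 / (real (n + 2))\<^sup>2 + (1 - 1 / real (n + 1))" using Suc by simp
  also have "1 / (real (n + 2))\<^sup>2 \<le> 1 / (real (n + 1) * real (n + 2))"
   unfolding power2_eq_square by (intro divide_left_mono mult_right_mono) auto
  also have "1 / (real (n + 1) * real (n + 2)) = 1 / real (n + 1) - 1 / real (n + 2)"
   by (simp add: field_simps)
  finally show ?case by (simp add: add_ac)
 qed simp
 finally show ?thesis by (rule order_trans) simp
qed

definition primes_below :: "real => nat set" where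
 "primes_below z = {p. prime p \<and> real p < z}"

lemma finite_primes_below: "finite (primes_below z)"
proof (rule finite_subset[of _ "{..nat \<lceil>z\<rceil>}"])
 show "primes_below z \<subseteq> {..nat \<lceil>z\<rceil>}" unfolding primes_below_def by (auto; linarith)
qed simp

lemma primes_below_ge2: "p \<in> primes_below z ==> p \<ge> 2"
 unfolding primes_below_def using prime_ge_2_nat by auto

text \<open>The expanded product runs over squarefree integers, each of them once.\<close>

lemma squarefree_euler_product_le:
 assumes "finite P" "\<And>p. p \<in> P ==> prime p" "s > 0"
 shows "\<exists>k. (\<Prod>p\<in>P. 1 + real p powr (- s)) \<le> zsum s k"
proof -
 have pos: "\<Prod>T > 0" if "T \<subseteq> P" for T
  using that assms(2) prime_gt_0_nat by (intro prod_pos) blast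
 have "(\<Prod>p\<in>P. real p powr (- s) + 1) = (\<Sum>T\<in>Pow P. (\<Prod>p\<in>T. real p powr (- s)) * (\<Prod>p\<in>P - T. 1))"
  by (rule prod_add[OF assms(1)])
 also have "... = (\<Sum>T\<in>Pow P. real (\<Prod>T) powr (- s))"
  by (intro sum.cong refl) (simp add: prod_powr_distrib)
 also have "... = (\<Sum>n\<in>(\<lambda>T. \<Prod>T) ` Pow P. real n powr (- s))"
 proof (rule sum.reindex[symmetric, unfolded o_def])
  show "inj_on (\<lambda>T. \<Prod>T) (Pow P)"
  proof (rule inj_onI)
   fix T T' assume T: "T \<in> Pow P" "T' \<in> Pow P" "\<Prod>T = \<Prod>T'"
   have mem: "p \<in> S \<longleftrightarrow> p dvd \<Prod>S" if "p \<in> P" "S \<subseteq> P" for p S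
   proof -
    have fin: "finite S" using that(2) assms(1) finite_subset by blast
    have 1: "p dvd \<Prod>S" if "p \<in> S" using dvd_prodI[OF fin that, of "\<lambda>x. x"] by simp
    have "p \<in> S" if dv: "p dvd \<Prod>S"
    proof -
     obtain q where q: "q \<in> S" "p dvd q"
      using prime_dvd_prod_iff[OF fin, of p "\<lambda>x. x"] assms(2)[OF \<open>p \<in> P\<close>] dv by auto
     moreover have "prime q" using q \<open>S \<subseteq> P\<close> assms(2) by blast
     ultimately show "p \<in> S" using assms(2)[OF \<open>p \<in> P\<close>] primes_dvd_imp_eq by blast
    qed
    thus ?thesis using 1 by blast
   qed
   show "T = T'" using mem[of _ T] mem[of _ T'] T by auto
  qed
 qed
 also have "... \<le> zsum s (\<Prod>P)"
  unfolding zsum_def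
 proof (rule sum_mono2)
  show "(\<lambda>T. \<Prod>T) ` Pow P \<subseteq> {1..\<Prod>P}"
  proof clarify
   fix T assume T: "T \<subseteq> P"
   have "\<Prod>T dvd \<Prod>P" using T assms(1) by (intro prod_dvd_prod_subset) auto
   thus "\<Prod>T \<in> {1..\<Prod>P}" using pos[OF T] pos[of P] dvd_imp_le[of "\<Prod>T" "\<Prod>P"] by (auto simp: Suc_le_eq)
  qed
 qed auto
 finally show ?thesis by (auto simp: add.commute)
qed

text \<open>Compare with the Euler product at \<open>1 + 1 / ln z\<close>.\<close>

lemma sum_inverse_primes_le:
 assumes z: "z \<ge> 2"
 shows "(\<Sum>p\<in>primes_below z. 1 / real p) \<le> ln (2 + ln z) + 3"
proof -
 define P where "P = primes_below z"
 have P: "finite P" "\<And>p. p \<in> P ==> p \<ge> 2" "\<And>p. p \<in> P ==> prime p"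
  unfolding P_def using finite_primes_below primes_below_ge2 by (auto simp: primes_below_def)
 define \<eta> where "\<eta> = 1 / ln z"
 have lnz: "ln z > 0" using z by simp
 hence \<eta>: "\<eta> > 0" by (simp add: \<eta>_def)
 define s where "s = 1 + \<eta>"
 \<comment> \<open>Moving the exponent from 1 to s costs at most \<open>\<eta> * ln p\<close>
   relative to 1 / p, in total at most 2 by \<open>sum_ln_over_prime_le\<close>.\<close>
 have "(\<Sum>p\<in>P. 1 / real p) \<le> (\<Sum>p\<in>P. real p powr (- s) + \<eta> * (ln (real p) / real p))"
 proof (rule sum_mono)
  fix p assume "p \<in> P"
  hence p: "p \<ge> 2" by (rule P)
  have "1 - \<eta> * ln (real p) \<le> exp (- (\<eta> * ln (real p)))" using exp_ge_add_one_self[of "- (\<eta> * ln (real p))"] by simp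
  also have "... = real p powr (- \<eta>)" using p by (simp add: powr_def)
  finally have "(1 / real p) * (1 - \<eta> * ln (real p)) \<le> (1 / real p) * real p powr (- \<eta>)"
   by (intro mult_left_mono) auto
  also have "(1 / real p) * real p powr (- \<eta>) = real p powr (- s)"
   using p by (simp add: s_def powr_diff powr_minus_divide)
  finally show "1 / real p \<le> real p powr (- s) + \<eta> * (ln (real p) / real p)"
   by (simp add: right_diff_distrib)
 qed
 also have "... = (\<Sum>p\<in>P. real p powr (- s)) + \<eta> * (\<Sum>p\<in>P. ln (real p) / real p)"
  by (simp add: sum.distrib sum_distrib_left)
 also have "\<eta> * (\<Sum>p\<in>P. ln (real p) / real p) \<le> 2"
 proof -
  define n where "n = nat \<lfloor>z\<rfloor>"
  have n: "n \<ge> 1" "real n \<le> z" using z unfolding n_def by linarith+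
  have "(\<Sum>p\<in>P. ln (real p) / real p) \<le> (\<Sum>p | prime p \<and> p \<le> n. ln (real p) / real p)"
  proof (rule sum_mono2)
   show "P \<subseteq> {p. prime p \<and> p \<le> n}" unfolding P_def primes_below_def n_def
    by (auto intro: le_nat_floor)
   show "finite {p. prime p \<and> p \<le> n}" by (rule finite_subset[of _ "{..n}"]) auto
   fix p assume "p \<in> {p. prime p \<and> p \<le> n} - P"
   thus "0 \<le> ln (real p) / real p" using prime_ge_1_nat[of p] by simp
  qed
  also have "... \<le> 2 * ln (real n)" by (rule sum_ln_over_prime_le[OF n(1)])
  also have "... \<le> 2 * ln z" using n by simp
  finally have "\<eta> * (\<Sum>p\<in>P. ln (real p) / real p) \<le> \<eta> * (2 * ln z)" using \<eta> by (intro mult_left_mono) auto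
  thus ?thesis using lnz by (simp add: \<eta>_def)
 qed
 also have "(\<Sum>p\<in>P. real p powr (- s)) \<le> ln (2 + ln z) + 1"
 proof -
  define f where "f p = real p powr (- s)" for p :: nat
  have f: "0 < f p" "f p \<le> 1 / real p" if "p \<in> P" for p
  proof -
   show "0 < f p" unfolding f_def using P(2)[OF that] by simp
   have "f p \<le> real p powr (- 1)" unfolding f_def s_def using P(2)[OF that] \<eta> by (intro powr_mono) auto
   thus "f p \<le> 1 / real p" using P(2)[OF that] by (simp add: powr_minus_divide)
  qed
  obtain k where k: "(\<Prod>p\<in>P. 1 + f p) \<le> zsum s k"
   using squarefree_euler_product_le[of P s] P \<eta> unfolding f_def s_def by auto
  \<comment> \<open>The partial sums of zeta at 1 + \<eta> exceed 1 / \<eta> by at most 2, and 1 /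
    \<eta> = ln z.\<close>
  have zs: "zsum s k \<le> 2 + ln z"
  proof (cases "k = 0")
   case True
   thus ?thesis using lnz by (simp add: zsum_def)
  next
   case False
   obtain \<gamma> where \<gamma>: "0 \<le> \<gamma>" "\<gamma> \<le> 1"
    and g: "\<And>k. k \<ge> 1 ==> zsum s k - zint s (real k) - \<gamma> \<le> real k powr (- s)"
    by (rule zsum_approx[of s]) (use \<eta> in \<open>auto simp: s_def\<close>)
   have "real k powr (- s) \<le> real k powr 0" using False \<eta> by (intro powr_mono) (auto simp: s_def)
   hence 1: "real k powr (- s) \<le> 1" using False by simp
   have "zint s (real k) = (1 - real k powr (- \<eta>)) / \<eta>"
    using \<eta> by (simp add: zint_def s_def field_simps)
   also have "... \<le> 1 / \<eta>" using \<eta> by (intro divide_right_mono) auto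
   finally have 2: "zint s (real k) \<le> ln z" by (simp add: \<eta>_def)
   have "k \<ge> 1" using False by simp
   from g[OF this] 1 2 \<gamma> show ?thesis by linarith
  qed
  have "(\<Sum>p\<in>P. f p) \<le> (\<Sum>p\<in>P. ln (1 + f p) + 1 / (real p)\<^sup>2)"
  proof (rule sum_mono)
   fix p assume p: "p \<in> P"
   have "1 / real p \<le> 1" using P(2)[OF p] by simp
   hence "f p - (f p)\<^sup>2 \<le> ln (1 + f p)" using f[OF p] by (intro ln_one_plus_pos_lower_bound) linarith+
   moreover have "(f p)\<^sup>2 \<le> (1 / real p)\<^sup>2" using f[OF p] by (intro power_mono) auto
   ultimately show "f p \<le> ln (1 + f p) + 1 / (real p)\<^sup>2" by (simp add: power_divide)
  qed
  also have "... = ln (\<Prod>p\<in>P. 1 + f p) + (\<Sum>p\<in>P. 1 / (real p)\<^sup>2)"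
  proof -
   have ne: "1 + f p > 0" if "p \<in> P" for p using f(1)[OF that] by simp
   have "ln (\<Prod>p\<in>P. 1 + f p) = (\<Sum>p\<in>P. ln (1 + f p))"
    by (rule ln_prod) (use ne P(1) in force)+
   thus ?thesis by (simp add: sum.distrib)
  qed
  also have "ln (\<Prod>p\<in>P. 1 + f p) \<le> ln (2 + ln z)"
  proof -
   have "0 < (\<Prod>p\<in>P. 1 + f p)" using f(1) by (intro prod_pos) (auto simp: add_pos_pos)
   thus ?thesis using k zs lnz by (subst ln_le_cancel_iff) auto
  qed
  finally show ?thesis using sum_inverse_squares_le[OF P(1,2)] unfolding f_def by linarith
 qed
 finally show ?thesis unfolding P_def by linarith
qed

text \<open>The bound is 1 - (1 - 1/p)^2, the proportion of zeros modulo p of a product of two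
  independent linear forms. The sieve thus has dimension at most two, and \<open>1 - g p\<close>
  stays positive even at p = 2.\<close>

definition sieve_densities :: "(nat => real) set" where
 "sieve_densities = {g. \<forall>p. prime p --> 0 \<le> g p \<and> g p \<le> (2 * real p - 1) / (real p)\<^sup>2}"

lemma sieve_densities_one_minus:
 assumes "g \<in> sieve_densities" "prime p"
 shows "(1 - 1 / real p)\<^sup>2 \<le> 1 - g p" "0 \<le> g p" "g p \<le> 2 / real p" "g p \<le> 1"
proof -
 have p: "real p \<ge> 2" using prime_ge_2_nat[OF assms(2)] by simp
 have g: "0 \<le> g p" "g p \<le> (2 * real p - 1) / (real p)\<^sup>2" using assms by (auto simp: sieve_densities_def)
 show "0 \<le> g p" by (rule g)
 have eq: "1 - (2 * real p - 1) / (real p)\<^sup>2 = (1 - 1 / real p)\<^sup>2"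
  using p by (simp add: field_simps power2_eq_square)
 thus 1: "(1 - 1 / real p)\<^sup>2 \<le> 1 - g p" using g by linarith
 have "0 \<le> (1 - 1 / real p)\<^sup>2" by simp
 thus "g p \<le> 1" using 1 by linarith
 have "(2 * real p - 1) / (real p)\<^sup>2 \<le> (2 * real p) / (real p)\<^sup>2" by (intro divide_right_mono) auto
 also have "... = 2 / real p" using p by (simp add: power2_eq_square)
 finally show "g p \<le> 2 / real p" using g by linarith
qed

text \<open>Each factor is at least (1 - 1/p)^2, and 1 - t is at least exp (- t - 2 t^2); the
  squares of 1 / p sum to at most 1, which gives the constant 4.\<close>

lemma prod_one_minus_density_ge:
 assumes g: "g \<in> sieve_densities" and P: "finite P" "\<And>p. p \<in> P ==> prime p"
 shows "exp (- 2 * (\<Sum>p\<in>P. 1 / real p) - 4) \<le> (\<Prod>p\<in>P. 1 - g p)"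
proof -
 have p2: "p \<ge> 2" if "p \<in> P" for p using P(2)[OF that] prime_ge_2_nat by blast
 have "exp (- 2 * (\<Sum>p\<in>P. 1 / real p) - 4) \<le> exp (- 2 * (\<Sum>p\<in>P. 1 / real p) - 4 * (\<Sum>p\<in>P. 1 / (real p)\<^sup>2))"
  using sum_inverse_squares_le[OF P(1) p2] by simp
 also have "- 2 * (\<Sum>p\<in>P. 1 / real p) - 4 * (\<Sum>p\<in>P. 1 / (real p)\<^sup>2) =
   (\<Sum>p\<in>P. 2 * (- (1 / real p) - 2 * (1 / real p)\<^sup>2))"
  by (simp add: sum_distrib_left sum_subtractf sum_negf power_divide right_diff_distrib)
 also have "exp ... = (\<Prod>p\<in>P. (exp (- (1 / real p) - 2 * (1 / real p)\<^sup>2))\<^sup>2)"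
  by (simp only: exp_sum[OF P(1)] exp_double)
 also have "... \<le> (\<Prod>p\<in>P. 1 - g p)"
 proof (rule prod_mono)
  fix p assume p: "p \<in> P"
  have "exp (- (1 / real p) - 2 * (1 / real p)\<^sup>2) \<le> 1 - 1 / real p"
   using p2[OF p] by (intro one_minus_ge_exp) (auto simp: field_simps)
  hence "(exp (- (1 / real p) - 2 * (1 / real p)\<^sup>2))\<^sup>2 \<le> (1 - 1 / real p)\<^sup>2" by (intro power_mono) auto
  also have "... \<le> 1 - g p" by (rule sieve_densities_one_minus[OF g P(2)[OF p]])
  finally show "0 \<le> (exp (- (1 / real p) - 2 * (1 / real p)\<^sup>2))\<^sup>2 \<and>
    (exp (- (1 / real p) - 2 * (1 / real p)\<^sup>2))\<^sup>2 \<le> 1 - g p" by simp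
 qed
 finally show ?thesis .
qed

lemma prod_primes_below_density_ge:
 assumes g: "g \<in> sieve_densities" and z: "z \<ge> 2"
 shows "exp (- 10) / 16 / (ln z)\<^sup>2 \<le> (\<Prod>p\<in>primes_below z. 1 - g p)"
proof -
 \<comment> \<open>This makes 2 + ln z at most 4 ln z, the origin of the 16; the exponent 10 is 2 *
   3 + 4.\<close>
 have lnz: "ln z \<ge> 2 / 3"
  using z ln2_ge_two_thirds by (meson ln_mono order_trans zero_less_numeral less_le_trans)
 have "exp (- 10) / 16 / (ln z)\<^sup>2 = exp (- 10) / (4 * ln z)\<^sup>2" by (simp add: power_mult_distrib)
 also have "... \<le> exp (- 10) / (2 + ln z)\<^sup>2"
  using lnz by (intro divide_left_mono power_mono mult_pos_pos zero_less_power) auto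
 also have "... = exp (- 2 * (ln (2 + ln z) + 3) - 4)"
 proof -
  have "exp (2 * ln (2 + ln z)) = (2 + ln z)\<^sup>2" using lnz by (simp add: exp_double)
  moreover have "- 2 * (ln (2 + ln z) + 3) - 4 = - 10 - 2 * ln (2 + ln z)" by simp
  ultimately show ?thesis by (simp only: exp_diff)
 qed
 also have "... \<le> exp (- 2 * (\<Sum>p\<in>primes_below z. 1 / real p) - 4)"
  using sum_inverse_primes_le[OF z] by simp
 also have "... \<le> (\<Prod>p\<in>primes_below z. 1 - g p)"
  by (rule prod_one_minus_density_ge[OF g finite_primes_below]) (simp add: primes_below_def)
 finally show ?thesis .
qed

text \<open>In the block every ln p is at least ln w, so the logarithmic sum, at most 2 ln (w^2),
  may be divided by ln w. For w < 2 only the primes 2 and 3 can occur.\<close>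

lemma sum_inverse_primes_block_le:
 assumes w: "w > 1"
 shows "(\<Sum>p\<in>primes_below (w\<^sup>2) - primes_below w. 1 / real p) \<le> 4"
proof (cases "w \<ge> 2")
 case True
 define n where "n = nat \<lfloor>w\<^sup>2\<rfloor>"
 have w2: "w\<^sup>2 \<ge> 1" using w by (simp add: one_le_power)
 hence n: "n \<ge> 1" "real n \<le> w\<^sup>2" unfolding n_def by linarith+
 have lw: "ln w > 0" using w by simp
 have "(\<Sum>p\<in>primes_below (w\<^sup>2) - primes_below w. 1 / real p) \<le>
   (\<Sum>p\<in>primes_below (w\<^sup>2) - primes_below w. (ln (real p) / real p) / ln w)"
 proof (rule sum_mono)
  fix p assume p: "p \<in> primes_below (w\<^sup>2) - primes_below w"
  hence "real p \<ge> w" by (auto simp: primes_below_def)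
  hence "ln w \<le> ln (real p)" using w by simp
  hence "1 \<le> ln (real p) / ln w" using lw by simp
  hence "1 / real p * 1 \<le> 1 / real p * (ln (real p) / ln w)" by (intro mult_left_mono) auto
  thus "1 / real p \<le> (ln (real p) / real p) / ln w" by (simp add: mult.commute)
 qed
 also have "... = (\<Sum>p\<in>primes_below (w\<^sup>2) - primes_below w. ln (real p) / real p) / ln w"
  by (simp add: sum_divide_distrib)
 also have "... \<le> (\<Sum>p | prime p \<and> p \<le> n. ln (real p) / real p) / ln w"
 proof (intro divide_right_mono sum_mono2)
  show "primes_below (w\<^sup>2) - primes_below w \<subseteq> {p. prime p \<and> p \<le> n}"
   unfolding primes_below_def n_def by (auto intro: le_nat_floor)
  show "finite {p. prime p \<and> p \<le> n}" by (rule finite_subset[of _ "{..n}"]) auto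
  fix p assume "p \<in> {p. prime p \<and> p \<le> n} - (primes_below (w\<^sup>2) - primes_below w)"
  thus "0 \<le> ln (real p) / real p" using prime_ge_1_nat[of p] by simp
 qed (use lw in simp)
 also have "... \<le> (2 * ln (w\<^sup>2)) / ln w"
 proof (intro divide_right_mono order_trans[OF sum_ln_over_prime_le[OF n(1)]])
  show "2 * ln (real n) \<le> 2 * ln (w\<^sup>2)"
   by (intro mult_left_mono iffD2[OF ln_le_cancel_iff]) (use n w in auto)
 qed (use lw in simp)
 also have "... = 4" using lw w by (simp add: ln_realpow)
 finally show ?thesis .
next
 case False
 hence "w\<^sup>2 < 2\<^sup>2" using w by (intro power_strict_mono) auto
 have "primes_below (w\<^sup>2) - primes_below w \<subseteq> {2, 3}"
 proof
  fix p assume p: "p \<in> primes_below (w\<^sup>2) - primes_below w"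
  hence "real p < 4" using \<open>w\<^sup>2 < 2\<^sup>2\<close> by (simp add: primes_below_def)
  hence "p < 4" by linarith
  moreover have "p \<ge> 2" using p primes_below_ge2 by blast
  ultimately show "p \<in> {2, 3}" by auto
 qed
 hence "(\<Sum>p\<in>primes_below (w\<^sup>2) - primes_below w. 1 / real p) \<le> (\<Sum>p\<in>{2, 3}. 1 / real p)"
  by (intro sum_mono2) auto
 thus ?thesis by simp
qed

section \<open>Construction of the sieve weights\<close>

lemma sieve_weights_mono:
 assumes "sieve_weights G P Z A U L" "Z \<le> Z'" "A \<le> A'"
  "\<And>g. g \<in> G ==> 0 \<le> (\<Prod>p\<in>P. 1 - g p)"
 shows "sieve_weights G P Z' A' U L"
proof -
 have "weight_sum U g P \<le> A' * (\<Prod>p\<in>P. 1 - g p) \<and> (2 - A') * (\<Prod>p\<in>P. 1 - g p) \<le> weight_sum L g P"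
  if "g \<in> G" for g
 proof -
  have "A * (\<Prod>p\<in>P. 1 - g p) \<le> A' * (\<Prod>p\<in>P. 1 - g p)"
   "(2 - A') * (\<Prod>p\<in>P. 1 - g p) \<le> (2 - A) * (\<Prod>p\<in>P. 1 - g p)"
   using assms(3,4) that by (auto intro!: mult_right_mono)
  thus ?thesis using assms(1) that unfolding sieve_weights_def by (meson order_trans)
 qed
 moreover have "\<forall>T. U T ~= 0 \<or> L T ~= 0 --> T \<subseteq> P \<and> real (\<Prod>T) \<le> Z'"
  using assms(1,2) unfolding sieve_weights_def by (meson order_trans)
 ultimately show ?thesis using assms(1) unfolding sieve_weights_def by simp
qed

lemma sieve_weights_empty:
 "sieve_weights G {} 1 1 (\<lambda>T. if T = {} then 1 else 0) (\<lambda>T. if T = {} then 1 else 0)"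
 unfolding sieve_weights_def weight_sum_def by auto

lemma exp_third_le: "exp (1 / 3 :: real) \<le> 3 / 2"
 by (rule order_trans[OF exp_bound]) (auto simp: power2_eq_square)

text \<open>The block \<open>[z\<^bsup>1/2^(j+1)\<^esup>, z\<^bsup>1/2^j\<^esup>)\<close> is truncated after \<open>b + 2 * j\<close> prime factors, so that the
 total level is bounded by a fixed power of \<open>z\<close> while the relative errors are summable.\<close>

lemma sieve_weights_exist:
 obtains B :: nat where
  "\<And>z. z \<ge> 2 ==> \<exists>U L. sieve_weights sieve_densities (primes_below z) (z ^ B) (3 / 2) U L"
proof -
 \<comment> \<open>On a block the densities sum to at most 2 * 4 = 8, so its n-th layer is at most
   \<open>a n\<close>.\<close>
 define a where "a n = (8 ^ n / fact n :: real)" for n :: nat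
 have a0: "a n \<ge> 0" for n by (simp add: a_def)
 have "summable a"
  using summable_exp[of "8 :: real"] unfolding a_def by (simp add: field_simps)
 \<comment> \<open>With this margin the \<epsilon> i below sum to at most 1 / 3, and exp (1 / 3)
   \<le> 3 / 2 is the quality claimed.\<close>
 moreover have "exp (- 12) / 3 > (0 :: real)" by simp
 ultimately obtain b1 where "\<forall>m\<ge>b1. \<forall>n. norm (sum a {m..<n}) < exp (- 12) / 3"
  unfolding summable_Cauchy by blast
 hence b1: "\<And>m n. m \<ge> b1 ==> norm (sum a {m..<n}) < exp (- 12) / 3" by blast
 define b where "b = 2 * b1"
 \<comment> \<open>The layer relative to the product over the block, which is at least exp (- 2 * 4
   - 4).\<close>
 define \<epsilon> where "\<epsilon> i = exp 12 * a (Suc (b + 2 * i))" for i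
 have \<epsilon>0: "\<epsilon> i \<ge> 0" for i using a0 by (simp add: \<epsilon>_def)
 have \<epsilon>sum: "(\<Sum>i\<in>{j..<J}. \<epsilon> i) \<le> 1 / 3" for j J
 proof -
  have "(\<Sum>i\<in>{j..<J}. a (Suc (b + 2 * i))) = sum a ((\<lambda>i. Suc (b + 2 * i)) ` {j..<J})"
   by (subst sum.reindex) (auto simp: inj_on_def)
  also have "... \<le> sum a {b..<Suc (b + 2 * J)}"
   by (rule sum_mono2) (use a0 in auto)
  also have "... \<le> exp (- 12) / 3" using b1[of b "Suc (b + 2 * J)"] abs_ge_self[of "sum a {b..<Suc (b + 2 * J)}"]
   unfolding real_norm_def b_def by linarith
  finally have "exp 12 * (\<Sum>i\<in>{j..<J}. a (Suc (b + 2 * i))) \<le> exp 12 * (exp (- 12) / 3)"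
   by (intro mult_left_mono) auto
  thus ?thesis by (simp add: \<epsilon>_def sum_distrib_left[symmetric] exp_minus)
 qed
 have prod\<epsilon>: "(\<Prod>i\<in>{j..<J}. 1 + \<epsilon> i) \<le> 3 / 2" "0 \<le> (\<Prod>i\<in>{j..<J}. 1 + \<epsilon> i)" for j J
 proof -
  have "(\<Prod>i\<in>{j..<J}. 1 + \<epsilon> i) \<le> (\<Prod>i\<in>{j..<J}. exp (\<epsilon> i))"
   by (intro prod_mono conjI) (use \<epsilon>0 in \<open>auto intro: add_nonneg_nonneg\<close>)
  also have "... = exp (\<Sum>i\<in>{j..<J}. \<epsilon> i)" by (simp add: exp_sum)
  also have "... \<le> exp (1 / 3)" using \<epsilon>sum by simp
  finally show "(\<Prod>i\<in>{j..<J}. 1 + \<epsilon> i) \<le> 3 / 2" using exp_third_le by linarith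
  show "0 \<le> (\<Prod>i\<in>{j..<J}. 1 + \<epsilon> i)" using \<epsilon>0 by (intro prod_nonneg) (auto intro: add_nonneg_nonneg)
 qed
 have "\<exists>U L. sieve_weights sieve_densities (primes_below z) (z ^ (2 * b + 6)) (3 / 2) U L"
  if z: "z \<ge> 2" for z
 proof -
  define y where "y j = z powr ((1 / 2) ^ j)" for j :: nat
  have y1: "y j > 1" for j unfolding y_def using z by (intro gr_one_powr) auto
  have ysq: "(y (Suc j))\<^sup>2 = y j" for j
   unfolding y_def using z by (simp add: powr_powr flip: powr_numeral)
  have "ln z > 0" using z by simp
  \<comment> \<open>After J halvings of the exponent the bound falls below 2, where there are no
    primes and the empty sieve starts the induction.\<close>
  obtain J where "(1 / 2 :: real) ^ J < ln 2 / ln z"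
   using real_arch_pow_inv[of "ln 2 / ln z" "1 / 2"] \<open>ln z > 0\<close> by auto
  hence "(1 / 2) ^ J * ln z < ln 2" using \<open>ln z > 0\<close> by (simp add: field_simps)
  hence "exp ((1 / 2) ^ J * ln z) < exp (ln 2)" by (simp only: exp_less_cancel_iff)
  hence yJ: "y J < 2" using z by (simp add: y_def powr_def)
  have emp: "primes_below (y J) = {}"
  proof -
   have False if p: "p \<in> primes_below (y J)" for p
   proof -
    have "real p < 2" using p yJ by (simp add: primes_below_def)
    moreover have "p \<ge> 2" using primes_below_ge2[OF p] .
    ultimately show False by linarith
   qed
   thus ?thesis by blast
  qed
  have "\<exists>U L. sieve_weights sieve_densities (primes_below (y j))
    (\<Prod>i\<in>{j..<J}. y i ^ Suc (b + 2 * i)) (\<Prod>i\<in>{j..<J}. 1 + \<epsilon> i) U L" if "j \<le> J" for j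
   using that
  proof (induction j rule: inc_induct)
   case base
   show ?case using sieve_weights_empty[of sieve_densities] by (auto simp: emp)
  next
   case (step j)
   define Bl where "Bl = primes_below (y j) - primes_below (y (Suc j))"
   have "y (Suc j) * 1 \<le> y (Suc j) * y (Suc j)" using y1[of "Suc j"] by (intro mult_left_mono) auto
   hence "y (Suc j) \<le> y j" using ysq[of j] by (simp add: power2_eq_square)
   hence un: "primes_below (y (Suc j)) \<union> Bl = primes_below (y j)"
    by (auto simp: Bl_def primes_below_def)
   have Bl: "finite Bl" "primes_below (y (Suc j)) \<inter> Bl = {}" "\<And>p. p \<in> Bl ==> prime p"
    using finite_primes_below by (auto simp: Bl_def primes_below_def)
   obtain U L where UL: "sieve_weights sieve_densities (primes_below (y (Suc j)))
     (\<Prod>i\<in>{Suc j..<J}. y i ^ Suc (b + 2 * i)) (\<Prod>i\<in>{Suc j..<J}. 1 + \<epsilon> i) U L"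
    using step.IH by blast
   have sumBl: "(\<Sum>p\<in>Bl. 1 / real p) \<le> 4"
    using sum_inverse_primes_block_le[OF y1[of "Suc j"]] unfolding ysq Bl_def .
   have "\<exists>U L. sieve_weights sieve_densities (primes_below (y (Suc j)) \<union> Bl)
     ((\<Prod>i\<in>{Suc j..<J}. y i ^ Suc (b + 2 * i)) * y j ^ Suc (b + 2 * j))
     ((\<Prod>i\<in>{Suc j..<J}. 1 + \<epsilon> i) * (1 + \<epsilon> j)) U L"
   proof (rule sieve_weights_step[OF UL Bl(1,2)])
    show "even (b + 2 * j)" by (simp add: b_def)
    show "1 \<le> p \<and> real p \<le> y j" if "p \<in> Bl" for p
     using that primes_below_ge2[of p "y j"] by (auto simp: Bl_def primes_below_def)
    show "y j \<ge> 1" using y1[of j] by simp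
    show "(\<Prod>i\<in>{Suc j..<J}. y i ^ Suc (b + 2 * i)) \<ge> 1"
     using y1 less_imp_le by (intro prod_ge_1 one_le_power) blast
    show "0 \<le> g p \<and> g p \<le> 1" if "g \<in> sieve_densities" "p \<in> primes_below (y (Suc j)) \<union> Bl" for g p
     using that sieve_densities_one_minus[of g p] unfolding un by (auto simp: primes_below_def)
    show "weight_sum (layer (Suc (b + 2 * j))) g Bl \<le> \<epsilon> j * (\<Prod>p\<in>Bl. 1 - g p)"
     if g: "g \<in> sieve_densities" for g
    proof -
     have gB: "0 \<le> g p" "g p \<le> 2 * (1 / real p)" if "p \<in> Bl" for p
      using sieve_densities_one_minus[OF g Bl(3)[OF that]] by auto
     have "sum g Bl \<le> (\<Sum>p\<in>Bl. 2 * (1 / real p))" by (rule sum_mono) (rule gB)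
     also have "... = 2 * (\<Sum>p\<in>Bl. 1 / real p)" by (rule sum_distrib_left[symmetric])
     finally have s8: "sum g Bl \<le> 8" using sumBl by linarith
     have "weight_sum (layer (Suc (b + 2 * j))) g Bl \<le> sum g Bl ^ Suc (b + 2 * j) / fact (Suc (b + 2 * j))"
      by (rule weight_sum_layer_le[OF Bl(1) gB(1)])
     also have "... \<le> a (Suc (b + 2 * j))"
      unfolding a_def using s8 gB by (intro divide_right_mono power_mono sum_nonneg) auto
     finally have 1: "weight_sum (layer (Suc (b + 2 * j))) g Bl \<le> a (Suc (b + 2 * j))" .
     have "exp (- 12) \<le> exp (- 2 * (\<Sum>p\<in>Bl. 1 / real p) - 4)" using sumBl by simp
     also have "... \<le> (\<Prod>p\<in>Bl. 1 - g p)" by (rule prod_one_minus_density_ge[OF g Bl(1,3)])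
     finally have "\<epsilon> j * exp (- 12) \<le> \<epsilon> j * (\<Prod>p\<in>Bl. 1 - g p)" using \<epsilon>0 by (intro mult_left_mono) auto
     moreover have "\<epsilon> j * exp (- 12) = a (Suc (b + 2 * j))" by (simp add: \<epsilon>_def exp_minus)
     ultimately show ?thesis using 1 by linarith
    qed
    show "0 \<le> (\<Prod>i\<in>{Suc j..<J}. 1 + \<epsilon> i)" "0 \<le> \<epsilon> j" using prod\<epsilon> \<epsilon>0 by auto
    show "(\<Prod>i\<in>{Suc j..<J}. 1 + \<epsilon> i) \<le> 2" using prod\<epsilon>(1)[of "Suc j" J] by simp
   qed
   note ex = this
   have pe: "(\<Prod>i\<in>{Suc j..<J}. f i) * f j = (\<Prod>i\<in>{j..<J}. f i)" for f :: "nat => real"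
    using step.hyps by (simp add: prod.atLeast_Suc_lessThan mult.commute)
   show ?case
    using ex unfolding un pe[of "\<lambda>i. y i ^ Suc (b + 2 * i)"] pe[of "\<lambda>i. 1 + \<epsilon> i"] .
  qed
  from this[of 0] obtain U L where UL: "sieve_weights sieve_densities (primes_below z)
    (\<Prod>i\<in>{0..<J}. y i ^ Suc (b + 2 * i)) (\<Prod>i\<in>{0..<J}. 1 + \<epsilon> i) U L"
   using z by (auto simp: y_def)
  \<comment> \<open>The limit 2 c + 4 at c = b + 1 is the level exponent 2 b + 6.\<close>
  have sum: "(\<Sum>i\<in>{0..<J}. (c + 2 * real i) * (1 / 2) ^ i) = 2 * c + 4 - (2 * c + 4 + 4 * real J) * (1 / 2) ^ J" for c
   by (induction J) (simp_all add: algebra_simps)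
  have "(\<Prod>i\<in>{0..<J}. y i ^ Suc (b + 2 * i)) = (\<Prod>i\<in>{0..<J}. z powr ((real (Suc b) + 2 * real i) * (1 / 2) ^ i))"
  proof (rule prod.cong[OF refl])
   fix i
   have "y i ^ Suc (b + 2 * i) = (z powr ((1 / 2) ^ i)) powr real (Suc (b + 2 * i))"
    unfolding y_def using z by (subst powr_realpow) auto
   thus "y i ^ Suc (b + 2 * i) = z powr ((real (Suc b) + 2 * real i) * (1 / 2) ^ i)"
    by (simp add: powr_powr mult.commute add.assoc)
  qed
  also have "... = z powr (\<Sum>i\<in>{0..<J}. (real (Suc b) + 2 * real i) * (1 / 2) ^ i)"
   using z by (subst powr_sum) auto
  also have "... \<le> z powr real (2 * b + 6)"
   unfolding sum using z by (intro powr_mono) auto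
  also have "... = z ^ (2 * b + 6)" using z by (subst powr_realpow) auto
  finally have Zle: "(\<Prod>i\<in>{0..<J}. y i ^ Suc (b + 2 * i)) \<le> z ^ (2 * b + 6)" .
  have "0 \<le> (\<Prod>p\<in>primes_below z. 1 - g p)" if "g \<in> sieve_densities" for g
   using sieve_densities_one_minus(4)[OF that] by (intro prod_nonneg) (auto simp: primes_below_def)
  from sieve_weights_mono[OF UL Zle prod\<epsilon>(1) this] show ?thesis by blast
 qed
 thus ?thesis using that by blast
qed

section \<open>Counting values of binary quadratic forms\<close>

definition qf :: "int => int => int => int => int => int" where
 "qf a b c u v = a * u\<^sup>2 + b * u * v + c * v\<^sup>2"

definition form_disc :: "nat => int => int => int => bool" where
 "form_disc D a b c \<longleftrightarrow> a > 0 \<and> 4 * a * c - b\<^sup>2 = int D"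

definition reduced_form :: "nat => int => int => int => bool" where
 "reduced_form D a b c \<longleftrightarrow> form_disc D a b c \<and> \<bar>b\<bar> \<le> a \<and> a \<le> c"

lemma four_a_qf: "4 * a * qf a b c u v = (2 * a * u + b * v)\<^sup>2 + (4 * a * c - b\<^sup>2) * v\<^sup>2"
 by (simp add: qf_def power2_eq_square algebra_simps)

lemma qf_nonneg:
 assumes "form_disc D a b c"
 shows "0 \<le> qf a b c u v"
proof -
 have "0 \<le> 4 * a * qf a b c u v"
  unfolding four_a_qf using assms by (simp add: form_disc_def)
 thus ?thesis using assms by (simp add: form_disc_def zero_le_mult_iff)
qed

text \<open>Gauss reduction: a translation of u brings b into [- a, a], and if then c < a,
  exchanging the variables lowers the leading coefficient. The substitution is kept because points,
  not only values, have to be transported. Reducedness bounds a by D and so makes the lattice count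
  uniform in the form.\<close>

lemma reduction:
 assumes "form_disc D a b c" "D > 0"
 shows "\<exists>a' b' c' \<alpha> \<beta> \<gamma> \<delta>. reduced_form D a' b' c' \<and> \<alpha> * \<delta> - \<beta> * \<gamma> = 1 \<and>
  (\<forall>u v. qf a b c u v = qf a' b' c' (\<alpha> * u + \<beta> * v) (\<gamma> * u + \<delta> * v))"
 using assms(1)
proof (induction "nat a" arbitrary: a b c rule: less_induct)
 case less
 have a: "a > 0" and disc: "4 * a * c - b\<^sup>2 = int D" using less.prems by (auto simp: form_disc_def)
 \<comment> \<open>The integer nearest to b / (2 a).\<close>
 define k where "k = (b + a) div (2 * a)"
 define b' where "b' = b - 2 * a * k"
 define c' where "c' = c - a * k\<^sup>2 - b' * k"
 have "b' = (b + a) mod (2 * a) - a"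
  unfolding b'_def k_def using div_mult_mod_eq[of "b + a" "2 * a"] by (simp add: algebra_simps)
 moreover have "0 \<le> (b + a) mod (2 * a)" "(b + a) mod (2 * a) < 2 * a" using a by simp_all
 ultimately have b': "\<bar>b'\<bar> \<le> a" by linarith
 have eq: "qf a b c u v = qf a b' c' (u + k * v) v" for u v
  by (simp add: qf_def b'_def c'_def power2_eq_square algebra_simps)
 have disc': "4 * a * c' - b'\<^sup>2 = int D"
  unfolding disc[symmetric] by (simp add: b'_def c'_def power2_eq_square algebra_simps)
 show ?case
 proof (cases "a \<le> c'")
  case True
  have "reduced_form D a b' c'" using True b' a disc' by (simp add: reduced_form_def form_disc_def)
  moreover have "(1 :: int) * 1 - k * 0 = 1" by simp
  moreover have "\<forall>u v. qf a b c u v = qf a b' c' (1 * u + k * v) (0 * u + 1 * v)" using eq by simp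
  ultimately show ?thesis by blast
 next
  case False
  have "0 < 4 * a * c'" using disc' assms(2) by (metis add_pos_nonneg diff_add_cancel of_nat_0_less_iff zero_le_power2)
  hence c': "c' > 0" using a by (simp add: zero_less_mult_iff)
  have "form_disc D c' (- b') a" using c' disc' by (simp add: form_disc_def mult_ac)
  from less.hyps[OF _ this] obtain A B C \<alpha> \<beta> \<gamma> \<delta> where red: "reduced_form D A B C" "\<alpha> * \<delta> - \<beta> * \<gamma> = 1"
   "\<And>u v. qf c' (- b') a u v = qf A B C (\<alpha> * u + \<beta> * v) (\<gamma> * u + \<delta> * v)"
   using False a c' by auto
  have "qf a b c u v = qf A B C ((- \<beta>) * u + (\<alpha> - \<beta> * k) * v) ((- \<delta>) * u + (\<gamma> - \<delta> * k) * v)" for u v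
  proof -
   have "qf a b c u v = qf c' (- b') a v (- (u + k * v))"
    unfolding eq by (simp add: qf_def power2_eq_square algebra_simps)
   also have "... = qf A B C ((- \<beta>) * u + (\<alpha> - \<beta> * k) * v) ((- \<delta>) * u + (\<gamma> - \<delta> * k) * v)"
    unfolding red(3) by (rule arg_cong2[of _ _ _ _ "qf A B C"]) (simp_all add: algebra_simps)
   finally show ?thesis .
  qed
  moreover have "(- \<beta>) * (\<gamma> - \<delta> * k) - (\<alpha> - \<beta> * k) * (- \<delta>) = 1"
   using red(2) by (simp add: algebra_simps)
  ultimately show ?thesis using red(1) by blast
 qed
qed

section \<open>Lattice points in an ellipse\<close>

lemma card_congruent_interval:
 fixes \<alpha> \<beta> :: real and r :: int
 assumes d: "d \<ge> 1" and le: "\<alpha> \<le> \<beta>"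
 defines "S \<equiv> {u::int. int d dvd u - r \<and> \<alpha> \<le> real_of_int u \<and> real_of_int u \<le> \<beta>}"
 shows "finite S" "\<bar>real (card S) - (\<beta> - \<alpha>) / real d\<bar> \<le> 1"
proof -
 define A where "A = (\<alpha> - real_of_int r) / real d"
 define B where "B = (\<beta> - real_of_int r) / real d"
 have d0: "real d > 0" using d by simp
 have AB: "A \<le> B" "B - A = (\<beta> - \<alpha>) / real d"
  unfolding A_def B_def using le d0 by (simp_all add: divide_right_mono diff_divide_distrib)
 have S: "S = (\<lambda>k. r + int d * k) ` {\<lceil>A\<rceil>..\<lfloor>B\<rfloor>}"
 proof (intro equalityI subsetI)
  fix u assume "u \<in> S"
  hence u: "int d dvd u - r" "\<alpha> \<le> real_of_int u" "real_of_int u \<le> \<beta>" by (auto simp: S_def)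
  then obtain k where "u - r = int d * k" by blast
  hence k: "u = r + int d * k" "\<alpha> \<le> real_of_int u" "real_of_int u \<le> \<beta>" using u by auto
  have "A \<le> real_of_int k" "real_of_int k \<le> B"
   unfolding A_def B_def using k d0 by (simp_all add: field_simps)
  thus "u \<in> (\<lambda>k. r + int d * k) ` {\<lceil>A\<rceil>..\<lfloor>B\<rfloor>}"
   using k(1) by (auto simp: ceiling_le_iff le_floor_iff)
 next
  fix u assume "u \<in> (\<lambda>k. r + int d * k) ` {\<lceil>A\<rceil>..\<lfloor>B\<rfloor>}"
  then obtain k where "u = r + int d * k" "k \<in> {\<lceil>A\<rceil>..\<lfloor>B\<rfloor>}" by blast
  hence k: "u = r + int d * k" "A \<le> real_of_int k" "real_of_int k \<le> B"
   by (auto simp: ceiling_le_iff le_floor_iff)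
  thus "u \<in> S" unfolding S_def A_def B_def using d0 by (simp add: field_simps)
 qed
 show "finite S" unfolding S by simp
 have "inj_on (\<lambda>k. r + int d * k) {\<lceil>A\<rceil>..\<lfloor>B\<rfloor>}" using d by (auto simp: inj_on_def)
 hence "card S = nat (\<lfloor>B\<rfloor> - \<lceil>A\<rceil> + 1)" unfolding S by (simp add: card_image)
 moreover have "real_of_int (\<lfloor>B\<rfloor> - \<lceil>A\<rceil> + 1) > B - A - 1" by linarith
 moreover have "real_of_int (\<lfloor>B\<rfloor> - \<lceil>A\<rceil> + 1) \<le> B - A + 1" by linarith
 ultimately show "\<bar>real (card S) - (\<beta> - \<alpha>) / real d\<bar> \<le> 1"
  unfolding AB(2)[symmetric] using AB(1) by (cases "\<lfloor>B\<rfloor> - \<lceil>A\<rceil> + 1 \<ge> 0") auto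
qed

definition semicircle :: "real => real" where
 "semicircle t = sqrt (max 0 (1 - t\<^sup>2))"

text \<open>The number pi / 4, so that \<open>8 * quarter_area / sqrt D * y\<close> is the area of
  the ellipse on which a form of discriminant -D is at most y.\<close>

definition quarter_area :: real where
 "quarter_area = integral {0..1} semicircle"

lemma semicircle_antimono: "0 \<le> s ==> s \<le> t ==> semicircle t \<le> semicircle s"
 unfolding semicircle_def by (intro real_sqrt_le_mono max.mono) (auto intro: power_mono)

lemma semicircle_bounds: "0 \<le> semicircle t" "semicircle t \<le> 1"
 by (auto simp: semicircle_def)

lemma semicircle_0: "t \<ge> 1 ==> semicircle t = 0"
proof -
 assume "t \<ge> 1"
 hence "1 \<le> t\<^sup>2" by (rule one_le_power)
 hence "max 0 (1 - t\<^sup>2) = 0" by (intro max_absorb1) linarith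
 thus ?thesis by (simp add: semicircle_def)
qed

lemma semicircle_integrable: "semicircle integrable_on {a..b}"
 unfolding semicircle_def by (intro integrable_continuous_interval continuous_intros)

lemma semicircle_integral_bounds:
 assumes "0 \<le> s" "s \<le> t"
 shows "(t - s) * semicircle t \<le> integral {s..t} semicircle"
  and "integral {s..t} semicircle \<le> (t - s) * semicircle s"
proof -
 have "integral {s..t} (\<lambda>_. semicircle t) \<le> integral {s..t} semicircle"
  by (rule integral_le) (use assms semicircle_antimono in \<open>auto simp: semicircle_integrable\<close>)
 thus "(t - s) * semicircle t \<le> integral {s..t} semicircle" using assms by simp
 have "integral {s..t} semicircle \<le> integral {s..t} (\<lambda>_. semicircle s)"
  by (rule integral_le) (use assms semicircle_antimono in \<open>auto simp: semicircle_integrable\<close>)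
 thus "integral {s..t} semicircle \<le> (t - s) * semicircle s" using assms by simp
qed

lemma quarter_area_pos: "quarter_area > 0"
proof -
 have "integral {0..1/2} semicircle + integral {1/2..1} semicircle = quarter_area"
  unfolding quarter_area_def
  by (rule Henstock_Kurzweil_Integration.integral_combine) (auto simp: semicircle_integrable)
 moreover have "semicircle (1/2) / 2 \<le> integral {0..1/2} semicircle"
  using semicircle_integral_bounds(1)[of 0 "1/2"] by simp
 moreover have "semicircle 1 / 2 \<le> integral {1/2..1} semicircle"
  using semicircle_integral_bounds(1)[of "1/2" 1] by simp
 moreover have "semicircle (1/2) > 0" by (simp add: semicircle_def power2_eq_square)
 ultimately show ?thesis using semicircle_bounds(1)[of 1] by linarith
qed

text \<open>A decreasing function against its Riemann sum of mesh d / R: the error is at most one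
  term, and no term exceeds 1, whatever d and R are.\<close>

lemma semicircle_progression:
 fixes s R d :: real
 assumes d: "d > 0" and R: "R > 0" and s: "0 \<le> s" "s \<le> d" and n: "s + real n * d \<ge> R"
 shows "\<bar>(\<Sum>k<n. semicircle ((s + real k * d) / R)) - quarter_area * R / d\<bar> \<le> 1"
proof -
 define t where "t k = (s + real k * d) / R" for k :: nat
 define \<delta> where "\<delta> = d / R"
 have \<delta>: "\<delta> > 0" using d R by (simp add: \<delta>_def)
 have t: "t (Suc k) - t k = \<delta>" "0 \<le> t k" "t k \<le> t (Suc k)" for k
  using d R s by (simp_all add: t_def \<delta>_def field_simps)
 have t0: "t 0 \<le> \<delta>" using s R by (simp add: t_def \<delta>_def divide_right_mono)
 have tn: "t n \<ge> 1" using n R by (simp add: t_def)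
 have tmono: "t 0 \<le> t k" for k using d R by (simp add: t_def divide_right_mono)
 define S where "S = (\<Sum>k<n. semicircle (t k))"
 have comb: "integral {t 0..t k} semicircle = (\<Sum>j<k. integral {t j..t (Suc j)} semicircle)" for k
 proof (induction k)
  case (Suc k)
  have "integral {t 0..t k} semicircle + integral {t k..t (Suc k)} semicircle = integral {t 0..t (Suc k)} semicircle"
   by (rule Henstock_Kurzweil_Integration.integral_combine) (use t tmono in \<open>auto simp: semicircle_integrable\<close>)
  thus ?case using Suc by simp
 qed simp
 have up: "integral {t 0..t n} semicircle \<le> \<delta> * S"
  unfolding comb S_def sum_distrib_left
 proof (rule sum_mono)
  fix k show "integral {t k..t (Suc k)} semicircle \<le> \<delta> * semicircle (t k)"
   using semicircle_integral_bounds(2)[OF t(2,3), of k] t(1) by simp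
 qed
 have lo: "\<delta> * (\<Sum>k<n. semicircle (t (Suc k))) \<le> integral {t 0..t n} semicircle"
  unfolding comb sum_distrib_left
 proof (rule sum_mono)
  fix k show "\<delta> * semicircle (t (Suc k)) \<le> integral {t k..t (Suc k)} semicircle"
   using semicircle_integral_bounds(1)[OF t(2,3), of k] t(1) by simp
 qed
 have "(\<Sum>k<n. semicircle (t (Suc k))) + semicircle (t 0) = S + semicircle (t n)"
  unfolding S_def by (induction n) simp_all
 hence S: "(\<Sum>k<n. semicircle (t (Suc k))) = S - semicircle (t 0)" using semicircle_0[OF tn] by simp
 have "integral {0..1} semicircle + integral {1..t n} semicircle = integral {0..t n} semicircle"
  by (rule Henstock_Kurzweil_Integration.integral_combine) (use tn in \<open>auto simp: semicircle_integrable\<close>)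
 moreover have "integral {1..t n} semicircle = 0"
  using semicircle_integral_bounds[of 1 "t n"] tn semicircle_0[of 1] semicircle_0[OF tn] by simp
 moreover have "integral {0..t 0} semicircle + integral {t 0..t n} semicircle = integral {0..t n} semicircle"
  by (rule Henstock_Kurzweil_Integration.integral_combine) (use t tmono in \<open>auto simp: semicircle_integrable\<close>)
 ultimately have q: "quarter_area = integral {0..t 0} semicircle + integral {t 0..t n} semicircle"
  by (simp add: quarter_area_def)
 have "integral {0..t 0} semicircle \<le> t 0 * semicircle 0" using semicircle_integral_bounds(2)[of 0 "t 0"] t by simp
 also have "... \<le> \<delta> * 1" using t0 t \<delta> semicircle_bounds by (intro mult_mono) auto
 finally have q1: "integral {0..t 0} semicircle \<le> \<delta>" by simp
 have q0: "0 \<le> integral {0..t 0} semicircle"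
  using semicircle_integral_bounds(1)[of 0 "t 0"] t semicircle_bounds(1)[of "t 0"]
  by (meson mult_nonneg_nonneg order_trans diff_ge_0_iff_ge order_refl)
 have "\<delta> * semicircle (t 0) \<le> \<delta> * 1" using \<delta> semicircle_bounds by (intro mult_left_mono) auto
 hence "\<delta> * S - \<delta> \<le> quarter_area" using lo q q0 unfolding S by (simp add: right_diff_distrib)
 moreover have "quarter_area \<le> \<delta> * S + \<delta>" using up q q1 by simp
 ultimately have "\<bar>\<delta> * S - quarter_area\<bar> \<le> \<delta>" by linarith
 hence "\<bar>\<delta> * S - quarter_area\<bar> / \<delta> \<le> 1" using \<delta> by simp
 moreover have "\<bar>\<delta> * S - quarter_area\<bar> / \<delta> = \<bar>(\<delta> * S - quarter_area) / \<delta>\<bar>" using \<delta> by (simp add: abs_divide)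
 moreover have "(\<delta> * S - quarter_area) / \<delta> = S - quarter_area * R / d"
  using \<delta> d R by (simp add: \<delta>_def field_simps)
 ultimately show ?thesis unfolding S_def t_def by simp
qed

lemma semicircle_residue_sum:
 fixes R :: real and r :: int
 assumes d: "d \<ge> 1" and R: "R > 0"
 shows "\<bar>(\<Sum>v | int d dvd v - r \<and> - R \<le> real_of_int v \<and> real_of_int v \<le> R. semicircle (real_of_int v / R))
  - 2 * quarter_area * R / real d\<bar> \<le> 2"
proof -
 define e where "e = r mod int d"
 have e: "0 \<le> e" "e < int d" using d by (simp_all add: e_def)
 define n where "n = nat \<lceil>R\<rceil>"
 have n: "real n \<ge> R" unfolding n_def by linarith
 define V where "V = {v. int d dvd v - r \<and> - R \<le> real_of_int v \<and> real_of_int v \<le> R}"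
 define pos where "pos k = e + int k * int d" for k :: nat
 define neg where "neg k = - (int d - e + int k * int d)" for k :: nat
 have inj: "inj_on pos {..<n}" "inj_on neg {..<n}" using d by (auto simp: inj_on_def pos_def neg_def)
 have disj: "pos ` {..<n} \<inter> neg ` {..<n} = {}"
 proof -
  have "pos j ~= neg k" for j k
  proof -
   have "0 \<le> int j * int d" "0 \<le> int k * int d" by simp_all
   thus ?thesis unfolding pos_def neg_def using e by linarith
  qed
  thus ?thesis by blast
 qed
 have kn: "k < n" if "real k < R" for k using that n by linarith
 \<comment> \<open>Integers with |v| = R may fall outside both ranges, but \<open>semicircle\<close>
   vanishes there.\<close>
 have sub: "V \<subseteq> pos ` {..<n} \<union> neg ` {..<n} \<union> {v. \<bar>real_of_int v\<bar> = R}"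
 proof
  fix v assume v: "v \<in> V"
  hence "int d dvd v - e" unfolding V_def e_def by (auto simp: mod_eq_dvd_iff[symmetric])
  then obtain k where k: "v = e + int d * k" by (auto simp: dvd_def algebra_simps)
  have vR: "\<bar>real_of_int v\<bar> \<le> R" using v by (auto simp: V_def)
  show "v \<in> pos ` {..<n} \<union> neg ` {..<n} \<union> {v. \<bar>real_of_int v\<bar> = R}"
  proof (cases "\<bar>real_of_int v\<bar> = R")
   case False
   hence vR: "\<bar>real_of_int v\<bar> < R" using vR by simp
   show ?thesis
   proof (cases "k \<ge> 0")
    case True
    then obtain j where j: "k = int j" using nonneg_int_cases by blast
    have "int j * 1 \<le> int j * int d" using d by (intro mult_left_mono) auto
    hence "int j \<le> v" using k e unfolding j by (simp add: mult.commute)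
    hence "real j \<le> \<bar>real_of_int v\<bar>" by linarith
    hence "j < n" using vR by (intro kn) linarith
    moreover have "v = pos j" using k j by (simp add: pos_def mult.commute)
    ultimately show ?thesis by blast
   next
    case False
    define j where "j = nat (- k - 1)"
    have j: "k = - 1 - int j" using False by (simp add: j_def)
    have "int j * 1 \<le> int j * int d" using d by (intro mult_left_mono) auto
    moreover have "v = neg j" using k unfolding j by (simp add: neg_def algebra_simps)
    ultimately have "int j \<le> - v" using e by (simp add: neg_def)
    hence "real j \<le> \<bar>real_of_int v\<bar>" by linarith
    hence "j < n" using vR by (intro kn) linarith
    thus ?thesis using \<open>v = neg j\<close> by blast
   qed
  qed simp
 qed
 have dv: "int d dvd pos k - r" "int d dvd neg k - r" for k
 proof -
  have "r = e + int d * (r div int d)" by (simp add: e_def)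
  hence "pos k - r = int d * (int k - r div int d)" "neg k - r = int d * (- 1 - int k - r div int d)"
   by (simp_all add: pos_def neg_def algebra_simps)
  thus "int d dvd pos k - r" "int d dvd neg k - r" by simp_all
 qed
 have z1: "semicircle (real_of_int v / R) = 0" if "\<bar>real_of_int v\<bar> \<ge> R" for v :: int
 proof -
  have "1 \<le> \<bar>real_of_int v / R\<bar>" using that R by (simp add: abs_divide)
  hence "1\<^sup>2 \<le> \<bar>real_of_int v / R\<bar>\<^sup>2" by (intro power_mono) auto
  hence "1 \<le> (real_of_int v / R)\<^sup>2" by (simp only: power2_abs one_power2)
  hence "max 0 (1 - (real_of_int v / R)\<^sup>2) = 0" by (intro max_absorb1) linarith
  thus ?thesis by (simp add: semicircle_def)
 qed
 have finV: "finite V"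
  unfolding V_def using card_congruent_interval(1)[OF d, of "-R" R r] R by simp
 have "(\<Sum>v\<in>V. semicircle (real_of_int v / R)) = (\<Sum>v\<in>V \<inter> (pos ` {..<n} \<union> neg ` {..<n}). semicircle (real_of_int v / R))"
  by (rule sum.mono_neutral_right) (use finV sub z1 in auto)
 also have "... = (\<Sum>v\<in>pos ` {..<n} \<union> neg ` {..<n}. semicircle (real_of_int v / R))"
 proof (rule sum.mono_neutral_left)
  show "\<forall>v\<in>pos ` {..<n} \<union> neg ` {..<n} - V \<inter> (pos ` {..<n} \<union> neg ` {..<n}). semicircle (real_of_int v / R) = 0"
  proof
   fix v assume "v \<in> pos ` {..<n} \<union> neg ` {..<n} - V \<inter> (pos ` {..<n} \<union> neg ` {..<n})"
   hence "v \<notin> V" "int d dvd v - r" using dv by auto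
   hence "\<bar>real_of_int v\<bar> \<ge> R" unfolding V_def by auto
   thus "semicircle (real_of_int v / R) = 0" by (rule z1)
  qed
 qed auto
 also have "... = (\<Sum>k<n. semicircle (real_of_int (pos k) / R)) + (\<Sum>k<n. semicircle (real_of_int (neg k) / R))"
  using disj by (subst sum.union_disjoint) (auto simp: sum.reindex[OF inj(1)] sum.reindex[OF inj(2)])
 also have "(\<Sum>k<n. semicircle (real_of_int (pos k) / R)) =
   (\<Sum>k<n. semicircle ((real_of_int e + real k * real d) / R))"
  by (simp add: pos_def)
 also have "(\<Sum>k<n. semicircle (real_of_int (neg k) / R)) =
   (\<Sum>k<n. semicircle ((real d - real_of_int e + real k * real d) / R))"
 proof (rule sum.cong[OF refl])
  fix k
  have "real_of_int (neg k) / R = - ((real d - real_of_int e + real k * real d) / R)"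
   by (simp add: neg_def minus_divide_left)
  thus "semicircle (real_of_int (neg k) / R) = semicircle ((real d - real_of_int e + real k * real d) / R)"
   by (simp add: semicircle_def)
 qed
 finally have eq: "(\<Sum>v\<in>V. semicircle (real_of_int v / R)) =
   (\<Sum>k<n. semicircle ((real_of_int e + real k * real d) / R)) +
   (\<Sum>k<n. semicircle ((real d - real_of_int e + real k * real d) / R))" .
 have nd: "real n * 1 \<le> real n * real d" using d by (intro mult_left_mono) auto
 have er: "0 \<le> real_of_int e" "real_of_int e \<le> real d" using e by auto
 have 1: "\<bar>(\<Sum>k<n. semicircle ((real_of_int e + real k * real d) / R)) - quarter_area * R / real d\<bar> \<le> 1"
 proof (rule semicircle_progression)
  show "R \<le> real_of_int e + real n * real d" using n nd er by linarith
 qed (use d R er in auto)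
 have 2: "\<bar>(\<Sum>k<n. semicircle ((real d - real_of_int e + real k * real d) / R)) - quarter_area * R / real d\<bar> \<le> 1"
 proof (rule semicircle_progression)
  show "R \<le> real d - real_of_int e + real n * real d" using n nd er by linarith
 qed (use d R er in auto)
 have add2: "\<bar>(p + q) - (r + r)\<bar> \<le> 2" if "\<bar>p - r\<bar> \<le> 1" "\<bar>q - r\<bar> \<le> 1" for p q r :: real
  using that by linarith
 have dbl: "2 * quarter_area * R / real d = quarter_area * R / real d + quarter_area * R / real d" by simp
 have "\<bar>(\<Sum>v\<in>V. semicircle (real_of_int v / R)) - 2 * quarter_area * R / real d\<bar> \<le> 2"
  unfolding eq dbl by (rule add2[OF 1 2])
 thus ?thesis unfolding V_def .
qed

lemma reduced_form_bounds:
 assumes "reduced_form D a b c" "D > 0"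
 shows "3 * a\<^sup>2 \<le> int D" "a \<ge> 1" "a \<le> int D"
proof -
 have r: "a > 0" "4 * a * c - b\<^sup>2 = int D" "\<bar>b\<bar> \<le> a" "a \<le> c"
  using assms by (auto simp: reduced_form_def form_disc_def)
 show "a \<ge> 1" using r by simp
 have "b\<^sup>2 \<le> a\<^sup>2" using r(1,3) abs_le_square_iff[of b a] by simp
 moreover have "a * a \<le> a * c" using r by (intro mult_left_mono) auto
 ultimately show 3: "3 * a\<^sup>2 \<le> int D" using r(2) unfolding power2_eq_square by linarith
 have "a * 1 \<le> a * a" using r by (intro mult_left_mono) auto
 thus "a \<le> int D" using 3 unfolding power2_eq_square using r(1) by linarith
qed

text \<open>Slices of constant v are intervals, each counted with error at most 1, and their lengths
  add up to a sampled semicircle. The bounds 1 \<le> a \<le> D of a reduced form keep both the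
  number of slices and the longest slice of order sqrt y, independently of the form and of
  D.\<close>

lemma ellipse_count:
 fixes y :: real and r s :: int
 assumes red: "reduced_form D a b c" and D: "D > 0" and d: "d \<ge> 1" and y: "y \<ge> 1"
 defines "S \<equiv> {(u, v). int d dvd u - r \<and> int d dvd v - s \<and> real_of_int (qf a b c u v) \<le> y}"
 shows "finite S" "\<bar>real (card S) - 8 * quarter_area / sqrt (real D) * y / (real d)\<^sup>2\<bar> \<le> 9 * sqrt y"
proof -
 define A where "A = real_of_int a"
 define Dr where "Dr = real D"
 have disc: "4 * a * c - b\<^sup>2 = int D" using red by (simp add: reduced_form_def form_disc_def)
 have A: "A \<ge> 1" "3 * A\<^sup>2 \<le> Dr"
 proof -
  show "A \<ge> 1" using reduced_form_bounds(2)[OF red D] by (simp add: A_def)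
  have "real_of_int (3 * a\<^sup>2) \<le> real_of_int (int D)" using reduced_form_bounds(1)[OF red D] by (simp only: of_int_le_iff)
  thus "3 * A\<^sup>2 \<le> Dr" by (simp add: A_def Dr_def)
 qed
 have Dr: "Dr > 0" using D by (simp add: Dr_def)
 \<comment> \<open>The largest |v| on the ellipse.\<close>
 define R where "R = sqrt (4 * A * y / Dr)"
 have R: "R > 0" unfolding R_def using A y Dr by simp
 have R2: "R\<^sup>2 = 4 * A * y / Dr" unfolding R_def using A y Dr by simp
 define V where "V = {v. int d dvd v - s \<and> - R \<le> real_of_int v \<and> real_of_int v \<le> R}"
 have V: "finite V" "\<bar>real (card V) - (R - - R) / real d\<bar> \<le> 1"
  unfolding V_def using card_congruent_interval[OF d, of "- R" R s] R by simp_all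
 define w where "w v = sqrt (4 * A * y - Dr * (real_of_int v)\<^sup>2)" for v
 have inV: "4 * A * y - Dr * (real_of_int v)\<^sup>2 \<ge> 0 \<longleftrightarrow> - R \<le> real_of_int v \<and> real_of_int v \<le> R" for v
 proof -
  have "4 * A * y - Dr * (real_of_int v)\<^sup>2 \<ge> 0 \<longleftrightarrow> (real_of_int v)\<^sup>2 \<le> R\<^sup>2"
   unfolding R2 using Dr by (simp add: field_simps)
  also have "... \<longleftrightarrow> \<bar>real_of_int v\<bar> \<le> R" using abs_le_square_iff[of "real_of_int v" R] R by simp
  also have "... \<longleftrightarrow> - R \<le> real_of_int v \<and> real_of_int v \<le> R" by (auto simp: abs_le_iff)
  finally show ?thesis .
 qed
 define U where "U v = {u. int d dvd u - r \<and> (- real_of_int b * real_of_int v - w v) / (2 * A) \<le> real_of_int u \<and>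
   real_of_int u \<le> (- real_of_int b * real_of_int v + w v) / (2 * A)}" for v
 have le: "real_of_int (qf a b c u v) \<le> y \<longleftrightarrow>
   (2 * A * real_of_int u + real_of_int b * real_of_int v)\<^sup>2 \<le> 4 * A * y - Dr * (real_of_int v)\<^sup>2" for u v
 proof -
  have "real_of_int (4 * a * qf a b c u v) = real_of_int ((2 * a * u + b * v)\<^sup>2 + int D * v\<^sup>2)"
   unfolding four_a_qf disc ..
  hence "4 * A * real_of_int (qf a b c u v) = (2 * A * real_of_int u + real_of_int b * real_of_int v)\<^sup>2 + Dr * (real_of_int v)\<^sup>2"
   by (simp add: A_def Dr_def)
  moreover have "real_of_int (qf a b c u v) \<le> y \<longleftrightarrow> 4 * A * real_of_int (qf a b c u v) \<le> 4 * A * y" using A by simp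
  ultimately show ?thesis by linarith
 qed
 have Smem: "(u, v) \<in> S \<longleftrightarrow> v \<in> V \<and> u \<in> U v" for u v
 proof (cases "4 * A * y - Dr * (real_of_int v)\<^sup>2 \<ge> 0")
  case True
  define X where "X = 2 * A * real_of_int u + real_of_int b * real_of_int v"
  have "X\<^sup>2 \<le> 4 * A * y - Dr * (real_of_int v)\<^sup>2 \<longleftrightarrow> \<bar>X\<bar> \<le> w v"
   unfolding w_def using True by (metis real_sqrt_abs real_sqrt_le_iff)
  also have "... \<longleftrightarrow> (- real_of_int b * real_of_int v - w v) / (2 * A) \<le> real_of_int u \<and>
   real_of_int u \<le> (- real_of_int b * real_of_int v + w v) / (2 * A)"
  proof -
   have "(- real_of_int b * real_of_int v - w v) / (2 * A) \<le> real_of_int u \<longleftrightarrow> - X \<le> w v"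
    "real_of_int u \<le> (- real_of_int b * real_of_int v + w v) / (2 * A) \<longleftrightarrow> X \<le> w v"
    using A unfolding X_def by (auto simp: field_simps)
   thus ?thesis by (auto simp: abs_le_iff)
  qed
  finally show ?thesis using True inV[of v] unfolding S_def U_def V_def X_def le by auto
 next
  case False
  hence "\<not> real_of_int (qf a b c u v) \<le> y" unfolding le
   using zero_le_power2[of "2 * A * real_of_int u + real_of_int b * real_of_int v"] by linarith
  thus ?thesis using False inV[of v] unfolding S_def V_def by auto
 qed
 have w0: "w v \<ge> 0" if "v \<in> V" for v unfolding w_def using that inV[of v] by (auto simp: V_def)
 have Uv: "finite (U v)" "\<bar>real (card (U v)) - w v / (A * real d)\<bar> \<le> 1" if "v \<in> V" for v
 proof -
  have ord: "(- real_of_int b * real_of_int v - w v) / (2 * A) \<le> (- real_of_int b * real_of_int v + w v) / (2 * A)"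
   using w0[OF that] A by (intro divide_right_mono) auto
  have "(- real_of_int b * real_of_int v + w v) / (2 * A) - (- real_of_int b * real_of_int v - w v) / (2 * A) = w v / A"
   using A by (simp add: field_simps)
  thus "finite (U v)" "\<bar>real (card (U v)) - w v / (A * real d)\<bar> \<le> 1"
   using card_congruent_interval[OF d ord, of r] unfolding U_def by simp_all
 qed
 have Seq: "S = (\<lambda>(v, u). (u, v)) ` (SIGMA v:V. U v)" using Smem by force
 have "finite (SIGMA v:V. U v)" using V Uv by auto
 thus "finite S" unfolding Seq by simp
 have "card S = card (SIGMA v:V. U v)"
  unfolding Seq by (rule card_image) (auto simp: inj_on_def)
 also have "... = (\<Sum>v\<in>V. card (U v))" using V Uv by (simp add: card_SigmaI)
 finally have cS: "real (card S) = (\<Sum>v\<in>V. real (card (U v)))" by simp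
 have e1: "\<bar>real (card S) - (\<Sum>v\<in>V. w v / (A * real d))\<bar> \<le> real (card V)"
 proof -
  have "\<bar>\<Sum>v\<in>V. (real (card (U v)) - w v / (A * real d))\<bar> \<le> (\<Sum>v\<in>V. 1)"
   by (rule order_trans[OF sum_abs sum_mono]) (rule Uv)
  thus ?thesis unfolding cS by (simp add: sum_subtractf)
 qed
 have wh: "w v = sqrt (4 * A * y) * semicircle (real_of_int v / R)" if "v \<in> V" for v
 proof -
  have "(real_of_int v / R)\<^sup>2 = Dr * (real_of_int v)\<^sup>2 / (4 * A * y)"
   unfolding power_divide R2 using A y Dr by (simp add: field_simps)
  hence "4 * A * y - Dr * (real_of_int v)\<^sup>2 = 4 * A * y * (1 - (real_of_int v / R)\<^sup>2)"
   using A y by (simp add: field_simps)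
  moreover have "0 \<le> 4 * A * y - Dr * (real_of_int v)\<^sup>2" using that inV[of v] by (auto simp: V_def)
  moreover have "4 * A * y > 0" using A y by simp
  ultimately have "max 0 (1 - (real_of_int v / R)\<^sup>2) = 1 - (real_of_int v / R)\<^sup>2"
   by (simp add: zero_le_mult_iff max_def)
  thus ?thesis unfolding w_def semicircle_def \<open>4 * A * y - Dr * (real_of_int v)\<^sup>2 = 4 * A * y * (1 - (real_of_int v / R)\<^sup>2)\<close>
   by (simp only: real_sqrt_mult)
 qed
 define c0 where "c0 = sqrt (4 * A * y) / (A * real d)"
 have c0: "c0 \<ge> 0" unfolding c0_def using A y by simp
 have "(\<Sum>v\<in>V. w v / (A * real d)) = (\<Sum>v\<in>V. c0 * semicircle (real_of_int v / R))"
  by (intro sum.cong refl) (simp add: wh c0_def)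
 also have "... = c0 * (\<Sum>v\<in>V. semicircle (real_of_int v / R))" by (rule sum_distrib_left[symmetric])
 finally have e2: "(\<Sum>v\<in>V. w v / (A * real d)) = c0 * (\<Sum>v\<in>V. semicircle (real_of_int v / R))" .
 have "\<bar>(\<Sum>v\<in>V. semicircle (real_of_int v / R)) - 2 * quarter_area * R / real d\<bar> \<le> 2"
  unfolding V_def by (rule semicircle_residue_sum[OF d R])
 hence le2: "c0 * \<bar>(\<Sum>v\<in>V. semicircle (real_of_int v / R)) - 2 * quarter_area * R / real d\<bar> \<le> c0 * 2"
  using c0 by (intro mult_left_mono) auto
 hence e3: "\<bar>c0 * (\<Sum>v\<in>V. semicircle (real_of_int v / R)) - c0 * (2 * quarter_area * R / real d)\<bar> \<le> c0 * 2"
 proof -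
  have "c0 * \<bar>x - z\<bar> = \<bar>c0 * x - c0 * z\<bar>" for x z :: real
   unfolding right_diff_distrib[symmetric] abs_mult using c0 by simp
  thus ?thesis using le2 by (simp only:)
 qed
 have main: "c0 * (2 * quarter_area * R / real d) = 8 * quarter_area / sqrt (real D) * y / (real d)\<^sup>2"
 proof -
  have "sqrt (4 * A * y) * R = 4 * A * y / sqrt Dr"
   unfolding R_def using A y Dr by (simp add: real_sqrt_divide real_sqrt_mult[symmetric])
  hence "c0 * R = 4 * y / (sqrt Dr * real d)" unfolding c0_def using A d Dr by (simp add: field_simps)
  moreover have "c0 * (2 * quarter_area * R / real d) = c0 * R * (2 * quarter_area / real d)" by simp
  ultimately show ?thesis unfolding Dr_def by (simp add: power2_eq_square mult.assoc)
 qed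
 have sy: "sqrt y \<ge> 1" using y by simp
 have d1: "real d \<ge> 1" using d by simp
 have c0le: "c0 \<le> 2 * sqrt y"
 proof -
  have "sqrt (4 * A * y) \<le> 2 * sqrt y * A"
  proof (rule real_le_lsqrt)
   have "A * 1 \<le> A * A" using A by (intro mult_left_mono) auto
   hence "4 * y * A \<le> 4 * y * (A * A)" using y by (intro mult_left_mono) auto
   thus "4 * A * y \<le> (2 * sqrt y * A)\<^sup>2" using y by (simp add: power_mult_distrib power2_eq_square mult_ac)
  qed (use A y in auto)
  also have "... \<le> 2 * sqrt y * (A * real d)" using A d1 y by (intro mult_left_mono) auto
  finally show ?thesis unfolding c0_def using A d1 by (simp add: divide_le_eq)
 qed
 have "R \<le> 2 * sqrt y"
 proof -
  have "A * 1 \<le> A * A" using A by (intro mult_left_mono) auto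
  hence "A \<le> Dr" using A unfolding power2_eq_square by linarith
  hence "A * y \<le> Dr * y" using y by (intro mult_right_mono) auto
  hence "4 * A * y / Dr \<le> 4 * y" using Dr by (simp add: divide_le_eq mult_ac)
  hence "R \<le> sqrt (4 * y)" unfolding R_def by (intro real_sqrt_le_mono)
  thus ?thesis by (simp add: real_sqrt_mult)
 qed
 moreover have "2 * R / real d \<le> 2 * R / 1"
  using d1 R by (intro divide_left_mono) auto
 ultimately have "2 * R / real d \<le> 4 * sqrt y" by simp
 moreover note c0le
 moreover have "(R - - R) / real d = 2 * R / real d" by simp
 ultimately have cV: "real (card V) \<le> 4 * sqrt y + 1" and c02: "c0 * 2 \<le> 4 * sqrt y"
  using V(2) by linarith+
 have tri: "\<bar>p - r\<bar> \<le> s + t" if "\<bar>p - q\<bar> \<le> s" "\<bar>q - r\<bar> \<le> t" for p q r s t :: real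
  using that by linarith
 have "\<bar>real (card S) - c0 * (2 * quarter_area * R / real d)\<bar> \<le> real (card V) + c0 * 2"
  by (rule tri[OF e1[unfolded e2] e3])
 also have "... \<le> 9 * sqrt y" using cV c02 sy by linarith
 finally show "\<bar>real (card S) - 8 * quarter_area / sqrt (real D) * y / (real d)\<^sup>2\<bar> \<le> 9 * sqrt y"
  unfolding main .
qed

section \<open>Values divisible by d, counted with weights\<close>

definition qf_roots :: "int => int => int => nat => (int \<times> int) set" where
 "qf_roots a b c d = {(i, j). i \<in> {0..<int d} \<and> j \<in> {0..<int d} \<and> int d dvd qf a b c i j}"

definition rho :: "int => int => int => nat => nat" where
 "rho a b c d = card (qf_roots a b c d)"

lemma finite_qf_roots: "finite (qf_roots a b c d)"
 by (rule finite_subset[of _ "{0..<int d} \<times> {0..<int d}"]) (auto simp: qf_roots_def)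

lemma rho_le_square: "rho a b c d \<le> d\<^sup>2"
proof -
 have "rho a b c d \<le> card ({0..<int d} \<times> {0..<int d})"
  unfolding rho_def by (rule card_mono) (auto simp: qf_roots_def)
 thus ?thesis by (simp add: card_cartesian_product power2_eq_square)
qed

lemma qf_dvd_cong:
 assumes "int d dvd u - i" "int d dvd v - j"
 shows "int d dvd qf a b c u v \<longleftrightarrow> int d dvd qf a b c i j"
proof -
 have u: "[u = i] (mod int d)" and v: "[v = j] (mod int d)" using assms by (simp_all add: cong_iff_dvd_diff)
 have "[qf a b c u v = qf a b c i j] (mod int d)"
  unfolding qf_def by (intro cong_add cong_mult cong_pow u v) simp_all
 thus ?thesis by (metis cong_dvd_iff)
qed

lemma dvd_diff_mod: "int d dvd u - u mod int d"
 by (simp add: minus_mod_eq_mult_div)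

lemma mod_eq_of_dvd_diff:
 assumes "int d dvd u - i" "i \<in> {0..<int d}"
 shows "u mod int d = i"
proof -
 have "u mod int d = i mod int d" using assms(1) by (simp add: mod_eq_dvd_iff)
 thus ?thesis using assms(2) by simp
qed

lemma zero_of_dvd:
 assumes "int p dvd i" "0 \<le> i" "i < int p"
 shows "i = 0"
 using assms zdvd_not_zless[of i "int p"] by linarith

text \<open>Split the points by their residues modulo d. Every zero modulo d contributes one ellipse
  count, and the errors are added up with the crude bound d^2 for the number of zeros.\<close>

lemma divisible_count:
 assumes red: "reduced_form D a b c" and D: "D > 0" and d: "d \<ge> 1" and y: "y \<ge> 1"
 defines "S \<equiv> {(u, v). int d dvd qf a b c u v \<and> real_of_int (qf a b c u v) \<le> y}"
 shows "finite S"
  "\<bar>real (card S) - real (rho a b c d) / (real d)\<^sup>2 * (8 * quarter_area / sqrt (real D)) * y\<bar> \<le>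
   9 * (real d)\<^sup>2 * sqrt y"
proof -
 define W where "W = (\<lambda>(i, j). {(u, v). int d dvd u - i \<and> int d dvd v - j \<and> real_of_int (qf a b c u v) \<le> y})"
 define K where "K = 8 * quarter_area / sqrt (real D) * y / (real d)\<^sup>2"
 have W: "finite (W ij)" "\<bar>real (card (W ij)) - K\<bar> \<le> 9 * sqrt y" for ij
  using ellipse_count[OF red D d y, of "fst ij" "snd ij"] unfolding W_def K_def by (simp_all add: case_prod_beta)
 have S: "S = (\<Union>ij\<in>qf_roots a b c d. W ij)"
 proof (intro equalityI subsetI)
  fix x assume "x \<in> S"
  then obtain u v where x: "x = (u, v)" "int d dvd qf a b c u v" "real_of_int (qf a b c u v) \<le> y"
   by (auto simp: S_def)
  have "int d dvd qf a b c (u mod int d) (v mod int d)"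
   using qf_dvd_cong[OF dvd_diff_mod dvd_diff_mod] x(2) by blast
  hence "(u mod int d, v mod int d) \<in> qf_roots a b c d" using d by (simp add: qf_roots_def)
  moreover have "x \<in> W (u mod int d, v mod int d)" using x dvd_diff_mod by (simp add: W_def)
  ultimately show "x \<in> (\<Union>ij\<in>qf_roots a b c d. W ij)" by blast
 next
  fix x assume "x \<in> (\<Union>ij\<in>qf_roots a b c d. W ij)"
  then obtain i j where ij: "(i, j) \<in> qf_roots a b c d" "x \<in> W (i, j)" by auto
  then obtain u v where x: "x = (u, v)" "int d dvd u - i" "int d dvd v - j" "real_of_int (qf a b c u v) \<le> y"
   by (auto simp: W_def)
  have "int d dvd qf a b c u v" using qf_dvd_cong[OF x(2,3)] ij(1) by (simp add: qf_roots_def)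
  thus "x \<in> S" using x by (simp add: S_def)
 qed
 have disj: "W ij \<inter> W kl = {}" if "ij \<in> qf_roots a b c d" "kl \<in> qf_roots a b c d" "ij ~= kl" for ij kl
 proof (rule ccontr)
  obtain i j k l where e: "ij = (i, j)" "kl = (k, l)" by (cases ij, cases kl) auto
  assume "W ij \<inter> W kl ~= {}"
  then obtain u v where "(u, v) \<in> W (i, j)" "(u, v) \<in> W (k, l)" using e by auto
  hence "u mod int d = i" "v mod int d = j" "u mod int d = k" "v mod int d = l"
   using that e by (auto simp: W_def qf_roots_def intro: mod_eq_of_dvd_diff)
  thus False using that(3) e by simp
 qed
 show "finite S" unfolding S using W finite_qf_roots by auto
 have "card S = (\<Sum>ij\<in>qf_roots a b c d. card (W ij))"
  unfolding S using W finite_qf_roots disj by (intro card_UN_disjoint) auto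
 hence "real (card S) - real (rho a b c d) * K = (\<Sum>ij\<in>qf_roots a b c d. (real (card (W ij)) - K))"
  by (simp add: sum_subtractf rho_def)
 hence "\<bar>real (card S) - real (rho a b c d) * K\<bar> \<le> (\<Sum>ij\<in>qf_roots a b c d. 9 * sqrt y)"
  by (simp only:) (rule order_trans[OF sum_abs sum_mono[OF W(2)]])
 also have "... = real (rho a b c d) * (9 * sqrt y)" by (simp add: rho_def)
 also have "... \<le> (real d)\<^sup>2 * (9 * sqrt y)"
 proof (intro mult_right_mono)
  have "real (rho a b c d) \<le> real (d\<^sup>2)" by (simp only: of_nat_le_iff rho_le_square)
  thus "real (rho a b c d) \<le> (real d)\<^sup>2" by simp
 qed (use y in simp)
 finally show "\<bar>real (card S) - real (rho a b c d) / (real d)\<^sup>2 * (8 * quarter_area / sqrt (real D)) * y\<bar> \<le>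
   9 * (real d)\<^sup>2 * sqrt y" by (simp add: K_def mult_ac)
qed

lemma abel_sum:
 fixes G A :: "nat => real"
 shows "(\<Sum>n\<in>{1..M}. (G n - G (Suc n)) * A n) =
  (\<Sum>n\<in>{1..M}. G n * (A n - A (n - 1))) + G 1 * A 0 - G (Suc M) * A M"
 by (induction M) (simp_all add: algebra_simps)

text \<open>Values from 1 on exclude the origin, the only point at which a definite form
  vanishes.\<close>

definition qf_points :: "int => int => int => nat => (int \<times> int) set" where
 "qf_points a b c M = {(u, v). 1 \<le> qf a b c u v \<and> qf a b c u v \<le> int M}"

lemma finite_qf_points:
 assumes red: "reduced_form D a b c" and D: "D > 0"
 shows "finite (qf_points a b c M)"
proof (rule finite_subset)
 show "finite {(u, v). int 1 dvd qf a b c u v \<and> real_of_int (qf a b c u v) \<le> real (Suc M)}"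
  by (rule divisible_count[OF red D]) auto
 show "qf_points a b c M \<subseteq> {(u, v). int 1 dvd qf a b c u v \<and> real_of_int (qf a b c u v) \<le> real (Suc M)}"
  by (auto simp: qf_points_def)
qed

text \<open>Abel summation from sharp counts to weights. \<open>G 1 = 0\<close> removes the term
  \<open>A 0\<close>, which counts the origin, and \<open>G (Suc M) = 0\<close> removes the boundary
  term at M.\<close>

lemma weighted_count:
 fixes G :: "nat => real"
 assumes red: "reduced_form D a b c" and D: "D > 0" and d: "d \<ge> 1"
  and G: "G 1 = 0" "G (Suc M) = 0"
 shows "\<bar>(\<Sum>x | x \<in> qf_points a b c M \<and> int d dvd case_prod (qf a b c) x. G (nat (case_prod (qf a b c) x))) -
   real (rho a b c d) / (real d)\<^sup>2 * (8 * quarter_area / sqrt (real D)) * (\<Sum>n\<in>{1..M}. G n)\<bar> \<le>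
  9 * (real d)\<^sup>2 * (\<Sum>n\<in>{1..M}. \<bar>G n - G (Suc n)\<bar> * sqrt (real n))"
proof -
 define Q where "Q x = case_prod (qf a b c) x" for x
 define S where "S n = {x. int d dvd Q x \<and> Q x \<le> int n}" for n :: nat
 define A where "A n = real (card (S n))" for n
 define \<kappa> where "\<kappa> = real (rho a b c d) / (real d)\<^sup>2 * (8 * quarter_area / sqrt (real D))"
 have disc: "form_disc D a b c" using red by (simp add: reduced_form_def)
 have Q0: "Q x \<ge> 0" for x using qf_nonneg[OF disc] by (simp add: Q_def case_prod_beta)
 have Seq: "S n = {(u, v). int d dvd qf a b c u v \<and> real_of_int (qf a b c u v) \<le> real n}" for n
  by (auto simp: S_def Q_def)
 have S: "finite (S n)" "\<bar>A n - \<kappa> * real n\<bar> \<le> 9 * (real d)\<^sup>2 * sqrt (real n)" if "n \<ge> 1" for n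
  using divisible_count[OF red D d, of "real n"] that unfolding A_def Seq \<kappa>_def by simp_all
 have S0: "finite (S 0)" by (rule finite_subset[OF _ S(1)[of 1]]) (auto simp: S_def)
 have finS: "finite (S n)" for n using S(1)[of n] S0 by (cases "n = 0") auto
 define P where "P = {x. x \<in> qf_points a b c M \<and> int d dvd Q x}"
 have P: "P = {x \<in> S M. 1 \<le> Q x}" by (auto simp: P_def qf_points_def S_def Q_def)
 have finP: "finite P" unfolding P using finS by auto
 have "(\<Sum>x\<in>P. G (nat (Q x))) = (\<Sum>n\<in>{1..M}. \<Sum>x\<in>{x \<in> P. nat (Q x) = n}. G (nat (Q x)))"
  by (rule sum.group[symmetric, OF finP]) (auto simp: P S_def)
 also have "... = (\<Sum>n\<in>{1..M}. G n * (A n - A (n - 1)))"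
 proof (rule sum.cong[OF refl])
  fix n assume n: "n \<in> {1..M}"
  have eq: "{x \<in> P. nat (Q x) = n} = S n - S (n - 1)"
   using n Q0 by (auto simp: P S_def)
  have sub: "S (n - 1) \<subseteq> S n" by (auto simp: S_def)
  have "real (card {x \<in> P. nat (Q x) = n}) = A n - A (n - 1)"
   unfolding eq A_def card_Diff_subset[OF finS sub] using card_mono[OF finS sub] by (simp add: of_nat_diff)
  thus "(\<Sum>x\<in>{x \<in> P. nat (Q x) = n}. G (nat (Q x))) = G n * (A n - A (n - 1))"
   by (simp add: mult.commute)
 qed
 also have "... = (\<Sum>n\<in>{1..M}. (G n - G (Suc n)) * A n)" unfolding abel_sum using G by simp
 finally have 1: "(\<Sum>x\<in>P. G (nat (Q x))) = (\<Sum>n\<in>{1..M}. (G n - G (Suc n)) * A n)" .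
 have "(\<Sum>n\<in>{1..M}. (G n - G (Suc n)) * real n) = (\<Sum>n\<in>{1..M}. G n * (real n - real (n - 1)))"
  unfolding abel_sum using G by simp
 also have "... = (\<Sum>n\<in>{1..M}. G n)" by (intro sum.cong refl) (auto simp: of_nat_diff)
 finally have GS: "(\<Sum>n\<in>{1..M}. (G n - G (Suc n)) * real n) = (\<Sum>n\<in>{1..M}. G n)" .
 have "\<kappa> * (\<Sum>n\<in>{1..M}. G n) = (\<Sum>n\<in>{1..M}. (G n - G (Suc n)) * (\<kappa> * real n))"
  unfolding GS[symmetric] sum_distrib_left by (simp only: mult.left_commute)
 hence "(\<Sum>x\<in>P. G (nat (Q x))) - \<kappa> * (\<Sum>n\<in>{1..M}. G n) = (\<Sum>n\<in>{1..M}. (G n - G (Suc n)) * (A n - \<kappa> * real n))"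
  unfolding 1 by (simp add: right_diff_distrib sum_subtractf)
 also have "\<bar>...\<bar> \<le> (\<Sum>n\<in>{1..M}. 9 * (real d)\<^sup>2 * (\<bar>G n - G (Suc n)\<bar> * sqrt (real n)))"
 proof (rule order_trans[OF sum_abs sum_mono])
  fix n assume "n \<in> {1..M}"
  hence "\<bar>G n - G (Suc n)\<bar> * \<bar>A n - \<kappa> * real n\<bar> \<le> \<bar>G n - G (Suc n)\<bar> * (9 * (real d)\<^sup>2 * sqrt (real n))"
   by (intro mult_left_mono S) auto
  thus "\<bar>(G n - G (Suc n)) * (A n - \<kappa> * real n)\<bar> \<le> 9 * (real d)\<^sup>2 * (\<bar>G n - G (Suc n)\<bar> * sqrt (real n))"
   by (simp add: abs_mult mult_ac)
 qed
 also have "... = 9 * (real d)\<^sup>2 * (\<Sum>n\<in>{1..M}. \<bar>G n - G (Suc n)\<bar> * sqrt (real n))"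
  by (rule sum_distrib_left[symmetric])
 finally show ?thesis unfolding P_def Q_def \<kappa>_def .
qed

section \<open>Zeros of a form modulo primes\<close>

lemma crt_bij:
 assumes "coprime m n" "m \<ge> 1" "n \<ge> 1"
 shows "bij_betw (\<lambda>x. (x mod int m, x mod int n)) {0..<int (m * n)} ({0..<int m} \<times> {0..<int n})"
proof -
 have inj: "inj_on (\<lambda>x. (x mod int m, x mod int n)) {0..<int (m * n)}"
 proof (rule inj_onI)
  fix x y assume xy: "x \<in> {0..<int (m * n)}" "y \<in> {0..<int (m * n)}"
   "(x mod int m, x mod int n) = (y mod int m, y mod int n)"
  hence "int m dvd x - y" "int n dvd x - y" by (simp_all add: mod_eq_dvd_iff)
  hence "int m * int n dvd x - y" using assms(1) by (intro divides_mult) auto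
  hence "x mod int (m * n) = y mod int (m * n)" by (simp add: mod_eq_dvd_iff)
  thus "x = y" using xy by simp
 qed
 moreover have "(\<lambda>x. (x mod int m, x mod int n)) ` {0..<int (m * n)} = {0..<int m} \<times> {0..<int n}"
 proof (rule card_subset_eq)
  show "(\<lambda>x. (x mod int m, x mod int n)) ` {0..<int (m * n)} \<subseteq> {0..<int m} \<times> {0..<int n}"
   using assms by auto
  show "card ((\<lambda>x. (x mod int m, x mod int n)) ` {0..<int (m * n)}) = card ({0..<int m} \<times> {0..<int n})"
   unfolding card_image[OF inj] by (simp add: card_cartesian_product nat_mult_distrib)
 qed simp
 ultimately show ?thesis by (simp add: bij_betw_def)
qed

lemma rho_mult:
 assumes "coprime m n" "m \<ge> 1" "n \<ge> 1"
 shows "rho a b c (m * n) = rho a b c m * rho a b c n"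
proof -
 define \<phi> where "\<phi> x = (x mod int m, x mod int n)" for x
 have bij: "bij_betw \<phi> {0..<int (m * n)} ({0..<int m} \<times> {0..<int n})"
  unfolding \<phi>_def by (rule crt_bij[OF assms])
 define F where "F = (\<lambda>(x, y). ((fst (\<phi> x), fst (\<phi> y)), (snd (\<phi> x), snd (\<phi> y))))"
 have dvd: "int (m * n) dvd qf a b c x y \<longleftrightarrow>
   int m dvd qf a b c (fst (\<phi> x)) (fst (\<phi> y)) \<and> int n dvd qf a b c (snd (\<phi> x)) (snd (\<phi> y))" for x y
 proof -
  have "int (m * n) dvd z \<longleftrightarrow> int m dvd z \<and> int n dvd z" for z
   using assms(1) divides_mult[of "int m" z "int n"] by (auto dest: dvd_mult_left dvd_mult_right)
  moreover have "int m dvd qf a b c x y \<longleftrightarrow> int m dvd qf a b c (fst (\<phi> x)) (fst (\<phi> y))"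
   "int n dvd qf a b c x y \<longleftrightarrow> int n dvd qf a b c (snd (\<phi> x)) (snd (\<phi> y))"
   unfolding \<phi>_def fst_conv snd_conv by (intro qf_dvd_cong dvd_diff_mod)+
  ultimately show ?thesis by blast
 qed
 have "bij_betw F (qf_roots a b c (m * n)) (qf_roots a b c m \<times> qf_roots a b c n)"
  unfolding bij_betw_def
 proof
  show "inj_on F (qf_roots a b c (m * n))"
  proof (rule inj_onI)
   fix p q assume pq: "p \<in> qf_roots a b c (m * n)" "q \<in> qf_roots a b c (m * n)" "F p = F q"
   obtain x y z w where e: "p = (x, y)" "q = (z, w)" by (cases p, cases q) auto
   have "\<phi> x = \<phi> z" "\<phi> y = \<phi> w" using pq(3) e by (auto simp: F_def prod_eq_iff)
   moreover have "x \<in> {0..<int (m * n)}" "z \<in> {0..<int (m * n)}" "y \<in> {0..<int (m * n)}" "w \<in> {0..<int (m * n)}"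
    using pq(1,2) e by (auto simp: qf_roots_def)
   ultimately show "p = q" using bij e unfolding bij_betw_def inj_on_def by blast
  qed
  show "F ` qf_roots a b c (m * n) = qf_roots a b c m \<times> qf_roots a b c n"
  proof (intro equalityI subsetI)
   fix t assume "t \<in> F ` qf_roots a b c (m * n)"
   then obtain x y where xy: "t = F (x, y)" "(x, y) \<in> qf_roots a b c (m * n)" by auto
   hence "\<phi> x \<in> {0..<int m} \<times> {0..<int n}" "\<phi> y \<in> {0..<int m} \<times> {0..<int n}"
    using bij_betw_apply[OF bij] by (auto simp: qf_roots_def)
   thus "t \<in> qf_roots a b c m \<times> qf_roots a b c n"
    using xy dvd[of x y] by (auto simp: F_def qf_roots_def)
  next
   fix t assume t: "t \<in> qf_roots a b c m \<times> qf_roots a b c n"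
   obtain i j k l where e: "t = ((i, j), (k, l))" by (metis prod.exhaust)
   have "(i, k) \<in> {0..<int m} \<times> {0..<int n}" "(j, l) \<in> {0..<int m} \<times> {0..<int n}"
    using t e by (auto simp: qf_roots_def)
   then obtain x y where xy: "x \<in> {0..<int (m * n)}" "\<phi> x = (i, k)" "y \<in> {0..<int (m * n)}" "\<phi> y = (j, l)"
   proof -
    have im: "\<phi> ` {0..<int (m * n)} = {0..<int m} \<times> {0..<int n}" using bij by (simp add: bij_betw_def)
    have "(i, k) \<in> \<phi> ` {0..<int (m * n)}" "(j, l) \<in> \<phi> ` {0..<int (m * n)}"
     unfolding im by fact+
    thus ?thesis using that by (metis (no_types) imageE)
   qed
   have "(x, y) \<in> qf_roots a b c (m * n)"
    using xy t e dvd[of x y] by (auto simp: qf_roots_def)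
   moreover have "F (x, y) = t" using xy e by (simp add: F_def)
   ultimately show "t \<in> F ` qf_roots a b c (m * n)" by blast
  qed
 qed
 from bij_betw_same_card[OF this] show ?thesis unfolding rho_def by (simp only: card_cartesian_product)
qed

lemma rho_one: "rho a b c 1 = 1"
proof -
 have "qf_roots a b c 1 = {(0, 0)}" by (auto simp: qf_roots_def)
 thus ?thesis by (simp add: rho_def)
qed

lemma rho_prod_primes:
 assumes "finite T" "\<And>p. p \<in> T ==> prime p"
 shows "rho a b c (\<Prod>T) = (\<Prod>p\<in>T. rho a b c p)"
 using assms
proof (induction T rule: finite_induct)
 case empty
 show ?case using rho_one by simp
next
 case (insert p T)
 have "coprime p (\<Prod>T)"
 proof (rule prod_coprime_right)
  fix q assume "q \<in> T"
  thus "coprime p q" using insert by (intro primes_coprime) auto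
 qed
 moreover have "\<Prod>T \<ge> 1"
  using insert.prems prime_ge_1_nat by (intro prod_ge_1) auto
 moreover have "p \<ge> 1" using insert.prems prime_ge_1_nat by auto
 ultimately show ?case using insert by (simp add: rho_mult)
qed

lemma card_linear_roots_le:
 fixes m n :: int
 assumes p: "prime p" "\<not> int p dvd m"
 shows "card {i \<in> {0..<int p}. int p dvd m * i + n} \<le> 1"
proof (rule card_le_Suc0_iff_eq[THEN iffD2, unfolded One_nat_def[symmetric]])
 show "\<forall>x\<in>{i \<in> {0..<int p}. int p dvd m * i + n}. \<forall>y\<in>{i \<in> {0..<int p}. int p dvd m * i + n}. x = y"
 proof (intro ballI)
  fix x y assume x: "x \<in> {i \<in> {0..<int p}. int p dvd m * i + n}" and y: "y \<in> {i \<in> {0..<int p}. int p dvd m * i + n}"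
  have "int p dvd (m * x + n) - (m * y + n)" using x y by (intro dvd_diff) auto
  hence "int p dvd m * (x - y)" by (simp add: algebra_simps)
  hence "int p dvd x - y" using p by (simp add: prime_dvd_mult_iff)
  hence "x mod int p = y mod int p" by (simp add: mod_eq_dvd_iff)
  thus "x = y" using x y by simp
 qed
qed (auto intro: finite_subset[of _ "{0..<int p}"])

text \<open>Subtracting a known root factors the quadratic congruence and leaves a linear
  one.\<close>

lemma card_quadratic_roots_le:
 fixes k m n :: int
 assumes p: "prime p" "\<not> int p dvd k"
 shows "card {i \<in> {0..<int p}. int p dvd k * i\<^sup>2 + m * i + n} \<le> 2"
proof (cases "{i \<in> {0..<int p}. int p dvd k * i\<^sup>2 + m * i + n} = {}")
 case False
 then obtain t where t: "t \<in> {0..<int p}" "int p dvd k * t\<^sup>2 + m * t + n" by auto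
 have "{i \<in> {0..<int p}. int p dvd k * i\<^sup>2 + m * i + n} \<subseteq>
   {t} \<union> {i \<in> {0..<int p}. int p dvd k * i + (k * t + m)}"
 proof
  fix i assume i: "i \<in> {i \<in> {0..<int p}. int p dvd k * i\<^sup>2 + m * i + n}"
  have "int p dvd (k * i\<^sup>2 + m * i + n) - (k * t\<^sup>2 + m * t + n)" using i t by (intro dvd_diff) auto
  also have "(k * i\<^sup>2 + m * i + n) - (k * t\<^sup>2 + m * t + n) = (i - t) * (k * i + (k * t + m))"
   by (simp add: power2_eq_square algebra_simps)
  finally have "int p dvd i - t \<or> int p dvd k * i + (k * t + m)" using p by (simp add: prime_dvd_mult_iff)
  moreover have "i = t" if "int p dvd i - t"
   using mod_eq_of_dvd_diff[OF that t(1)] i by simp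
  ultimately show "i \<in> {t} \<union> {i \<in> {0..<int p}. int p dvd k * i + (k * t + m)}" using i by auto
 qed
 hence "card {i \<in> {0..<int p}. int p dvd k * i\<^sup>2 + m * i + n} \<le>
   card ({t} \<union> {i \<in> {0..<int p}. int p dvd k * i + (k * t + m)})"
  by (intro card_mono) (auto intro: finite_subset[of _ "{0..<int p}"])
 also have "... \<le> 1 + card {i \<in> {0..<int p}. int p dvd k * i + (k * t + m)}"
  by (rule order_trans[OF card_Un_le]) simp
 also have "... \<le> 2" using card_linear_roots_le[OF p] by simp
 finally show ?thesis .
qed (simp only: card.empty)

text \<open>For j = 0 only i = 0 is a zero, and each of the other p - 1 values of j admits at most
  two.\<close>

lemma rho_prime_le_aux:
 assumes p: "prime p" "\<not> int p dvd a"
 shows "rho a b c p \<le> 2 * p - 1"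
proof -
 define R where "R j = {i \<in> {0..<int p}. int p dvd a * i\<^sup>2 + (b * j) * i + c * j\<^sup>2}" for j
 have p0: "p \<ge> 2" using prime_ge_2_nat[OF p(1)] .
 have "qf_roots a b c p = (\<lambda>(j, i). (i, j)) ` (SIGMA j:{0..<int p}. R j)"
  by (force simp: qf_roots_def R_def qf_def mult_ac)
 hence "rho a b c p = card (SIGMA j:{0..<int p}. R j)"
  unfolding rho_def by (simp add: card_image inj_on_def case_prod_beta prod_eq_iff)
 also have "... = (\<Sum>j\<in>{0..<int p}. card (R j))"     by (rule card_SigmaI) (auto simp: R_def intro: finite_subset[of _ "{0..<int p}"])
 also have "{0..<int p} = insert 0 {1..<int p}" using p0 by auto
 also have "(\<Sum>j\<in>insert 0 {1..<int p}. card (R j)) = card (R 0) + (\<Sum>j\<in>{1..<int p}. card (R j))" by simp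
 also have "... \<le> 1 + (\<Sum>j\<in>{1..<int p}. 2)"
 proof (intro add_mono sum_mono)
  have "R 0 \<subseteq> {0}"
  proof
   fix i assume i: "i \<in> R 0"
   hence "int p dvd a * i\<^sup>2" by (simp add: R_def)
   hence "int p dvd i" using p by (simp add: prime_dvd_mult_iff prime_dvd_power_iff)
   thus "i \<in> {0}" using i zero_of_dvd[of p i] by (simp add: R_def)
  qed
  thus "card (R 0) \<le> 1" using card_mono[of "{0}" "R 0"] by simp
  show "card (R j) \<le> 2" for j unfolding R_def by (rule card_quadratic_roots_le[OF p])
 qed
 also have "... = 1 + 2 * (p - 1)" by simp
 finally show ?thesis using p0 by linarith
qed

lemma rho_swap: "rho a b c p = rho c b a p"
proof -
 have "qf_roots a b c p = prod.swap ` qf_roots c b a p"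
 proof (intro equalityI subsetI)
  fix x assume "x \<in> qf_roots a b c p"
  hence "prod.swap x \<in> qf_roots c b a p" by (auto simp: qf_roots_def qf_def algebra_simps)
  thus "x \<in> prod.swap ` qf_roots c b a p" by (metis image_eqI swap_swap)
 qed (auto simp: qf_roots_def qf_def algebra_simps)
 moreover have "inj_on prod.swap (qf_roots c b a p)" by (auto intro!: inj_onI)
 ultimately show ?thesis unfolding rho_def by (simp only: card_image)
qed

text \<open>An outer coefficient prime to p can serve as the leading one. If p divides both, it
  cannot divide b, since p^2 would divide the prime D; modulo p the form is then b u v, whose zeros
  are the two axes.\<close>

lemma rho_prime_le:
 assumes p: "prime p" and form: "form_disc D a b c" "prime D"
 shows "rho a b c p \<le> 2 * p - 1"
proof -
 consider "\<not> int p dvd a" | "\<not> int p dvd c" | "int p dvd a" "int p dvd c" by blast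
 thus ?thesis
 proof cases
  case 1
  thus ?thesis by (rule rho_prime_le_aux[OF p])
 next
  case 2
  show ?thesis unfolding rho_swap[of a b c] by (rule rho_prime_le_aux[OF p 2])
 next
  case 3
  have p2: "p \<ge> 2" using prime_ge_2_nat[OF p] .
  have "\<not> int p dvd b"
  proof
   assume "int p dvd b"
   hence "int p * int p dvd 4 * (a * c) - b * b" using 3 by (intro dvd_diff dvd_mult mult_dvd_mono)
   hence "int (p * p) dvd int D" using form(1) by (simp add: form_disc_def power2_eq_square mult.assoc)
   hence "p * p dvd D" by (simp only: int_dvd_int_iff)
   hence pD: "p = D" using p form(2) by (metis dvd_mult_left primes_dvd_imp_eq)
   hence "D * D dvd D" using \<open>p * p dvd D\<close> by simp
   hence "D * D \<le> D" using form(2) prime_gt_0_nat dvd_imp_le by blast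
   thus False using p2 pD by simp
  qed
  have "qf_roots a b c p \<subseteq> ({0} \<times> {0..<int p}) \<union> ({1..<int p} \<times> {0})"
  proof
   fix x assume x: "x \<in> qf_roots a b c p"
   obtain i j where e: "x = (i, j)" by (cases x)
   have ij: "i \<in> {0..<int p}" "j \<in> {0..<int p}" "int p dvd qf a b c i j" using x e by (auto simp: qf_roots_def)
   have "int p dvd a * i\<^sup>2 + c * j\<^sup>2" using 3 by (intro dvd_add dvd_mult2)
   hence "int p dvd qf a b c i j - (a * i\<^sup>2 + c * j\<^sup>2)" by (rule dvd_diff[OF ij(3)])
   hence "int p dvd b * (i * j)" by (simp add: qf_def algebra_simps)
   hence "int p dvd i \<or> int p dvd j" using p \<open>\<not> int p dvd b\<close> by (simp add: prime_dvd_mult_iff)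
   hence "i = 0 \<or> j = 0" using zero_of_dvd[of p i] zero_of_dvd[of p j] ij by auto
   thus "x \<in> ({0} \<times> {0..<int p}) \<union> ({1..<int p} \<times> {0})" using e ij by auto
  qed
  hence "rho a b c p \<le> card (({0 :: int} \<times> {0..<int p}) \<union> ({1..<int p} \<times> {0 :: int}))"
   unfolding rho_def by (intro card_mono) auto
  also have "... \<le> card ({0 :: int} \<times> {0..<int p}) + card ({1..<int p} \<times> {0 :: int})" by (rule card_Un_le)
  also have "... = p + (p - 1)" by (simp add: card_cartesian_product)
  finally show ?thesis using p2 by linarith
 qed
qed

text \<open>A substitution of determinant prime to l is injective modulo l and carries zeros to
  zeros. It serves to compare the densities of a form with those of its restriction to a
  sublattice.\<close>

lemma rho_le_transform:
 assumes tr: "\<And>u v. qf a' b' c' (m1 * u + m2 * v) (m3 * u + m4 * v) = k * qf a b c u v"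
  and det: "coprime (m1 * m4 - m2 * m3) (int l)" and l: "l \<ge> 1"
 shows "rho a b c l \<le> rho a' b' c' l"
proof -
 define F where "F = (\<lambda>(u, v). ((m1 * u + m2 * v) mod int l, (m3 * u + m4 * v) mod int l))"
 have inj: "inj_on F (qf_roots a b c l)"
 proof (rule inj_onI)
  fix x y assume xy: "x \<in> qf_roots a b c l" "y \<in> qf_roots a b c l" "F x = F y"
  obtain u v s t where e: "x = (u, v)" "y = (s, t)" by (cases x, cases y) auto
  have d1: "int l dvd m1 * (u - s) + m2 * (v - t)" and d2: "int l dvd m3 * (u - s) + m4 * (v - t)"
   using xy(3) e by (simp_all add: F_def mod_eq_dvd_iff algebra_simps)
  have "int l dvd m4 * (m1 * (u - s) + m2 * (v - t)) - m2 * (m3 * (u - s) + m4 * (v - t))"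
   using d1 d2 by (intro dvd_diff dvd_mult)
  hence "int l dvd (m1 * m4 - m2 * m3) * (u - s)" by (simp add: algebra_simps)
  hence 1: "int l dvd u - s" using det by (metis coprime_commute coprime_dvd_mult_right_iff)
  have "int l dvd m1 * (m3 * (u - s) + m4 * (v - t)) - m3 * (m1 * (u - s) + m2 * (v - t))"
   using d1 d2 by (intro dvd_diff dvd_mult)
  hence "int l dvd (m1 * m4 - m2 * m3) * (v - t)" by (simp add: algebra_simps)
  hence 2: "int l dvd v - t" using det by (metis coprime_commute coprime_dvd_mult_right_iff)
  show "x = y" using mod_eq_of_dvd_diff[OF 1] mod_eq_of_dvd_diff[OF 2] xy e by (auto simp: qf_roots_def)
 qed
 have "F ` qf_roots a b c l \<subseteq> qf_roots a' b' c' l"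
 proof
  fix x assume "x \<in> F ` qf_roots a b c l"
  then obtain u v where uv: "x = F (u, v)" "(u, v) \<in> qf_roots a b c l" by auto
  have "int l dvd qf a' b' c' (m1 * u + m2 * v) (m3 * u + m4 * v)"
   unfolding tr using uv by (simp add: qf_roots_def)
  hence "int l dvd qf a' b' c' ((m1 * u + m2 * v) mod int l) ((m3 * u + m4 * v) mod int l)"
   using qf_dvd_cong[OF dvd_diff_mod dvd_diff_mod] by blast
  thus "x \<in> qf_roots a' b' c' l" using l uv(1) by (simp add: F_def qf_roots_def)
 qed
 thus ?thesis unfolding rho_def by (rule card_inj_on_le[OF inj _ finite_qf_roots])
qed

section \<open>Ideals of the imaginary quadratic field\<close>

locale imag_quad =
 fixes D q :: nat
 assumes D_prime: "prime D" and D_gt: "D > 3" and D_q: "D + 1 = 4 * q"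
begin

text \<open>A root of t^2 - t + q with q = (D + 1) / 4; together with 1 it is an integral
  basis.\<close>

definition om :: complex where
 "om = (1 + \<i> * of_real (sqrt (real D))) / 2"

definition el :: "int => int => complex" where
 "el s t = of_int s + of_int t * om"

lemma sqrtD_pos: "sqrt (real D) > 0"
 using D_gt by simp

lemma Re_el: "Re (el s t) = of_int s + of_int t / 2"
 by (simp add: el_def om_def)

lemma Im_el: "Im (el s t) = of_int t * sqrt (real D) / 2"
 by (simp add: el_def om_def)

lemma el_eq_iff: "el s t = el s' t' \<longleftrightarrow> s = s' \<and> t = t'"
proof
 assume eq: "el s t = el s' t'"
 hence "of_int t * sqrt (real D) / 2 = of_int t' * sqrt (real D) / 2" using Im_el by metis
 hence "t = t'" using sqrtD_pos by simp
 thus "s = s' \<and> t = t'" using eq by (simp add: el_def)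
qed simp

lemma el_add: "el s t + el s' t' = el (s + s') (t + t')"
 by (simp add: el_def algebra_simps)

lemma el_minus: "- el s t = el (- s) (- t)"
 by (simp add: el_def)

lemma sqrtD_sq: "(\<i> * complex_of_real (sqrt (real D))) * (\<i> * complex_of_real (sqrt (real D))) = - of_nat D"
proof -
 have "complex_of_real (sqrt (real D)) * complex_of_real (sqrt (real D)) = of_real (sqrt (real D) * sqrt (real D))"
  by (rule of_real_mult[symmetric])
 also have "sqrt (real D) * sqrt (real D) = real D" by simp
 finally have S: "complex_of_real (sqrt (real D)) * complex_of_real (sqrt (real D)) = of_nat D"
  unfolding of_real_of_nat_eq .
 have "(\<i> * S) * (\<i> * S) = (\<i> * \<i>) * (S * S)" for S :: complex by (simp only: mult_ac)
 from this[of "complex_of_real (sqrt (real D))"] show ?thesis by (simp only: S) simp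
qed

lemma om_square: "om * om = om - of_nat q"
proof -
 define R where "R = \<i> * complex_of_real (sqrt (real D))"
 have "complex_of_nat (D + 1) = of_nat (4 * q)" by (simp only: D_q)
 hence RR: "R * R = 1 - 4 * of_nat q" unfolding R_def sqrtD_sq by (simp add: algebra_simps)
 have "om * om = (1 + 2 * R + R * R) / 4" by (simp add: om_def R_def algebra_simps)
 also have "... = (1 + R) / 2 - of_nat q" unfolding RR by (simp add: field_simps)
 finally show ?thesis by (simp add: om_def R_def)
qed

lemma of_rat_complex: "complex_of_rat x = of_real (of_rat x)"
 by (cases x) (simp add: of_rat_rat)

lemma el_mult: "el a b * el s t = el (a * s - int q * b * t) (a * t + b * s + b * t)"
proof -
 have "el a b * el s t = of_int (a * s) + of_int (a * t + b * s) * om + of_int (b * t) * (om * om)"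
  by (simp add: el_def algebra_simps)
 thus ?thesis unfolding om_square by (simp add: el_def algebra_simps)
qed

lemma el_of_int: "of_int k * el s t = el (k * s) (k * t)"
 by (simp add: el_def algebra_simps)

lemma cnj_el: "cnj (el s t) = el (s + t) (- t)"
 by (simp add: complex_eq_iff Re_el Im_el)

lemma el_zero: "el 0 0 = 0" and el_one: "el 1 0 = 1"
 by (simp_all add: el_def)

lemma el_neq_0: "el s t ~= 0 \<longleftrightarrow> s ~= 0 \<or> t ~= 0"
 using el_eq_iff[of s t 0 0] by (simp add: el_zero)

section \<open>The ring of integers\<close>

lemma algebraic_int_el: "algebraic_int (el s t)"
proof (rule algebraic_int.intros)
 define p where "p = [:complex_of_int (s * s + s * t + int q * t * t), - of_int (2 * s + t), 1:]"
 show "lead_coeff p = 1" by (simp add: p_def)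
 show "\<forall>i. Polynomial.coeff p i \<in> \<int>"
  by (auto simp: p_def coeff_pCons split: nat.splits)
 have "poly p (el s t) = el s t * el s t - of_int (2 * s + t) * el s t + el (s * s + s * t + int q * t * t) 0"
  by (simp add: p_def el_def algebra_simps)
 also have "... = el s t * el s t + (- el ((2 * s + t) * s) ((2 * s + t) * t)) + el (s * s + s * t + int q * t * t) 0"
  unfolding el_of_int by simp
 also have "... = el 0 0" unfolding el_mult el_minus el_add by (simp add: el_eq_iff algebra_simps)
 finally show "poly p (el s t) = 0" by (simp add: el_zero)
qed

lemma quad_field_iff: "z \<in> quad_field D \<longleftrightarrow> (\<exists>a b :: rat. z = of_rat a + of_rat b * (\<i> * of_real (sqrt (real D))))"
 by (auto simp: quad_field_def)

lemma el_quad_field: "el s t \<in> quad_field D"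
 unfolding quad_field_iff
 by (intro exI[of _ "of_int s + of_int t / 2"] exI[of _ "of_int t / 2"])
   (simp add: el_def om_def of_rat_add of_rat_divide algebra_simps add_divide_distrib)

lemma el_quad_integers: "el s t \<in> quad_integers D"
 unfolding quad_integers_def using el_quad_field[of s t] algebraic_int_el by simp

lemma quad_field_mult:
 assumes "x \<in> quad_field D" "y \<in> quad_field D"
 shows "x * y \<in> quad_field D"
proof -
 define r where "r = \<i> * complex_of_real (sqrt (real D))"
 obtain a b c d where x: "x = of_rat a + of_rat b * r" and y: "y = of_rat c + of_rat d * r"
  using assms unfolding quad_field_iff r_def by auto
 have "x * y = of_rat (a * c) + of_rat (a * d + b * c) * r + of_rat (b * d) * (r * r)"
  unfolding x y by (simp add: of_rat_mult of_rat_add algebra_simps)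
 also have "... = of_rat (a * c - b * d * of_nat D) + of_rat (a * d + b * c) * r"
  unfolding sqrtD_sq[folded r_def] by (simp add: of_rat_mult of_rat_add of_rat_diff)
 finally show ?thesis unfolding quad_field_iff r_def by blast
qed

lemma quad_field_inverse:
 assumes "x \<in> quad_field D" "x ~= 0"
 shows "inverse x \<in> quad_field D"
proof -
 define r where "r = \<i> * complex_of_real (sqrt (real D))"
 obtain a b where x: "x = of_rat a + of_rat b * r" using assms(1) unfolding quad_field_iff r_def by auto
 have "x * (of_rat a + of_rat (- b) * r) = of_rat (a * a) - of_rat (b * b) * (r * r)"
  unfolding x by (simp add: of_rat_mult of_rat_minus algebra_simps)
 also have "... = of_rat (a * a + b * b * of_nat D)"
  unfolding sqrtD_sq[folded r_def] by (simp add: of_rat_mult of_rat_add)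
 finally have xm: "x * (of_rat a + of_rat (- b) * r) = of_rat (a * a + b * b * of_nat D)" .
 define N where "N = a * a + b * b * of_nat D"
 have "N ~= 0"
 proof
  assume "N = 0"
  moreover have "0 \<le> a * a" "0 \<le> b * b * of_nat D" by simp_all
  ultimately have "a * a = 0" "b * b * of_nat D = 0" unfolding N_def by linarith+
  hence "a = 0" "b = 0" using D_gt by auto
  thus False using assms(2) x by simp
 qed
 have "x * ((of_rat a + of_rat (- b) * r) / of_rat N) = 1"
  using xm \<open>N ~= 0\<close> by (simp add: N_def[symmetric])
 hence "inverse x = (of_rat a + of_rat (- b) * r) / of_rat N"
  using assms(2) by (metis inverse_unique)
 also have "... = of_rat (a / N) + of_rat (- b / N) * r"
  by (simp add: of_rat_divide of_rat_minus diff_divide_distrib)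
 finally show ?thesis unfolding quad_field_iff r_def by blast
qed

text \<open>The order generated by sqrt (-D): closed under conjugation, with rational elements that
  are visibly integers, as the denominator argument requires.\<close>

definition Zroot :: "complex set" where
 "Zroot = {of_int u + of_int v * (\<i> * of_real (sqrt (real D))) | u v. True}"

lemma Zroot_closed:
 shows Zroot_of_int: "of_int k \<in> Zroot"
  and Zroot_add: "x \<in> Zroot ==> y \<in> Zroot ==> x + y \<in> Zroot"
  and Zroot_mult: "x \<in> Zroot ==> y \<in> Zroot ==> x * y \<in> Zroot"
  and Zroot_cnj: "x \<in> Zroot ==> cnj x \<in> Zroot"
proof -
 define r where "r = \<i> * complex_of_real (sqrt (real D))"
 have Z: "x \<in> Zroot \<longleftrightarrow> (\<exists>u v. x = of_int u + of_int v * r)" for x by (auto simp: Zroot_def r_def)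
 show "of_int k \<in> Zroot" unfolding Z by (intro exI[of _ k] exI[of _ 0]) simp
 show "x + y \<in> Zroot" if x: "x \<in> Zroot" and y: "y \<in> Zroot"
 proof -
  obtain u v u' v' where "x = of_int u + of_int v * r" "y = of_int u' + of_int v' * r" using x y unfolding Z by blast
  hence "x + y = of_int (u + u') + of_int (v + v') * r" by (simp add: algebra_simps)
  thus ?thesis unfolding Z by blast
 qed
 show "x * y \<in> Zroot" if x: "x \<in> Zroot" and y: "y \<in> Zroot"
 proof -
  obtain u v u' v' where xy: "x = of_int u + of_int v * r" "y = of_int u' + of_int v' * r" using x y unfolding Z by blast
  have "x * y = of_int (u * u') + of_int (u * v' + v * u') * r + of_int (v * v') * (r * r)"
   unfolding xy by (simp add: algebra_simps)
  also have "... = of_int (u * u' - v * v' * int D) + of_int (u * v' + v * u') * r"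
   unfolding sqrtD_sq[folded r_def] by simp
  finally show ?thesis unfolding Z by blast
 qed
 show "cnj x \<in> Zroot" if x: "x \<in> Zroot"
 proof -
  obtain u v where "x = of_int u + of_int v * r" using x unfolding Z by blast
  hence "cnj x = of_int u + of_int (- v) * r" by (simp add: r_def)
  thus ?thesis unfolding Z by blast
 qed
qed

lemma Zroot_sum: "(\<And>i. i \<in> A ==> f i \<in> Zroot) ==> sum f A \<in> Zroot"
 by (induction A rule: infinite_finite_induct) (use Zroot_of_int[of 0] in \<open>auto intro: Zroot_add\<close>)

lemma Zroot_power: "x \<in> Zroot ==> x ^ k \<in> Zroot"
 by (induction k) (use Zroot_of_int[of 1] in \<open>auto intro: Zroot_mult\<close>)

text \<open>The powers of an algebraic integer have a common denominator, and so do the powers of its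
 trace and norm; a rational number with that property is an integer.\<close>

lemma rat_bounded_denominator:
 fixes r :: rat and d :: int
 assumes d: "d \<ge> 1" and pw: "\<And>k. \<exists>m. of_int d * r ^ k = of_int m"
 shows "\<exists>m. r = of_int m"
proof -
 obtain x y where xy: "r = of_int x / of_int y" "y > 0" "coprime x y"
  by (metis Fract_of_int_quotient Rat_cases)
 have dv: "y ^ k dvd d" for k
 proof -
  obtain m where "of_int d * r ^ k = of_int m" using pw by blast
  hence "(of_int (d * x ^ k) :: rat) = of_int (m * y ^ k)" using xy by (simp add: field_simps power_divide)
  hence "d * x ^ k = m * y ^ k" by (simp only: of_int_eq_iff)
  hence "y ^ k dvd d * x ^ k" by simp
  moreover have "coprime (y ^ k) (x ^ k)" using xy(3) by (simp add: coprime_commute)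
  ultimately show ?thesis by (simp add: coprime_dvd_mult_left_iff)
 qed
 have "y = 1"
 proof (rule ccontr)
  assume "y ~= 1"
  hence y2: "2 \<le> y" using xy(2) by simp
  have "2 ^ nat d \<le> y ^ nat d" using y2 by (intro power_mono) auto
  also have "... \<le> d" using dv[of "nat d"] d by (intro zdvd_imp_le) auto
  finally have "2 ^ nat d \<le> int (nat d)" using d by simp
  moreover have "int (nat d) < 2 ^ nat d" using of_nat_less_two_power by blast
  ultimately show False by simp
 qed
 thus ?thesis using xy by auto
qed

lemma Zroot_of_rat:
 assumes "complex_of_rat r \<in> Zroot"
 shows "\<exists>m. r = of_int m"
proof -
 obtain u v where uv: "complex_of_rat r = of_int u + of_int v * (\<i> * of_real (sqrt (real D)))"
  using assms by (auto simp: Zroot_def)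
 have "complex_of_rat r = complex_of_real (of_rat r)" by (rule of_rat_complex)
 hence "complex_of_real (of_rat r) = of_int u + of_int v * (\<i> * of_real (sqrt (real D)))" using uv by simp
 hence "Re (complex_of_real (of_rat r)) = Re (of_int u + of_int v * (\<i> * of_real (sqrt (real D))))" by (simp only:)
 hence "real_of_rat r = real_of_rat (of_int u)" by simp
 hence "r = of_int u" by (simp only: of_rat_eq_iff)
 thus ?thesis by blast
qed

lemma algebraic_int_trace_norm:
 assumes "algebraic_int z" and z: "z = of_rat a + of_rat b * (\<i> * of_real (sqrt (real D)))"
 shows "\<exists>m. 2 * a = of_int m" "\<exists>m. a * a + b * b * of_nat D = of_int m"
proof -
 obtain p where p: "lead_coeff p = 1" "\<And>i. Polynomial.coeff p i \<in> \<int>" "poly p z = 0"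
  using assms(1) by (auto elim: algebraic_int.cases)
 define n where "n = degree p"
 obtain x1 y1 where a: "a = of_int x1 / of_int y1" "y1 > 0" by (metis Fract_of_int_quotient Rat_cases)
 obtain x2 y2 where b: "b = of_int x2 / of_int y2" "y2 > 0" by (metis Fract_of_int_quotient Rat_cases)
 define c where "c = y1 * y2"
 have c: "c \<ge> 1" using a b unfolding c_def by (simp add: int_one_le_iff_zero_less)
 have cz: "of_int c * z \<in> Zroot"
 proof -
  have "of_int c * z = of_int (x1 * y2) + of_int (x2 * y1) * (\<i> * of_real (sqrt (real D)))"
   unfolding z a b c_def using a(2) b(2) by (simp add: of_rat_divide field_simps)
  thus ?thesis unfolding Zroot_def by blast
 qed
 \<comment> \<open>One denominator for all powers of z: up to the degree n it clears them directly,
   and beyond n the monic equation expresses a power by lower ones.\<close>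
 define d where "d = c ^ n"
 have d: "d \<ge> 1" using c by (simp add: d_def one_le_power)
 have dz: "of_int d * z ^ k \<in> Zroot" for k
 proof (induction k rule: less_induct)
  case (less k)
  show ?case
  proof (cases "k \<le> n")
   case True
   hence "of_int d * z ^ k = of_int (c ^ (n - k)) * (of_int c * z) ^ k"
    by (simp add: d_def power_mult_distrib power_add[symmetric] mult.assoc[symmetric])
   thus ?thesis using Zroot_mult[OF Zroot_of_int Zroot_power[OF cz]] by metis
  next
   case False
   have "poly p z = (\<Sum>i\<le>n. Polynomial.coeff p i * z ^ i)" by (simp add: poly_altdef n_def)
   also have "... = (\<Sum>i<n. Polynomial.coeff p i * z ^ i) + z ^ n"
    using p(1) by (simp add: lessThan_Suc_atMost[symmetric] n_def)
   finally have zn: "z ^ n = - (\<Sum>i<n. Polynomial.coeff p i * z ^ i)" using p(3) by (simp add: eq_neg_iff_add_eq_0 add.commute)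
   have "z ^ k = z ^ (k - n) * z ^ n" using False by (simp flip: power_add)
   also have "... = (\<Sum>i<n. (- Polynomial.coeff p i) * z ^ (i + (k - n)))"
    unfolding zn by (simp add: sum_distrib_left sum_negf power_add mult_ac)
   finally have "of_int d * z ^ k = (\<Sum>i<n. (- Polynomial.coeff p i) * (of_int d * z ^ (i + (k - n))))"
    by (simp add: sum_distrib_left mult_ac)
   moreover have "(- Polynomial.coeff p i) * (of_int d * z ^ (i + (k - n))) \<in> Zroot" if "i < n" for i
   proof -
    obtain m where "Polynomial.coeff p i = of_int m" using p(2)[of i] by (auto elim: Ints_cases)
    hence "- Polynomial.coeff p i = of_int (- m)" by simp
    moreover have "of_int d * z ^ (i + (k - n)) \<in> Zroot" using that False by (intro less.IH) auto
    ultimately show ?thesis using Zroot_mult Zroot_of_int by metis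
   qed
   ultimately show ?thesis using Zroot_sum[of "{..<n}"] by simp
  qed
 qed
 have dzc: "of_int d * cnj z ^ k \<in> Zroot" for k using Zroot_cnj[OF dz[of k]] by simp
 have mix: "of_int (d * d) * (z ^ i * cnj z ^ j) \<in> Zroot" for i j
  using Zroot_mult[OF dz[of i] dzc[of j]] by (simp add: mult_ac)
 have re: "of_rat x = complex_of_real (of_rat x)" for x by (rule of_rat_complex)
 have Rez: "Re z = of_rat a" "Im z = of_rat b * sqrt (real D)" unfolding z re by simp_all
 have tr: "z + cnj z = of_rat (2 * a)" unfolding re
  by (rule complex_eqI) (simp_all add: Rez of_rat_mult)
 have nm: "z * cnj z = of_rat (a * a + b * b * of_nat D)" unfolding re
 proof (rule complex_eqI)
  have "sqrt (real D) * sqrt (real D) = real D" by simp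
  thus "Re (z * cnj z) = Re (complex_of_real (of_rat (a * a + b * b * of_nat D)))"
   by (simp add: Rez of_rat_mult of_rat_add algebra_simps)
 qed (simp add: Rez)
 have dd: "d * d \<ge> 1" using d mult_mono[of 1 d 1 d] by simp
 show "\<exists>m. 2 * a = of_int m"
 proof (rule rat_bounded_denominator[OF dd])
  fix k
  have "complex_of_rat (of_int (d * d) * (2 * a) ^ k) = of_int (d * d) * (z + cnj z) ^ k"
   unfolding tr by (simp add: of_rat_mult of_rat_power)
  also have "... = (\<Sum>i\<le>k. of_int (int (k choose i)) * (of_int (d * d) * (z ^ i * cnj z ^ (k - i))))"
   unfolding binomial_ring by (simp add: sum_distrib_left mult_ac)
  also have "... \<in> Zroot" by (intro Zroot_sum Zroot_mult[OF Zroot_of_int] mix)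
  finally show "\<exists>m. of_int (d * d) * (2 * a) ^ k = of_int m" by (rule Zroot_of_rat)
 qed
 show "\<exists>m. a * a + b * b * of_nat D = of_int m"
 proof (rule rat_bounded_denominator[OF dd])
  fix k
  have "complex_of_rat (of_int (d * d) * (a * a + b * b * of_nat D) ^ k) = of_int (d * d) * (z * cnj z) ^ k"
   unfolding nm by (simp only: of_rat_mult of_rat_power of_rat_of_int_eq)
  also have "... \<in> Zroot" using mix[of k k] by (simp add: power_mult_distrib)
  finally show "\<exists>m. of_int (d * d) * (a * a + b * b * of_nat D) ^ k = of_int m" by (rule Zroot_of_rat)
 qed
qed

text \<open>Trace and norm are integers. The square of the denominator of 2 b divides the prime D,
  so 2 b is an integer; then D + 1 = 4 q forces 2 a and 2 b to have the same parity.\<close>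

lemma quad_integers_el:
 assumes "z \<in> quad_integers D"
 shows "\<exists>s t. z = el s t"
proof -
 obtain a b :: rat where z: "z = of_rat a + of_rat b * (\<i> * of_real (sqrt (real D)))"
  using assms unfolding quad_integers_def quad_field_iff by auto
 have re: "of_rat x = complex_of_real (of_rat x)" for x by (rule of_rat_complex)
 have Rez: "Re z = of_rat a" "Im z = of_rat b * sqrt (real D)" unfolding z re by simp_all
 have "algebraic_int z" using assms by (simp add: quad_integers_def)
 from algebraic_int_trace_norm[OF this z]
 obtain A N where A: "2 * a = of_int A" and N: "a * a + b * b * of_nat D = of_int N" by blast
 obtain x y where xy: "2 * b = of_int x / of_int y" "y > 0" "coprime x y"
  by (metis Fract_of_int_quotient Rat_cases)
 have "(2 * b) * (2 * b) * of_nat D = of_int (4 * N - A * A)"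
  using N A[symmetric] by (simp add: algebra_simps)
 hence "of_int (x * x * int D) = (of_int ((4 * N - A * A) * (y * y)) :: rat)"
  unfolding xy(1) using xy(2) by (simp add: field_simps)
 hence "x * x * int D = (4 * N - A * A) * (y * y)" by (simp only: of_int_eq_iff)
 hence "y * y dvd int D * (x * x)" by (metis dvd_triv_right mult.commute)
 moreover have "coprime (y * y) (x * x)" using xy(3) by (simp add: coprime_commute)
 ultimately have yD: "y * y dvd int D" by (simp add: coprime_dvd_mult_left_iff)
 have "y = 1"
 proof -
  have "int (nat y * nat y) dvd int D" using yD xy(2) by simp
  hence yy: "nat y * nat y dvd D" by (simp only: int_dvd_int_iff)
  hence "nat y dvd D" by (rule dvd_mult_left)
  hence "nat y = 1 \<or> nat y = D" using D_prime by (simp add: prime_nat_iff)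
  moreover have "nat y ~= D"
  proof
   assume "nat y = D"
   hence "D * D \<le> D" using yy D_gt by (intro dvd_imp_le) simp_all
   moreover have "4 * D \<le> D * D" using D_gt by simp
   ultimately show False using D_gt by linarith
  qed
  ultimately show ?thesis using xy(2) by auto
 qed
 hence B: "2 * b = of_int x" using xy by simp
 have "(of_int (A * A + x * x * int D) :: rat) = of_int (4 * N)"
  using N A[symmetric] B[symmetric] by (simp add: algebra_simps)
 hence AB: "A * A + x * x * int D = 4 * N" by (simp only: of_int_eq_iff)
 have "even (A - x)"
 proof (rule ccontr)
  assume "odd (A - x)"
  hence "odd (A + x)" "odd (A - x)" by auto
  hence "odd ((A - x) * (A + x))" by simp
  moreover have "(A - x) * (A + x) = 4 * N - x * x * int (D + 1)" using AB by (simp add: algebra_simps)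
  ultimately show False unfolding D_q by simp
 qed
 then obtain s where "A - x = 2 * s" by (blast elim: evenE)
 hence s: "A = x + 2 * s" by simp
 have "z = el s x"
 proof (rule complex_eqI)
  have "real_of_rat (2 * a) = of_int A" "real_of_rat (2 * b) = of_int x"
   using A B by (simp_all only: of_rat_of_int_eq)
  hence r: "2 * real_of_rat a = of_int A" "2 * real_of_rat b = of_int x" by (simp_all add: of_rat_mult)
  show "Re z = Re (el s x)" unfolding Rez Re_el using r s by simp
  show "Im z = Im (el s x)" unfolding Rez Im_el r(2)[symmetric] by simp
 qed
 thus ?thesis by blast
qed

section \<open>Hermite normal form of ideals\<close>

definition hnf :: "int => int => int => complex set" where
 "hnf g n e = {el (g * (n * x + e * y)) (g * y) | x y. True}"

lemma el_hnf_iff: "el s t \<in> hnf g n e \<longleftrightarrow> (\<exists>x y. s = g * (n * x + e * y) \<and> t = g * y)"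
 unfolding hnf_def by (auto simp: el_eq_iff)

lemma hnf_subset: "hnf g n e \<subseteq> quad_integers D"
 by (auto simp: hnf_def el_quad_integers)

text \<open>The number e^2 + e + q is the norm of e + om. Its divisibility by n makes the lattice
  spanned by n and e + om stable under om, so that \<open>hnf g n e\<close>, its multiple by g, is
  an ideal.\<close>

definition ideal_data :: "int => int => bool" where
 "ideal_data n e \<longleftrightarrow> n \<ge> 1 \<and> n dvd e\<^sup>2 + e + int q"

lemma hnf_closed:
 assumes "ideal_data n e" "a \<in> quad_integers D" "z \<in> hnf g n e"
 shows "a * z \<in> hnf g n e"
proof -
 obtain u v where a: "a = el u v" using assms(2) quad_integers_el by blast
 obtain x y where z: "z = el (g * (n * x + e * y)) (g * y)" using assms(3) by (auto simp: hnf_def)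
 obtain m where m: "e\<^sup>2 + e + int q = n * m" using assms(1) by (auto simp: ideal_data_def)
 define y' where "y' = u * y + v * (n * x + e * y) + v * y"
 define x' where "x' = u * x - v * (e * x + y * m)"
 have "u * (n * x + e * y) - int q * v * y = n * x' + e * y'"
 proof -
  have "n * x' + e * y' = u * (n * x + e * y) - v * y * (n * m - e\<^sup>2 - e)"
   unfolding x'_def y'_def by (simp add: power2_eq_square algebra_simps)
  also have "n * m - e\<^sup>2 - e = int q" using m by simp
  finally show ?thesis by (simp add: mult_ac)
 qed
 hence "a * z = el (g * (n * x' + e * y')) (g * y')"
  unfolding a z el_mult y'_def by (simp add: el_eq_iff algebra_simps)
 thus ?thesis by (auto simp: hnf_def)
qed

lemma subgroup_int_generator:
 fixes A :: "int set"
 assumes add: "\<And>x y. x \<in> A ==> y \<in> A ==> x + y \<in> A" and neg: "\<And>x. x \<in> A ==> - x \<in> A"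
  and ne: "\<exists>x\<in>A. x ~= 0"
 shows "\<exists>g\<ge>1. g \<in> A \<and> (\<forall>x\<in>A. g dvd x)"
proof -
 obtain x where x: "x \<in> A" "x ~= 0" using ne by blast
 hence ex: "\<exists>k::nat. k > 0 \<and> int k \<in> A"
  using neg[of x] by (cases "x > 0") (auto intro!: exI[of _ "nat \<bar>x\<bar>"])
 define k where "k = (LEAST k::nat. k > 0 \<and> int k \<in> A)"
 have k: "k > 0" "int k \<in> A" using LeastI_ex[OF ex] by (simp_all add: k_def)
 have min: "k \<le> j" if "j > 0" "int j \<in> A" for j unfolding k_def by (rule Least_le) (use that in auto)
 have z0: "0 \<in> A" using add[OF x(1) neg[OF x(1)]] by simp
 have mul: "int j * int k \<in> A" for j :: nat
  by (induction j) (use z0 add k(2) in \<open>auto simp: algebra_simps\<close>)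
 have mulz: "c * int k \<in> A" for c :: int
  using mul[of "nat c"] neg[OF mul[of "nat (- c)"]] by (cases "c \<ge> 0") auto
 have "int k dvd y" if "y \<in> A" for y
 proof -
  have "y - (y div int k) * int k \<in> A" using add[OF that neg[OF mulz[of "y div int k"]]] by simp
  hence r: "y mod int k \<in> A" by (simp add: minus_div_mult_eq_mod)
  have b: "0 \<le> y mod int k" "y mod int k < int k" using k(1) by simp_all
  have "y mod int k = 0"
  proof (rule ccontr)
   assume "y mod int k ~= 0"
   hence "k \<le> nat (y mod int k)" using min[of "nat (y mod int k)"] b r by simp
   thus False using b by linarith
  qed
  thus ?thesis by presburger
 qed
 thus ?thesis using k by (intro exI[of _ "int k"]) auto
qed

text \<open>Here m generates the rational integers in I and g the group of om-coordinates. Stability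
  under om makes g divide m and e0, so I is g times a lattice spanned by some n and e + om.\<close>

lemma integral_ideal_hnf:
 assumes I: "fractional_ideal D I" "I \<subseteq> quad_integers D"
 obtains g n e where "g \<ge> 1" "ideal_data n e" "I = hnf g n e"
proof -
 have add: "x + y \<in> I" if "x \<in> I" "y \<in> I" for x y using I(1) that by (auto simp: fractional_ideal_def)
 have mul: "a * x \<in> I" if "a \<in> quad_integers D" "x \<in> I" for a x using I(1) that by (auto simp: fractional_ideal_def)
 have neg: "- x \<in> I" if "x \<in> I" for x using mul[OF el_quad_integers that, of "-1" 0] by (simp add: el_def)
 have z0: "0 \<in> I" using I(1) by (simp add: fractional_ideal_def)
 obtain z where z: "z \<in> I" "z ~= 0" using I(1) by (auto simp: fractional_ideal_def)
 obtain s0 t0 where s0: "z = el s0 t0" using z(1) I(2) quad_integers_el by blast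
 define T where "T = {t. \<exists>s. el s t \<in> I}"
 define M where "M = {s. el s 0 \<in> I}"
 have omI: "el (- int q * t) (s + t) \<in> I" if "el s t \<in> I" for s t
  using mul[OF el_quad_integers[of 0 1] that] by (simp add: el_mult)
 have norm: "el (s0 * s0 + s0 * t0 + int q * t0 * t0) 0 \<in> I"
 proof -
  have "cnj z * z \<in> I" unfolding s0 cnj_el by (rule mul[OF el_quad_integers]) (use s0 z in simp)
  moreover have "cnj z * z = el (s0 * s0 + s0 * t0 + int q * t0 * t0) 0"
   unfolding s0 cnj_el el_mult by (simp add: el_eq_iff algebra_simps)
  ultimately show ?thesis by simp
 qed
 have norm0: "s0 * s0 + s0 * t0 + int q * t0 * t0 ~= 0"
 proof
  assume "s0 * s0 + s0 * t0 + int q * t0 * t0 = 0"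
  hence "cnj z * z = 0" unfolding s0 cnj_el el_mult by (simp add: el_zero[symmetric] el_eq_iff algebra_simps)
  thus False using z by simp
 qed
 have "\<exists>m\<ge>1. m \<in> M \<and> (\<forall>x\<in>M. m dvd x)"
 proof (rule subgroup_int_generator)
  show "x + y \<in> M" if "x \<in> M" "y \<in> M" for x y using add[of "el x 0" "el y 0"] that by (simp add: M_def el_add)
  show "- x \<in> M" if "x \<in> M" for x using neg[of "el x 0"] that by (simp add: M_def el_minus)
  show "\<exists>x\<in>M. x ~= 0" using norm norm0 by (auto simp: M_def)
 qed
 then obtain m where m: "m \<ge> 1" "el m 0 \<in> I" "\<And>x. el x 0 \<in> I ==> m dvd x" by (auto simp: M_def)
 have mT: "m \<in> T" using omI[OF m(2)] by (auto simp: T_def)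
 have "\<exists>g\<ge>1. g \<in> T \<and> (\<forall>x\<in>T. g dvd x)"
 proof (rule subgroup_int_generator)
  show "x + y \<in> T" if xT: "x \<in> T" and yT: "y \<in> T" for x y
  proof -
   obtain a b where "el a x \<in> I" "el b y \<in> I" using xT yT unfolding T_def by blast
   thus ?thesis using add[of "el a x" "el b y"] by (auto simp: T_def el_add)
  qed
  show "- x \<in> T" if xT: "x \<in> T" for x
  proof -
   obtain a where "el a x \<in> I" using xT unfolding T_def by blast
   thus ?thesis using neg[of "el a x"] by (auto simp: T_def el_minus)
  qed
  show "\<exists>x\<in>T. x ~= 0" using mT m(1) by (intro bexI[of _ m]) auto
 qed
 then obtain g e0 where g: "g \<ge> 1" "el e0 g \<in> I" "\<And>s x. el s x \<in> I ==> g dvd x" by (auto simp: T_def)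
 obtain n where n: "m = g * n" using g(3)[OF omI[OF m(2)]] by auto
 have "n \<ge> 1" using n m(1) g(1) by (metis int_one_le_iff_zero_less less_le_trans zero_less_mult_pos zero_less_one)
 have "g dvd e0 + g" using g(3)[OF omI[OF g(2)]] .
 hence "g dvd e0" by (simp add: dvd_add_left_iff)
 then obtain e where e: "e0 = g * e" by auto
 have intmul: "el (k * s) (k * t) \<in> I" if "el s t \<in> I" for k s t
  using mul[OF el_quad_integers[of k 0] that] by (simp add: el_mult)
 \<comment> \<open>om times e0 + g om, minus e + 1 copies of that element: the om-part cancels, and
   the rational rest - g (e^2 + e + q) is a multiple of m = g n.\<close>
 have "el (- int q * g - (e + 1) * e0) (e0 + g - (e + 1) * g) \<in> I"
  using add[OF omI[OF g(2)] neg[OF intmul[OF g(2), of "e + 1"]]] by (simp add: el_add el_minus)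
 moreover have "e0 + g - (e + 1) * g = 0" by (simp add: e algebra_simps)
 ultimately have "m dvd - int q * g - (e + 1) * e0" using m(3) by simp
 moreover have "- int q * g - (e + 1) * e0 = g * (- (e\<^sup>2 + e + int q))"
  by (simp add: e power2_eq_square algebra_simps)
 ultimately have "g * n dvd g * (- (e\<^sup>2 + e + int q))" unfolding n by (simp only:)
 hence "n dvd - (e\<^sup>2 + e + int q)" using g(1) by (simp only: dvd_mult_cancel_left) auto
 hence "n dvd e\<^sup>2 + e + int q" by (simp only: dvd_minus_iff)
 hence data: "ideal_data n e" using \<open>n \<ge> 1\<close> by (simp add: ideal_data_def)
 have "I = hnf g n e"
 proof (intro equalityI subsetI)
  fix x assume x: "x \<in> I"
  obtain s t where st: "x = el s t" using x I(2) quad_integers_el by blast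
  obtain y where y: "t = g * y" using g(3) x st by blast
  have "el (s - y * e0) (t - y * g) \<in> I"
   using add[OF x[unfolded st] neg[OF intmul[OF g(2), of y]]] by (simp add: el_add el_minus)
  hence "m dvd s - y * e0" using m(3) y by (simp add: mult.commute)
  then obtain x' where "s - y * e0 = m * x'" by auto
  hence "s = g * (n * x' + e * y)" using n e by (simp add: algebra_simps)
  thus "x \<in> hnf g n e" using st y by (auto simp: el_hnf_iff)
 next
  fix x assume "x \<in> hnf g n e"
  then obtain a b where ab: "x = el (g * (n * a + e * b)) (g * b)" by (auto simp: hnf_def)
  have "el (a * m + b * e0) (a * 0 + b * g) \<in> I"
   using add[OF intmul[OF m(2), of a] intmul[OF g(2), of b]] by (simp add: el_add)
  thus "x \<in> I" using ab n e by (simp add: algebra_simps)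
 qed
 thus ?thesis using that g(1) data by blast
qed

lemma zero_hnf: "0 \<in> hnf g n e"
proof -
 have "el 0 0 \<in> hnf g n e" unfolding el_hnf_iff by (intro exI[of _ 0]) simp
 thus ?thesis by (simp only: el_zero)
qed

lemma hnf_fractional:
 assumes "g \<ge> 1" "ideal_data n e"
 shows "fractional_ideal D (hnf g n e)"
 unfolding fractional_ideal_def
proof (intro conjI ballI)
 show "hnf g n e \<subseteq> quad_field D" by (auto simp: hnf_def el_quad_field)
 show "0 \<in> hnf g n e" by (rule zero_hnf)
 have "el (g * n) 0 \<in> hnf g n e" unfolding el_hnf_iff by (intro exI[of _ 1] exI[of _ 0]) simp
 moreover have "el (g * n) 0 ~= 0" using assms by (simp add: el_neq_0 ideal_data_def)
 ultimately show "hnf g n e ~= {0}" by blast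
 show "x + y \<in> hnf g n e" if "x \<in> hnf g n e" "y \<in> hnf g n e" for x y
 proof -
  obtain a b c d where "x = el (g * (n * a + e * b)) (g * b)" "y = el (g * (n * c + e * d)) (g * d)"
   using \<open>x \<in> hnf g n e\<close> \<open>y \<in> hnf g n e\<close> by (auto simp: hnf_def)
  hence "x + y = el (g * (n * (a + c) + e * (b + d))) (g * (b + d))"
   by (simp add: el_add el_eq_iff algebra_simps)
  thus ?thesis by (auto simp: hnf_def)
 qed
 show "a * x \<in> hnf g n e" if "a \<in> quad_integers D" "x \<in> hnf g n e" for a x
  by (rule hnf_closed[OF assms(2) that])
 show "\<exists>d\<in>quad_integers D - {0}. \<forall>x\<in>hnf g n e. d * x \<in> quad_integers D"
  using el_quad_integers[of 1 0] hnf_subset by (intro bexI[of _ 1]) (auto simp: el_one)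
qed

text \<open>The rectangle \<open>{0..<g * n} \<times> {0..<g}\<close> is a fundamental domain:
  reduce the om-coordinate modulo g first, then the other coordinate modulo g n.\<close>

lemma ideal_norm_hnf:
 assumes "g \<ge> 1" "n \<ge> 1"
 shows "ideal_norm D (hnf g n e) = nat (g * g * n)"
proof -
 define coset where "coset z = (+) z ` hnf g n e" for z :: complex
 have sum: "el s t + el s' t' \<in> hnf g n e" if st: "el s t \<in> hnf g n e" "el s' t' \<in> hnf g n e" for s t s' t'
 proof -
  obtain a b c d where "s = g * (n * a + e * b)" "t = g * b" "s' = g * (n * c + e * d)" "t' = g * d"
   using st unfolding el_hnf_iff by auto
  thus ?thesis unfolding el_add el_hnf_iff
   by (intro exI[of _ "a + c"] exI[of _ "b + d"]) (simp add: algebra_simps)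
 qed
 have coset_eq: "coset (el s t) = coset (el s' t')" if st: "el (s' - s) (t' - t) \<in> hnf g n e" for s t s' t'
 proof -
  have sub: "coset (el a b) \<subseteq> coset (el a' b')" if h: "el (a - a') (b - b') \<in> hnf g n e" for a b a' b'
  proof
   fix x assume "x \<in> coset (el a b)"
   then obtain h where h': "h \<in> hnf g n e" "x = el a b + h" by (auto simp: coset_def)
   obtain u v where uv: "h = el u v" using h'(1) hnf_subset quad_integers_el by blast
   have "x = el a' b' + (el (a - a') (b - b') + el u v)" unfolding h'(2) uv by (simp add: el_add)
   moreover have "el (a - a') (b - b') + el u v \<in> hnf g n e" using sum[OF h] h'(1) uv by blast
   ultimately show "x \<in> coset (el a' b')" unfolding coset_def by blast
  qed
  have "el (s - s') (t - t') \<in> hnf g n e"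
  proof -
   obtain x y where "s' - s = g * (n * x + e * y)" "t' - t = g * y" using st unfolding el_hnf_iff by auto
   thus ?thesis unfolding el_hnf_iff by (intro exI[of _ "- x"] exI[of _ "- y"]) (simp add: algebra_simps)
  qed
  thus ?thesis using sub st by blast
 qed
 have coset_D: "el (s - s') (t - t') \<in> hnf g n e" if st: "coset (el s t) = coset (el s' t')" for s t s' t'
 proof -
  have "el s t + 0 \<in> coset (el s t)" unfolding coset_def using zero_hnf by blast
  hence "el s t \<in> coset (el s' t')" unfolding st by simp
  then obtain h where "h \<in> hnf g n e" "el s t = el s' t' + h" unfolding coset_def by blast
  moreover have "el s t = el s' t' + el (s - s') (t - t')" by (simp add: el_add)
  ultimately show ?thesis by (metis add_left_cancel)
 qed
 define R where "R = {0..<g * n} \<times> {0..<g}"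
 have "bij_betw (\<lambda>(i, j). coset (el i j)) R (coset ` quad_integers D)"
  unfolding bij_betw_def
 proof
  show "inj_on (\<lambda>(i, j). coset (el i j)) R"
  proof (rule inj_onI)
   fix a b assume ab: "a \<in> R" "b \<in> R" "(case a of (i, j) => coset (el i j)) = (case b of (i, j) => coset (el i j))"
   obtain i j k l where e1: "a = (i, j)" "b = (k, l)" by (cases a, cases b) auto
   have "el (i - k) (j - l) \<in> hnf g n e" using ab(3) e1 coset_D by simp
   then obtain x y where xy: "i - k = g * (n * x + e * y)" "j - l = g * y" unfolding el_hnf_iff by auto
   have r: "0 \<le> i" "i < g * n" "0 \<le> j" "j < g" "0 \<le> k" "k < g * n" "0 \<le> l" "l < g"
    using ab e1 by (auto simp: R_def)
   have "j mod g = l mod g" using xy(2) by (simp add: mod_eq_dvd_iff)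
   hence jl: "j = l" using r by simp
   hence "y = 0" using xy(2) assms(1) by simp
   hence "i - k = (g * n) * x" using xy(1) by simp
   hence "i mod (g * n) = k mod (g * n)" by (simp add: mod_eq_dvd_iff)
   hence "i = k" using r by simp
   thus "a = b" using jl e1 by simp
  qed
  show "(\<lambda>(i, j). coset (el i j)) ` R = coset ` quad_integers D"
  proof (intro equalityI subsetI)
   fix c assume "c \<in> coset ` quad_integers D"
   then obtain z where z: "c = coset z" "z \<in> quad_integers D" by blast
   obtain s t where c: "c = coset (el s t)" using quad_integers_el[OF z(2)] z(1) by blast
   define j y where "j = t mod g" and "y = t div g"
   define i x where "i = (s - g * e * y) mod (g * n)" and "x = (s - g * e * y) div (g * n)"
   have ty: "t = g * y + j" unfolding j_def y_def by simp
   have "g * n * x + i = s - g * e * y" unfolding i_def x_def by (rule mult_div_mod_eq)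
   hence sx: "s = g * e * y + (g * n * x + i)" by simp
   have "(i, j) \<in> R" unfolding R_def i_def j_def using assms by (simp add: pos_mod_bound)
   moreover have "el (s - i) (t - j) \<in> hnf g n e" unfolding el_hnf_iff
    by (intro exI[of _ x] exI[of _ y]) (simp add: ty sx algebra_simps)
   hence "coset (el i j) = c" unfolding c by (rule coset_eq)
   ultimately show "c \<in> (\<lambda>(i, j). coset (el i j)) ` R" by force
  qed (auto simp: el_quad_integers)
 qed
 hence "ideal_norm D (hnf g n e) = card R"
  unfolding ideal_norm_def coset_def by (simp add: bij_betw_same_card)
 also have "... = nat (g * n) * nat g" unfolding R_def by (simp add: card_cartesian_product)
 also have "... = nat (g * g * n)" using assms by (simp add: nat_mult_distrib mult_ac)
 finally show ?thesis .
qed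

text \<open>Each basis is an integral combination of the other, so the two determinants divide each
  other. Together with \<open>ideal_norm_hnf\<close> this reads the norm off any explicit
  basis.\<close>

lemma hnf_determinant:
 assumes g: "g \<ge> 1" "n \<ge> 1" and eq: "hnf g n e = {el (p1 * x + p2 * y) (q1 * x + q2 * y) | x y. True}"
 shows "\<bar>p1 * q2 - p2 * q1\<bar> = g * g * n"
proof -
 have mem: "el (p1 * x + p2 * y) (q1 * x + q2 * y) \<in> hnf g n e" for x y unfolding eq by blast
 obtain x1 y1 where 1: "p1 = g * (n * x1 + e * y1)" "q1 = g * y1" using mem[of 1 0] unfolding el_hnf_iff by auto
 obtain x2 y2 where 2: "p2 = g * (n * x2 + e * y2)" "q2 = g * y2" using mem[of 0 1] unfolding el_hnf_iff by auto
 have "p1 * q2 - p2 * q1 = (g * g * n) * (x1 * y2 - x2 * y1)" unfolding 1 2 by (simp add: algebra_simps)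
 hence d1: "g * g * n dvd p1 * q2 - p2 * q1" by simp
 have "el (g * n) 0 \<in> hnf g n e" unfolding el_hnf_iff by (intro exI[of _ 1] exI[of _ 0]) simp
 then obtain a b where 3: "g * n = p1 * a + p2 * b" "0 = q1 * a + q2 * b" unfolding eq by (auto simp: el_eq_iff)
 have "el (g * e) g \<in> hnf g n e" unfolding el_hnf_iff by (intro exI[of _ 0] exI[of _ 1]) simp
 then obtain c d where 4: "g * e = p1 * c + p2 * d" "g = q1 * c + q2 * d" unfolding eq by (auto simp: el_eq_iff)
 have "g * g * n = (g * n) * g - (g * e) * 0" by simp
 also have "... = (p1 * a + p2 * b) * (q1 * c + q2 * d) - (p1 * c + p2 * d) * (q1 * a + q2 * b)"
  by (simp only: 3[symmetric] 4[symmetric])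
 also have "... = (p1 * q2 - p2 * q1) * (a * d - b * c)" by (simp add: algebra_simps)
 finally have "p1 * q2 - p2 * q1 dvd g * g * n" by simp
 hence "\<bar>p1 * q2 - p2 * q1\<bar> = \<bar>g * g * n\<bar>" using d1 by (rule zdvd_antisym_abs)
 thus ?thesis using g by (simp add: abs_mult)
qed

end

lemma sl2_bij:
 fixes \<alpha> \<beta> \<gamma> \<delta> :: int
 assumes "\<alpha> * \<delta> - \<beta> * \<gamma> = 1"
 shows "bij (\<lambda>(u, v). (\<alpha> * u + \<beta> * v, \<gamma> * u + \<delta> * v))"
proof (rule bij_betw_byWitness[of _ "\<lambda>(u, v). (\<delta> * u - \<beta> * v, - \<gamma> * u + \<alpha> * v)"])
 have 1: "\<delta> * (\<alpha> * u + \<beta> * v) - \<beta> * (\<gamma> * u + \<delta> * v) = (\<alpha> * \<delta> - \<beta> * \<gamma>) * u"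
  "- \<gamma> * (\<alpha> * u + \<beta> * v) + \<alpha> * (\<gamma> * u + \<delta> * v) = (\<alpha> * \<delta> - \<beta> * \<gamma>) * v"
  "\<alpha> * (\<delta> * u - \<beta> * v) + \<beta> * (- \<gamma> * u + \<alpha> * v) = (\<alpha> * \<delta> - \<beta> * \<gamma>) * u"
  "\<gamma> * (\<delta> * u - \<beta> * v) + \<delta> * (- \<gamma> * u + \<alpha> * v) = (\<alpha> * \<delta> - \<beta> * \<gamma>) * v" for u v
  by (simp_all add: algebra_simps)
 show "\<forall>a\<in>UNIV. (\<lambda>(u, v). (\<delta> * u - \<beta> * v, - \<gamma> * u + \<alpha> * v)) ((\<lambda>(u, v). (\<alpha> * u + \<beta> * v, \<gamma> * u + \<delta> * v)) a) = a"
  using 1(1,2) assms by (simp add: split_beta)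
 show "\<forall>a\<in>UNIV. (\<lambda>(u, v). (\<alpha> * u + \<beta> * v, \<gamma> * u + \<delta> * v)) ((\<lambda>(u, v). (\<delta> * u - \<beta> * v, - \<gamma> * u + \<alpha> * v)) a) = a"
  using 1(3,4) assms by (simp add: split_beta)
qed auto

text \<open>The substitution of \<open>reduction\<close> embeds the points into those of a reduced
  form, for which the ellipse has been counted.\<close>

lemma form_count_le:
 assumes f: "form_disc D a b c" and D: "D > 0" and y: "y \<ge> 1"
 shows "finite {x. real_of_int (case_prod (qf a b c) x) \<le> y}"
  "real (card {x. real_of_int (case_prod (qf a b c) x) \<le> y}) \<le> 8 * quarter_area / sqrt (real D) * y + 9 * sqrt y"
proof -
 obtain a' b' c' \<alpha> \<beta> \<gamma> \<delta> where r: "reduced_form D a' b' c'" "\<alpha> * \<delta> - \<beta> * \<gamma> = 1"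
  "\<And>u v. qf a b c u v = qf a' b' c' (\<alpha> * u + \<beta> * v) (\<gamma> * u + \<delta> * v)"
  using reduction[OF f D] by blast
 define T where "T = (\<lambda>(u, v). (\<alpha> * u + \<beta> * v, \<gamma> * u + \<delta> * v))"
 have T: "inj T" using sl2_bij[OF r(2)] by (simp add: T_def bij_def)
 define S where "S = {(u, v). int 1 dvd u - 0 \<and> int 1 dvd v - 0 \<and> real_of_int (qf a' b' c' u v) \<le> y}"
 have S: "finite S" "\<bar>real (card S) - 8 * quarter_area / sqrt (real D) * y / (real 1)\<^sup>2\<bar> \<le> 9 * sqrt y"
  unfolding S_def by (rule ellipse_count[OF r(1) D _ y], simp)+
 define P where "P = {x. real_of_int (case_prod (qf a b c) x) \<le> y}"
 have sub: "T ` P \<subseteq> S" unfolding P_def S_def T_def by (auto simp: r(3))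
 have "finite P" using finite_imageD[OF finite_subset[OF sub S(1)]] T by (meson inj_on_subset subset_UNIV)
 moreover have "card P \<le> card S" using card_inj_on_le[OF _ sub S(1)] T by (meson inj_on_subset subset_UNIV)
 ultimately show "finite {x. real_of_int (case_prod (qf a b c) x) \<le> y}"
  "real (card {x. real_of_int (case_prod (qf a b c) x) \<le> y}) \<le> 8 * quarter_area / sqrt (real D) * y + 9 * sqrt y"
  using S(2) unfolding P_def[symmetric] by simp_all
qed

lemma card_le_twice_fibres:
 assumes S: "finite S" and fib: "\<And>x. x \<in> S ==> card {y \<in> S. f y = f x} \<le> 2" and im: "f ` S \<subseteq> T" "finite T"
 shows "card S \<le> 2 * card T"
proof -
 have "card S = (\<Sum>z\<in>f ` S. card {y \<in> S. f y = z})"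
  using sum.group[OF S finite_imageI[OF S] subset_refl, where g = f and h = "\<lambda>_. 1 :: nat"] by simp
 also have "... \<le> (\<Sum>z\<in>f ` S. 2)" by (rule sum_mono) (use fib in auto)
 also have "... \<le> 2 * card T" using card_mono[OF im(2,1)] by simp
 finally show ?thesis .
qed

section \<open>Ideal classes and their quadratic forms\<close>

context imag_quad
begin

lemma hnf_scale: "hnf g n e = (*) (of_int g) ` hnf 1 n e"
proof -
 have "hnf g n e = (\<lambda>(x, y). el (g * (n * x + e * y)) (g * y)) ` UNIV" for g
  unfolding hnf_def by auto
 thus ?thesis by (simp add: image_image case_prod_unfold el_of_int)
qed

lemma fractional_ideal_scale:
 assumes I: "fractional_ideal D I" and a: "a \<in> quad_field D" "a ~= 0" and sub: "(*) a ` I \<subseteq> quad_integers D"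
 shows "fractional_ideal D ((*) a ` I)"
 unfolding fractional_ideal_def
proof (intro conjI ballI)
 have I': "I \<subseteq> quad_field D" "0 \<in> I" "I ~= {0}" "\<And>x y. x \<in> I ==> y \<in> I ==> x + y \<in> I"
  "\<And>c x. c \<in> quad_integers D ==> x \<in> I ==> c * x \<in> I"
  using I unfolding fractional_ideal_def by blast+
 show "(*) a ` I \<subseteq> quad_field D" using I'(1) quad_field_mult[OF a(1)] by blast
 show "0 \<in> (*) a ` I" using I'(2) by (metis imageI mult_zero_right)
 obtain z where "z \<in> I" "z ~= 0" using I'(2,3) by blast
 hence "a * z \<in> (*) a ` I" "a * z ~= 0" using a(2) by auto
 thus "(*) a ` I ~= {0}" by blast
 show "x + y \<in> (*) a ` I" if xy: "x \<in> (*) a ` I" "y \<in> (*) a ` I" for x y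
 proof -
  obtain u v where "x = a * u" "y = a * v" "u \<in> I" "v \<in> I" using xy by blast
  thus ?thesis using I'(4)[of u v] by (metis distrib_left imageI)
 qed
 show "c * x \<in> (*) a ` I" if cx: "c \<in> quad_integers D" "x \<in> (*) a ` I" for c x
 proof -
  obtain u where "x = a * u" "u \<in> I" using cx by blast
  thus ?thesis using I'(5)[OF cx(1), of u] by (metis mult.left_commute imageI)
 qed
 show "\<exists>d\<in>quad_integers D - {0}. \<forall>x\<in>(*) a ` I. d * x \<in> quad_integers D"
  using el_quad_integers[of 1 0] sub by (intro bexI[of _ 1]) (auto simp: el_one)
qed

lemma image_mult_mult: "(*) (a :: complex) ` (*) b ` I = (*) (a * b) ` I"
 by (simp add: image_image mult.assoc)

text \<open>Clearing the denominator and dividing by the content g are scalings by field elements,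
  so the class contains a lattice with g = 1.\<close>

lemma class_representative:
 assumes "C \<in> ideal_classes D"
 obtains n e where "ideal_data n e"
  "\<And>J. J \<in> C \<longleftrightarrow> fractional_ideal D J \<and> (\<exists>\<alpha>\<in>quad_field D - {0}. J = (*) \<alpha> ` hnf 1 n e)"
proof -
 obtain I where I: "fractional_ideal D I" "C = ideal_equiv D `` {I}"
  using assms unfolding ideal_classes_def by (auto elim!: quotientE)
 obtain d where d: "d \<in> quad_integers D - {0}" "\<forall>x\<in>I. d * x \<in> quad_integers D"
  using I(1) by (auto simp: fractional_ideal_def)
 have dK: "d \<in> quad_field D" "d ~= 0" using d by (auto simp: quad_integers_def)
 have sub: "(*) d ` I \<subseteq> quad_integers D" using d by blast
 obtain g n e where g: "g \<ge> 1" "ideal_data n e" "(*) d ` I = hnf g n e"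
  by (rule integral_ideal_hnf[OF fractional_ideal_scale[OF I(1) dK sub] sub])
 define \<gamma> where "\<gamma> = d / of_int g"
 have gK: "(of_int g :: complex) \<in> quad_field D" using el_quad_field[of g 0] by (simp add: el_def)
 have g0: "(of_int g :: complex) ~= 0" using g(1) by simp
 have \<gamma>: "\<gamma> \<in> quad_field D" "\<gamma> ~= 0"
  unfolding \<gamma>_def divide_inverse using quad_field_mult[OF dK(1) quad_field_inverse[OF gK g0]] dK g0 by auto
 have H: "hnf 1 n e = (*) \<gamma> ` I"
 proof -
  have "(*) (inverse (of_int g)) ` hnf g n e = hnf 1 n e"
   unfolding hnf_scale[of g] image_mult_mult using g0 by simp
  thus ?thesis unfolding g(3)[symmetric] image_mult_mult \<gamma>_def by (simp add: divide_inverse mult.commute)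
 qed
 have I_H: "I = (*) (inverse \<gamma>) ` hnf 1 n e"
  unfolding H image_mult_mult using \<gamma>(2) by simp
 have mem: "J \<in> C \<longleftrightarrow> fractional_ideal D J \<and> (\<exists>\<alpha>\<in>quad_field D - {0}. J = (*) \<alpha> ` hnf 1 n e)" for J
 proof -
  have "J \<in> C \<longleftrightarrow> fractional_ideal D J \<and> (\<exists>\<alpha>\<in>quad_field D - {0}. J = (*) \<alpha> ` I)"
   unfolding I(2) ideal_equiv_def using I(1) by auto
  also have "(\<exists>\<alpha>\<in>quad_field D - {0}. J = (*) \<alpha> ` I) \<longleftrightarrow> (\<exists>\<alpha>\<in>quad_field D - {0}. J = (*) \<alpha> ` hnf 1 n e)"
  proof
   assume "\<exists>\<alpha>\<in>quad_field D - {0}. J = (*) \<alpha> ` I"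
   then obtain \<alpha> where \<alpha>: "\<alpha> \<in> quad_field D" "\<alpha> ~= 0" "J = (*) \<alpha> ` I" by blast
   have "J = (*) (\<alpha> * inverse \<gamma>) ` hnf 1 n e" unfolding \<alpha>(3) by (subst I_H) (rule image_mult_mult)
   moreover have "\<alpha> * inverse \<gamma> \<in> quad_field D - {0}"
    using quad_field_mult[OF \<alpha>(1) quad_field_inverse[OF \<gamma>]] \<alpha>(2) \<gamma>(2) by simp
   ultimately show "\<exists>\<alpha>\<in>quad_field D - {0}. J = (*) \<alpha> ` hnf 1 n e" by blast
  next
   assume "\<exists>\<alpha>\<in>quad_field D - {0}. J = (*) \<alpha> ` hnf 1 n e"
   then obtain \<alpha> where \<alpha>: "\<alpha> \<in> quad_field D" "\<alpha> ~= 0" "J = (*) \<alpha> ` hnf 1 n e" by blast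
   have "J = (*) (\<alpha> * \<gamma>) ` I" unfolding \<alpha>(3) H by (rule image_mult_mult)
   moreover have "\<alpha> * \<gamma> \<in> quad_field D - {0}"
    using quad_field_mult[OF \<alpha>(1) \<gamma>(1)] \<alpha>(2) \<gamma>(2) by simp
   ultimately show "\<exists>\<alpha>\<in>quad_field D - {0}. J = (*) \<alpha> ` I" by blast
  qed
  finally show ?thesis .
 qed
 show ?thesis by (rule that[OF g(2) mem])
qed

definition data_form :: "int => int => int => int => int" where
 "data_form n e = qf n (2 * e + 1) ((e\<^sup>2 + e + int q) div n)"

lemma data_form_disc:
 assumes "ideal_data n e"
 shows "form_disc D n (2 * e + 1) ((e\<^sup>2 + e + int q) div n)"
proof -
 have m: "n * ((e\<^sup>2 + e + int q) div n) = e\<^sup>2 + e + int q" using assms by (simp add: ideal_data_def)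
 have "int D = 4 * int q - 1" using D_q by linarith
 moreover have "4 * n * ((e\<^sup>2 + e + int q) div n) - (2 * e + 1)\<^sup>2 = 4 * int q - 1"
  unfolding mult.assoc m by (simp add: power2_eq_square algebra_simps)
 ultimately show ?thesis using assms by (simp add: form_disc_def ideal_data_def)
qed

text \<open>The image of \<open>hnf 1 n e\<close> under \<open>multiplier\<close>, in an explicit
  basis whose determinant is the value \<open>data_form n e s t\<close>.\<close>

definition class_ideal :: "int => int => int => int => complex set" where
 "class_ideal n e s t = {el ((s * n + t * e + t) * x + (s * e + t * ((e\<^sup>2 + e + int q) div n)) * y)
   ((- t) * x + s * y) | x y. True}"

text \<open>The conjugate of the lattice element s n + t (e + om), divided by n.\<close>

definition multiplier :: "int => int => int => int => complex" where
 "multiplier n e s t = el (s * n + t * e + t) (- t) / of_int n"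

lemma multiplier_basis:
 assumes "ideal_data n e"
 shows "multiplier n e s t * el n 0 = el (s * n + t * e + t) (- t)"
  "multiplier n e s t * el e 1 = el (s * e + t * ((e\<^sup>2 + e + int q) div n)) s"
proof -
 define m where "m = (e\<^sup>2 + e + int q) div n"
 have m: "n * m = e\<^sup>2 + e + int q" using assms by (simp add: ideal_data_def m_def)
 have n0: "(of_int n :: complex) ~= 0" using assms by (simp add: ideal_data_def)
 have "el n 0 = of_int n" by (simp add: el_def)
 thus "multiplier n e s t * el n 0 = el (s * n + t * e + t) (- t)" using n0 by (simp add: multiplier_def)
 have "el (s * n + t * e + t) (- t) * el e 1 = of_int n * el (s * e + t * m) s"
 proof -
  have "n * (s * e + t * m) = s * n * e + t * (n * m)" by (simp add: algebra_simps)
  also have "... = (s * n + t * e + t) * e - int q * (- t) * 1" unfolding m by (simp add: power2_eq_square algebra_simps)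
  finally have "(s * n + t * e + t) * e - int q * (- t) * 1 = n * (s * e + t * m)" by simp
  thus ?thesis unfolding el_mult el_of_int by (simp add: el_eq_iff algebra_simps)
 qed
 thus "multiplier n e s t * el e 1 = el (s * e + t * ((e\<^sup>2 + e + int q) div n)) s"
  using n0 unfolding multiplier_def m_def[symmetric] by (simp add: field_simps)
qed

lemma image_hnf:
 assumes "a * el n 0 = el p1 q1" "a * el e 1 = el p2 q2"
 shows "(*) a ` hnf 1 n e = {el (p1 * x + p2 * y) (q1 * x + q2 * y) | x y. True}"
proof -
 have "a * el (1 * (n * x + e * y)) (1 * y) = el (p1 * x + p2 * y) (q1 * x + q2 * y)" for x y
 proof -
  have "el (1 * (n * x + e * y)) (1 * y) = of_int x * el n 0 + of_int y * el e 1"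
   by (simp add: el_def algebra_simps)
  hence "a * el (1 * (n * x + e * y)) (1 * y) = of_int x * (a * el n 0) + of_int y * (a * el e 1)"
   by (simp add: algebra_simps)
  also have "... = el (p1 * x + p2 * y) (q1 * x + q2 * y)"
   unfolding assms el_of_int el_add by (simp add: mult.commute)
  finally show ?thesis .
 qed
 hence "(\<lambda>(x, y). a * el (1 * (n * x + e * y)) (1 * y)) ` UNIV = (\<lambda>(x, y). el (p1 * x + p2 * y) (q1 * x + q2 * y)) ` UNIV"
  by (intro image_cong refl) (auto split: prod.splits)
 moreover have "hnf 1 n e = (\<lambda>(x, y). el (1 * (n * x + e * y)) (1 * y)) ` UNIV" unfolding hnf_def by auto
 moreover have "{el (p1 * x + p2 * y) (q1 * x + q2 * y) | x y. True} = (\<lambda>(x, y). el (p1 * x + p2 * y) (q1 * x + q2 * y)) ` UNIV"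
  by auto
 ultimately show ?thesis by (simp only: image_image case_prod_unfold)
qed

lemma class_ideal_eq:
 assumes "ideal_data n e"
 shows "class_ideal n e s t = (*) (multiplier n e s t) ` hnf 1 n e"
 unfolding class_ideal_def image_hnf[OF multiplier_basis[OF assms]] ..

lemma class_ideal_subset: "class_ideal n e s t \<subseteq> quad_integers D"
 by (auto simp: class_ideal_def el_quad_integers)

lemma multiplier_quad_field:
 assumes "ideal_data n e" "(s, t) ~= (0, 0)"
 shows "multiplier n e s t \<in> quad_field D - {0}"
proof -
 have n0: "(of_int n :: complex) ~= 0" "n \<ge> 1" using assms by (auto simp: ideal_data_def)
 have "(of_int n :: complex) \<in> quad_field D" using el_quad_field[of n 0] by (simp add: el_def)
 hence "multiplier n e s t \<in> quad_field D"
  unfolding multiplier_def divide_inverse by (intro quad_field_mult el_quad_field quad_field_inverse n0)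
 moreover have "el (s * n + t * e + t) (- t) ~= 0" unfolding el_neq_0 using assms(2) n0 by auto
 ultimately show ?thesis using n0 by (simp add: multiplier_def)
qed

lemma class_ideal_fractional:
 assumes "ideal_data n e" "(s, t) ~= (0, 0)"
 shows "fractional_ideal D (class_ideal n e s t)"
 unfolding class_ideal_eq[OF assms(1)]
proof (rule fractional_ideal_scale)
 show "fractional_ideal D (hnf 1 n e)" by (rule hnf_fractional) (use assms in auto)
 show "(*) (multiplier n e s t) ` hnf 1 n e \<subseteq> quad_integers D"
  unfolding class_ideal_eq[OF assms(1), symmetric] by (rule class_ideal_subset)
qed (use multiplier_quad_field[OF assms] in auto)

text \<open>Two bases of one lattice: the explicit one has the form value as its determinant, the
  normal form has g^2 n'.\<close>

lemma class_ideal_hnf: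
 assumes "ideal_data n e" "class_ideal n e s t = hnf g n' e'" "g \<ge> 1" "n' \<ge> 1"
 shows "data_form n e s t = g * g * n'"
proof -
 define m where "m = (e\<^sup>2 + e + int q) div n"
 have "\<bar>(s * n + t * e + t) * s - (s * e + t * m) * (- t)\<bar> = g * g * n'"
  by (rule hnf_determinant[OF assms(3,4)]) (use assms(2) in \<open>simp add: class_ideal_def m_def\<close>)
 moreover have "(s * n + t * e + t) * s - (s * e + t * m) * (- t) = data_form n e s t"
  unfolding data_form_def qf_def m_def[symmetric] by (simp add: power2_eq_square algebra_simps)
 moreover have "0 \<le> data_form n e s t" unfolding data_form_def by (rule qf_nonneg[OF data_form_disc[OF assms(1)]])
 ultimately show ?thesis by simp
qed

text \<open>The relation between the images of n and e + om under \<alpha> forces them into the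
  shape of \<open>class_ideal\<close>; s = d and t = - b are read off from the
  om-coordinates.\<close>

lemma class_ideal_surj:
 assumes nd: "ideal_data n e" and \<alpha>: "\<alpha> ~= 0" and sub: "(*) \<alpha> ` hnf 1 n e \<subseteq> quad_integers D"
 shows "\<exists>s t. (*) \<alpha> ` hnf 1 n e = class_ideal n e s t"
proof -
 define m where "m = (e\<^sup>2 + e + int q) div n"
 have m: "n * m = e\<^sup>2 + e + int q" using nd by (simp add: ideal_data_def m_def)
 have n1: "n \<ge> 1" using nd by (simp add: ideal_data_def)
 have "el n 0 \<in> hnf 1 n e" unfolding el_hnf_iff by (intro exI[of _ 1] exI[of _ 0]) simp
 then obtain a b where ab: "\<alpha> * el n 0 = el a b" using sub quad_integers_el by blast
 have "el e 1 \<in> hnf 1 n e" unfolding el_hnf_iff by (intro exI[of _ 0] exI[of _ 1]) simp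
 then obtain c d where cd: "\<alpha> * el e 1 = el c d" using sub quad_integers_el by blast
 have "el a b * el e 1 = of_int n * el c d"
  unfolding ab[symmetric] cd[symmetric] by (simp add: el_def)
 hence 1: "a * e - int q * b = n * c" "a + b * e + b = n * d"
  unfolding el_mult el_of_int by (simp_all add: el_eq_iff)
 have a: "a = d * n + (- b) * e + (- b)" using 1(2) by (simp add: algebra_simps)
 have "n * c = n * (d * e + (- b) * m)"
 proof -
  have "n * c = (d * n - b * e - b) * e - int q * b" using 1(1) a by simp
  also have "... = n * (d * e) - b * (n * m)" unfolding m by (simp add: power2_eq_square algebra_simps)
  finally show ?thesis by (simp add: algebra_simps)
 qed
 hence c: "c = d * e + (- b) * m" using n1 by simp
 have "(*) \<alpha> ` hnf 1 n e = {el (a * x + c * y) (b * x + d * y) | x y. True}" by (rule image_hnf[OF ab cd])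
 also have "... = class_ideal n e d (- b)"
  unfolding class_ideal_def m_def[symmetric] a[symmetric] c[symmetric] by simp
 finally show ?thesis by blast
qed

text \<open>As D > 3 gives q \<ge> 2, completing the square leaves no room for a nonzero t. The
  units of the ring are therefore 1 and -1.\<close>

lemma norm_form_one:
 assumes "s * s + s * t + int q * t * t = 1"
 shows "t = 0 \<and> (s = 1 \<or> s = - 1)"
proof -
 have q2: "int q \<ge> 2" using D_q D_gt by linarith
 have "(2 * s + t) * (2 * s + t) + (4 * int q - 1) * (t * t) = 4 * (s * s + s * t + int q * t * t)"
  by (simp add: algebra_simps)
 hence eq: "(2 * s + t) * (2 * s + t) + (4 * int q - 1) * (t * t) = 4" using assms by simp
 have t: "t = 0"
 proof (rule ccontr)
  assume "t ~= 0"
  hence "1 \<le> t * t" by (metis int_one_le_iff_zero_less not_square_less_zero linorder_neqE_linordered_idom mult_eq_0_iff)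
  hence "7 * 1 \<le> (4 * int q - 1) * (t * t)" using q2 by (intro mult_mono) auto
  moreover have "0 \<le> (2 * s + t) * (2 * s + t)" by simp
  ultimately show False using eq by linarith
 qed
 hence "s * s = 1" using assms by simp
 hence "(s - 1) * (s + 1) = 0" by (simp add: algebra_simps)
 hence "s = 1 \<or> s = - 1" by auto
 thus ?thesis using t by auto
qed

lemma el_norm: "el s t * cnj (el s t) = of_int (s * s + s * t + int q * t * t)"
proof -
 have "el s t * cnj (el s t) = el (s * s + s * t + int q * t * t) 0"
  unfolding cnj_el el_mult by (simp add: el_eq_iff algebra_simps)
 thus ?thesis by (simp add: el_def)
qed

text \<open>Two points that give the same ideal J differ by a factor \<eta> of norm 1 which maps J
  to itself. Once \<eta> is seen to be integral, it is a unit, hence 1 or -1. Integrality is checked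
  in coordinates: prime norm gives J the basis p, e1 + om.\<close>

lemma class_ideal_fibre:
 assumes nd: "ideal_data n e" and p: "prime p" and Q: "data_form n e s t = int p" "data_form n e s' t' = int p"
  and eq: "class_ideal n e s t = class_ideal n e s' t'"
 shows "(s' = s \<and> t' = t) \<or> (s' = - s \<and> t' = - t)"
proof -
 have p1: "int p \<ge> 2" using prime_ge_2_nat[OF p] by simp
 have nz: "(s, t) ~= (0, 0)" "(s', t') ~= (0, 0)" using Q p1 by (auto simp: data_form_def qf_def)
 have n1: "n \<ge> 1" using nd by (simp add: ideal_data_def)
 define \<mu> where "\<mu> = multiplier n e s t"
 define \<mu>' where "\<mu>' = multiplier n e s' t'"
 have \<mu>0: "\<mu> ~= 0" "\<mu>' ~= 0" using multiplier_quad_field[OF nd nz(1)] multiplier_quad_field[OF nd nz(2)]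
  unfolding \<mu>_def \<mu>'_def by auto
 define \<eta> where "\<eta> = \<mu>' / \<mu>"
 \<comment> \<open>The multiplier has norm Q(s, t) / n, so equal form values give a quotient of norm
   1.\<close>
 have norm\<mu>: "multiplier n e s t * cnj (multiplier n e s t) = of_int (data_form n e s t) / of_int n" for s t
 proof -
  define m where "m = (e\<^sup>2 + e + int q) div n"
  have m: "n * m = e\<^sup>2 + e + int q" using nd by (simp add: ideal_data_def m_def)
  have n0: "(of_int n :: complex) ~= 0" using n1 by simp
  define A where "A = s * n + t * e + t"
  have "A * A + A * (- t) + int q * (- t) * (- t) = n * data_form n e s t"
  proof -
   have "n * data_form n e s t = n * (n * s * s + (2 * e + 1) * s * t) + (n * m) * t * t"
    unfolding data_form_def qf_def m_def[symmetric] by (simp add: power2_eq_square algebra_simps)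
   thus ?thesis unfolding m A_def by (simp add: power2_eq_square algebra_simps)
  qed
  hence "el A (- t) * cnj (el A (- t)) = of_int (n * data_form n e s t)" unfolding el_norm by simp
  moreover have "multiplier n e s t * cnj (multiplier n e s t) = el A (- t) * cnj (el A (- t)) / (of_int n * of_int n)"
   by (simp add: multiplier_def A_def)
  ultimately show ?thesis using n0 by simp
 qed
 have \<eta>1: "\<eta> * cnj \<eta> = 1"
 proof -
  have "\<mu> * cnj \<mu> = \<mu>' * cnj \<mu>'" unfolding \<mu>_def \<mu>'_def norm\<mu> Q ..
  moreover have "\<eta> * cnj \<eta> = (\<mu>' * cnj \<mu>') / (\<mu> * cnj \<mu>)" by (simp add: \<eta>_def)
  ultimately show ?thesis using \<mu>0 by simp
 qed
 have "fractional_ideal D (class_ideal n e s t)" by (rule class_ideal_fractional[OF nd nz(1)])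
 then obtain g n1' e1 where h: "g \<ge> 1" "ideal_data n1' e1" "class_ideal n e s t = hnf g n1' e1"
  using integral_ideal_hnf[OF _ class_ideal_subset] by metis
 have "n1' \<ge> 1" using h(2) by (simp add: ideal_data_def)
 have gp: "int p = g * g * n1'" using class_ideal_hnf[OF nd h(3,1) \<open>n1' \<ge> 1\<close>] Q by simp
 \<comment> \<open>The square of g divides the prime p.\<close>
 have "g = 1"
 proof (rule ccontr)
  assume "g ~= 1"
  hence "nat g dvd p" "nat g ~= 1" using gp h(1) by (auto simp: nat_dvd_iff)
  hence "nat g = p" using p by (auto simp: prime_nat_iff)
  hence "g = int p" using h(1) by simp
  hence "g * 1 = g * (g * n1')" using gp by (simp add: mult.assoc)
  hence "1 = g * n1'" using h(1) by simp
  thus False using \<open>g ~= 1\<close> h(1) by (metis pos_zmult_eq_1_iff less_le_trans zero_less_one)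
 qed
 hence n1p: "n1' = int p" using gp by simp
 define J where "J = class_ideal n e s t"
 have Jh: "J = hnf 1 (int p) e1" using h(3) \<open>g = 1\<close> n1p by (simp add: J_def)
 have "J = (*) \<eta> ` J"
 proof -
  have "(*) \<eta> ` J = (*) (\<eta> * \<mu>) ` hnf 1 n e"
   unfolding J_def class_ideal_eq[OF nd] \<mu>_def by (rule image_mult_mult)
  also have "\<eta> * \<mu> = \<mu>'" using \<mu>0 by (simp add: \<eta>_def)
  also have "(*) \<mu>' ` hnf 1 n e = class_ideal n e s' t'" unfolding \<mu>'_def by (rule class_ideal_eq[OF nd, symmetric])
  also have "... = J" by (simp only: J_def eq)
  finally show ?thesis by simp
 qed
 hence \<eta>J: "\<eta> * z \<in> J" if "z \<in> J" for z using that by blast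
 have "el (int p) 0 \<in> J" unfolding Jh el_hnf_iff by (intro exI[of _ 1] exI[of _ 0]) simp
 from \<eta>J[OF this] obtain a b where ab: "\<eta> * el (int p) 0 = el (int p * a + e1 * b) b"
  unfolding Jh hnf_def by auto
 have "el e1 1 \<in> J" unfolding Jh el_hnf_iff by (intro exI[of _ 0] exI[of _ 1]) simp
 from \<eta>J[OF this] obtain c d where cd: "\<eta> * el e1 1 = el (int p * c + e1 * d) d"
  unfolding Jh hnf_def by auto
 obtain m1 where m1: "e1\<^sup>2 + e1 + int q = int p * m1" using h(2) n1p by (auto simp: ideal_data_def)
 have elp: "el (int p) 0 = of_int (int p)" by (simp add: el_def)
 have "el (int p * a + e1 * b) b * el e1 1 = of_int (int p) * el (int p * c + e1 * d) d"
  unfolding ab[symmetric] cd[symmetric] elp by (simp add: mult_ac)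
 hence 1: "(int p * a + e1 * b) * e1 - int q * b = int p * (int p * c + e1 * d)"
  "int p * a + e1 * b + b * e1 + b = int p * d"
  unfolding el_mult el_of_int by (simp_all add: el_eq_iff)
 \<comment> \<open>Otherwise p divides both \<open>2 * e1 + 1\<close> and m1, so that p^2 divides
   the prime D.\<close>
 have "int p dvd b"
 proof (rule ccontr)
  assume nb: "\<not> int p dvd b"
  have "b * (2 * e1 + 1) = int p * (d - a)" using 1(2) by (simp add: algebra_simps)
  hence "int p dvd b * (2 * e1 + 1)" by simp
  hence d1: "int p dvd 2 * e1 + 1" using nb p by (simp add: prime_dvd_mult_iff)
  have "int p * (e1 * d) = e1 * (int p * a + e1 * b + b * e1 + b)" unfolding 1(2) by simp
  hence "b * (e1\<^sup>2 + e1 + int q) = - (int p * (int p * c))"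
   using 1(1) by (simp add: power2_eq_square algebra_simps)
  hence "int p * (b * m1) = int p * (- (int p * c))" unfolding m1 by (simp add: algebra_simps)
  hence "b * m1 = - (int p * c)" using p1 by (simp only: mult_cancel_left) simp
  hence "int p dvd b * m1" by simp
  hence d2: "int p dvd m1" using nb p by (simp add: prime_dvd_mult_iff)
  have "int p * int p dvd 4 * (int p * m1) - (2 * e1 + 1) * (2 * e1 + 1)"
   using d1 d2 by (intro dvd_diff dvd_mult mult_dvd_mono) auto
  also have "4 * (int p * m1) - (2 * e1 + 1) * (2 * e1 + 1) = int D"
  proof -
   have "int D = 4 * int q - 1" using D_q by linarith
   thus ?thesis unfolding m1[symmetric] by (simp add: power2_eq_square algebra_simps)
  qed
  finally have "int (p * p) dvd int D" by simp
  hence pp: "p * p dvd D" by (simp only: int_dvd_int_iff)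
  hence "p dvd D" by (rule dvd_mult_left)
  hence pD: "p = D" using p D_prime by (simp add: primes_dvd_imp_eq)
  have "D * D \<le> D" using pp D_gt unfolding pD by (intro dvd_imp_le) simp_all
  moreover have "4 * D \<le> D * D" using D_gt by simp
  ultimately show False using D_gt by linarith
 qed
 then obtain b' where b': "b = int p * b'" by blast
 have "of_int (int p) * \<eta> = of_int (int p) * el (a + e1 * b') b'"
  using ab unfolding elp el_of_int b' by (simp add: algebra_simps)
 hence \<eta>el: "\<eta> = el (a + e1 * b') b'" using p1 by simp
 have "(of_int ((a + e1 * b') * (a + e1 * b') + (a + e1 * b') * b' + int q * b' * b') :: complex) = of_int 1"
  using \<eta>1 unfolding \<eta>el el_norm by simp
 hence "(a + e1 * b') * (a + e1 * b') + (a + e1 * b') * b' + int q * b' * b' = 1" by (simp only: of_int_eq_iff)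
 from norm_form_one[OF this] have "\<eta> = 1 \<or> \<eta> = - 1" unfolding \<eta>el by (auto simp: el_def)
 hence "\<mu>' = \<mu> \<or> \<mu>' = - \<mu>" using \<mu>0 by (auto simp: \<eta>_def field_simps)
 hence "\<mu>' * el n 0 = \<mu> * el n 0 \<or> \<mu>' * el n 0 = - (\<mu> * el n 0)" by auto
 hence "el (s' * n + t' * e + t') (- t') = el (s * n + t * e + t) (- t) \<or>
   el (s' * n + t' * e + t') (- t') = - el (s * n + t * e + t) (- t)"
  unfolding \<mu>_def \<mu>'_def multiplier_basis[OF nd] .
 thus ?thesis
 proof
  assume "el (s' * n + t' * e + t') (- t') = el (s * n + t * e + t) (- t)"
  hence "t' = t" "s' * n = s * n" by (auto simp: el_eq_iff)
  thus ?thesis using n1 by simp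
 next
  assume "el (s' * n + t' * e + t') (- t') = - el (s * n + t * e + t) (- t)"
  hence t: "t' = - t" and "s' * n + t' * e + t' = - (s * n + t * e + t)" by (auto simp: el_minus el_eq_iff)
  hence "s' * n = (- s) * n" by simp
  hence "s' = - s" using n1 by (simp only: mult_cancel_right) simp
  thus ?thesis using t by simp
 qed
qed

lemma hnf_shift: "hnf g n (e mod n) = hnf g n e"
proof -
 have "hnf g n (e + n * k) \<subseteq> hnf g n e" for e k
 proof
  fix z assume "z \<in> hnf g n (e + n * k)"
  then obtain x y where "z = el (g * (n * x + (e + n * k) * y)) (g * y)" by (auto simp: hnf_def)
  moreover have "n * x + (e + n * k) * y = n * (x + k * y) + e * y" by (simp add: algebra_simps)
  ultimately show "z \<in> hnf g n e" unfolding hnf_def by auto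
 qed
 from this[of e "- (e div n)"] this[of "e mod n" "e div n"] show ?thesis
  by (auto simp: minus_mult_div_eq_mod)
qed

text \<open>Points of value p map to ideals of norm p in the class, and by
  \<open>class_ideal_fibre\<close> a fibre has at most two elements, x and - x.\<close>

lemma class_ideal_count_ge:
 assumes nd: "ideal_data n e" and p: "prime p"
  and C: "\<And>J. J \<in> C \<longleftrightarrow> fractional_ideal D J \<and> (\<exists>\<alpha>\<in>quad_field D - {0}. J = (*) \<alpha> ` hnf 1 n e)"
 shows "card {x. case_prod (data_form n e) x = int p} \<le> 2 * class_ideal_count D C p"
proof -
 define T where "T = {I \<in> C. I \<subseteq> quad_integers D \<and> ideal_norm D I = p}"
 define S where "S = {x. case_prod (data_form n e) x = int p}"
 have p1: "p \<ge> 1" using p prime_ge_1_nat by blast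
 have D0: "D > 0" using D_gt by simp
 have "finite {x. real_of_int (case_prod (qf n (2 * e + 1) ((e\<^sup>2 + e + int q) div n)) x) \<le> real p}"
  using p1 by (intro form_count_le[OF data_form_disc[OF nd] D0]) simp
 moreover have "S \<subseteq> {x. real_of_int (case_prod (qf n (2 * e + 1) ((e\<^sup>2 + e + int q) div n)) x) \<le> real p}"
  by (auto simp: S_def data_form_def)
 ultimately have finS: "finite S" by (rule finite_subset[rotated])
 \<comment> \<open>\<open>class_ideal_count\<close> is a \<open>card\<close>, which is 0 on infinite
   sets, so the ideals of norm p must first be confined to finitely many normal forms.\<close>
 have "T \<subseteq> (\<lambda>(g, n, e). hnf g n e) ` ({1..int p} \<times> {1..int p} \<times> {0..int p})"
 proof
  fix I assume I: "I \<in> T"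
  hence "fractional_ideal D I" "I \<subseteq> quad_integers D" "ideal_norm D I = p" using C by (auto simp: T_def)
  then obtain g n' e' where h: "g \<ge> 1" "ideal_data n' e'" "I = hnf g n' e'"
   using integral_ideal_hnf by metis
  have n': "n' \<ge> 1" using h(2) by (simp add: ideal_data_def)
  have "nat (g * g * n') = p" using ideal_norm_hnf[OF h(1) n'] \<open>ideal_norm D I = p\<close> h(3) by simp
  hence gp: "g * g * n' = int p" using p1 by linarith
  have "g * 1 \<le> g * (g * n')" using h(1) n' mult_mono[of 1 g 1 n'] by (intro mult_left_mono) auto
  hence g1: "g \<le> int p" using gp by (simp add: mult.assoc)
  have "1 * n' \<le> (g * g) * n'" using h(1) n' mult_mono[of 1 g 1 g] by (intro mult_right_mono) auto
  hence n1: "n' \<le> int p" using gp by simp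
  have "0 \<le> e' mod n'" "e' mod n' < n'" using n' by simp_all
  hence "0 \<le> e' mod n'" "e' mod n' \<le> int p" using n1 by linarith+
  hence "(g, n', e' mod n') \<in> {1..int p} \<times> {1..int p} \<times> {0..int p}" using g1 n1 h(1) n'
   by (simp only: mem_Sigma_iff atLeastAtMost_iff simp_thms)
  moreover have "I = (\<lambda>(g, n, e). hnf g n e) (g, n', e' mod n')" using h(3) hnf_shift by simp
  ultimately show "I \<in> (\<lambda>(g, n, e). hnf g n e) ` ({1..int p} \<times> {1..int p} \<times> {0..int p})" by blast
 qed
 hence finT: "finite T" by (rule finite_subset) auto
 define f where "f = (\<lambda>(s, t). class_ideal n e s t)"
 have "card S \<le> 2 * card T"
 proof (rule card_le_twice_fibres[OF finS, of f])
  fix x assume x: "x \<in> S"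
  obtain s t where st: "x = (s, t)" by (cases x)
  have "{y \<in> S. f y = f x} \<subseteq> {(s, t), (- s, - t)}"
  proof
   fix y assume y: "y \<in> {y \<in> S. f y = f x}"
   obtain s' t' where st': "y = (s', t')" by (cases y)
   have "(s' = s \<and> t' = t) \<or> (s' = - s \<and> t' = - t)"
    by (rule class_ideal_fibre[OF nd p]) (use x y st st' in \<open>auto simp: S_def f_def\<close>)
   thus "y \<in> {(s, t), (- s, - t)}" using st' by auto
  qed
  hence "card {y \<in> S. f y = f x} \<le> card {(s, t), (- s, - t)}" by (intro card_mono) auto
  also have "... \<le> 2" by (simp add: card_insert_if)
  finally show "card {y \<in> S. f y = f x} \<le> 2" .
 next
  show "f ` S \<subseteq> T"
  proof
   fix I assume "I \<in> f ` S"
   then obtain s t where st: "I = class_ideal n e s t" "data_form n e s t = int p" by (auto simp: f_def S_def)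
   have nz: "(s, t) ~= (0, 0)" using st(2) p1 by (auto simp: data_form_def qf_def)
   have fr: "fractional_ideal D I" unfolding st(1) by (rule class_ideal_fractional[OF nd nz])
   have sub: "I \<subseteq> quad_integers D" unfolding st(1) by (rule class_ideal_subset)
   obtain g n' e' where h: "g \<ge> 1" "ideal_data n' e'" "I = hnf g n' e'"
    using integral_ideal_hnf[OF fr sub] by metis
   have n': "n' \<ge> 1" using h(2) by (simp add: ideal_data_def)
   have "int p = g * g * n'" using class_ideal_hnf[OF nd _ h(1) n'] st h(3) by metis
   hence "ideal_norm D I = p" unfolding h(3) ideal_norm_hnf[OF h(1) n'] by simp
   moreover have "I \<in> C" unfolding C using fr multiplier_quad_field[OF nd nz] class_ideal_eq[OF nd] st(1) by blast
   ultimately show "I \<in> T" using sub by (simp add: T_def)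
  qed
 qed (rule finT)
 thus ?thesis unfolding S_def T_def class_ideal_count_def .
qed

text \<open>The integral ideals of norm at most y; t is reduced modulo n so that each ideal has only
  one triple.\<close>

definition hnf_triples :: "nat => (int \<times> int \<times> int) set" where
 "hnf_triples y = {(k, n, t). 1 \<le> k \<and> 0 \<le> t \<and> t < n \<and> ideal_data n t \<and> k * k * n \<le> int y}"

lemma finite_hnf_triples: "finite (hnf_triples y)"
proof (rule finite_subset)
 show "hnf_triples y \<subseteq> {1..int y} \<times> {1..int y} \<times> {0..int y}"
 proof
  fix x assume "x \<in> hnf_triples y"
  then obtain k n t where x: "x = (k, n, t)" "1 \<le> k" "0 \<le> t" "t < n" "ideal_data n t" "k * k * n \<le> int y"
   by (auto simp: hnf_triples_def)
  have n: "n \<ge> 1" using x(5) by (simp add: ideal_data_def)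
  have "k * 1 \<le> k * (k * n)" using x n mult_mono[of 1 k 1 n] by (intro mult_left_mono) auto
  hence k: "k \<le> int y" using x(6) by (simp only: mult.assoc mult_1_right)
  have "1 * n \<le> (k * k) * n" using x n mult_mono[of 1 k 1 k] by (intro mult_right_mono) auto
  hence ny: "n \<le> int y" using x(6) by (simp only: mult_1_left)
  hence "t \<le> int y" using x(4) by linarith
  thus "x \<in> {1..int y} \<times> {1..int y} \<times> {0..int y}" using x n k ny by simp
 qed
qed simp

text \<open>The content k is recovered from the om-coordinates, k n from the rational members, and t
  modulo n from the member k (t + om).\<close>

lemma hnf_inj: "inj_on (\<lambda>(k, n, t). hnf k n t) (hnf_triples y)"
proof (rule inj_onI)
 fix x x' assume x: "x \<in> hnf_triples y" "x' \<in> hnf_triples y"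
  "(case x of (k, n, t) => hnf k n t) = (case x' of (k, n, t) => hnf k n t)"
 obtain k n t k' n' t' where e: "x = (k, n, t)" "x' = (k', n', t')" by (cases x, cases x') auto
 have h: "1 \<le> k" "0 \<le> t" "t < n" "1 \<le> k'" "0 \<le> t'" "t' < n'" using x e by (auto simp: hnf_triples_def)
 have eq: "hnf k n t = hnf k' n' t'" using x(3) e by simp
 have gen: "k' dvd k \<and> k' * n' dvd k * n" if "hnf k n t = hnf k' n' t'" "1 \<le> k'" for k n t k' n' t'
 proof -
  have "el (k * t) k \<in> hnf k' n' t'" unfolding that(1)[symmetric] el_hnf_iff by (intro exI[of _ 0] exI[of _ 1]) simp
  moreover have "el (k * n) 0 \<in> hnf k' n' t'" unfolding that(1)[symmetric] el_hnf_iff by (intro exI[of _ 1] exI[of _ 0]) simp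
  ultimately show ?thesis unfolding el_hnf_iff using that(2) by auto
 qed
 have "k = k'" using gen[OF eq h(4)] gen[OF eq[symmetric] h(1)] h by (auto intro: zdvd_antisym_nonneg)
 moreover have "k * n = k' * n'" using gen[OF eq h(4)] gen[OF eq[symmetric] h(1)] h
  by (intro zdvd_antisym_nonneg) auto
 ultimately have kn: "k = k'" "n = n'" using h by auto
 have "el (k * t) k \<in> hnf k' n' t'" unfolding eq[symmetric] el_hnf_iff by (intro exI[of _ 0] exI[of _ 1]) simp
 then obtain a b where ab: "k * t = k * (n * a + t' * b)" "k = k * b" unfolding el_hnf_iff kn by auto
 have "b = 1" using ab(2) h by simp
 hence "t = n * a + t'" using ab(1) h by simp
 hence "t mod n = t' mod n" by simp
 hence "t = t'" using h kn by simp
 thus "x = x'" using e kn by simp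
qed

text \<open>Every integral ideal of a class comes from some point of its form, with the norm as
  value. Choosing one such point for each ideal is injective, so a class has at most as many ideals
  as the ellipse has points.\<close>

lemma card_hnf_triples_le:
 assumes fin: "finite (ideal_classes D)" and y: "y \<ge> 1"
 shows "real (card (hnf_triples y)) \<le>
  real (class_number D) * (8 * quarter_area / sqrt (real D) * real y + 9 * sqrt (real y))"
proof -
 define F where "F = (\<lambda>(k, n, t). hnf k n t)"
 define B where "B = 8 * quarter_area / sqrt (real D) * real y + 9 * sqrt (real y)"
 have mem: "F x \<in> \<Union>(ideal_classes D)" if x: "x \<in> hnf_triples y" for x
 proof -
  obtain k n t where e: "x = (k, n, t)" by (cases x)
  have fr: "fractional_ideal D (F x)"
   unfolding F_def e using x e by (auto simp: hnf_triples_def intro!: hnf_fractional)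
  have "(F x, F x) \<in> ideal_equiv D"
   unfolding ideal_equiv_def using fr el_quad_field[of 1 0] by (auto simp: el_one intro!: bexI[of _ 1])
  hence "F x \<in> ideal_equiv D `` {F x}" by blast
  moreover have "ideal_equiv D `` {F x} \<in> ideal_classes D"
   unfolding ideal_classes_def using fr by (intro quotientI) simp
  ultimately show ?thesis by blast
 qed
 have each: "real (card {x \<in> hnf_triples y. F x \<in> C}) \<le> B" if C: "C \<in> ideal_classes D" for C
 proof -
  obtain n e where nd: "ideal_data n e"
   "\<And>J. J \<in> C \<longleftrightarrow> fractional_ideal D J \<and> (\<exists>\<alpha>\<in>quad_field D - {0}. J = (*) \<alpha> ` hnf 1 n e)"
   by (rule class_representative[OF C]) blast
  define S where "S = {x. real_of_int (case_prod (qf n (2 * e + 1) ((e\<^sup>2 + e + int q) div n)) x) \<le> real y}"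
  have S: "finite S" "real (card S) \<le> B"
   unfolding S_def B_def using y D_gt by (intro form_count_le[OF data_form_disc[OF nd(1)]]; simp)+
  have "\<exists>st. F x = case_prod (class_ideal n e) st" if "x \<in> hnf_triples y" "F x \<in> C" for x
  proof -
   have "F x \<subseteq> quad_integers D" unfolding F_def using hnf_subset by (cases x) auto
   moreover obtain \<alpha> where "\<alpha> ~= 0" "F x = (*) \<alpha> ` hnf 1 n e" using \<open>F x \<in> C\<close> nd(2) by blast
   ultimately show ?thesis using class_ideal_surj[OF nd(1), of \<alpha>] by auto
  qed
  then obtain G where G: "\<And>x. x \<in> hnf_triples y ==> F x \<in> C ==> F x = case_prod (class_ideal n e) (G x)"
   by metis
  have "inj_on G {x \<in> hnf_triples y. F x \<in> C}"
  proof (rule inj_onI)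
   fix x x' assume xx: "x \<in> {x \<in> hnf_triples y. F x \<in> C}" "x' \<in> {x \<in> hnf_triples y. F x \<in> C}" "G x = G x'"
   hence "F x = F x'" using G[of x] G[of x'] by simp
   thus "x = x'" unfolding F_def by (rule inj_onD[OF hnf_inj]) (use xx in auto)
  qed
  moreover have "G ` {x \<in> hnf_triples y. F x \<in> C} \<subseteq> S"
  proof
   fix z assume "z \<in> G ` {x \<in> hnf_triples y. F x \<in> C}"
   then obtain x where x: "x \<in> hnf_triples y" "F x \<in> C" "z = G x" by blast
   obtain k n' t where e: "x = (k, n', t)" by (cases x)
   obtain u v where uv: "z = (u, v)" by (cases z)
   have h: "1 \<le> k" "n' \<ge> 1" "k * k * n' \<le> int y" using x(1) e by (auto simp: hnf_triples_def ideal_data_def)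
   have "F x = hnf k n' t" by (simp add: F_def e)
   hence "class_ideal n e u v = hnf k n' t" using G[OF x(1,2)] unfolding x(3)[symmetric] uv by simp
   from class_ideal_hnf[OF nd(1) this h(1,2)] have "data_form n e u v \<le> int y" using h(3) by simp
   thus "z \<in> S" unfolding S_def uv by (simp add: data_form_def)
  qed
  ultimately have "card {x \<in> hnf_triples y. F x \<in> C} \<le> card S" using S(1) by (rule card_inj_on_le)
  thus ?thesis using S(2) by simp
 qed
 have "hnf_triples y = (\<Union>C\<in>ideal_classes D. {x \<in> hnf_triples y. F x \<in> C})" using mem by blast
 hence "card (hnf_triples y) \<le> (\<Sum>C\<in>ideal_classes D. card {x \<in> hnf_triples y. F x \<in> C})"
  using card_UN_le[OF fin, of "\<lambda>C. {x \<in> hnf_triples y. F x \<in> C}"] by simp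
 hence "real (card (hnf_triples y)) \<le> (\<Sum>C\<in>ideal_classes D. real (card {x \<in> hnf_triples y. F x \<in> C}))"
  unfolding of_nat_sum[symmetric] of_nat_le_iff .
 also have "... \<le> (\<Sum>C\<in>ideal_classes D. B)" by (rule sum_mono) (rule each)
 finally show ?thesis by (simp add: class_number_def B_def)
qed

end

section \<open>The class number inequality\<close>

context imag_quad
begin

definition roots :: "nat => int set" where
 "roots n = {t \<in> {0..<int n}. int n dvd t\<^sup>2 + t + int q}"

text \<open>The number of normal forms of norm m: k is the content, and the roots are the admissible
  residues modulo m / k^2.\<close>

definition ideal_count :: "nat => nat" where
 "ideal_count m = card (SIGMA k:{k. k * k dvd m}. roots (m div (k * k)))"

lemma finite_roots: "finite (roots n)"
 by (rule finite_subset[of _ "{0..<int n}"]) (auto simp: roots_def)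

lemma finite_square_divisors: "m > 0 ==> finite {k. k * k dvd m}" for m :: nat
proof (rule finite_subset[of _ "{..m}"])
 assume m: "m > 0"
 show "{k. k * k dvd m} \<subseteq> {..m}"
 proof
  fix k assume "k \<in> {k. k * k dvd m}"
  hence "k dvd m" by (auto intro: dvd_mult_left)
  thus "k \<in> {..m}" using m by (simp add: dvd_imp_le)
 qed
qed simp

lemma ideal_count_eq: "m > 0 ==> ideal_count m = (\<Sum>k\<in>{k. k * k dvd m}. card (roots (m div (k * k))))"
 unfolding ideal_count_def using finite_square_divisors finite_roots by (subst card_SigmaI) auto

lemma mod_root_iff: "int n dvd (t mod int n)\<^sup>2 + t mod int n + int q \<longleftrightarrow> int n dvd t\<^sup>2 + t + int q"
proof -
 have "[(t mod int n)\<^sup>2 + t mod int n + int q = t\<^sup>2 + t + int q] (mod int n)"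
  by (intro cong_add cong_pow cong_mod_left cong_refl) auto
 thus ?thesis by (rule cong_dvd_iff)
qed

lemma mod_in_roots: "n \<ge> 1 ==> int n dvd t\<^sup>2 + t + int q ==> t mod int n \<in> roots n"
 by (simp add: roots_def mod_root_iff)

lemma card_roots_mult:
 assumes "coprime m n" "m \<ge> 1" "n \<ge> 1"
 shows "card (roots (m * n)) = card (roots m) * card (roots n)"
proof -
 define F where "F = (\<lambda>x. (x mod int m, x mod int n))"
 have bij: "bij_betw F {0..<int (m * n)} ({0..<int m} \<times> {0..<int n})"
  unfolding F_def by (rule crt_bij[OF assms])
 have cop: "coprime (int m) (int n)" using assms(1) by simp
 have iff: "int (m * n) dvd x \<longleftrightarrow> int m dvd x \<and> int n dvd x" for x
  using cop by (auto intro: divides_mult dvd_mult_left dvd_mult_right)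
 have "F ` roots (m * n) = roots m \<times> roots n"
 proof (intro equalityI subsetI)
  fix y assume "y \<in> F ` roots (m * n)"
  then obtain x where "x \<in> roots (m * n)" "y = F x" by blast
  thus "y \<in> roots m \<times> roots n"
   using assms by (auto simp: roots_def iff F_def mod_root_iff simp del: of_nat_mult)
 next
  fix y assume y: "y \<in> roots m \<times> roots n"
  hence "y \<in> {0..<int m} \<times> {0..<int n}" by (auto simp: roots_def)
  hence "y \<in> F ` {0..<int (m * n)}" using bij by (simp only: bij_betw_def)
  then obtain x where x: "x \<in> {0..<int (m * n)}" "y = F x" by blast
  have "x \<in> roots (m * n)"
   using y x by (auto simp: roots_def iff F_def mod_root_iff simp del: of_nat_mult)
  thus "y \<in> F ` roots (m * n)" using x(2) by blast
 qed
 moreover have "inj_on F (roots (m * n))"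
  by (rule inj_on_subset[OF bij_betw_imp_inj_on[OF bij]]) (auto simp: roots_def)
 ultimately have "card (roots m \<times> roots n) = card (roots (m * n))" by (metis card_image)
 thus ?thesis by (simp add: card_cartesian_product)
qed

text \<open>Contents k and l of coprime m and n give distinct contents k l of m n, and the numbers
  of roots multiply by the Chinese remainder theorem.\<close>

lemma ideal_count_mult:
 assumes co: "coprime m n" and pos: "m > 0" "n > 0"
 shows "ideal_count m * ideal_count n \<le> ideal_count (m * n)"
proof -
 define K where "K m = {k. k * k dvd m}" for m :: nat
 define P where "P = (\<lambda>(k, l). k * l :: nat)"
 have cop: "coprime k l" "coprime k n" "coprime l m" if "k \<in> K m" "l \<in> K n" for k l
 proof -
  have "k dvd m" "l dvd n" using that by (auto simp: K_def intro: dvd_mult_left)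
  thus "coprime k l" "coprime k n" "coprime l m" using co
   by (meson coprime_commute coprime_divisors dvd_refl)+
 qed
 have inj: "inj_on P (K m \<times> K n)"
 proof (rule inj_onI)
  have gen: "k dvd k'" if "k * l = k' * l'" "coprime k l'" for k l k' l' :: nat
  proof -
   have "k dvd k' * l'" using that(1) by (metis dvd_triv_left)
   thus ?thesis using that(2) by (simp add: coprime_dvd_mult_left_iff)
  qed
  fix x y assume xy: "x \<in> K m \<times> K n" "y \<in> K m \<times> K n" "P x = P y"
  obtain k l k' l' where e: "x = (k, l)" "y = (k', l')" by (cases x, cases y) auto
  have kk: "k \<in> K m" "l \<in> K n" "k' \<in> K m" "l' \<in> K n" "k * l = k' * l'" using xy e by (auto simp: P_def)
  have "k dvd k'" by (rule gen[OF kk(5) cop(1)[OF kk(1,4)]])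
  moreover have "k' dvd k" by (rule gen[OF kk(5)[symmetric] cop(1)[OF kk(3,2)]])
  ultimately have "k = k'" by (rule dvd_antisym)
  moreover have "k > 0" using kk(1) pos by (cases "k = 0") (auto simp: K_def)
  ultimately show "x = y" using kk(5) e by simp
 qed
 have fin: "finite (K m)" "finite (K n)" "finite (K (m * n))"
  unfolding K_def using finite_square_divisors pos by auto
 have summand: "card (roots (m * n div (k * l * (k * l)))) = card (roots (m div (k * k))) * card (roots (n div (l * l)))"
  if "k \<in> K m" "l \<in> K n" for k l
 proof -
  have "k * k dvd m" "l * l dvd n" using that by (simp_all add: K_def)
  then obtain m' n' where mn: "m = (k * k) * m'" "n = (l * l) * n'" by (blast elim: dvdE)
  have "k > 0" "l > 0" "m' \<ge> 1" "n' \<ge> 1" using mn pos by (auto simp: Suc_le_eq)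
  moreover have "coprime m' n'" using co unfolding mn by simp
  moreover have "m * n = (k * l * (k * l)) * (m' * n')" unfolding mn by (simp add: mult_ac)
  ultimately show ?thesis using card_roots_mult[of m' n'] mn by simp
 qed
 have "ideal_count m * ideal_count n = (\<Sum>k\<in>K m. card (roots (m div (k * k)))) * (\<Sum>l\<in>K n. card (roots (n div (l * l))))"
  using ideal_count_eq pos by (simp add: K_def)
 also have "... = (\<Sum>x\<in>K m \<times> K n. card (roots (m div (fst x * fst x))) * card (roots (n div (snd x * snd x))))"
  unfolding sum_product sum.cartesian_product by (simp add: case_prod_unfold)
 also have "... = (\<Sum>x\<in>K m \<times> K n. card (roots (m * n div (P x * P x))))"
  by (rule sum.cong[OF refl]) (auto simp: P_def summand)
 also have "... = (\<Sum>k\<in>P ` (K m \<times> K n). card (roots (m * n div (k * k))))"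
  using inj by (simp add: sum.reindex)
 also have "... \<le> (\<Sum>k\<in>K (m * n). card (roots (m * n div (k * k))))"
 proof (rule sum_mono2[OF fin(3)])
  show "P ` (K m \<times> K n) \<subseteq> K (m * n)"
  proof
   fix j assume "j \<in> P ` (K m \<times> K n)"
   then obtain k l where "j = k * l" "k * k dvd m" "l * l dvd n" by (auto simp: P_def K_def)
   hence "(k * k) * (l * l) dvd m * n" "j * j = (k * k) * (l * l)" by (auto intro: mult_dvd_mono)
   thus "j \<in> K (m * n)" by (simp add: K_def)
  qed
 qed simp
 also have "... = ideal_count (m * n)" using ideal_count_eq pos by (simp add: K_def)
 finally show ?thesis .
qed

text \<open>The contents of p^(k+2) divisible by p correspond to the contents of p^k with the same
  quotient, and the content 1 adds the roots modulo p^(k+2).\<close>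

lemma ideal_count_step:
 assumes p: "prime p"
 shows "card (roots (p ^ k)) \<le> ideal_count (p ^ k)"
  and "ideal_count (p ^ k) + card (roots (p ^ (k + 2))) \<le> ideal_count (p ^ (k + 2))"
proof -
 have p0: "p > 1" "p > 0" using prime_gt_1_nat[OF p] by auto
 define K where "K m = {k. k * k dvd m}" for m :: nat
 define N where "N j = card (roots j)" for j
 have fin: "finite (K (p ^ k))" for k unfolding K_def using finite_square_divisors p0 by simp
 have eq: "ideal_count (p ^ k) = (\<Sum>j\<in>K (p ^ k). N (p ^ k div (j * j)))" for k
  using ideal_count_eq p0 by (simp add: K_def N_def)
 have "1 \<in> K (p ^ k)" by (simp add: K_def)
 thus "card (roots (p ^ k)) \<le> ideal_count (p ^ k)"
  using member_le_sum[of 1 "K (p ^ k)" "\<lambda>j. N (p ^ k div (j * j))"] fin unfolding eq by (simp add: N_def)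
 have pp: "p ^ (k + 2) = (p * p) * p ^ k" by (simp add: mult_ac)
 have inj: "inj_on ((*) p) (K (p ^ k))" using p0 by (auto simp: inj_on_def)
 have "ideal_count (p ^ k) = (\<Sum>j\<in>K (p ^ k). N (p ^ (k + 2) div ((p * j) * (p * j))))"
  unfolding eq
 proof (rule sum.cong[OF refl])
  fix j
  have "(p * j) * (p * j) = (p * p) * (j * j)" by (simp add: mult_ac)
  hence "p ^ (k + 2) div ((p * j) * (p * j)) = (p * p) * p ^ k div ((p * p) * (j * j))" by (simp only: pp)
  also have "... = p ^ k div (j * j)" using p0 by (intro div_mult_mult1) simp
  finally show "N (p ^ k div (j * j)) = N (p ^ (k + 2) div ((p * j) * (p * j)))" by simp
 qed
 also have "... = (\<Sum>j\<in>(*) p ` K (p ^ k). N (p ^ (k + 2) div (j * j)))"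
  unfolding sum.reindex[OF inj] comp_def ..
 finally have old: "ideal_count (p ^ k) = (\<Sum>j\<in>(*) p ` K (p ^ k). N (p ^ (k + 2) div (j * j)))" .
 have notin: "1 \<notin> (*) p ` K (p ^ k)"
 proof
  assume "1 \<in> (*) p ` K (p ^ k)"
  then obtain i where "1 = p * i" by blast
  hence "p dvd 1" by (rule dvdI)
  thus False using p0 by simp
 qed
 have "(\<Sum>j\<in>insert 1 ((*) p ` K (p ^ k)). N (p ^ (k + 2) div (j * j))) =
   N (p ^ (k + 2) div (1 * 1)) + (\<Sum>j\<in>(*) p ` K (p ^ k). N (p ^ (k + 2) div (j * j)))"
  by (rule sum.insert[OF finite_imageI[OF fin] notin])
 hence "ideal_count (p ^ k) + N (p ^ (k + 2)) =
   (\<Sum>j\<in>insert 1 ((*) p ` K (p ^ k)). N (p ^ (k + 2) div (j * j)))"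
  unfolding old[symmetric] by (simp only: mult_1_right div_by_1 add.commute)
 also have "... \<le> (\<Sum>j\<in>K (p ^ (k + 2)). N (p ^ (k + 2) div (j * j)))"
 proof (rule sum_mono2[OF fin])
  show "insert 1 ((*) p ` K (p ^ k)) \<subseteq> K (p ^ (k + 2))"
  proof
   fix j assume "j \<in> insert 1 ((*) p ` K (p ^ k))"
   then consider "j = 1" | i where "j = p * i" "i * i dvd p ^ k" by (auto simp: K_def)
   thus "j \<in> K (p ^ (k + 2))"
   proof cases
    case 2
    have "(p * p) * (i * i) dvd (p * p) * p ^ k" using 2(2) by (rule mult_dvd_mono[OF dvd_refl])
    moreover have "j * j = (p * p) * (i * i)" using 2(1) by (simp add: mult_ac)
    ultimately show ?thesis by (simp only: K_def pp mem_Collect_eq)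
   qed (simp add: K_def)
  qed
 qed simp
 finally show "ideal_count (p ^ k) + card (roots (p ^ (k + 2))) \<le> ideal_count (p ^ (k + 2))"
  unfolding eq[of "k + 2"] N_def .
qed

section \<open>Roots modulo prime powers\<close>

lemma four_root: "4 * (t\<^sup>2 + t + int q) = (2 * t + 1)\<^sup>2 + int D"
proof -
 have "int D = 4 * int q - 1" using D_q by linarith
 thus ?thesis by (simp add: power2_eq_square algebra_simps)
qed

lemma kron_prime: "prime p ==> kron D p = of_int (kronecker_prime (- int D) p)"
 using prime_gt_0_nat[of p] by (simp add: kron_def kronecker_def prime_factorization_prime)

lemma D_mod_4: "[D = 3] (mod 4)"
 using D_q unfolding cong_def by presburger

text \<open>A square root of -D modulo p can be written as 2 t + 1, after adding p if its parity is
  wrong. At p = 2 the value 1 of the symbol means that q is even, and then t = 0 is a root.\<close>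

lemma root_of_split:
 assumes p: "prime p" and X: "kron D p = 1"
 shows "\<exists>t. int p dvd t\<^sup>2 + t + int q \<and> \<not> int p dvd 2 * t + 1"
proof -
 have kp: "kronecker_prime (- int D) p = 1" using X kron_prime[OF p] by simp
 show ?thesis
 proof (cases "p = 2")
  case True
  have "(- int D) mod 8 = 1 \<or> (- int D) mod 8 = 7"
   using kp True by (auto simp: kronecker_prime_def split: if_splits)
  moreover have "- int D = 1 - 4 * int q" using D_q by linarith
  ultimately have "even (int q)" by presburger
  thus ?thesis using True by (intro exI[of _ 0]) simp
 next
  case False
  have "Legendre (- int D) (int p) = 1" using kp False by (simp add: kronecker_prime_def)
  hence L: "\<not> [- int D = 0] (mod int p)" "QuadRes (int p) (- int D)"
   by (auto simp: Legendre_def split: if_splits)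
  then obtain y where "[y\<^sup>2 = - int D] (mod int p)" by (auto simp: QuadRes_def)
  hence y: "int p dvd y\<^sup>2 + int D" by (simp add: cong_iff_dvd_diff)
  have odd: "odd p" using False p primes_dvd_imp_eq two_is_prime_nat by blast
  have "\<exists>t. int p dvd (2 * t + 1) - y"
  proof (cases "even y")
   case True
   have "even (y + int p - 1)" using True odd by simp
   then obtain t where "y + int p - 1 = 2 * t" by blast
   hence "(2 * t + 1) - y = int p" by simp
   thus ?thesis by (metis dvd_refl)
  next
   case False
   then obtain t where "y = 2 * t + 1" by (auto elim: oddE)
   hence "(2 * t + 1) - y = 0" by simp
   thus ?thesis by (metis dvd_0_right)
  qed
  then obtain t where t: "int p dvd (2 * t + 1) - y" by blast
  have "(2 * t + 1)\<^sup>2 + int D = ((2 * t + 1) - y) * ((2 * t + 1) + y) + (y\<^sup>2 + int D)"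
   by (simp add: power2_eq_square algebra_simps)
  moreover have "int p dvd ((2 * t + 1) - y) * ((2 * t + 1) + y) + (y\<^sup>2 + int D)"
   by (rule dvd_add[OF dvd_mult2[OF t] y])
  ultimately have d: "int p dvd (2 * t + 1)\<^sup>2 + int D" by (simp only:)
  hence "int p dvd 4 * (t\<^sup>2 + t + int q)" by (simp only: four_root)
  moreover have "coprime (int p) 4"
  proof -
   have "coprime (int p) 2" using odd by simp
   hence "coprime (int p) (2 ^ 2)" by (simp only: coprime_power_right_iff) simp
   thus ?thesis by simp
  qed
  ultimately have "int p dvd t\<^sup>2 + t + int q" by (simp only: coprime_dvd_mult_right_iff)
  moreover have "\<not> int p dvd 2 * t + 1"
  proof
   assume "int p dvd 2 * t + 1"
   hence "int p dvd (2 * t + 1)\<^sup>2" by (simp add: power2_eq_square)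
   hence "int p dvd int D" using d by (simp add: dvd_add_right_iff)
   thus False using L(1) by (simp add: cong_iff_dvd_diff)
  qed
  ultimately show ?thesis by blast
 qed
qed

text \<open>Hensel lifting, possible because p does not divide the derivative 2 t + 1. The second
  root is -1 - t, distinct from t for the same reason.\<close>

lemma card_roots_split:
 assumes p: "prime p" and X: "kron D p = 1" and i: "i \<ge> 1"
 shows "2 \<le> card (roots (p ^ i))"
proof -
 obtain t0 where t0: "int p dvd t0\<^sup>2 + t0 + int q" "\<not> int p dvd 2 * t0 + 1" using root_of_split[OF p X] by blast
 have p1: "p > 1" using prime_gt_1_nat[OF p] .
 have "\<exists>t. int (p ^ i) dvd t\<^sup>2 + t + int q \<and> \<not> int p dvd 2 * t + 1"
  using i
 proof (induction i rule: dec_induct)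
  case base
  show ?case using t0 by auto
 next
  case (step i)
  then obtain t where t: "int (p ^ i) dvd t\<^sup>2 + t + int q" "\<not> int p dvd 2 * t + 1" by blast
  define P where "P = int (p ^ i)"
  have Pp: "int p dvd P" using step(1) unfolding P_def by (cases i) auto
  obtain w where w: "t\<^sup>2 + t + int q = P * w" using t(1) unfolding P_def by blast
  have "coprime (2 * t + 1) (int p)" using t(2) p prime_imp_coprime[of "int p" "2 * t + 1"]
   by (simp add: coprime_commute)
  then obtain s0 where s0: "[(2 * t + 1) * s0 = 1] (mod int p)" using cong_solve_coprime_int by blast
  \<comment> \<open>The Newton correction - w / (2 t + 1) modulo p, with s0 the inverse of 2 t +
    1.\<close>
  define s where "s = - (w * s0)"
  have "int p dvd w * ((2 * t + 1) * s0 - 1)" using s0 by (simp add: cong_iff_dvd_diff)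
  moreover have "w + (2 * t + 1) * s = - (w * ((2 * t + 1) * s0 - 1))" by (simp add: s_def algebra_simps)
  ultimately have 1: "int p dvd w + (2 * t + 1) * s" by simp
  have "(t + P * s)\<^sup>2 + (t + P * s) + int q = (t\<^sup>2 + t + int q) + P * ((2 * t + 1) * s) + P * (P * (s * s))"
   by (simp add: power2_eq_square algebra_simps)
  also have "... = P * ((w + (2 * t + 1) * s) + P * (s * s))" unfolding w by (simp add: algebra_simps)
  finally have e: "(t + P * s)\<^sup>2 + (t + P * s) + int q = P * ((w + (2 * t + 1) * s) + P * (s * s))" .
  have "int p dvd (w + (2 * t + 1) * s) + P * (s * s)" by (rule dvd_add[OF 1 dvd_mult2[OF Pp]])
  hence "P * int p dvd (t + P * s)\<^sup>2 + (t + P * s) + int q" unfolding e by (rule mult_dvd_mono[OF dvd_refl])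
  moreover have "P * int p = int (p ^ Suc i)" by (simp add: P_def)
  moreover have "\<not> int p dvd 2 * (t + P * s) + 1"
  proof
   assume a: "int p dvd 2 * (t + P * s) + 1"
   have "2 * t + 1 = (2 * (t + P * s) + 1) - P * (2 * s)" by (simp add: algebra_simps)
   also have "int p dvd ..." by (rule dvd_diff[OF a dvd_mult2[OF Pp]])
   finally show False using t(2) by simp
  qed
  ultimately show ?case by metis
 qed
 then obtain t where t: "int (p ^ i) dvd t\<^sup>2 + t + int q" "\<not> int p dvd 2 * t + 1" by blast
 have "(- 1 - t)\<^sup>2 + (- 1 - t) + int q = t\<^sup>2 + t + int q" by (simp add: power2_eq_square algebra_simps)
 hence t': "int (p ^ i) dvd (- 1 - t)\<^sup>2 + (- 1 - t) + int q" using t(1) by (simp only:)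
 have pi: "p ^ i \<ge> 1" using p1 by simp
 have ne: "t mod int (p ^ i) ~= (- 1 - t) mod int (p ^ i)"
 proof
  assume "t mod int (p ^ i) = (- 1 - t) mod int (p ^ i)"
  hence "int (p ^ i) dvd t - (- 1 - t)" by (simp add: mod_eq_dvd_iff)
  moreover have "int p dvd int (p ^ i)" using i by (cases i) auto
  ultimately have "int p dvd t - (- 1 - t)" by (rule dvd_trans[rotated])
  thus False using t(2) by (simp add: algebra_simps)
 qed
 have "card {t mod int (p ^ i), (- 1 - t) mod int (p ^ i)} \<le> card (roots (p ^ i))"
  using mod_in_roots[OF pi t(1)] mod_in_roots[OF pi t'] by (intro card_mono finite_roots) simp
 thus ?thesis using ne by simp
qed

lemma card_roots_one: "card (roots 1) = 1"
proof -
 have "roots 1 = {0}" by (auto simp: roots_def)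
 thus ?thesis by simp
qed

lemma card_roots_ramified: "1 \<le> card (roots D)"
proof -
 \<comment> \<open>The double root: t = 2 q - 1 satisfies 2 t + 1 = D.\<close>
 have "(2 * int q - 1)\<^sup>2 + (2 * int q - 1) + int q = int q * (4 * int q - 1)"
  by (simp add: power2_eq_square algebra_simps)
 moreover have "4 * int q - 1 = int D" using D_q by linarith
 ultimately have "int D dvd (2 * int q - 1)\<^sup>2 + (2 * int q - 1) + int q" by simp
 from mod_in_roots[OF _ this] have "roots D ~= {}" using D_gt by auto
 hence "card (roots D) > 0" using finite_roots card_gt_0_iff by blast
 thus ?thesis by simp
qed

lemma ramified_prime:
 assumes p: "prime p" and X: "kron D p = 0"
 shows "p = D"
proof -
 have kp: "kronecker_prime (- int D) p = 0" using X kron_prime[OF p] by simp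
 have "odd D" using D_q by presburger
 hence "p ~= 2" using kp by (auto simp: kronecker_prime_def split: if_splits)
 hence "Legendre (- int D) (int p) = 0" using kp by (simp add: kronecker_prime_def)
 hence "[- int D = 0] (mod int p)" by (auto simp: Legendre_def split: if_splits)
 hence "int p dvd int D" by (simp add: cong_iff_dvd_diff)
 thus ?thesis using p D_prime by (simp add: primes_dvd_imp_eq)
qed

sublocale rc: real_character "kron D" D
 by (rule real_character_kron[OF D_prime D_mod_4 D_gt])

text \<open>In the split, ramified and inert cases the left side is k + 1, is 1, or is 1 for even k
  only. Going up two powers at a time, a split prime adds two roots in every step; in the other
  cases the ideals found at the lowest power suffice.\<close>

lemma lam_prime_power_le:
 assumes p: "prime p"
 shows "rc.lam (p ^ k) \<le> real (ideal_count (p ^ k))"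
proof -
 consider "kron D p = 1" | "kron D p = 0" | "kron D p = - 1" using rc.X_vals[of p] by auto
 thus ?thesis
 proof cases
  case 1
  have "Suc k \<le> ideal_count (p ^ k)"
  proof (induction k rule: less_induct)
   case (less k)
   consider "k = 0" | "k = 1" | j where "k = j + 2" by (metis One_nat_def add_2_eq_Suc' not0_implies_Suc)
   thus ?case
   proof cases
    case 1
    thus ?thesis using ideal_count_step(1)[OF p, of 0] card_roots_one by simp
   next
    case 2
    thus ?thesis using ideal_count_step(1)[OF p, of 1] card_roots_split[OF p \<open>kron D p = 1\<close>, of 1] by simp
   next
    case 3
    have "Suc j \<le> ideal_count (p ^ j)" using less[of j] 3 by simp
    thus ?thesis using ideal_count_step(2)[OF p, of j] card_roots_split[OF p \<open>kron D p = 1\<close>, of "j + 2"] 3 by simp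
   qed
  qed
  moreover have "rc.lam (p ^ k) = real (Suc k)" unfolding rc.lam_prime_power[OF p] 1 by simp
  ultimately show ?thesis by simp
 next
  case 2
  have pD: "p = D" by (rule ramified_prime[OF p 2])
  have "1 \<le> ideal_count (p ^ k)"
  proof (induction k rule: less_induct)
   case (less k)
   consider "k = 0" | "k = 1" | j where "k = j + 2" by (metis One_nat_def add_2_eq_Suc' not0_implies_Suc)
   thus ?case
   proof cases
    case 1
    thus ?thesis using ideal_count_step(1)[OF p, of 0] card_roots_one by simp
   next
    case 2
    thus ?thesis using ideal_count_step(1)[OF p, of 1] card_roots_ramified pD by simp
   next
    case 3
    have "1 \<le> ideal_count (p ^ j)" using less[of j] 3 by simp
    thus ?thesis using ideal_count_step(2)[OF p, of j] 3 by simp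
   qed
  qed
  moreover have "rc.lam (p ^ k) = 1" unfolding rc.lam_prime_power[OF p] 2 by (simp add: power_0_left)
  ultimately show ?thesis by simp
 next
  case 3
  have lam: "rc.lam (p ^ k) = (if even k then 1 else 0)"
   unfolding rc.lam_prime_power[OF p] 3 by (induction k) auto
  have "1 \<le> ideal_count (p ^ (2 * j))" for j
  proof (induction j)
   case 0
   thus ?case using ideal_count_step(1)[OF p, of 0] card_roots_one by simp
  next
   case (Suc j)
   thus ?case using ideal_count_step(2)[OF p, of "2 * j"] by simp
  qed
  thus ?thesis unfolding lam by (auto elim!: evenE)
 qed
qed

text \<open>Split off one full prime power at a time: \<open>lam\<close> is multiplicative, and
  \<open>ideal_count\<close> is at least as large as the product.\<close>

lemma lam_le_ideal_count: "n > 0 ==> rc.lam n \<le> real (ideal_count n)"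
proof (induction n rule: less_induct)
 case (less n)
 show ?case
 proof (cases "n = 1")
  case True
  thus ?thesis using lam_prime_power_le[OF two_is_prime_nat, of 0] by simp
 next
  case False
  then obtain p where p: "prime p" "p dvd n" using prime_factor_nat by blast
  define k where "k = multiplicity p n"
  obtain m where nm: "n = p ^ k * m" "\<not> p dvd m"
   using multiplicity_decompose'[of n p] p less.prems unfolding k_def by (metis not_prime_unit neq0_conv)
  have k: "k > 0" unfolding k_def using p less.prems by (simp add: prime_multiplicity_gt_zero_iff)
  have m0: "m > 0" using less.prems nm(1) by (cases "m = 0") auto
  have p1: "p > 1" using prime_gt_1_nat[OF p(1)] .
  have "1 < p ^ k" by (rule one_less_power[OF p1 k])
  hence "1 * m < p ^ k * m" using m0 by (rule mult_strict_right_mono)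
  hence "m < n" using nm(1) by (simp only: mult_1_left)
  have co: "coprime (p ^ k) m" using p(1) nm(2) by (simp add: prime_imp_coprime)
  have "rc.lam n = rc.lam (p ^ k * m)" using nm(1) by (rule arg_cong)
  also have "... = rc.lam (p ^ k) * rc.lam m" by (rule rc.lam_mult[OF co])
  also have "... \<le> real (ideal_count (p ^ k)) * real (ideal_count m)"
   using lam_prime_power_le[OF p(1)] less.IH[OF \<open>m < n\<close> m0] rc.lam_nonneg[OF m0] by (intro mult_mono) auto
  also have "... = real (ideal_count (p ^ k) * ideal_count m)" by simp
  also have "... \<le> real (ideal_count (p ^ k * m))"
   unfolding of_nat_le_iff by (rule ideal_count_mult[OF co _ m0]) (use p1 in simp)
  also have "p ^ k * m = n" by (rule nm(1)[symmetric])
  finally show ?thesis .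
 qed
qed

text \<open>A triple determines its norm k^2 n, so the normal forms belonging to different m are
  disjoint.\<close>

lemma sum_ideal_count_le: "(\<Sum>m\<in>{1..y}. ideal_count m) \<le> card (hnf_triples y)"
proof -
 define F where "F m = (SIGMA k:{k. k * k dvd m}. roots (m div (k * k)))" for m :: nat
 define g where "g m = (\<lambda>(k, t :: int). (int k, int (m div (k * k)), t))" for m :: nat
 have fin: "finite (F m)" if "m > 0" for m
  unfolding F_def using finite_square_divisors[OF that] finite_roots by blast
 have inj: "inj_on (g m) (F m)" for m by (auto simp: inj_on_def g_def)
 have rec: "case_prod (\<lambda>k. case_prod (\<lambda>n t. k * k * n)) (g m x) = int m" if "x \<in> F m" for m x
  using that by (auto simp: F_def g_def simp flip: of_nat_mult)
 have "ideal_count m = card (g m ` F m)" for m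
  unfolding card_image[OF inj] unfolding ideal_count_def F_def ..
 hence "(\<Sum>m\<in>{1..y}. ideal_count m) = (\<Sum>m\<in>{1..y}. card (g m ` F m))" by (simp only:)
 also have "... = card (\<Union>m\<in>{1..y}. g m ` F m)"
 proof (rule card_UN_disjoint[symmetric])
  show "\<forall>i\<in>{1..y}. \<forall>j\<in>{1..y}. i ~= j --> g i ` F i \<inter> g j ` F j = {}"
  proof (intro ballI impI)
   fix i j :: nat assume "i ~= j"
   show "g i ` F i \<inter> g j ` F j = {}"
   proof (rule ccontr)
    assume "g i ` F i \<inter> g j ` F j ~= {}"
    then obtain x x' where "x \<in> F i" "x' \<in> F j" "g i x = g j x'" by blast
    thus False using rec[of x i] rec[of x' j] \<open>i ~= j\<close> by simp
   qed
  qed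
 qed (use fin in auto)
 also have "... \<le> card (hnf_triples y)"
 proof (rule card_mono[OF finite_hnf_triples])
  show "(\<Union>m\<in>{1..y}. g m ` F m) \<subseteq> hnf_triples y"
  proof
   fix z assume "z \<in> (\<Union>m\<in>{1..y}. g m ` F m)"
   then obtain m k t where m: "1 \<le> m" "m \<le> y" "k * k dvd m" "t \<in> roots (m div (k * k))"
    "z = (int k, int (m div (k * k)), t)" by (auto simp: F_def g_def)
   obtain n where n: "m = k * k * n" using m(3) by blast
   have k: "k \<ge> 1" "n \<ge> 1" using m(1) n by (auto simp: Suc_le_eq)
   have mn: "m div (k * k) = n" using n k by simp
   have "int k * int k * int n = int m" using n by simp
   thus "z \<in> hnf_triples y" using m k unfolding mn
    by (auto simp: hnf_triples_def roots_def ideal_data_def)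
  qed
 qed
 finally show ?thesis .
qed

text \<open>Hyperbola method at U = sqrt y: for d up to U the rounding in y div d costs at most 1
  each, and for larger d the weights y div d decrease, so that the character sums cancel.\<close>

lemma sum_lam_ge:
 assumes L: "(\<lambda>n. kron D (Suc n) * real (Suc n) powr (- 1)) sums l" and U: "U \<ge> 1"
 shows "real U ^ 2 * l - (2 * real D + 1) * real U \<le> (\<Sum>n\<in>{1..U ^ 2}. rc.lam n)"
proof -
 define y where "y = U ^ 2"
 define X where "X = kron D"
 have Uy: "U \<le> y" unfolding y_def using U by (simp add: power2_eq_square)
 have "(\<Sum>n\<in>{1..y}. rc.lam n) = (\<Sum>d\<in>{1..y}. X d * real (y div d))"
  using rc.sum_lam[of "\<lambda>_. 1" y] by (simp add: X_def)
 also have "... = (\<Sum>d\<in>{1..U} \<union> {Suc U..y}. X d * real (y div d))"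
  using Uy by (intro sum.cong refl) auto
 also have "... = (\<Sum>d\<in>{1..U}. X d * real (y div d)) + (\<Sum>d\<in>{Suc U..y}. X d * real (y div d))"
  by (rule sum.union_disjoint) auto
 finally have split: "(\<Sum>n\<in>{1..y}. rc.lam n) = (\<Sum>d\<in>{1..U}. X d * real (y div d)) + (\<Sum>d\<in>{Suc U..y}. X d * real (y div d))" .
 have A: "real y * (\<Sum>d\<in>{1..U}. X d * real d powr (- 1)) - real U \<le> (\<Sum>d\<in>{1..U}. X d * real (y div d))"
 proof -
  have "X d * real (y div d) \<ge> real y * (X d * real d powr (- 1)) - 1" if "d \<in> {1..U}" for d
  proof -
   have d: "real d > 0" using that by simp
   have "real (y div d) = real_of_int \<lfloor>real y / real d\<rfloor>" by (simp add: floor_divide_of_nat_eq)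
   hence "\<bar>real y / real d - real (y div d)\<bar> \<le> 1" by linarith
   hence "\<bar>X d * (real y / real d - real (y div d))\<bar> \<le> 1 * 1"
    unfolding abs_mult using rc.abs_X_le[of d] unfolding X_def by (intro mult_mono) auto
   moreover have "real d powr (- 1) = 1 / real d" using d by (simp add: powr_minus_divide)
   hence "real y * (X d * real d powr (- 1)) = X d * (real y / real d)" by simp
   ultimately show ?thesis unfolding right_diff_distrib by linarith
  qed
  hence "(\<Sum>d\<in>{1..U}. real y * (X d * real d powr (- 1)) - 1) \<le> (\<Sum>d\<in>{1..U}. X d * real (y div d))"
   by (intro sum_mono) blast
  thus ?thesis by (simp add: sum_subtractf sum_distrib_left)
 qed
 have "l - real D * real U powr (- 1) \<le> (\<Sum>d\<in>{1..U}. X d * real d powr (- 1))"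
  using rc.L_tail[OF L zero_less_one U] unfolding X_def by linarith
 hence "real y * (l - real D * real U powr (- 1)) \<le> real y * (\<Sum>d\<in>{1..U}. X d * real d powr (- 1))"
  by (intro mult_left_mono) auto
 moreover have "real y * (l - real D * real U powr (- 1)) = real U ^ 2 * l - real D * real U"
 proof -
  have "real U powr (- 1) = 1 / real U" using U by (simp add: powr_minus_divide)
  moreover have "real U * real U * (real D * (1 / real U)) = real D * real U" using U by simp
  ultimately show ?thesis unfolding y_def by (simp add: power2_eq_square right_diff_distrib)
 qed
 ultimately have A': "real U ^ 2 * l - real D * real U - real U \<le> (\<Sum>d\<in>{1..U}. X d * real (y div d))" using A by linarith
 have B: "\<bar>\<Sum>d\<in>{Suc U..y}. X d * real (y div d)\<bar> \<le> real D * real U"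
 proof (cases "Suc U < Suc y")
  case True
  have "\<bar>\<Sum>d\<in>{Suc U..<Suc y}. X d * real (y div d)\<bar> \<le> real D * real (y div Suc U)"
   unfolding X_def by (rule rc.abs_X_weighted_sum_le) (use True in \<open>auto intro: div_le_mono2\<close>)
  also have "y div Suc U \<le> U * Suc U div Suc U" unfolding y_def by (rule div_le_mono) (simp add: power2_eq_square)
  hence "y div Suc U \<le> U" by (simp only: nonzero_mult_div_cancel_right nat.distinct simp_thms)
  hence "real D * real (y div Suc U) \<le> real D * real U" by (intro mult_left_mono) auto
  finally show ?thesis by (simp add: atLeastLessThanSuc_atLeastAtMost)
 next
  case False
  hence "{Suc U..y} = {}" by auto
  thus ?thesis by (simp only: sum.empty) simp
 qed
 have "(2 * real D + 1) * real U = real D * real U + (real D * real U + real U)" by (simp add: algebra_simps)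
 thus ?thesis using A' B split unfolding y_def[symmetric] by linarith
qed

text \<open>Both counts up to U^2 have a main term proportional to U^2 and, for fixed D, errors of
  order U, so a large U compares the coefficients. The bound is twice the value in the class number
  formula, since the points x and - x are not identified.\<close>

lemma class_number_inequality:
 assumes fin: "finite (ideal_classes D)" and L: "(\<lambda>n. kron D (Suc n) * real (Suc n) powr (- 1)) sums l"
 shows "l \<le> 8 * quarter_area / sqrt (real D) * real (class_number D)"
proof (rule ccontr)
 define K where "K = 8 * quarter_area / sqrt (real D) * real (class_number D)"
 define B where "B = 9 * real (class_number D) + 2 * real D + 1"
 assume "\<not> l \<le> 8 * quarter_area / sqrt (real D) * real (class_number D)"
 hence d: "l - K > 0" by (simp add: K_def)
 obtain U :: nat where U: "real U > B / (l - K)" using reals_Archimedean2 by blast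
 have B: "B > 0" unfolding B_def by (simp add: add_nonneg_pos)
 hence "B / (l - K) > 0" using d by simp
 hence U1: "U \<ge> 1" using U by simp
 have "real U ^ 2 * l - (2 * real D + 1) * real U \<le> (\<Sum>n\<in>{1..U ^ 2}. rc.lam n)" by (rule sum_lam_ge[OF L U1])
 also have "... \<le> (\<Sum>n\<in>{1..U ^ 2}. real (ideal_count n))" by (rule sum_mono) (use lam_le_ideal_count in auto)
 also have "... = real (\<Sum>n\<in>{1..U ^ 2}. ideal_count n)" by simp
 also have "... \<le> real (card (hnf_triples (U ^ 2)))" unfolding of_nat_le_iff by (rule sum_ideal_count_le)
 also have "... \<le> real (class_number D) * (8 * quarter_area / sqrt (real D) * real (U ^ 2) + 9 * sqrt (real (U ^ 2)))"
  by (rule card_hnf_triples_le[OF fin]) (use U1 in simp)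
 also have "... = real U * real U * K + 9 * real (class_number D) * real U"
  unfolding K_def by (simp add: real_sqrt_abs power2_eq_square algebra_simps)
 finally have "real U * (real U * (l - K)) \<le> real U * B" unfolding B_def by (simp add: power2_eq_square algebra_simps)
 hence "real U * (l - K) \<le> B" using U1 by (simp add: mult_le_cancel_left_pos)
 moreover have "B < real U * (l - K)" using U d by (simp add: pos_divide_less_eq)
 ultimately show False by simp
qed

end

section \<open>Sieving the values of a form\<close>

lemma prod_primes_dvd_iff:
 assumes "finite T" "\<And>p. p \<in> T ==> prime p"
 shows "int (\<Prod>T) dvd m \<longleftrightarrow> (\<forall>l\<in>T. int l dvd m)"
 using assms
proof (induction T rule: finite_induct)
 case (insert p F)
 have "coprime p (\<Prod>F)"
  by (rule prod_coprime_right) (use insert in \<open>auto intro!: primes_coprime\<close>)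
 hence "coprime (int p) (int (\<Prod>F))" by (simp only: coprime_int_iff)
 hence "int p * int (\<Prod>F) dvd m \<longleftrightarrow> int p dvd m \<and> int (\<Prod>F) dvd m"
  by (auto intro: divides_mult dvd_mult_left dvd_mult_right)
 moreover have "int (\<Prod>(insert p F)) = int p * int (\<Prod>F)" using insert.hyps by simp
 ultimately show ?case using insert by (simp only:) auto
qed simp

text \<open>A squarefree modulus d up to Z has remainder at most 9 d^2 E, and at most Z moduli
  occur; hence the factor Z^3.\<close>

lemma form_sieve:
 fixes G :: "nat => real"
 assumes red: "reduced_form D a b c" and D: "prime D"
  and sw: "sieve_weights sieve_densities P Z (3 / 2) U L"
  and P: "\<And>p. p \<in> P ==> prime p" and Z: "Z \<ge> 1"
  and G: "G 1 = 0" "G (Suc M) = 0" "\<And>n. G n \<ge> 0"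
 defines "S \<equiv> (\<Sum>x | x \<in> qf_points a b c M \<and> (\<forall>l\<in>P. \<not> int l dvd case_prod (qf a b c) x). G (nat (case_prod (qf a b c) x)))"
  and "X \<equiv> 8 * quarter_area / sqrt (real D) * (\<Sum>n\<in>{1..M}. G n)"
  and "V \<equiv> \<Prod>p\<in>P. 1 - real (rho a b c p) / (real p)\<^sup>2"
  and "E \<equiv> \<Sum>n\<in>{1..M}. \<bar>G n - G (Suc n)\<bar> * sqrt (real n)"
 shows "S \<le> 3 / 2 * X * V + 9 * Z ^ 3 * E" "1 / 2 * X * V - 9 * Z ^ 3 * E \<le> S"
proof -
 define Q where "Q x = case_prod (qf a b c) x" for x
 define g where "g p = real (rho a b c p) / (real p)\<^sup>2" for p
 have D0: "D > 0" using prime_gt_0_nat[OF D] .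
 have finP: "finite P" using sw by (simp add: sieve_weights_def)
 have form: "form_disc D a b c" using red by (simp add: reduced_form_def)
 have gd: "g \<in> sieve_densities"
  unfolding sieve_densities_def
 proof (intro CollectI allI impI conjI)
  fix p :: nat assume p: "prime p"
  have "1 \<le> p" using prime_ge_1_nat[OF p] .
  have "real (rho a b c p) \<le> real (2 * p - 1)" using rho_le_square rho_prime_le[OF p form D] by (simp only: of_nat_le_iff)
  also have "... = 2 * real p - 1" using \<open>1 \<le> p\<close> by (simp add: of_nat_diff)
  finally show "g p \<le> (2 * real p - 1) / (real p)\<^sup>2" unfolding g_def by (rule divide_right_mono) simp
 qed (simp add: g_def)
 have E0: "E \<ge> 0" unfolding E_def by (intro sum_nonneg) simp
 have X0: "X \<ge> 0" unfolding X_def using quarter_area_pos G(3) by (intro mult_nonneg_nonneg sum_nonneg) auto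
 have rem: "\<bar>(\<Sum>\<omega> | \<omega> \<in> qf_points a b c M \<and> T \<subseteq> {l \<in> P. int l dvd Q \<omega>}. G (nat (Q \<omega>))) - X * prod g T\<bar> \<le> 9 * Z ^ 2 * E"
  if T: "T \<subseteq> P" "real (\<Prod>T) \<le> Z" for T
 proof -
  have finT: "finite T" using T(1) finP by (rule finite_subset)
  have pT: "prime p" if "p \<in> T" for p using P T(1) that by blast
  define d where "d = \<Prod>T"
  have d1: "d \<ge> 1" unfolding d_def using prime_ge_1_nat[OF pT] by (intro prod_ge_1) auto
  have "T \<subseteq> {l \<in> P. int l dvd Q \<omega>} \<longleftrightarrow> int d dvd Q \<omega>" for \<omega>
   using prod_primes_dvd_iff[OF finT pT] T(1) unfolding d_def by blast
  moreover have "prod g T = real (rho a b c d) / (real d)\<^sup>2"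
   using rho_prod_primes[OF finT pT, of a b c] unfolding d_def g_def
   by (simp add: prod_dividef prod_power_distrib)
  ultimately have "\<bar>(\<Sum>\<omega> | \<omega> \<in> qf_points a b c M \<and> T \<subseteq> {l \<in> P. int l dvd Q \<omega>}. G (nat (Q \<omega>))) - X * prod g T\<bar>
    = \<bar>(\<Sum>\<omega> | \<omega> \<in> qf_points a b c M \<and> int d dvd Q \<omega>. G (nat (Q \<omega>))) -
     real (rho a b c d) / (real d)\<^sup>2 * (8 * quarter_area / sqrt (real D)) * (\<Sum>n\<in>{1..M}. G n)\<bar>"
   by (simp add: X_def mult_ac)
  also have "... \<le> 9 * (real d)\<^sup>2 * E" unfolding Q_def E_def by (rule weighted_count[OF red D0 d1 G(1,2)])
  also have "... \<le> 9 * Z ^ 2 * E"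
   using T(2)[folded d_def] E0 by (intro mult_right_mono mult_left_mono power_mono) auto
  finally show ?thesis .
 qed
 have R0: "0 \<le> 9 * Z ^ 2 * E" using E0 by simp
 have S: "S = (\<Sum>\<omega> | \<omega> \<in> qf_points a b c M \<and> {l \<in> P. int l dvd Q \<omega>} = {}. G (nat (Q \<omega>)))"
  unfolding S_def Q_def by (rule sum.cong) auto
 have ZR: "Z * (9 * Z ^ 2 * E) = 9 * Z ^ 3 * E" by (simp add: power3_eq_cube power2_eq_square)
 have fin: "finite (qf_points a b c M)" by (rule finite_qf_points[OF red D0])
 note sieve = sieve_weights_apply[OF sw gd fin, of "\<lambda>\<omega>. G (nat (Q \<omega>))" "\<lambda>\<omega>. {l \<in> P. int l dvd Q \<omega>}" X "9 * Z ^ 2 * E",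
   OF G(3) _ X0 R0 Z P rem]
 have "S \<le> 3 / 2 * X * (\<Prod>p\<in>P. 1 - g p) + Z * (9 * Z ^ 2 * E)" unfolding S by (rule sieve(1)) auto
 thus "S \<le> 3 / 2 * X * V + 9 * Z ^ 3 * E" unfolding ZR V_def g_def .
 have "(2 - 3 / 2) * X * (\<Prod>p\<in>P. 1 - g p) - Z * (9 * Z ^ 2 * E) \<le> S" unfolding S by (rule sieve(2)) auto
 thus "1 / 2 * X * V - 9 * Z ^ 3 * E \<le> S" unfolding ZR V_def g_def by simp
qed

text \<open>On the points u = p s + k v the form is p times one with coefficients a p, 2 a k + b,
  c', again of discriminant -D, whose reduction can be sieved. The weight p G(p n) gives back the
  shape of a weight on the values n and leaves the factor 1 / p outside.\<close>

lemma form_sieve_sublattice: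
 fixes G :: "nat => real"
 assumes red: "reduced_form D a b c" and D: "prime D"
  and sw: "sieve_weights sieve_densities P Z (3 / 2) U L"
  and P: "\<And>l. l \<in> P ==> prime l" "\<And>l. l \<in> P ==> l < p" and Z: "Z \<ge> 1"
  and p: "prime p" and k: "int p dvd a * k\<^sup>2 + b * k + c"
  and G: "G p = 0" "G (p * Suc M) = 0" "\<And>n. G n \<ge> 0"
 defines "S \<equiv> (\<Sum>x | x \<in> qf_points a b c M \<and> (\<forall>l\<in>P. \<not> int l dvd case_prod (qf a b c) x) \<and>
    int p dvd fst x - k * snd x. G (nat (case_prod (qf a b c) x)))"
  and "X \<equiv> 8 * quarter_area / sqrt (real D) * (\<Sum>n\<in>{1..M}. real p * G (p * n))"
  and "V \<equiv> \<Prod>p\<in>P. 1 - real (rho a b c p) / (real p)\<^sup>2"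
  and "E \<equiv> \<Sum>n\<in>{1..M}. \<bar>real p * G (p * n) - real p * G (p * Suc n)\<bar> * sqrt (real n)"
 shows "S \<le> (3 / 2 * X * V + 9 * Z ^ 3 * E) / real p"
proof -
 have D0: "D > 0" using prime_gt_0_nat[OF D] .
 have p1: "p \<ge> 1" using prime_ge_1_nat[OF p] .
 have form: "a > 0" "4 * a * c - b\<^sup>2 = int D" using red by (auto simp: reduced_form_def form_disc_def)
 obtain c' where c': "a * k\<^sup>2 + b * k + c = int p * c'" using k by blast
 have "4 * (a * int p) * c' - (2 * a * k + b)\<^sup>2 = 4 * a * (a * k\<^sup>2 + b * k + c) - (2 * a * k + b)\<^sup>2"
  unfolding c' by simp
 also have "... = int D" unfolding form(2)[symmetric] by (simp add: power2_eq_square algebra_simps)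
 finally have f': "form_disc D (a * int p) (2 * a * k + b) c'" using form(1) p1 by (simp add: form_disc_def)
 obtain a2 b2 c2 \<alpha> \<beta> \<gamma> \<delta> where r: "reduced_form D a2 b2 c2" "\<alpha> * \<delta> - \<beta> * \<gamma> = 1"
  "\<And>u v. qf (a * int p) (2 * a * k + b) c' u v = qf a2 b2 c2 (\<alpha> * u + \<beta> * v) (\<gamma> * u + \<delta> * v)"
  using reduction[OF f' D0] by blast
 have q1: "qf a b c (int p * s + k * t) t = int p * qf (a * int p) (2 * a * k + b) c' s t" for s t
 proof -
  have "qf a b c (int p * s + k * t) t = int p * (a * int p * s\<^sup>2 + (2 * a * k + b) * s * t) + (a * k\<^sup>2 + b * k + c) * t\<^sup>2"
   by (simp add: qf_def power2_eq_square algebra_simps)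
  also have "... = int p * qf (a * int p) (2 * a * k + b) c' s t"
   unfolding c' qf_def by (simp add: algebra_simps)
  finally show ?thesis .
 qed
 \<comment> \<open>The multiples of p form a sublattice of index p in the given one, and p is prime
   to every l in P. So the new form has at least as many zeros modulo l, and its sieve product is no
   larger.\<close>
 have rho_le: "rho a b c l \<le> rho a2 b2 c2 l" if l: "l \<in> P" for l
 proof (rule rho_le_transform)
  fix u v
  have "int p * qf (a * int p) (2 * a * k + b) c' (u - k * v) (int p * v) = qf a b c (int p * u) (int p * v)"
   using q1[of "u - k * v" "int p * v"] by (simp add: algebra_simps)
  also have "... = int p * (int p * qf a b c u v)" by (simp add: qf_def power2_eq_square algebra_simps)
  finally have "qf (a * int p) (2 * a * k + b) c' (u - k * v) (int p * v) = int p * qf a b c u v" using p1 by simp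
  moreover have "\<alpha> * u + (\<beta> * int p - \<alpha> * k) * v = \<alpha> * (u - k * v) + \<beta> * (int p * v)"
   "\<gamma> * u + (\<delta> * int p - \<gamma> * k) * v = \<gamma> * (u - k * v) + \<delta> * (int p * v)" by (simp_all add: algebra_simps)
  ultimately show "qf a2 b2 c2 (\<alpha> * u + (\<beta> * int p - \<alpha> * k) * v) (\<gamma> * u + (\<delta> * int p - \<gamma> * k) * v) = int p * qf a b c u v"
   using r(3) by simp
 next
  have "\<alpha> * (\<delta> * int p - \<gamma> * k) - (\<beta> * int p - \<alpha> * k) * \<gamma> = int p * (\<alpha> * \<delta> - \<beta> * \<gamma>)" by (simp add: algebra_simps)
  also have "... = int p" by (simp add: r(2))
  finally have e: "\<alpha> * (\<delta> * int p - \<gamma> * k) - (\<beta> * int p - \<alpha> * k) * \<gamma> = int p" .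
  have "coprime p l" using P[OF l] p by (intro primes_coprime) auto
  thus "coprime (\<alpha> * (\<delta> * int p - \<gamma> * k) - (\<beta> * int p - \<alpha> * k) * \<gamma>) (int l)" unfolding e by simp
  show "l \<ge> 1" using prime_ge_1_nat[OF P(1)[OF l]] .
 qed
 define G' where "G' n = real p * G (p * n)" for n
 define S' where "S' = {x. x \<in> qf_points a b c M \<and> (\<forall>l\<in>P. \<not> int l dvd case_prod (qf a b c) x) \<and> int p dvd fst x - k * snd x}"
 define T' where "T' = {x. x \<in> qf_points a2 b2 c2 M \<and> (\<forall>l\<in>P. \<not> int l dvd case_prod (qf a2 b2 c2) x)}"
 \<comment> \<open>Coordinates on the sublattice, followed by the reducing substitution.\<close>
 define \<Psi> where "\<Psi> x = (\<alpha> * ((fst x - k * snd x) div int p) + \<beta> * snd x, \<gamma> * ((fst x - k * snd x) div int p) + \<delta> * snd x)" for x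
 have \<Psi>: "case_prod (qf a b c) x = int p * case_prod (qf a2 b2 c2) (\<Psi> x)" if x: "int p dvd fst x - k * snd x" for x
 proof -
  obtain s where s: "fst x - k * snd x = int p * s" using x by blast
  hence "fst x = int p * s + k * snd x" by simp
  hence "case_prod (qf a b c) x = int p * qf (a * int p) (2 * a * k + b) c' s (snd x)"
   using q1[of s "snd x"] by (simp add: case_prod_unfold)
  thus ?thesis unfolding \<Psi>_def s using p1 r(3) by simp
 qed
 have inj: "inj_on \<Psi> S'"
 proof (rule inj_onI)
  fix x y assume xy: "x \<in> S'" "y \<in> S'" "\<Psi> x = \<Psi> y"
  obtain s where s: "fst x - k * snd x = int p * s" using xy(1) by (auto simp: S'_def)
  obtain s' where s': "fst y - k * snd y = int p * s'" using xy(2) by (auto simp: S'_def)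
  have e: "\<alpha> * s + \<beta> * snd x = \<alpha> * s' + \<beta> * snd y" "\<gamma> * s + \<delta> * snd x = \<gamma> * s' + \<delta> * snd y"
   using xy(3) p1 unfolding \<Psi>_def s s' by simp_all
  have "s = \<delta> * (\<alpha> * s + \<beta> * snd x) - \<beta> * (\<gamma> * s + \<delta> * snd x)" for s
  proof -
   have "\<delta> * (\<alpha> * s + \<beta> * snd x) - \<beta> * (\<gamma> * s + \<delta> * snd x) = (\<alpha> * \<delta> - \<beta> * \<gamma>) * s" by (simp add: algebra_simps)
   thus ?thesis by (simp add: r(2))
  qed
  moreover have "s' = \<delta> * (\<alpha> * s' + \<beta> * snd y) - \<beta> * (\<gamma> * s' + \<delta> * snd y)"
  proof -
   have "\<delta> * (\<alpha> * s' + \<beta> * snd y) - \<beta> * (\<gamma> * s' + \<delta> * snd y) = (\<alpha> * \<delta> - \<beta> * \<gamma>) * s'" by (simp add: algebra_simps)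
   thus ?thesis by (simp add: r(2))
  qed
  ultimately have ss: "s = s'" using e by metis
  have t: "t = \<alpha> * (\<gamma> * s + \<delta> * t) - \<gamma> * (\<alpha> * s + \<beta> * t)" for t
  proof -
   have "\<alpha> * (\<gamma> * s + \<delta> * t) - \<gamma> * (\<alpha> * s + \<beta> * t) = (\<alpha> * \<delta> - \<beta> * \<gamma>) * t" by (simp add: algebra_simps)
   thus ?thesis by (simp add: r(2))
  qed
  have "snd x = \<alpha> * (\<gamma> * s + \<delta> * snd x) - \<gamma> * (\<alpha> * s + \<beta> * snd x)" by (rule t)
  also have "... = \<alpha> * (\<gamma> * s' + \<delta> * snd y) - \<gamma> * (\<alpha> * s' + \<beta> * snd y)" by (simp only: e)
  also have "... = snd y" unfolding ss[symmetric] by (rule t[symmetric])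
  finally have "snd x = snd y" .
  thus "x = y" using s s' ss by (simp add: prod_eq_iff)
 qed
 have im: "\<Psi> ` S' \<subseteq> T'"
 proof
  fix y assume "y \<in> \<Psi> ` S'"
  then obtain x where x: "x \<in> S'" "y = \<Psi> x" by blast
  define m where "m = case_prod (qf a2 b2 c2) y"
  have e: "case_prod (qf a b c) x = int p * m" unfolding m_def x(2) by (rule \<Psi>) (use x in \<open>simp add: S'_def\<close>)
  have b: "1 \<le> int p * m" "int p * m \<le> int M" "\<forall>l\<in>P. \<not> int l dvd int p * m"
   using x(1) unfolding S'_def qf_points_def e[symmetric] by auto
  have m1: "m \<ge> 1"
  proof (rule ccontr)
   assume "\<not> m \<ge> 1"
   hence "int p * m \<le> 0" by (intro mult_nonneg_nonpos) auto
   thus False using b(1) by simp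
  qed
  hence "1 * m \<le> int p * m" using p1 by (intro mult_right_mono) auto
  hence "m \<le> int M" using b(2) by simp
  thus "y \<in> T'" using m1 b(3) unfolding T'_def qf_points_def m_def by (auto simp: case_prod_unfold)
 qed
 have finT: "finite T'" unfolding T'_def using finite_qf_points[OF r(1) D0] by simp
 have G'0: "G' n \<ge> 0" for n using G(3) by (simp add: G'_def)
 have "S = (\<Sum>x\<in>S'. G' (nat (case_prod (qf a2 b2 c2) (\<Psi> x))) / real p)"
  unfolding S_def S'_def
 proof (rule sum.cong[OF refl])
  fix x assume x: "x \<in> {x. x \<in> qf_points a b c M \<and> (\<forall>l\<in>P. \<not> int l dvd case_prod (qf a b c) x) \<and> int p dvd fst x - k * snd x}"
  hence e: "case_prod (qf a b c) x = int p * case_prod (qf a2 b2 c2) (\<Psi> x)" by (intro \<Psi>) simp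
  have "nat (int p * case_prod (qf a2 b2 c2) (\<Psi> x)) = p * nat (case_prod (qf a2 b2 c2) (\<Psi> x))"
   by (simp add: nat_mult_distrib)
  thus "G (nat (case_prod (qf a b c) x)) = G' (nat (case_prod (qf a2 b2 c2) (\<Psi> x))) / real p"
   unfolding e G'_def using p1 by simp
 qed
 also have "... = (\<Sum>y\<in>\<Psi> ` S'. G' (nat (case_prod (qf a2 b2 c2) y))) / real p"
  using inj by (simp add: sum.reindex sum_divide_distrib)
 also have "... \<le> (\<Sum>y\<in>T'. G' (nat (case_prod (qf a2 b2 c2) y))) / real p"
  using G'0 by (intro divide_right_mono sum_mono2[OF finT im]) auto
 also have "... \<le> (3 / 2 * X * (\<Prod>p\<in>P. 1 - real (rho a2 b2 c2 p) / (real p)\<^sup>2) + 9 * Z ^ 3 * E) / real p"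
 proof (rule divide_right_mono)
  have "G' 1 = 0" "G' (Suc M) = 0" using G by (simp_all add: G'_def)
  from form_sieve(1)[OF r(1) D sw P(1) Z this G'0]
  show "(\<Sum>y\<in>T'. G' (nat (case_prod (qf a2 b2 c2) y))) \<le> 3 / 2 * X * (\<Prod>p\<in>P. 1 - real (rho a2 b2 c2 p) / (real p)\<^sup>2) + 9 * Z ^ 3 * E"
   unfolding T'_def G'_def X_def E_def .
 qed simp
 also have "... \<le> (3 / 2 * X * V + 9 * Z ^ 3 * E) / real p"
 proof (intro divide_right_mono add_right_mono mult_left_mono)
  show "(\<Prod>p\<in>P. 1 - real (rho a2 b2 c2 p) / (real p)\<^sup>2) \<le> V"
   unfolding V_def
  proof (intro prod_mono conjI)
   fix l assume l: "l \<in> P"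
   have l1: "real l > 0" using prime_gt_0_nat[OF P(1)[OF l]] by simp
   have "real (rho a2 b2 c2 l) \<le> real (l\<^sup>2)" unfolding of_nat_le_iff by (rule rho_le_square)
   thus "0 \<le> 1 - real (rho a2 b2 c2 l) / (real l)\<^sup>2" using l1 by simp
   show "1 - real (rho a2 b2 c2 l) / (real l)\<^sup>2 \<le> 1 - real (rho a b c l) / (real l)\<^sup>2"
    using rho_le[OF l] by (intro diff_left_mono divide_right_mono) auto
  qed
  show "0 \<le> 3 / 2 * X" unfolding X_def using quarter_area_pos G(3)
   by (intro mult_nonneg_nonneg sum_nonneg) auto
 qed simp
 finally show ?thesis .
qed

section \<open>Split and inert primes beyond D\<close>

context imag_quad
begin

lemma not_dvd_leading:
 assumes red: "reduced_form D a b c" and p: "prime p" "D < p"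
 shows "\<not> int p dvd 2 * a" "odd p"
proof -
 have D0: "D > 0" using D_gt by simp
 have "p ~= 2" using p D_gt by simp
 thus odd: "odd p" using p primes_dvd_imp_eq two_is_prime_nat by blast
 have a: "a \<ge> 1" "a \<le> int D" using reduced_form_bounds[OF red D0] by auto
 hence "\<not> int p dvd a" using p zdvd_imp_le[of "int p" a] by linarith
 moreover have "\<not> int p dvd 2"
  using \<open>p ~= 2\<close> p D_gt zdvd_imp_le[of "int p" 2] by linarith
 ultimately show "\<not> int p dvd 2 * a" using p by (simp add: prime_dvd_mult_iff)
qed

text \<open>If y^2 is congruent to -D, then 4 a times the form factors modulo p as (2 a u + b v - y
  v) (2 a u + b v + y v). As p > D does not divide 2 a, the vanishing of a factor is a condition u =
  k v modulo p.\<close>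

lemma split_prime_sublattices:
 assumes red: "reduced_form D a b c" and p: "prime p" "D < p" and X: "kron D p = 1"
 shows "\<exists>k1 k2. int p dvd a * k1\<^sup>2 + b * k1 + c \<and> int p dvd a * k2\<^sup>2 + b * k2 + c \<and>
  (\<forall>u v. int p dvd qf a b c u v --> int p dvd u - k1 * v \<or> int p dvd u - k2 * v)"
proof -
 have na: "\<not> int p dvd 2 * a" by (rule not_dvd_leading(1)[OF red p])
 have pp: "prime (int p)" using p by simp
 have disc: "4 * a * c - b\<^sup>2 = int D" using red by (auto simp: reduced_form_def form_disc_def)
 obtain t where t: "int p dvd t\<^sup>2 + t + int q" using root_of_split[OF p(1) X] by blast
 define y where "y = 2 * t + 1"
 have y: "int p dvd y\<^sup>2 + int D" unfolding y_def four_root[symmetric] using t by (rule dvd_mult)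
 have "coprime (2 * a) (int p)" using na pp by (meson coprime_commute prime_imp_coprime)
 then obtain i where i: "[2 * a * i = 1] (mod int p)" using cong_solve_coprime_int by blast
 have root: "int p dvd a * (i * (w - b))\<^sup>2 + b * (i * (w - b)) + c \<and>
   (\<forall>u v. int p dvd 2 * a * u + b * v - w * v --> int p dvd u - (i * (w - b)) * v)"
  if w: "int p dvd w\<^sup>2 + int D" for w
 proof -
  define k where "k = i * (w - b)"
  have e: "2 * a * k + b - w = (2 * a * i - 1) * (w - b)" by (simp add: k_def algebra_simps)
  have k: "int p dvd 2 * a * k + b - w" unfolding e using i by (simp add: cong_iff_dvd_diff)
  have e2: "(2 * a) * (2 * (a * k\<^sup>2 + b * k + c)) = (2 * a * k + b - w) * (2 * a * k + b + w) + (w\<^sup>2 + int D)"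
   unfolding disc[symmetric] by (simp add: power2_eq_square algebra_simps)
  have "int p dvd (2 * a) * (2 * (a * k\<^sup>2 + b * k + c))" unfolding e2 by (rule dvd_add[OF dvd_mult2[OF k] w])
  hence "int p dvd 2 * (a * k\<^sup>2 + b * k + c)" using na pp by (metis prime_dvd_mult_iff)
  moreover have "\<not> int p dvd 2" using na by (metis dvd_mult2)
  ultimately have 1: "int p dvd a * k\<^sup>2 + b * k + c" using pp by (metis prime_dvd_mult_iff)
  have "int p dvd u - k * v" if uv: "int p dvd 2 * a * u + b * v - w * v" for u v
  proof -
   have e3: "(2 * a) * (u - k * v) = (2 * a * u + b * v - w * v) - (2 * a * k + b - w) * v" by (simp add: algebra_simps)
   have "int p dvd (2 * a) * (u - k * v)" unfolding e3 by (rule dvd_diff[OF uv dvd_mult2[OF k]])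
   thus ?thesis using na pp by (metis prime_dvd_mult_iff)
  qed
  thus ?thesis using 1 unfolding k_def by blast
 qed
 have y': "int p dvd (- y)\<^sup>2 + int D" using y by simp
 have "int p dvd u - (i * (y - b)) * v \<or> int p dvd u - (i * (- y - b)) * v" if Q: "int p dvd qf a b c u v" for u v
 proof -
  have e: "(2 * a * u + b * v - y * v) * (2 * a * u + b * v - (- y) * v) = 4 * a * qf a b c u v - (y\<^sup>2 + int D) * v\<^sup>2"
   unfolding four_a_qf disc by (simp add: power2_eq_square algebra_simps)
  have "int p dvd (2 * a * u + b * v - y * v) * (2 * a * u + b * v - (- y) * v)"
   unfolding e by (rule dvd_diff[OF dvd_mult[OF Q] dvd_mult2[OF y]])
  hence "int p dvd 2 * a * u + b * v - y * v \<or> int p dvd 2 * a * u + b * v - (- y) * v"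
   using pp by (metis prime_dvd_mult_iff)
  thus ?thesis using root[OF y] root[OF y'] by blast
 qed
 thus ?thesis using root[OF y] root[OF y'] by blast
qed

text \<open>A zero with v invertible modulo p would make -D a square modulo p.\<close>

lemma inert_prime_dvd:
 assumes red: "reduced_form D a b c" and p: "prime p" "D < p" and X: "kron D p = - 1"
  and Q: "int p dvd qf a b c u v"
 shows "int p dvd u" "int p dvd v"
proof -
 have na: "\<not> int p dvd 2 * a" by (rule not_dvd_leading(1)[OF red p])
 have pp: "prime (int p)" using p by simp
 have disc: "4 * a * c - b\<^sup>2 = int D" using red by (auto simp: reduced_form_def form_disc_def)
 have "p ~= 2" using p D_gt by simp
 hence L: "Legendre (- int D) (int p) = - 1" using X kron_prime[OF p(1)] by (simp add: kronecker_prime_def)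
 hence nq: "\<not> QuadRes (int p) (- int D)" by (auto simp: Legendre_def split: if_splits)
 have d: "int p dvd (2 * a * u + b * v)\<^sup>2 + int D * v\<^sup>2"
  using dvd_mult[OF Q, of "4 * a"] unfolding four_a_qf disc .
 show v: "int p dvd v"
 proof (rule ccontr)
  assume "\<not> int p dvd v"
  hence "coprime v (int p)" using pp by (meson coprime_commute prime_imp_coprime)
  then obtain w where w: "[v * w = 1] (mod int p)" using cong_solve_coprime_int by blast
  define A where "A = 2 * a * u + b * v"
  have "((A * w)\<^sup>2 - (- int D)) = (A\<^sup>2 + int D * v\<^sup>2) * w\<^sup>2 - int D * ((v * w - 1) * (v * w + 1))"
   by (simp add: power2_eq_square algebra_simps)
  moreover have w1: "int p dvd v * w - 1" using w by (simp add: cong_iff_dvd_diff)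
  have "int p dvd (A\<^sup>2 + int D * v\<^sup>2) * w\<^sup>2 - int D * ((v * w - 1) * (v * w + 1))"
   by (rule dvd_diff[OF dvd_mult2[OF d[folded A_def]] dvd_mult[OF dvd_mult2[OF w1]]])
  ultimately have "[(A * w)\<^sup>2 = - int D] (mod int p)" by (simp only: cong_iff_dvd_diff)
  thus False using nq by (auto simp: QuadRes_def)
 qed
 have "int p dvd (2 * a * u + b * v)\<^sup>2"
 proof -
  have e: "(2 * a * u + b * v)\<^sup>2 = ((2 * a * u + b * v)\<^sup>2 + int D * v\<^sup>2) - int D * v * v" by (simp add: power2_eq_square)
  show ?thesis by (subst e) (rule dvd_diff[OF d dvd_mult[OF v]])
 qed
 hence "int p dvd 2 * a * u + b * v" using pp prime_dvd_power by blast
 moreover have e: "2 * a * u = (2 * a * u + b * v) - b * v" by simp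
 ultimately have "int p dvd (2 * a) * u" using dvd_diff[OF _ dvd_mult[OF v]] by metis
 thus "int p dvd u" using na pp by (metis prime_dvd_mult_iff)
qed

end

section \<open>Sums of the weight function\<close>

lemma harmonic_sum_le: "M \<ge> 1 ==> (\<Sum>n\<in>{1..M}. 1 / real n) \<le> 1 + ln (real M)"
proof (induction M rule: dec_induct)
 case (step M)
 have M: "real M > 0" using step by simp
 have "1 / real (Suc M) \<le> ln (real (Suc M)) - ln (real M)"
 proof -
  have "ln (real M / real (Suc M)) \<le> real M / real (Suc M) - 1" using M by (intro ln_le_minus_one) simp
  also have "... = - (1 / real (Suc M))" by (simp add: field_simps)
  finally show ?thesis using M by (simp add: ln_div)
 qed
 thus ?case using step by simp
qed simp

text \<open>The interval [0, 3] contains all arguments \<open>ln y / L + \<mu>\<close> that occur,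
  because y stays below x^2. K depends on f, and so does the threshold for x in the end.\<close>

locale test_function =
 fixes f :: "real => real" and \<nu> K :: real
 assumes diff: "\<And>u. f differentiable (at u)"
  and nonneg: "\<And>u. 0 \<le> f u"
  and supp: "\<And>u. u \<notin> {1 - \<nu>..1} ==> f u = 0"
  and \<nu>: "0 < \<nu>" "\<nu> \<le> 1 / 4"
  and K: "\<And>u. u \<in> {0..3} ==> f u \<le> K" "\<And>u. u \<in> {0..3} ==> \<bar>deriv f u\<bar> \<le> K"
begin

lemma K_nonneg: "K \<ge> 0"
 using nonneg[of 0] K(1)[of 0] by simp

lemma cont: "continuous_on A f"
 using diff by (meson continuous_at_imp_continuous_on differentiable_imp_continuous_within)

text \<open>The shift serves the sublattices: with \<mu> = ln p / L,
  \<open>p * weight L 0 (p * n)\<close> equals \<open>weight L \<mu> n\<close>.\<close>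

definition weight :: "real => real => nat => real" where
 "weight L \<mu> n = f (ln (real n) / L + \<mu>) / real n"

definition total :: real where "total = integral {0..3} f"

context
 fixes x L \<mu> :: real and M :: nat
 assumes x: "x \<ge> 3" and L: "L = ln x" and \<mu>: "0 \<le> \<mu>" "\<mu> \<le> 1 / 2" and M: "M = nat \<lfloor>x\<rfloor>"
begin

lemma L_pos: "L \<ge> 1"
proof -
 have "exp 1 \<le> x" using x exp_le by simp
 thus ?thesis unfolding L using x by (subst ln_ge_iff) auto
qed

lemma M_bounds: "real M \<le> x" "x < real M + 1" "M \<ge> 1"
proof -
 show "real M \<le> x" "x < real M + 1" unfolding M using x by linarith+
 thus "M \<ge> 1" using x by linarith
qed

lemma arg_range:
 assumes "1 \<le> y" "y \<le> real M + 1"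
 shows "ln y / L + \<mu> \<in> {0..3}"
proof -
 have "3 * x \<le> x * x" using x by (intro mult_right_mono) auto
 hence "x + 1 \<le> x * x" using x by linarith
 hence "ln y \<le> ln (x * x)" using assms M_bounds by (subst ln_le_cancel_iff) auto
 also have "... = 2 * L" using x by (simp add: ln_mult L)
 finally have "ln y / L \<le> 2" using L_pos by (simp add: divide_le_eq)
 moreover have "0 \<le> ln y / L" using assms L_pos by simp
 ultimately show ?thesis using \<mu> by simp
qed

definition profile :: "real => real" where "profile y = f (ln y / L + \<mu>) / y"

text \<open>With f and its derivative bounded by K and L \<ge> 1, the derivative of
  \<open>profile\<close> at t is at most 2 K / t^2.\<close>

lemma profile_lipschitz:
 assumes n: "n \<ge> 1" "n \<le> M" and y: "real n \<le> y" "y \<le> real n + 1"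
 shows "\<bar>profile y - profile (real n)\<bar> \<le> 2 * K / (real n)\<^sup>2"
proof (cases "y = real n")
 case True
 thus ?thesis using K_nonneg by simp
next
 case False
 hence ny: "real n < y" using y by simp
 have der: "(profile has_real_derivative (deriv f (ln t / L + \<mu>) * (1 / t / L) * t - f (ln t / L + \<mu>) * 1) / (t * t)) (at t)"
  if t: "real n \<le> t" for t
 proof -
  have t0: "t > 0" using t n by linarith
  have "((\<lambda>t. ln t / L + \<mu>) has_real_derivative (1 / t / L)) (at t)"
   using t0 L_pos by (auto intro!: derivative_eq_intros simp: divide_simps)
  moreover have "(f has_real_derivative deriv f (ln t / L + \<mu>)) (at (ln t / L + \<mu>))"
   using diff by (simp add: DERIV_deriv_iff_real_differentiable)
  ultimately have "((\<lambda>t. f (ln t / L + \<mu>)) has_real_derivative deriv f (ln t / L + \<mu>) * (1 / t / L)) (at t)"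
   by (rule DERIV_chain2[rotated])
  from DERIV_divide[OF this DERIV_ident] t0 show ?thesis unfolding profile_def[abs_def] by simp
 qed
 obtain t where t: "real n < t" "t < y" "profile y - profile (real n) =
   (y - real n) * ((deriv f (ln t / L + \<mu>) * (1 / t / L) * t - f (ln t / L + \<mu>) * 1) / (t * t))"
  using MVT2[OF ny der] by blast
 define w where "w = ln t / L + \<mu>"
 have t0: "t > 0" "real n > 0" using t n by linarith+
 have w: "w \<in> {0..3}" unfolding w_def using t y n by (intro arg_range) auto
 have "deriv f w * (1 / t / L) * t - f w * 1 = deriv f w / L - f w" using t0 by simp
 moreover have "\<bar>deriv f w / L - f w\<bar> \<le> 2 * K"
 proof -
  have "\<bar>deriv f w / L\<bar> \<le> K / 1"
   unfolding abs_divide using K(2)[OF w] L_pos K_nonneg by (intro frac_le) auto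
  moreover have "\<bar>f w\<bar> \<le> K" using nonneg[of w] K(1)[OF w] by simp
  ultimately show ?thesis by linarith
 qed
 ultimately have num: "\<bar>deriv f w * (1 / t / L) * t - f w * 1\<bar> \<le> 2 * K" by simp
 have "\<bar>profile y - profile (real n)\<bar> = \<bar>y - real n\<bar> * (\<bar>deriv f w * (1 / t / L) * t - f w * 1\<bar> / (t * t))"
  unfolding t(3) w_def[symmetric] by (simp add: abs_mult)
 also have "... \<le> 1 * (2 * K / (real n * real n))"
  using y t t0 num K_nonneg by (intro mult_mono frac_le) auto
 finally show ?thesis by (simp add: power2_eq_square)
qed

lemma profile_eq_0: "y > 0 ==> y < x powr (1 - \<nu> - \<mu>) ==> profile y = 0"
proof -
 assume y: "y > 0" "y < x powr (1 - \<nu> - \<mu>)"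
 hence "ln y < ln (x powr (1 - \<nu> - \<mu>))" using x by (subst ln_less_cancel_iff) auto
 hence "ln y < (1 - \<nu> - \<mu>) * L" using x by (simp add: ln_powr L)
 hence "ln y / L < 1 - \<nu> - \<mu>" using L_pos by (simp add: divide_less_eq)
 thus "profile y = 0" unfolding profile_def using supp[of "ln y / L + \<mu>"] by simp
qed

lemma weight_eq: "weight L \<mu> n = profile (real n)"
 by (simp add: weight_def profile_def)

lemma weight_zero: "weight L \<mu> 1 = 0" "weight L \<mu> (Suc M) = 0"
proof -
 show "weight L \<mu> 1 = 0" unfolding weight_def using supp[of \<mu>] \<mu> \<nu> by simp
 have "ln x < ln (real (Suc M))" using M_bounds x by (subst ln_less_cancel_iff) auto
 hence "ln (real (Suc M)) / L > 1" using L_pos by (simp add: L)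
 thus "weight L \<mu> (Suc M) = 0" unfolding weight_def using supp[of "ln (real (Suc M)) / L + \<mu>"] \<mu> by simp
qed

text \<open>Since 1 - \<nu> - \<mu> \<ge> 1 / 4, terms below about x^(1/4) vanish. Beyond that point
  n^(-3/2) is at most 2 x^(-1/8) / n, and the harmonic sum contributes the factor L.\<close>

lemma sum_error_le:
 assumes "\<And>n. n \<in> {1..M} ==> real n + 1 < x powr (1 - \<nu> - \<mu>) ==> e n = 0"
  and "\<And>n. n \<in> {1..M} ==> e n \<le> 2 * K / (real n)\<^sup>2 * sqrt (real n)"
 shows "(\<Sum>n\<in>{1..M}. e n) \<le> 8 * K * L * x powr (- (1 / 8))"
proof -
 define n0 where "n0 = x powr (1 - \<nu> - \<mu>)"
 have n0: "n0 \<ge> x powr (1 / 4)" unfolding n0_def using x \<nu> \<mu> by (intro powr_mono) auto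
 have x4: "x powr (1 / 4) > 0" using x by simp
 define s where "s = x powr (- (1 / 8))"
 have s0: "s > 0" using x by (simp add: s_def)
 have ss: "s * s * x powr (1 / 4) = 1"
  unfolding s_def using x by (simp add: powr_add[symmetric])
 have "e n \<le> 4 * K * s * (1 / real n)" if n: "n \<in> {1..M}" for n
 proof (cases "real n + 1 < n0")
  case True
  thus ?thesis using assms(1)[OF n] K_nonneg s0 by (simp add: n0_def)
 next
  case False
  define r where "r = sqrt (real n)"
  have r: "r > 0" "r * r = real n" using n by (auto simp: r_def)
  have "x powr (1 / 4) \<le> 2 * (r * r)" using False n0 n r by simp
  hence "s * s * x powr (1 / 4) \<le> s * s * (2 * (r * r))" using s0 by (intro mult_left_mono) auto
  hence "1 \<le> 2 * (s * r) * (s * r)" unfolding ss by (simp add: mult_ac)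
  hence "1 * 1 \<le> (2 * (s * r)) * (2 * (s * r))" by simp
  hence "1 \<le> 2 * (s * r)" using s0 r mult_strict_mono[of "2 * (s * r)" 1 "2 * (s * r)" 1] by (force simp: not_le)
  hence "1 / r \<le> 2 * s" using r by (simp add: divide_le_eq mult_ac)
  hence "2 * K / (real n) * (1 / r) \<le> 2 * K / real n * (2 * s)" using K_nonneg by (intro mult_left_mono) auto
  moreover have "2 * K / (real n)\<^sup>2 * sqrt (real n) = 2 * K / (real n) * (1 / r)"
   unfolding r_def[symmetric] r(2)[symmetric] using r(1) by (simp add: power2_eq_square field_simps)
  ultimately show ?thesis using assms(2)[OF n] by (simp add: mult_ac)
 qed
 hence "(\<Sum>n\<in>{1..M}. e n) \<le> (\<Sum>n\<in>{1..M}. 4 * K * s * (1 / real n))" by (intro sum_mono) blast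
 also have "... = 4 * K * s * (\<Sum>n\<in>{1..M}. 1 / real n)" by (rule sum_distrib_left[symmetric])
 also have "... \<le> 4 * K * s * (2 * L)"
 proof (rule mult_left_mono)
  have "ln (real M) \<le> L" unfolding L using M_bounds x by (subst ln_le_cancel_iff) auto
  thus "(\<Sum>n\<in>{1..M}. 1 / real n) \<le> 2 * L" using harmonic_sum_le[OF M_bounds(3)] L_pos by linarith
 qed (use K_nonneg s0 in simp)
 finally show ?thesis by (simp add: s_def mult_ac)
qed

lemma weight_variation:
 "(\<Sum>n\<in>{1..M}. \<bar>weight L \<mu> n - weight L \<mu> (Suc n)\<bar> * sqrt (real n)) \<le> 8 * K * L * x powr (- (1 / 8))"
proof (rule sum_error_le)
 fix n assume n: "n \<in> {1..M}" and lt: "real n + 1 < x powr (1 - \<nu> - \<mu>)"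
 have "profile (real n) = 0" "profile (real (Suc n)) = 0" using n lt by (auto intro!: profile_eq_0)
 thus "\<bar>weight L \<mu> n - weight L \<mu> (Suc n)\<bar> * sqrt (real n) = 0" by (simp add: weight_eq)
next
 fix n assume n: "n \<in> {1..M}"
 have "\<bar>profile (real (Suc n)) - profile (real n)\<bar> \<le> 2 * K / (real n)\<^sup>2" using n by (intro profile_lipschitz) auto
 thus "\<bar>weight L \<mu> n - weight L \<mu> (Suc n)\<bar> * sqrt (real n) \<le> 2 * K / (real n)\<^sup>2 * sqrt (real n)"
  unfolding weight_eq by (intro mult_right_mono) auto
qed

text \<open>In the variable ln t / L + \<mu> the integral of \<open>profile\<close> is L times an
  integral of f. The shift disappears because the support of f lies between \<mu> and 1.\<close>

lemma weight_sum: "\<bar>(\<Sum>n\<in>{1..M}. weight L \<mu> n) - L * total\<bar> \<le> 8 * K * L * x powr (- (1 / 8))"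
proof -
 \<comment> \<open>Starting at -1 keeps the arguments, which are at least 0, in the interior, where
   the primitive is differentiable.\<close>
 define \<Phi> where "\<Phi> u = integral {- 1..u} f" for u
 define H where "H y = L * \<Phi> (ln y / L + \<mu>)" for y
 have int: "f integrable_on {a..b}" for a b by (rule integrable_continuous_real[OF cont])
 have \<Phi>: "(\<Phi> has_real_derivative f u) (at u)" if "u > - 1" for u
 proof -
  have "((\<lambda>u. integral {- 1..u} f) has_real_derivative f u) (at u within {- 1..u + 1})"
   by (rule integral_has_real_derivative[OF cont]) (use that in auto)
  moreover have "at u within {- 1..u + 1} = at u" using that by (intro at_within_interior) (simp add: interior_atLeastAtMost_real)
  ultimately show ?thesis unfolding \<Phi>_def[abs_def] by simp
 qed
 have diffH: "\<bar>weight L \<mu> n - (H (real (Suc n)) - H (real n))\<bar> \<le> 2 * K / (real n)\<^sup>2 \<and>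
   (real n + 1 < x powr (1 - \<nu> - \<mu>) --> weight L \<mu> n - (H (real (Suc n)) - H (real n)) = 0)"
  if n: "n \<in> {1..M}" for n
 proof -
  have der: "(H has_real_derivative profile t) (at t)" if t: "real n \<le> t" for t
  proof -
   have t0: "t > 0" "t \<ge> 1" using t n by auto
   have "((\<lambda>t. ln t / L + \<mu>) has_real_derivative (1 / t / L)) (at t)"
    using t0 L_pos by (auto intro!: derivative_eq_intros simp: divide_simps)
   moreover have "ln t / L + \<mu> > - 1" using t0 L_pos \<mu> by (simp add: add_strict_increasing2)
   ultimately have "((\<lambda>t. \<Phi> (ln t / L + \<mu>)) has_real_derivative f (ln t / L + \<mu>) * (1 / t / L)) (at t)"
    by (intro DERIV_chain2[OF \<Phi>])
   from DERIV_cmult[OF this, of L] show ?thesis unfolding H_def[abs_def] profile_def using L_pos by simp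
  qed
  obtain t where t: "real n < t" "t < real n + 1" "H (real n + 1) - H (real n) = (real n + 1 - real n) * profile t"
   using MVT2[of "real n" "real n + 1" H profile, OF _ der] by auto
  have eq: "weight L \<mu> n - (H (real (Suc n)) - H (real n)) = profile (real n) - profile t"
   using t(3) unfolding weight_eq by (simp add: add.commute)
  have 1: "\<bar>profile (real n) - profile t\<bar> \<le> 2 * K / (real n)\<^sup>2"
   using profile_lipschitz[of n t] n t by (simp add: abs_minus_commute)
  have 2: "profile (real n) - profile t = 0" if "real n + 1 < x powr (1 - \<nu> - \<mu>)"
   using profile_eq_0[of "real n"] profile_eq_0[of t] n t that by auto
  show ?thesis unfolding eq using 1 2 by blast
 qed
 have "(\<Sum>n\<in>{1..M}. \<bar>weight L \<mu> n - (H (real (Suc n)) - H (real n))\<bar>) \<le> 8 * K * L * x powr (- (1 / 8))"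
 proof (rule sum_error_le)
  fix n assume n: "n \<in> {1..M}"
  have "2 * K / (real n)\<^sup>2 * 1 \<le> 2 * K / (real n)\<^sup>2 * sqrt (real n)"
   using n K_nonneg by (intro mult_left_mono) auto
  thus "\<bar>weight L \<mu> n - (H (real (Suc n)) - H (real n))\<bar> \<le> 2 * K / (real n)\<^sup>2 * sqrt (real n)"
   using diffH[OF n] by linarith
  assume "real n + 1 < x powr (1 - \<nu> - \<mu>)"
  thus "\<bar>weight L \<mu> n - (H (real (Suc n)) - H (real n))\<bar> = 0" using diffH[OF n] by simp
 qed
 hence "\<bar>\<Sum>n\<in>{1..M}. weight L \<mu> n - (H (real (Suc n)) - H (real n))\<bar> \<le> 8 * K * L * x powr (- (1 / 8))"
  by (rule order_trans[OF sum_abs])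
 moreover have "(\<Sum>n\<in>{1..M}. H (real (Suc n)) - H (real n)) = H (real (Suc M)) - H 1"
  using sum_Suc_diff[of 1 M "\<lambda>n. H (real n)"] M_bounds(3) by simp
 moreover have "H (real (Suc M)) - H 1 = L * total"
 proof -
  have zero: "integral {a..b} f = 0" if "a \<ge> 1 \<or> b \<le> 1 - \<nu>" for a b
  proof -
   have "negligible {1, 1 - \<nu>}" by (intro negligible_finite) simp
   moreover have "f u = 0" if u: "u \<in> {a..b} - {1, 1 - \<nu>}" for u
    using u \<open>a \<ge> 1 \<or> b \<le> 1 - \<nu>\<close> by (intro supp) auto
   ultimately have "integral {a..b} f = integral {a..b} (\<lambda>_. 0)"
    by (intro integral_spike[of "{1, 1 - \<nu>}"]) simp_all
   thus ?thesis by simp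
  qed
  define u where "u = ln (real (Suc M)) / L + \<mu>"
  have "ln x \<le> ln (real (Suc M))" using M_bounds x by (subst ln_le_cancel_iff) auto
  hence "ln (real (Suc M)) / L \<ge> 1" using L_pos by (simp add: L le_divide_eq)
  hence u: "u \<ge> 1" "u \<le> 3" using \<mu> arg_range[of "real (Suc M)"] by (auto simp: u_def add.commute)
  have "\<Phi> \<mu> = 0" unfolding \<Phi>_def using \<mu> \<nu> by (intro zero) simp
  moreover have "\<Phi> u = integral {- 1..0} f + integral {0..u} f" unfolding \<Phi>_def
   using u by (intro Henstock_Kurzweil_Integration.integral_combine[symmetric] int) auto
  moreover have "integral {- 1..0} f = 0" using \<nu> by (intro zero) simp
  moreover have "total = integral {0..u} f + integral {u..3} f" unfolding total_def
   using u by (intro Henstock_Kurzweil_Integration.integral_combine[symmetric] int) auto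
  moreover have "integral {u..3} f = 0" using u by (intro zero) simp
  ultimately show ?thesis unfolding H_def u_def[symmetric] by (simp add: right_diff_distrib)
 qed
 ultimately show ?thesis by (simp add: sum_subtractf)
qed

end

end

text \<open>Continuity of f and its derivative on a compact interval yields K, and the support
  condition turns the transform at 0 into an integral over [0, 3].\<close>

lemma weight_function_test:
 assumes w: "weight_function \<nu> f" and \<nu>: "0 < \<nu>" "\<nu> \<le> 1 / 4"
 shows "\<exists>K. test_function f \<nu> K" "Re (fourier_transform f 0) = integral {0..3} f"
proof -
 have sm: "(deriv ^^ k) f differentiable_on UNIV" for k using w by (simp add: weight_function_def smooth_real_def)
 have d: "f differentiable (at u)" for u using sm[of 0] by (simp add: differentiable_on_def)
 have "deriv f differentiable_on UNIV" using sm[of 1] by simp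
 hence cd: "continuous_on {0..3} (deriv f)"
  using differentiable_imp_continuous_on continuous_on_subset by blast
 have cf: "continuous_on A f" for A
  using d by (meson continuous_at_imp_continuous_on differentiable_imp_continuous_within)
 have nn: "0 \<le> f u" for u using w by (simp add: weight_function_def)
 have sp: "f u = 0" if "u \<notin> {1 - \<nu>..1}" for u using w that by (simp add: weight_function_def)
 have "bounded (f ` {0..3})" "bounded (deriv f ` {0..3})"
  by (intro compact_imp_bounded compact_continuous_image cf cd compact_Icc)+
 then obtain K1 K2 where "\<forall>y\<in>f ` {0..3}. norm y \<le> K1" "\<forall>y\<in>deriv f ` {0..3}. norm y \<le> K2"
  unfolding bounded_iff by blast
 hence K: "\<And>u. u \<in> {0..3} ==> \<bar>f u\<bar> \<le> K1" "\<And>u. u \<in> {0..3} ==> \<bar>deriv f u\<bar> \<le> K2" by simp_all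
 have "test_function f \<nu> (max K1 K2)"
 proof
  fix u :: real assume u: "u \<in> {0..3}"
  show "f u \<le> max K1 K2" using K(1)[OF u] by linarith
  show "\<bar>deriv f u\<bar> \<le> max K1 K2" using K(2)[OF u] by linarith
 qed (use d nn sp \<nu> in auto)
 thus "\<exists>K. test_function f \<nu> K" by blast
 have "fourier_transform f 0 = (LINT u|lborel. complex_of_real (f u))" by (simp add: fourier_transform_def)
 also have "... = of_real (LINT u|lborel. f u)" by (rule integral_complex_of_real)
 finally have "Re (fourier_transform f 0) = (LINT u|lborel. f u)" by simp
 also have "... = (LINT u:{0..3}|lborel. f u)" unfolding set_lebesgue_integral_def
 proof (rule Bochner_Integration.integral_cong[OF refl])
  fix u :: real
  show "f u = indicator {0..3} u *\<^sub>R f u"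
  proof (cases "u \<in> {0..3}")
   case False
   hence "u \<notin> {1 - \<nu>..1}" using \<nu> by auto
   thus ?thesis using sp[of u] by simp
  qed simp
 qed
 also have "... = integral {0..3} f"
  by (intro set_borel_integral_eq_integral(2) borel_integrable_atLeastAtMost' cf)
 finally show "Re (fourier_transform f 0) = integral {0..3} f" .
qed

section \<open>The lower bound\<close>

lemma sum_inverse_squares_tail:
 assumes "N \<ge> 1"
 shows "(\<Sum>n\<in>{N<..M}. 1 / (real n)\<^sup>2) \<le> 1 / real N"
proof (cases "N \<le> M")
 case True
 have "(\<Sum>n\<in>{N<..M}. 1 / (real n)\<^sup>2) \<le> 1 / real N - 1 / real M"
  using True
 proof (induction M rule: dec_induct)
  case (step M)
  have M: "real M > 0" using step assms by simp
  have "1 / (real (Suc M))\<^sup>2 \<le> 1 / (real M * real (Suc M))"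
   unfolding power2_eq_square using M by (intro divide_left_mono mult_right_mono) auto
  also have "... = 1 / real M - 1 / real (Suc M)" using M by (simp add: field_simps)
  finally have "1 / (real (Suc M))\<^sup>2 \<le> 1 / real M - 1 / real (Suc M)" .
  moreover have "{N<..Suc M} = insert (Suc M) {N<..M}" using step by auto
  ultimately show ?case using step.IH by simp
 qed simp
 thus ?thesis using zero_le_divide_1_iff[of "real M"] by linarith
qed simp

lemma prime_square_divisor:
 assumes "m > 1" "\<not> prime m"
 shows "\<exists>p. prime p \<and> p dvd m \<and> p * p \<le> (m :: nat)"
proof -
 obtain k where k: "k dvd m" "k ~= 1" "k ~= m" using assms by (auto simp: prime_nat_iff)
 obtain l where l: "m = k * l" using k(1) by blast
 have "k ~= 0" "l ~= 0" "l ~= 1" using l k assms by auto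
 define j where "j = min k l"
 have "j ~= 1" "j dvd m" "j * j \<le> m" "j > 0"
  unfolding j_def using k l \<open>l ~= 1\<close> \<open>k ~= 0\<close> \<open>l ~= 0\<close> by (auto simp: min_def)
 obtain p where p: "prime p" "p dvd j" using prime_factor_nat[OF \<open>j ~= 1\<close>] by blast
 have "p \<le> j" using p(2) \<open>j > 0\<close> by (rule dvd_imp_le)
 hence "p * p \<le> j * j" by (rule mult_le_mono[OF _ \<open>p \<le> j\<close>])
 thus ?thesis using p \<open>j dvd m\<close> \<open>j * j \<le> m\<close> by (meson dvd_trans order_trans)
qed

lemma prime_class_sum_nonneg:
 assumes "\<And>u. 0 \<le> f u"
 shows "0 \<le> prime_class_sum D C f x"
 unfolding prime_class_sum_def by (rule infsum_nonneg) (simp add: assms)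

context imag_quad
begin

text \<open>The form is the reduced form of the class; an ideal of prime norm has at most two
  points, whence the factor 2. The infinite sum is finite because f vanishes for p > x.\<close>

lemma prime_class_sum_ge_form:
 assumes tf: "test_function f \<nu> K" and x: "x \<ge> 3" and C: "C \<in> ideal_classes D"
 obtains a b c where "reduced_form D a b c"
  "(\<Sum>y | y \<in> qf_points a b c (nat \<lfloor>x\<rfloor>) \<and> prime (nat (case_prod (qf a b c) y)).
    test_function.weight f (ln x) 0 (nat (case_prod (qf a b c) y))) \<le> 2 * prime_class_sum D C f x"
proof -
 interpret test_function f \<nu> K by (rule tf)
 define M where "M = nat \<lfloor>x\<rfloor>"
 define G where "G = weight (ln x) 0"
 have lam0: "(0 :: real) \<le> 1 / 2" by simp
 have M: "real M \<le> x" "x < real M + 1" "M \<ge> 1" using M_bounds[OF x refl order_refl lam0 M_def] by auto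
 have lnx: "ln x \<ge> 1" using L_pos[OF x refl order_refl lam0 M_def] .
 have D0: "D > 0" using D_gt by simp
 obtain n e where nd: "ideal_data n e"
  "\<And>J. J \<in> C \<longleftrightarrow> fractional_ideal D J \<and> (\<exists>\<alpha>\<in>quad_field D - {0}. J = (*) \<alpha> ` hnf 1 n e)"
  by (rule class_representative[OF C]) blast
 define m where "m = (e\<^sup>2 + e + int q) div n"
 have disc: "form_disc D n (2 * e + 1) m" unfolding m_def by (rule data_form_disc[OF nd(1)])
 have df: "data_form n e = qf n (2 * e + 1) m" unfolding data_form_def m_def by (intro ext) simp
 obtain a b c \<alpha> \<beta> \<gamma> \<delta> where r: "reduced_form D a b c" "\<alpha> * \<delta> - \<beta> * \<gamma> = 1"
  "\<And>u v. qf n (2 * e + 1) m u v = qf a b c (\<alpha> * u + \<beta> * v) (\<gamma> * u + \<delta> * v)"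
  using reduction[OF disc D0] by blast
 define T where "T = (\<lambda>(u, v). (\<alpha> * u + \<beta> * v, \<gamma> * u + \<delta> * v))"
 have surjT: "range T = UNIV" using sl2_bij[OF r(2)] unfolding T_def bij_def by blast
 define Q where "Q y = case_prod (qf a b c) y" for y
 have QT: "Q (T y) = case_prod (data_form n e) y" for y
  unfolding Q_def T_def df by (simp add: case_prod_unfold r(3))
 define pts where "pts = qf_points a b c M"
 have finpts: "finite pts" unfolding pts_def by (rule finite_qf_points[OF r(1) D0])
 define S where "S = {y. y \<in> pts \<and> prime (nat (Q y))}"
 define P where "P = {p. prime p \<and> p \<le> M}"
 have finS: "finite S" unfolding S_def using finpts by simp
 have finP: "finite P" by (rule finite_subset[of _ "{..M}"]) (auto simp: P_def)
 have card_le: "card {y \<in> S. nat (Q y) = p} \<le> 2 * class_ideal_count D C p" if p: "p \<in> P" for p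
 proof -
  have pr: "prime p" using p by (simp add: P_def)
  have p1: "p \<ge> 1" using prime_ge_1_nat[OF pr] .
  define R where "R = {y. case_prod (data_form n e) y = int p}"
  have "finite {y. real_of_int (case_prod (qf n (2 * e + 1) m) y) \<le> real p}"
   by (rule form_count_le(1)[OF disc D0]) (use p1 in simp)
  moreover have "R \<subseteq> {y. real_of_int (case_prod (qf n (2 * e + 1) m) y) \<le> real p}" unfolding R_def df by auto
  ultimately have finR: "finite R" by (rule finite_subset[rotated])
  have "{y \<in> S. nat (Q y) = p} \<subseteq> T ` R"
  proof
   fix y assume y: "y \<in> {y \<in> S. nat (Q y) = p}"
   obtain w where w: "y = T w" using surjT by blast
   have "Q y = int p" using y p1 by auto
   hence "w \<in> R" unfolding R_def w QT by simp
   thus "y \<in> T ` R" using w by blast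
  qed
  hence "card {y \<in> S. nat (Q y) = p} \<le> card (T ` R)" by (rule card_mono[OF finite_imageI[OF finR]])
  also have "... \<le> card R" by (rule card_image_le[OF finR])
  also have "... \<le> 2 * class_ideal_count D C p" unfolding R_def by (rule class_ideal_count_ge[OF nd(1) pr nd(2)])
  finally show ?thesis .
 qed
 have G0: "G k \<ge> 0" for k unfolding G_def weight_def using nonneg by simp
 have "(\<lambda>y. nat (Q y)) ` S \<subseteq> P" unfolding S_def P_def pts_def qf_points_def Q_def by auto
 from sum.group[OF finS finP this, where h = "\<lambda>y. G (nat (Q y))"]
 have "(\<Sum>y\<in>S. G (nat (Q y))) = (\<Sum>p\<in>P. \<Sum>y\<in>{y \<in> S. nat (Q y) = p}. G (nat (Q y)))" by simp
 also have "... = (\<Sum>p\<in>P. real (card {y \<in> S. nat (Q y) = p}) * G p)"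
  by (intro sum.cong refl) simp
 also have "... \<le> (\<Sum>p\<in>P. real (2 * class_ideal_count D C p) * G p)"
  by (intro sum_mono mult_right_mono G0) (simp only: of_nat_le_iff card_le)
 also have "... = 2 * (\<Sum>p\<in>P. 1 / real p * real (class_ideal_count D C p) * f (ln (real p) / ln x))"
  by (simp add: sum_distrib_left G_def weight_def mult_ac)
 also have "(\<Sum>p\<in>P. 1 / real p * real (class_ideal_count D C p) * f (ln (real p) / ln x)) = prime_class_sum D C f x"
 proof -
  have z: "f (ln (real p) / ln x) = 0" if "p > M" for p
  proof -
   have "x < real p" using M that by linarith
   hence "ln x < ln (real p)" using x by (subst ln_less_cancel_iff) auto
   hence "ln (real p) / ln x > 1" using lnx by simp
   thus ?thesis by (intro supp) simp
  qed
  have "prime_class_sum D C f x = (\<Sum>\<^sub>\<infinity>p\<in>P. 1 / real p * real (class_ideal_count D C p) * f (ln (real p) / ln x))"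
   unfolding prime_class_sum_def
   by (rule infsum_cong_neutral) (use z in \<open>auto simp: P_def not_le\<close>)
  thus ?thesis using finP by simp
 qed
 finally have "(\<Sum>y\<in>S. G (nat (Q y))) \<le> 2 * prime_class_sum D C f x" .
 thus thesis using that[OF r(1)] unfolding S_def pts_def Q_def G_def M_def by simp
qed

text \<open>For a split prime each of the two sublattices contributes half of the first term. For an
  inert prime the points are p times points of value at most x / p^2; there are at most
  \<open>8 * quarter_area + 9\<close> times x / p^2 of them, each of weight at most K x^(\<nu> -
  1).\<close>

lemma sifted_divisible_bound:
 assumes tf: "test_function f \<nu> K" and x: "x \<ge> 3" and red: "reduced_form D a b c"
  and sw: "sieve_weights sieve_densities (primes_below z) Z (3 / 2) U0 L0" and Z: "Z \<ge> 1"
  and p: "prime p" "D < p" "z \<le> real p" "real p * real p \<le> x"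
 defines "L \<equiv> ln x" and "M \<equiv> nat \<lfloor>x\<rfloor>" and "B \<equiv> 8 * K * ln x * x powr (- (1 / 8))"
  and "c0 \<equiv> 8 * quarter_area / sqrt (real D)"
  and "V \<equiv> \<Prod>p\<in>primes_below z. 1 - real (rho a b c p) / (real p)\<^sup>2"
  and "h \<equiv> \<lambda>y. test_function.weight f (ln x) 0 (nat (case_prod (qf a b c) y))"
  and "sif \<equiv> \<lambda>y. \<forall>l\<in>primes_below z. \<not> int l dvd case_prod (qf a b c) y"
 shows "(\<Sum>y | y \<in> qf_points a b c M \<and> sif y \<and> int p dvd case_prod (qf a b c) y. h y) \<le>
  (if kron D p = 1 then 1 / real p else 0) * (3 * c0 * (L * integral {0..3} f + B) * V + 18 * Z ^ 3 * B) +
  K * (8 * quarter_area + 9) * x powr \<nu> / (real p)\<^sup>2"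
proof -
 interpret test_function f \<nu> K by (rule tf)
 have M_def': "M = nat \<lfloor>x\<rfloor>" by (simp add: M_def)
 have L_def': "L = ln x" by (simp add: L_def)
 define Q where "Q y = case_prod (qf a b c) y" for y
 define \<mu> where "\<mu> = ln (real p) / L"
 have D0: "D > 0" using D_gt by simp
 have p2: "p \<ge> 2" using prime_ge_2_nat[OF p(1)] .
 have lam0: "(0 :: real) \<le> 1 / 2" by simp
 have M: "real M \<le> x" "x < real M + 1" "M \<ge> 1" using M_bounds[OF x refl order_refl lam0 M_def'] by auto
 have L1: "L \<ge> 1" using L_pos[OF x L_def' order_refl lam0 M_def'] .
 \<comment> \<open>The bound p^2 \<le> x keeps the shift within the range of the weight
   estimates.\<close>
 have \<mu>: "0 \<le> \<mu>" "\<mu> \<le> 1 / 2"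
 proof -
  show "0 \<le> \<mu>" unfolding \<mu>_def using p2 L1 by simp
  have "ln (real p * real p) \<le> L" unfolding L_def using p(4) p2 x by (subst ln_le_cancel_iff) auto
  hence "2 * ln (real p) \<le> L" using p2 by (simp add: ln_mult)
  thus "\<mu> \<le> 1 / 2" unfolding \<mu>_def using L1 by (simp add: divide_le_eq)
 qed
 have c0: "0 < c0" "c0 \<le> 8 * quarter_area"
 proof -
  have "sqrt (real D) \<ge> 1" using D_gt by simp
  hence "8 * quarter_area / sqrt (real D) \<le> 8 * quarter_area / 1" using quarter_area_pos by (intro frac_le) auto
  thus "c0 \<le> 8 * quarter_area" unfolding c0_def by simp
  show "0 < c0" unfolding c0_def using quarter_area_pos D_gt by simp
 qed
 define G where "G = weight L 0"
 have G0: "G k \<ge> 0" for k unfolding G_def weight_def using nonneg by simp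
 have hG: "h y = G (nat (Q y))" for y unfolding h_def G_def Q_def L_def ..
 have finpts: "finite (qf_points a b c M)" by (rule finite_qf_points[OF red D0])
 have Bdef: "8 * K * L * x powr (- (1 / 8)) = B" unfolding B_def L_def ..
 have B0: "B \<ge> 0" unfolding B_def using K_nonneg L1 x by (simp add: L_def)
 have J0: "integral {0..3} f \<ge> 0" by (rule integral_nonneg[OF integrable_continuous_real[OF cont]]) (rule nonneg)
 have V0: "V \<ge> 0" unfolding V_def
 proof (rule prod_nonneg)
  fix l assume "l \<in> primes_below z"
  have "real (rho a b c l) \<le> real (l\<^sup>2)" unfolding of_nat_le_iff by (rule rho_le_square)
  thus "0 \<le> 1 - real (rho a b c l) / (real l)\<^sup>2" by (simp add: divide_le_eq)
 qed
 define A where "A = 3 * c0 * (L * integral {0..3} f + B) * V + 18 * Z ^ 3 * B"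
 have A0: "A \<ge> 0" unfolding A_def using c0 L1 J0 B0 V0 Z by (intro add_nonneg_nonneg mult_nonneg_nonneg) auto
 define W where "W = {y. y \<in> qf_points a b c M \<and> sif y \<and> int p dvd Q y}"
 have finW: "finite W" unfolding W_def using finpts by simp
 have T0: "K * (8 * quarter_area + 9) * x powr \<nu> / (real p)\<^sup>2 \<ge> 0"
  using K_nonneg quarter_area_pos x by simp
 have "(\<Sum>y\<in>W. h y) \<le> (if kron D p = 1 then 1 / real p else 0) * A + K * (8 * quarter_area + 9) * x powr \<nu> / (real p)\<^sup>2"
 proof (cases "kron D p = 1")
  case True
  obtain k1 k2 where k: "int p dvd a * k1\<^sup>2 + b * k1 + c" "int p dvd a * k2\<^sup>2 + b * k2 + c"
   "\<And>u v. int p dvd qf a b c u v ==> int p dvd u - k1 * v \<or> int p dvd u - k2 * v"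
   using split_prime_sublattices[OF red p(1,2) True] by blast
  have wt: "real p * G (p * k) = weight L \<mu> k" if "k \<ge> 1" for k
  proof -
   have "ln (real (p * k)) = ln (real p) + ln (real k)" using p2 that by (simp add: ln_mult)
   hence "ln (real (p * k)) / L + 0 = ln (real k) / L + \<mu>" unfolding \<mu>_def by (simp add: add_divide_distrib)
   thus ?thesis unfolding G_def weight_def using p2 by (simp add: mult_ac)
  qed
  have Gz: "G p = 0" "G (p * Suc M) = 0"
   using wt[of 1] wt[of "Suc M"] weight_zero[OF x L_def' \<mu> M_def'] p2 by auto
  have half: "(\<Sum>y | y \<in> qf_points a b c M \<and> sif y \<and> int p dvd fst y - k * snd y. h y) \<le> A / 2 / real p"
   if k: "int p dvd a * k\<^sup>2 + b * k + c" for k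
  proof -
   have P: "prime l" "l < p" if "l \<in> primes_below z" for l using that p(3) by (auto simp: primes_below_def)
   have s1: "(\<Sum>n\<in>{1..M}. real p * G (p * n)) = (\<Sum>n\<in>{1..M}. weight L \<mu> n)"
    by (intro sum.cong refl wt) simp
   have s2: "(\<Sum>n\<in>{1..M}. \<bar>real p * G (p * n) - real p * G (p * Suc n)\<bar> * sqrt (real n)) =
     (\<Sum>n\<in>{1..M}. \<bar>weight L \<mu> n - weight L \<mu> (Suc n)\<bar> * sqrt (real n))"
   proof (rule sum.cong[OF refl])
    fix n assume "n \<in> {1..M}"
    hence "real p * G (p * n) = weight L \<mu> n" "real p * G (p * Suc n) = weight L \<mu> (Suc n)" by (auto intro!: wt simp del: mult_Suc_right)
    thus "\<bar>real p * G (p * n) - real p * G (p * Suc n)\<bar> * sqrt (real n) = \<bar>weight L \<mu> n - weight L \<mu> (Suc n)\<bar> * sqrt (real n)"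
     by (simp only:)
   qed
   have le1: "(\<Sum>n\<in>{1..M}. weight L \<mu> n) \<le> L * integral {0..3} f + B"
    using weight_sum[OF x L_def' \<mu> M_def'] unfolding Bdef total_def by linarith
   have le2: "(\<Sum>n\<in>{1..M}. \<bar>weight L \<mu> n - weight L \<mu> (Suc n)\<bar> * sqrt (real n)) \<le> B"
    using weight_variation[OF x L_def' \<mu> M_def'] unfolding Bdef .
   have "(\<Sum>y | y \<in> qf_points a b c M \<and> sif y \<and> int p dvd fst y - k * snd y. h y) \<le>
     (3 / 2 * (c0 * (\<Sum>n\<in>{1..M}. weight L \<mu> n)) * V +
      9 * Z ^ 3 * (\<Sum>n\<in>{1..M}. \<bar>weight L \<mu> n - weight L \<mu> (Suc n)\<bar> * sqrt (real n))) / real p"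
    using form_sieve_sublattice[OF red D_prime sw P Z p(1) k Gz G0] unfolding s1 s2
    unfolding sif_def hG Q_def c0_def V_def .
   also have "... \<le> (3 / 2 * (c0 * (L * integral {0..3} f + B)) * V + 9 * Z ^ 3 * B) / real p"
    using le1 le2 c0 V0 Z by (intro divide_right_mono add_mono mult_right_mono mult_left_mono) auto
   also have "... = A / 2 / real p" by (simp add: A_def algebra_simps add_divide_distrib)
   finally show ?thesis .
  qed
  define W1 where "W1 k = {y. y \<in> qf_points a b c M \<and> sif y \<and> int p dvd fst y - k * snd y}" for k
  have finW1: "finite (W1 k)" for k unfolding W1_def using finpts by simp
  have h0: "h y \<ge> 0" for y unfolding hG by (rule G0)
  have "W \<subseteq> W1 k1 \<union> W1 k2"
  proof
   fix y assume y: "y \<in> W"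
   have "int p dvd qf a b c (fst y) (snd y)" using y by (simp add: W_def Q_def case_prod_unfold)
   thus "y \<in> W1 k1 \<union> W1 k2" using k(3) y by (auto simp: W_def W1_def)
  qed
  hence "(\<Sum>y\<in>W. h y) \<le> (\<Sum>y\<in>W1 k1 \<union> W1 k2. h y)" using finW1 h0 by (intro sum_mono2) auto
  also have "... \<le> (\<Sum>y\<in>W1 k1. h y) + (\<Sum>y\<in>W1 k2. h y)"
   using sum.union_inter[OF finW1 finW1, of h k1 k2] sum_nonneg[of "W1 k1 \<inter> W1 k2" h] h0 by simp
  also have "... \<le> A / 2 / real p + A / 2 / real p" unfolding W1_def by (intro add_mono half k(1,2))
  also have "... = 1 / real p * A" by (simp add: field_simps)
  finally show ?thesis using True T0 by simp
 next
  case False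
  \<comment> \<open>The only ramified prime is D, and p is larger.\<close>
  have "kron D p ~= 0" using ramified_prime[OF p(1)] p(2) by auto
  hence X: "kron D p = - 1" using False rc.X_vals[of p] by auto
  define y0 where "y0 = x / (real p)\<^sup>2"
  have y0: "y0 \<ge> 1" unfolding y0_def using p(4) p2 by (simp add: le_divide_eq power2_eq_square)
  define R where "R = {y. real_of_int (Q y) \<le> y0}"
  have form: "form_disc D a b c" using red by (simp add: reduced_form_def)
  have R: "finite R" "real (card R) \<le> c0 * y0 + 9 * sqrt y0"
   unfolding R_def Q_def c0_def using form_count_le[OF form D0 y0] by auto
  define \<Psi> where "\<Psi> y = (fst y div int p, snd y div int p)" for y :: "int \<times> int"
  have \<Psi>: "fst y = int p * fst (\<Psi> y)" "snd y = int p * snd (\<Psi> y)" "Q y = (int p)\<^sup>2 * Q (\<Psi> y)" if y: "y \<in> W" for y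
  proof -
   have "int p dvd qf a b c (fst y) (snd y)" using y by (simp add: W_def Q_def case_prod_unfold)
   from inert_prime_dvd[OF red p(1,2) X this]
   show 1: "fst y = int p * fst (\<Psi> y)" "snd y = int p * snd (\<Psi> y)" by (simp_all add: \<Psi>_def)
   have "Q y = qf a b c (int p * fst (\<Psi> y)) (int p * snd (\<Psi> y))" unfolding Q_def case_prod_unfold 1[symmetric] ..
   thus "Q y = (int p)\<^sup>2 * Q (\<Psi> y)" by (simp add: Q_def case_prod_unfold qf_def power2_eq_square algebra_simps)
  qed
  have "inj_on \<Psi> W"
  proof (rule inj_onI)
   fix y y' assume "y \<in> W" "y' \<in> W" "\<Psi> y = \<Psi> y'"
   thus "y = y'" using \<Psi>(1,2)[of y] \<Psi>(1,2)[of y'] by (simp add: prod_eq_iff)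
  qed
  moreover have "\<Psi> ` W \<subseteq> R"
  proof
   fix w assume "w \<in> \<Psi> ` W"
   then obtain y where y: "y \<in> W" "w = \<Psi> y" by blast
   have "Q y \<le> int M" using y(1) by (auto simp: W_def qf_points_def Q_def)
   hence "real_of_int (Q y) \<le> x" using M(1) by linarith
   hence "(real p)\<^sup>2 * real_of_int (Q w) \<le> x" unfolding \<Psi>(3)[OF y(1)] y(2) by simp
   thus "w \<in> R" unfolding R_def y0_def using p2 by (simp add: le_divide_eq mult.commute)
  qed
  ultimately have "card W \<le> card R" using R(1) by (rule card_inj_on_le)
  hence "real (card W) \<le> c0 * y0 + 9 * sqrt y0" using R(2) by linarith
  also have "... \<le> 8 * quarter_area * y0 + 9 * y0"
  proof -
   have "sqrt y0 \<le> sqrt (y0 * y0)" using y0 by (intro real_sqrt_le_mono) simp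
   hence "sqrt y0 \<le> y0" using y0 by simp
   moreover have "c0 * y0 \<le> 8 * quarter_area * y0" using c0 y0 by (intro mult_right_mono) auto
   ultimately show ?thesis by linarith
  qed
  finally have cW: "real (card W) \<le> (8 * quarter_area + 9) * y0" by (simp add: algebra_simps)
  \<comment> \<open>The weight vanishes for values below x^(1 - \<nu>), so dividing by the value
    gains almost a full power of x.\<close>
  have hle: "h y \<le> K * x powr \<nu> / x" if y: "y \<in> W" for y
  proof -
   define m where "m = nat (Q y)"
   have m: "m \<ge> 1" "real m \<le> x" using y M by (auto simp: W_def qf_points_def Q_def m_def)
   define u where "u = ln (real m) / L"
   have h: "h y = f u / real m" unfolding hG m_def[symmetric] G_def weight_def u_def by simp
   show ?thesis
   proof (cases "u \<in> {1 - \<nu>..1}")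
    case True
    have "(1 - \<nu>) * L \<le> ln (real m)" using True L1 by (simp add: u_def le_divide_eq)
    hence "exp ((1 - \<nu>) * L) \<le> exp (ln (real m))" by simp
    hence xm: "x powr (1 - \<nu>) \<le> real m" using m x by (simp add: powr_def L_def)
    have "f u \<le> K" using True \<nu> by (intro K(1)) auto
    hence "f u / real m \<le> K / x powr (1 - \<nu>)"
     using xm m x K_nonneg by (intro frac_le) auto
    also have "x powr (1 - \<nu>) = x / x powr \<nu>" using x by (simp add: powr_diff)
    finally show ?thesis unfolding h by simp
   next
    case False
    thus ?thesis unfolding h using supp[OF False] K_nonneg x by simp
   qed
  qed
  have "(\<Sum>y\<in>W. h y) \<le> real (card W) * (K * x powr \<nu> / x)"
   using sum_bounded_above[of W h "K * x powr \<nu> / x"] hle by simp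
  also have "... \<le> ((8 * quarter_area + 9) * y0) * (K * x powr \<nu> / x)"
   using cW K_nonneg x by (intro mult_right_mono) auto
  also have "... = K * (8 * quarter_area + 9) * x powr \<nu> / (real p)\<^sup>2"
  proof -
   have "y0 * (K * x powr \<nu> / x) = K * x powr \<nu> / (real p)\<^sup>2" unfolding y0_def using x by simp
   hence "(8 * quarter_area + 9) * (y0 * (K * x powr \<nu> / x)) = (8 * quarter_area + 9) * (K * x powr \<nu> / (real p)\<^sup>2)" by (simp only:)
   thus ?thesis by (simp only: mult_ac times_divide_eq_right times_divide_eq_left)
  qed
  finally show ?thesis using False by simp
 qed
 thus ?thesis unfolding W_def Q_def A_def .
qed

end

context imag_quad
begin

text \<open>The lower sieve keeps 1 / 2 of the main term. The composites cost at most 1 / 12 of the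
  constant 3 from two sublattices and upper sieves of constant 3 / 2, that is 1 / 4, and 1 / 4
  remains. The constant 11 covers the remainders 9 + 3 / 2.\<close>

lemma prime_class_sum_lower_bound:
 assumes tf: "test_function f \<nu> K" and x: "x \<ge> 3" and C: "C \<in> ideal_classes D"
  and sw: "sieve_weights sieve_densities (primes_below z) Z (3 / 2) U0 L0" and Z: "Z \<ge> 1"
  and z: "z = real (D ^ 32) + 1"
  and split: "(\<Sum>p | prime p \<and> D ^ 32 < p \<and> p \<le> (nat \<lceil>x\<rceil>)\<^sup>2 \<and> kron D p = 1. 1 / real p) \<le> 1 / 12"
 defines "L \<equiv> ln x" and "J \<equiv> integral {0..3} f" and "B \<equiv> 8 * K * ln x * x powr (- (1 / 8))"
  and "c0 \<equiv> 8 * quarter_area / sqrt (real D)"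
 assumes small: "B \<le> L * J / 4"
 shows "exp (- 10) / 16 / (ln z)\<^sup>2 * c0 * (L * J / 4 - B) - 11 * Z ^ 3 * B -
   K * (8 * quarter_area + 9) * x powr \<nu> / real (D ^ 32) \<le> 2 * prime_class_sum D C f x"
proof -
 interpret test_function f \<nu> K by (rule tf)
 define M where "M = nat \<lfloor>x\<rfloor>"
 have L_def': "L = ln x" by (simp add: L_def)
 have lam0: "(0 :: real) \<le> 1 / 2" by simp
 note ctx = x L_def' order_refl lam0 M_def
 have M: "real M \<le> x" "x < real M + 1" "M \<ge> 1" using M_bounds[OF ctx] by auto
 have L1: "L \<ge> 1" using L_pos[OF ctx] .
 have D0: "D > 0" using D_gt by simp
 define N where "N = D ^ 32"
 have DN: "D \<le> N" "N \<ge> 1" unfolding N_def using D_gt by (auto intro: self_le_power)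
 obtain a b c where red: "reduced_form D a b c" and S_ge:
  "(\<Sum>y | y \<in> qf_points a b c M \<and> prime (nat (case_prod (qf a b c) y)).
    weight L 0 (nat (case_prod (qf a b c) y))) \<le> 2 * prime_class_sum D C f x"
  using prime_class_sum_ge_form[OF tf x C] unfolding M_def L_def by blast
 define Q where "Q y = case_prod (qf a b c) y" for y
 define h where "h y = weight L 0 (nat (Q y))" for y
 define pts where "pts = qf_points a b c M"
 define sif where "sif y \<longleftrightarrow> (\<forall>l\<in>primes_below z. \<not> int l dvd Q y)" for y
 define V where "V = (\<Prod>p\<in>primes_below z. 1 - real (rho a b c p) / (real p)\<^sup>2)"
 \<comment> \<open>The last condition asks for a prime factor up to the square root of the value;
   every composite value has one, and it is at most sqrt x.\<close>
 define W where "W p y \<longleftrightarrow> sif y \<and> int p dvd Q y \<and> int p * int p \<le> Q y" for p :: nat and y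
 define PP where "PP = {p. prime p \<and> N < p \<and> p \<le> M}"
 define A where "A = 3 * c0 * (L * J + B) * V + 18 * Z ^ 3 * B"
 define T where "T = K * (8 * quarter_area + 9) * x powr \<nu>"
 have finpts: "finite pts" unfolding pts_def by (rule finite_qf_points[OF red D0])
 have finPP: "finite PP" by (rule finite_subset[of _ "{..M}"]) (auto simp: PP_def)
 have h0: "h y \<ge> 0" for y unfolding h_def weight_def using nonneg by simp
 have c0: "0 < c0" unfolding c0_def using quarter_area_pos D_gt by simp
 have Bdef: "8 * K * L * x powr (- (1 / 8)) = B" unfolding B_def L_def ..
 have B0: "B \<ge> 0" unfolding B_def using K_nonneg L1 x by (simp add: L_def)
 have J0: "J \<ge> 0" unfolding J_def by (rule integral_nonneg[OF integrable_continuous_real[OF cont]]) (rule nonneg)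
 have T0: "T \<ge> 0" unfolding T_def using K_nonneg quarter_area_pos by simp
 \<comment> \<open>The added 1 turns the strict inequality of \<open>primes_below\<close> into p
   \<le> D^32.\<close>
 have zN: "z = real N + 1" unfolding z N_def ..
 have z2: "z \<ge> 2" using DN unfolding zN by simp
 have V_ge: "exp (- 10) / 16 / (ln z)\<^sup>2 \<le> V"
 proof -
  have "(\<lambda>p. real (rho a b c p) / (real p)\<^sup>2) \<in> sieve_densities"
   unfolding sieve_densities_def
  proof (intro CollectI allI impI conjI)
   fix p :: nat assume p: "prime p"
   have "1 \<le> p" using prime_ge_1_nat[OF p] .
   have "form_disc D a b c" using red by (simp add: reduced_form_def)
   from rho_prime_le[OF p this D_prime] have "real (rho a b c p) \<le> real (2 * p - 1)" by (simp only: of_nat_le_iff)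
   also have "... = 2 * real p - 1" using \<open>1 \<le> p\<close> by (simp add: of_nat_diff)
   finally show "real (rho a b c p) / (real p)\<^sup>2 \<le> (2 * real p - 1) / (real p)\<^sup>2" by (rule divide_right_mono) simp
  qed simp
  thus ?thesis unfolding V_def by (rule prod_primes_below_density_ge[OF _ z2])
 qed
 have "0 \<le> exp (- 10) / 16 / (ln z)\<^sup>2" by simp
 hence V0: "V \<ge> 0" using V_ge by linarith
 have A0: "A \<ge> 0" unfolding A_def using c0 L1 J0 B0 V0 Z by (intro add_nonneg_nonneg mult_nonneg_nonneg) auto
 have sift: "1 / 2 * (c0 * (L * J - B)) * V - 9 * Z ^ 3 * B \<le> (\<Sum>y | y \<in> pts \<and> sif y. h y)"
 proof -
  have wn: "weight L 0 n \<ge> 0" for n unfolding weight_def using nonneg by simp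
  have P: "prime p" if "p \<in> primes_below z" for p using that by (simp add: primes_below_def)
  have le1: "L * J - B \<le> (\<Sum>n\<in>{1..M}. weight L 0 n)"
   using weight_sum[OF ctx] unfolding Bdef total_def J_def by linarith
  have le2: "(\<Sum>n\<in>{1..M}. \<bar>weight L 0 n - weight L 0 (Suc n)\<bar> * sqrt (real n)) \<le> B"
   using weight_variation[OF ctx] unfolding Bdef .
  have "1 / 2 * (c0 * (L * J - B)) * V - 9 * Z ^ 3 * B \<le>
    1 / 2 * (c0 * (\<Sum>n\<in>{1..M}. weight L 0 n)) * V -
    9 * Z ^ 3 * (\<Sum>n\<in>{1..M}. \<bar>weight L 0 n - weight L 0 (Suc n)\<bar> * sqrt (real n))"
   using le1 le2 c0 V0 Z by (intro diff_mono mult_right_mono mult_left_mono) auto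
  also have "... \<le> (\<Sum>y | y \<in> pts \<and> sif y. h y)"
   using form_sieve(2)[OF red D_prime sw P Z weight_zero[OF ctx] wn]
   unfolding pts_def sif_def h_def Q_def c0_def V_def .
  finally show ?thesis .
 qed
 have WP: "(\<Sum>y | y \<in> pts \<and> W p y. h y) \<le> (if kron D p = 1 then 1 / real p else 0) * A + T / (real p)\<^sup>2"
  if p: "p \<in> PP" for p
 proof (cases "real p * real p \<le> x")
  case True
  have pp: "prime p" "D < p" "z \<le> real p" using p DN unfolding PP_def zN by auto
  have "(\<Sum>y | y \<in> pts \<and> W p y. h y) \<le> (\<Sum>y | y \<in> pts \<and> sif y \<and> int p dvd Q y. h y)"
   using finpts h0 by (intro sum_mono2) (auto simp: W_def)
  also have "... \<le> (if kron D p = 1 then 1 / real p else 0) * A + T / (real p)\<^sup>2"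
   using sifted_divisible_bound[OF tf x red sw Z pp True]
   unfolding pts_def sif_def h_def Q_def A_def T_def V_def c0_def J_def B_def L_def M_def .
  finally show ?thesis .
 next
  \<comment> \<open>A prime with p^2 > x is too large to be such a factor, so the sum is
    empty.\<close>
  case False
  have "\<not> (y \<in> pts \<and> W p y)" for y
  proof
   assume y: "y \<in> pts \<and> W p y"
   hence "int p * int p \<le> int M" unfolding pts_def qf_points_def W_def Q_def by auto
   hence "real_of_int (int p * int p) \<le> real_of_int (int M)" by (simp only: of_int_le_iff)
   thus False using False M(1) by simp
  qed
  hence e: "{y. y \<in> pts \<and> W p y} = {}" by blast
  show ?thesis unfolding e using A0 T0 by simp
 qed
 \<comment> \<open>A sifted value is 1, a prime, or composite and then caught by some
   \<open>W p\<close>. Weights are nonnegative, so counting a composite for several p does no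
   harm.\<close>
 have cover: "(\<Sum>y | y \<in> pts \<and> sif y. h y) \<le>
   (\<Sum>y | y \<in> pts \<and> prime (nat (Q y)). h y) + (\<Sum>p\<in>PP. \<Sum>y | y \<in> pts \<and> W p y. h y)"
 proof -
  have pw: "(if sif y then h y else 0) \<le> (if prime (nat (Q y)) then h y else 0) + (\<Sum>p\<in>PP. if W p y then h y else 0)"
   if y: "y \<in> pts" for y
  proof -
   have s0: "0 \<le> (\<Sum>p\<in>PP. if W p y then h y else 0)" using h0 by (intro sum_nonneg) auto
   define m where "m = nat (Q y)"
   have m: "m \<ge> 1" "m \<le> M" "Q y = int m" using y unfolding pts_def qf_points_def Q_def m_def by auto
   consider "\<not> sif y" | "prime m" | "m = 1" | "sif y" "m > 1" "\<not> prime m" using m(1) by linarith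
   thus ?thesis
   proof cases
    case 1
    thus ?thesis using s0 h0 by simp
   next
    case 2
    thus ?thesis using s0 h0 unfolding m_def by simp
   next
    \<comment> \<open>The value 1 is neither prime nor composite, but its weight is 0.\<close>
    case 3
    have "h y = 0" unfolding h_def using 3 weight_zero(1)[OF ctx] by (simp add: m_def)
    thus ?thesis using s0 by simp
   next
    case 4
    obtain p where p: "prime p" "p dvd m" "p * p \<le> m" using prime_square_divisor[OF 4(2,3)] by blast
    have "p \<le> p * p" using prime_ge_1_nat[OF p(1)] by simp
    hence pM: "p \<le> M" using p(3) m(2) by linarith
    have dv: "int p dvd Q y" unfolding m(3) using p(2) by simp
    have "p \<notin> primes_below z" using 4(1) dv unfolding sif_def by blast
    hence "N < p" using p(1) unfolding primes_below_def zN by auto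
    hence pPP: "p \<in> PP" using p(1) pM by (simp add: PP_def)
    have "int p * int p \<le> Q y" unfolding m(3) using p(3) by (simp flip: of_nat_mult)
    hence "W p y" using 4(1) dv by (simp add: W_def)
    hence "h y = (if W p y then h y else 0)" by simp
    also have "... \<le> (\<Sum>p\<in>PP. if W p y then h y else 0)"
     by (rule member_le_sum[OF pPP _ finPP]) (use h0 in auto)
    finally show ?thesis using 4(1) h0[of y] by simp
   qed
  qed
  have "(\<Sum>y | y \<in> pts \<and> sif y. h y) = (\<Sum>y\<in>pts. if sif y then h y else 0)"
   by (rule sum.inter_filter[OF finpts])
  also have "... \<le> (\<Sum>y\<in>pts. (if prime (nat (Q y)) then h y else 0) + (\<Sum>p\<in>PP. if W p y then h y else 0))"
   by (rule sum_mono) (rule pw)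
  also have "... = (\<Sum>y\<in>pts. if prime (nat (Q y)) then h y else 0) + (\<Sum>p\<in>PP. \<Sum>y\<in>pts. if W p y then h y else 0)"
   unfolding sum.distrib by (subst sum.swap) (rule refl)
  also have "(\<Sum>y\<in>pts. if prime (nat (Q y)) then h y else 0) = (\<Sum>y | y \<in> pts \<and> prime (nat (Q y)). h y)"
   by (rule sum.inter_filter[OF finpts, symmetric])
  also have "(\<Sum>p\<in>PP. \<Sum>y\<in>pts. if W p y then h y else 0) = (\<Sum>p\<in>PP. \<Sum>y | y \<in> pts \<and> W p y. h y)"
   by (intro sum.cong refl sum.inter_filter[OF finpts, symmetric])
  finally show ?thesis .
 qed
 have "(\<Sum>p\<in>PP. \<Sum>y | y \<in> pts \<and> W p y. h y) \<le> (\<Sum>p\<in>PP. (if kron D p = 1 then 1 / real p else 0) * A + T / (real p)\<^sup>2)"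
  by (rule sum_mono) (rule WP)
 also have "... = (\<Sum>p\<in>PP. if kron D p = 1 then 1 / real p else 0) * A + T * (\<Sum>p\<in>PP. 1 / (real p)\<^sup>2)"
  by (simp add: sum.distrib sum_distrib_right sum_distrib_left)
 also have "... \<le> 1 / 12 * A + T * (1 / real N)"
 proof (intro add_mono mult_right_mono mult_left_mono A0 T0)
  have "(\<Sum>p\<in>PP. if kron D p = 1 then 1 / real p else 0) = (\<Sum>p | p \<in> PP \<and> kron D p = 1. 1 / real p)"
   by (rule sum.inter_filter[OF finPP, symmetric])
  also have "... \<le> (\<Sum>p | prime p \<and> D ^ 32 < p \<and> p \<le> (nat \<lceil>x\<rceil>)\<^sup>2 \<and> kron D p = 1. 1 / real p)"
  proof (rule sum_mono2)
   show "finite {p. prime p \<and> D ^ 32 < p \<and> p \<le> (nat \<lceil>x\<rceil>)\<^sup>2 \<and> kron D p = 1}"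
    by (rule finite_subset[of _ "{..(nat \<lceil>x\<rceil>)\<^sup>2}"]) auto
   \<comment> \<open>The range up to the square of the rounded x stems from the squares in
     \<open>exceptional_zero_split_primes\<close>; it amply contains the primes up to M.\<close>
   have "M \<le> nat \<lceil>x\<rceil>" unfolding M_def by linarith
   moreover have "nat \<lceil>x\<rceil> \<le> (nat \<lceil>x\<rceil>)\<^sup>2" using x by (intro self_le_power) linarith+
   ultimately have "M \<le> (nat \<lceil>x\<rceil>)\<^sup>2" by linarith
   thus "{p. p \<in> PP \<and> kron D p = 1} \<subseteq> {p. prime p \<and> D ^ 32 < p \<and> p \<le> (nat \<lceil>x\<rceil>)\<^sup>2 \<and> kron D p = 1}"
    unfolding PP_def N_def by auto
  qed simp
  also note split
  finally show "(\<Sum>p\<in>PP. if kron D p = 1 then 1 / real p else 0) \<le> 1 / 12" .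
  have "(\<Sum>p\<in>PP. 1 / (real p)\<^sup>2) \<le> (\<Sum>p\<in>{N<..M}. 1 / (real p)\<^sup>2)"
   by (rule sum_mono2) (auto simp: PP_def)
  thus "(\<Sum>p\<in>PP. 1 / (real p)\<^sup>2) \<le> 1 / real N" using sum_inverse_squares_tail[OF DN(2), of M] by linarith
 qed
 finally have comp: "(\<Sum>p\<in>PP. \<Sum>y | y \<in> pts \<and> W p y. h y) \<le> A / 12 + T / real N" by simp
 have prim: "(\<Sum>y | y \<in> pts \<and> prime (nat (Q y)). h y) \<le> 2 * prime_class_sum D C f x"
  using S_ge unfolding pts_def h_def Q_def .
 have e1: "A / 12 = 1 / 4 * (c0 * V * (L * J)) + 1 / 4 * (c0 * V * B) + 3 / 2 * (Z ^ 3 * B)"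
  unfolding A_def by (simp add: algebra_simps)
 have e2: "1 / 2 * (c0 * (L * J - B)) * V - 9 * Z ^ 3 * B = 1 / 2 * (c0 * V * (L * J)) - 1 / 2 * (c0 * V * B) - 9 * (Z ^ 3 * B)"
  by (simp add: algebra_simps)
 have p1: "0 \<le> c0 * V * B" "0 \<le> Z ^ 3 * B" using c0 V0 B0 Z by simp_all
 have "exp (- 10) / 16 / (ln z)\<^sup>2 * c0 * (L * J / 4 - B) \<le> V * c0 * (L * J / 4 - B)"
  using V_ge c0 small by (intro mult_right_mono) auto
 also have "... = 1 / 4 * (c0 * V * (L * J)) - c0 * V * B" by (simp add: algebra_simps)
 finally have "exp (- 10) / 16 / (ln z)\<^sup>2 * c0 * (L * J / 4 - B) \<le> 1 / 4 * (c0 * V * (L * J)) - c0 * V * B" .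
 moreover have "11 * Z ^ 3 * B = 11 * (Z ^ 3 * B)" by simp
 ultimately show ?thesis
  using sift comp prim cover p1 unfolding e1 e2 T_def[symmetric] N_def[symmetric] by linarith
qed

text \<open>Since ln Y is at most 8 Y^(1/8) and U^(1/8) = D^2 for U = D^16, the errors are at most
  13 * 8 / D, and D \<ge> 10400 makes this at most 1 / 100. As V^2 is at most x^4, the hypothesis on
  \<beta> bounds the growth factor by exp (1 / 100).\<close>

lemma split_prime_sum_small:
 assumes L: "(\<lambda>n. kron D (Suc n) * real (Suc n) powr (- 1)) sums l" "l > 0"
  and z: "(\<lambda>n. kron D (Suc n) * real (Suc n) powr (- \<beta>)) sums 0"
  and \<beta>: "\<beta> \<ge> 3 / 4" "1 - \<beta> \<le> 1 / (400 * ln x)" and x: "x \<ge> 3" and D: "D \<ge> 10400"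
 shows "(\<Sum>p | prime p \<and> D ^ 32 < p \<and> p \<le> (nat \<lceil>x\<rceil>)\<^sup>2 \<and> kron D p = 1. 1 / real p) \<le> 1 / 12"
proof -
 define U where "U = D ^ 16"
 define V where "V = nat \<lceil>x\<rceil>"
 define \<epsilon> where "\<epsilon> = 104 / real D"
 have \<epsilon>: "0 < \<epsilon>" "\<epsilon> \<le> 1 / 100" unfolding \<epsilon>_def using D by (auto simp: divide_le_eq)
 have DU: "D \<le> U" unfolding U_def using D by (intro self_le_power) auto
 have V1: "V \<ge> 1" unfolding V_def using x by linarith
 have small: "13 * real D * real Y powr (- (1 / 4)) * ln (real Y) \<le> \<epsilon>" if Y: "U \<le> Y" for Y :: nat
 proof -
  have Y1: "real Y \<ge> 1" using Y DU D by linarith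
  have "ln (real Y) \<le> real Y powr (1 / 8) / (1 / 8)" by (rule ln_powr_bound[OF Y1]) simp
  hence "13 * real D * real Y powr (- (1 / 4)) * ln (real Y) \<le> 13 * real D * real Y powr (- (1 / 4)) * (real Y powr (1 / 8) / (1 / 8))"
   by (intro mult_left_mono) auto
  also have "... = 104 * real D * (real Y powr (- (1 / 4)) * real Y powr (1 / 8))" by simp
  also have "real Y powr (- (1 / 4)) * real Y powr (1 / 8) = real Y powr (- (1 / 8))" by (simp flip: powr_add)
  also have "104 * real D * real Y powr (- (1 / 8)) \<le> 104 * real D * real U powr (- (1 / 8))"
   using Y DU D by (intro mult_left_mono powr_mono2') auto
  also have "real U powr (- (1 / 8)) = real D powr (- 2)"
  proof -
   have "real U = real D powr 16" unfolding U_def using D by (simp add: powr_numeral)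
   thus ?thesis by (simp only: powr_powr) simp
  qed
  also have "104 * real D * real D powr (- 2) = \<epsilon>"
   unfolding \<epsilon>_def using D by (simp add: powr_minus power2_eq_square divide_simps)
  finally show ?thesis .
 qed
 have UV: "U \<le> U * V" using V1 by simp
 have U4: "U \<ge> 4" using DU D by simp
 have e1: "\<epsilon> < 1" using \<epsilon> by simp
 note ex = rc.exceptional_zero_split_primes[OF L(1) z \<beta>(1) U4 V1 L(2) e1 small[OF order_refl] small[OF UV]]
 have lx: "ln x \<ge> 1"
 proof -
  have "exp 1 \<le> x" using x exp_le by simp
  thus ?thesis using x by (subst ln_ge_iff) auto
 qed
 have "real (V ^ 2) powr (1 - \<beta>) \<le> exp (1 / 100)"
 proof -
  have "3 * x \<le> x * x" using x by (intro mult_right_mono) auto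
  moreover have "real V \<le> x + 1" unfolding V_def using x by linarith
  ultimately have Vx: "real V \<le> x * x" using x by linarith
  have "real (V ^ 2) \<le> (x * x) * (x * x)" unfolding power2_eq_square of_nat_mult using Vx V1 by (intro mult_mono) auto
  hence "ln (real (V ^ 2)) \<le> ln ((x * x) * (x * x))" using V1 x by (subst ln_le_cancel_iff) auto
  also have "... = 4 * ln x" using x by (simp add: ln_mult)
  finally have lv: "ln (real (V ^ 2)) \<le> 4 * ln x" .
  have "(1 - \<beta>) * ln (real (V ^ 2)) \<le> 1 / (400 * ln x) * (4 * ln x)"
   using \<beta>(2) ex(1) lv V1 lx by (intro mult_mono) auto
  also have "... = 1 / 100" using lx by simp
  finally show ?thesis using V1 by (simp add: powr_def)
 qed
 also have "exp (1 / 100 :: real) \<le> 1 + 1 / 100 + (1 / 100)\<^sup>2" by (rule exp_bound) auto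
 also have "... \<le> 1 + 2 / 100" by (simp add: power2_eq_square)
 finally have a: "real (V ^ 2) powr (1 - \<beta>) - 1 \<le> 2 / 100" by simp
 have "(1 + \<epsilon>) * (real (V ^ 2) powr (1 - \<beta>) - 1) \<le> (1 + \<epsilon>) * (2 / 100)" using a \<epsilon> by (intro mult_left_mono) auto
 also have "... \<le> (1 + 1 / 100) * (2 / 100)" using \<epsilon> by (intro mult_right_mono) auto
 finally have b: "(1 + \<epsilon>) * (real (V ^ 2) powr (1 - \<beta>) - 1) \<le> (1 + 1 / 100) * (2 / 100)" .
 have "(\<Sum>p | prime p \<and> U ^ 2 < p \<and> p \<le> V ^ 2 \<and> kron D p = 1. 1 / real p) \<le>
   (1 + \<epsilon>) * (real (V ^ 2) powr (1 - \<beta>) - 1) + 2 * \<epsilon>" by (rule ex(2))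
 also have "... \<le> (1 + 1 / 100) * (2 / 100) + 2 * (1 / 100)"
  by (rule add_mono[OF b mult_left_mono[OF \<epsilon>(2)]]) simp
 also have "... \<le> 1 / 12" by simp
 finally have "(\<Sum>p | prime p \<and> U ^ 2 < p \<and> p \<le> V ^ 2 \<and> kron D p = 1. 1 / real p) \<le> 1 / 12" .
 moreover have "U ^ 2 = D ^ 32" unfolding U_def by (simp flip: power_mult)
 ultimately show ?thesis unfolding V_def by simp
qed

end

section \<open>The choice of the constants\<close>

lemma eventually_log_decay:
 fixes c a \<epsilon> :: real
 assumes "a > 0" "\<epsilon> > 0" "c \<ge> 0"
 shows "\<forall>\<^sub>F x in at_top. c * (ln x)\<^sup>2 * x powr (- a) \<le> \<epsilon>"
proof -
 have "((\<lambda>x. c * (16 / a\<^sup>2) * x powr (- (a / 2))) \<longlongrightarrow> c * (16 / a\<^sup>2) * 0) at_top"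
  using assms(1) by (intro tendsto_mult tendsto_const tendsto_neg_powr filterlim_ident) auto
 hence "\<forall>\<^sub>F x in at_top. c * (16 / a\<^sup>2) * x powr (- (a / 2)) < \<epsilon>"
  using assms(2) by (intro order_tendstoD(2)) auto
 thus ?thesis using eventually_ge_at_top[of 1]
 proof eventually_elim
  case (elim x)
  have "ln x \<le> x powr (a / 4) / (a / 4)" using elim assms(1) by (intro ln_powr_bound) auto
  hence "(ln x)\<^sup>2 \<le> (x powr (a / 4) / (a / 4))\<^sup>2" using elim by (intro power_mono) auto
  also have "... = 16 / a\<^sup>2 * (x powr (a / 4) * x powr (a / 4))" by (simp add: power2_eq_square field_simps)
  also have "x powr (a / 4) * x powr (a / 4) = x powr (a / 2)" by (simp flip: powr_add)
  finally have "c * (ln x)\<^sup>2 * x powr (- a) \<le> c * (16 / a\<^sup>2 * x powr (a / 2)) * x powr (- a)"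
   using assms(3) by (intro mult_right_mono mult_left_mono) auto
  also have "... = c * (16 / a\<^sup>2) * (x powr (a / 2) * x powr (- a))" by simp
  also have "x powr (a / 2) * x powr (- a) = x powr (- (a / 2))" by (simp flip: powr_add)
  finally show ?case using elim by simp
 qed
qed

theorem theorem2p2:
  shows "\<exists>\<theta>::real. 0 < \<theta> \<and> \<theta> < 1 \<and>
    (\<exists>\<nu>0::real. 0 < \<nu>0 \<and> \<nu>0 < 1 \<and>
    (\<exists>c::real. 0 < c \<and>
    (\<exists>\<kappa>::real. 0 < \<kappa> \<and>
      (\<forall>\<nu> f. 0 < \<nu> \<and> \<nu> \<le> \<nu>0 \<and> weight_function \<nu> f \<longrightarrow>
        (\<forall>\<^sub>F x::real in at_top. \<forall>D::nat. \<forall>C.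
           prime D \<and> D > 3 \<and> [D = 3] (mod 4) \<and> real D = x powr \<theta> \<and> C \<in> ideal_classes D \<and>
           (\<exists>\<beta>::real. \<beta> > 1 - c / ln (real D) \<and> dirichlet_L (chi D) (of_real \<beta>) = 0)
           \<longrightarrow>
           prime_class_sum D C f x \<ge>
             \<kappa> * (Re (fourier_transform f 0) / real (class_number D)
                  * (Re (dirichlet_L (chi D) 1) / ln x)))))))"
proof -
 have "\<exists>b. \<forall>z\<ge>2. \<exists>U L. sieve_weights sieve_densities (primes_below z) (z ^ b) (3 / 2) U L"
  by (rule sieve_weights_exist) blast
 then obtain b :: nat where sieve:
  "\<forall>z\<ge>2. \<exists>U L. sieve_weights sieve_densities (primes_below z) (z ^ b) (3 / 2) U L"
  by blast
 \<comment> \<open>Small enough that Z^3, at most D^(99 b), stays below x^(1/16), half of the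
   exponent 1 / 8 saved in the lattice count.\<close>
 define \<theta> where "\<theta> = 1 / (16 * (100 * real b + 100))"
 have \<theta>: "0 < \<theta>" "\<theta> \<le> 1 / 1600" "real (99 * b) * \<theta> \<le> 1 / 16"
 proof -
  define a where "a = 100 * real b + 100"
  have a: "a \<ge> 100" "real (99 * b) \<le> a" by (simp_all add: a_def)
  have \<theta>a: "\<theta> = 1 / (16 * a)" by (simp add: \<theta>_def a_def)
  show "0 < \<theta>" unfolding \<theta>a using a(1) by simp
  show "\<theta> \<le> 1 / 1600" unfolding \<theta>a using a(1) by (intro frac_le) auto
  have "real (99 * b) * \<theta> = real (99 * b) / (16 * a)" unfolding \<theta>a by simp
  also have "... \<le> a / (16 * a)" by (rule divide_right_mono[OF a(2)]) (use a(1) in simp)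
  also have "... = 1 / 16" using a(1) by simp
  finally show "real (99 * b) * \<theta> \<le> 1 / 16" .
 qed
 \<comment> \<open>With Y = \<kappa> c0 J / L the sieve term P below is at least 16 Y. The part 3 P
   / 16 survives the subtraction of B, one Y pays for the other errors, and 2 Y is left for twice
   the sum.\<close>
 define \<kappa> where "\<kappa> = exp (- 10 :: real) / 256"
 have \<kappa>: "\<kappa> > 0" by (simp add: \<kappa>_def)
 define q where "q = quarter_area"
 have q: "q > 0" unfolding q_def by (rule quarter_area_pos)
 \<comment> \<open>Makes \<open>c6 * J * (t / L)\<close> equal to the Y allotted to the
   errors.\<close>
 define c6 where "c6 = exp (- 10) * q / 32"
 have c6: "c6 > 0" using q by (simp add: c6_def)
 have main: "\<forall>\<^sub>F x::real in at_top. \<forall>D::nat. \<forall>C.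
      prime D \<and> D > 3 \<and> [D = 3] (mod 4) \<and> real D = x powr \<theta> \<and> C \<in> ideal_classes D \<and>
      (\<exists>\<beta>::real. \<beta> > 1 - \<theta> / 400 / ln (real D) \<and> dirichlet_L (chi D) (of_real \<beta>) = 0)
      -->
      prime_class_sum D C f x \<ge>
       \<kappa> * (Re (fourier_transform f 0) / real (class_number D)
         * (Re (dirichlet_L (chi D) 1) / ln x))"
  if \<nu>: "0 < \<nu>" "\<nu> \<le> \<theta>" and wf: "weight_function \<nu> f" for \<nu> f
 proof -
  have \<nu>4: "\<nu> \<le> 1 / 4" using \<nu> \<theta> by linarith
  obtain K where tf: "test_function f \<nu> K" using weight_function_test(1)[OF wf \<nu>(1) \<nu>4] by blast
  define J where "J = integral {0..3} f"
  have JF: "Re (fourier_transform f 0) = J" unfolding J_def by (rule weight_function_test(2)[OF wf \<nu>(1) \<nu>4])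
  have J: "J > 0" using wf unfolding weight_function_def JF by blast
  have fnn: "0 \<le> f u" for u using wf unfolding weight_function_def by blast
  have K: "K \<ge> 0" by (rule test_function.K_nonneg[OF tf])
  \<comment> \<open>What x has to exceed: E1 makes B at most L J / 16, E2 and E3 absorb the sieve
    remainder and the inert primes, and E4 gives D \<ge> 10400.\<close>
  have E1: "\<forall>\<^sub>F x in at_top. 128 * K * (ln x)\<^sup>2 * x powr (- (1 / 8)) \<le> J"
   by (rule eventually_log_decay) (use J K in auto)
  have E2: "\<forall>\<^sub>F x in at_top. 88 * K * (ln x)\<^sup>2 * x powr (- (1 / 32)) \<le> c6 * J / 2"
   by (rule eventually_log_decay) (use J K c6 in auto)
  have E3: "\<forall>\<^sub>F x in at_top. K * (8 * q + 9) * (ln x)\<^sup>2 * x powr (- \<theta>) \<le> c6 * J / 2"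
   by (rule eventually_log_decay) (use J K c6 q \<theta> in auto)
  have E4: "\<forall>\<^sub>F x in at_top. 10400 * (ln x)\<^sup>2 * x powr (- \<theta>) \<le> 1"
   by (rule eventually_log_decay) (use \<theta> in auto)
  show ?thesis using eventually_ge_at_top[of 3] E1 E2 E3 E4
  proof eventually_elim
   case (elim x)
   define L where "L = ln x"
   have x: "x \<ge> 3" "x > 0" "x \<ge> 1" using elim(1) by auto
   have L1: "L \<ge> 1"
   proof -
    have "exp 1 \<le> x" using x exp_le by simp
    thus ?thesis unfolding L_def using x by (subst ln_ge_iff) auto
   qed
   have LL: "1 \<le> L\<^sup>2" using L1 by (simp add: one_le_power)
   show ?case
   proof (intro allI impI, elim conjE exE)
    fix D C \<beta>
    assume D: "prime D" "D > 3" "[D = 3] (mod 4)" and Dx: "real D = x powr \<theta>" and C: "C \<in> ideal_classes D"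
     and \<beta>: "\<beta> > 1 - \<theta> / 400 / ln (real D)" and zero: "dirichlet_L (chi D) (of_real \<beta>) = 0"
    have "D mod 4 = 3" using D(3) by (simp add: cong_def)
    hence "D + 1 = 4 * ((D + 1) div 4)" by presburger
    then interpret imag_quad D "(D + 1) div 4" by unfold_locales (use D in auto)
    have chi: "chi D = (\<lambda>n. of_real (kron D n))" by (rule ext) (rule chi_eq_kron)
    define l where "l = Re (dirichlet_L (chi D) 1)"
    define h where "h = real (class_number D)"
    have S0: "prime_class_sum D C f x \<ge> 0" by (rule prime_class_sum_nonneg[OF fnn])
    have "\<kappa> * (J / h * (l / L)) \<le> prime_class_sum D C f x"
    \<comment> \<open>Degenerate values: division by a class number 0 yields 0, and l \<le> 0 makes
      the right-hand side at most 0, while the sum is nonnegative.\<close>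
    proof (cases "class_number D = 0 \<or> l \<le> 0")
     case True
     have "J / h * (l / L) \<le> 0"
     proof (cases "class_number D = 0")
      case False
      hence "l / L \<le> 0" using True L1 by (simp add: divide_le_0_iff)
      moreover have "J / h \<ge> 0" using J by (simp add: h_def)
      ultimately show ?thesis by (rule mult_nonneg_nonpos[rotated])
     qed (simp add: h_def)
     hence "\<kappa> * (J / h * (l / L)) \<le> 0" by (rule mult_nonneg_nonpos[OF less_imp_le[OF \<kappa>]])
     thus ?thesis using S0 by linarith
    next
     case False
     hence l0: "l > 0" and h0: "h > 0" and fin: "finite (ideal_classes D)"
      by (auto simp: h_def class_number_def card_gt_0_iff intro: card_ge_0_finite)
     have lnD: "ln (real D) = \<theta> * L" unfolding Dx L_def using x by (simp add: ln_powr)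
     \<comment> \<open>Since ln D = \<theta> ln x, the constant c = \<theta> / 400 becomes the bound
       1 / (400 ln x).\<close>
     have "\<theta> / 400 / (\<theta> * L) = 1 / (400 * L)" using \<theta> by simp
     hence \<beta>1: "1 - \<beta> \<le> 1 / (400 * L)" using \<beta> unfolding lnD by linarith
     have "1 / (400 * L) \<le> 1 / (400 * 1)" using L1 by (intro frac_le) auto
     hence \<beta>2: "\<beta> \<ge> 3 / 4" using \<beta>1 by linarith
     have sums1: "(\<lambda>n. kron D (Suc n) * real (Suc n) powr (- 1)) sums l"
      using rc.dirichlet_L_sums(1)[of 1] unfolding l_def chi by simp
     have sums0: "(\<lambda>n. kron D (Suc n) * real (Suc n) powr (- \<beta>)) sums 0"
      using rc.dirichlet_L_sums(1)[of \<beta>] \<beta>2 zero unfolding chi by simp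
     have xt: "x powr (- \<theta>) * x powr \<theta> = 1" using x by (simp flip: powr_add)
     have "10400 * 1 * x powr (- \<theta>) \<le> 10400 * L\<^sup>2 * x powr (- \<theta>)"
      using LL by (intro mult_right_mono mult_left_mono) auto
     hence "10400 * x powr (- \<theta>) \<le> 1" using elim(5) unfolding L_def by linarith
     hence "(10400 * x powr (- \<theta>)) * x powr \<theta> \<le> 1 * x powr \<theta>" by (intro mult_right_mono) auto
     hence "10400 \<le> real D" unfolding Dx mult.assoc xt by simp
     hence D10400: "D \<ge> 10400" by simp
     have split: "(\<Sum>p | prime p \<and> D ^ 32 < p \<and> p \<le> (nat \<lceil>x\<rceil>)\<^sup>2 \<and> kron D p = 1. 1 / real p) \<le> 1 / 12"
      by (rule split_prime_sum_small[OF sums1 l0 sums0 \<beta>2 _ x(1) D10400]) (use \<beta>1 in \<open>simp add: L_def\<close>)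
     define z where "z = real (D ^ 32) + 1"
     define N where "N = real D"
     have N: "N \<ge> 2" "N = x powr \<theta>" unfolding N_def using D10400 Dx by auto
     have N1: "1 \<le> N ^ 32" using N by (intro one_le_power) auto
     have zN: "z = N ^ 32 + 1" by (simp add: z_def N_def)
     have z2: "z \<ge> 2" using N1 zN by simp
     have "z \<le> 2 * N ^ 32" using N1 zN by simp
     also have "... \<le> N * N ^ 32" using N by (intro mult_right_mono) auto
     finally have z33: "z \<le> N ^ 33" by (simp flip: power_Suc)
     have Npow: "N ^ k = x powr (real k * \<theta>)" for k
     proof -
      have "N ^ k = N powr real k" by (rule powr_realpow[symmetric]) (use N(1) in linarith)
      thus ?thesis unfolding N(2) powr_powr by (simp add: mult.commute)
     qed
     obtain U0 L0 where sw: "sieve_weights sieve_densities (primes_below z) (z ^ b) (3 / 2) U0 L0"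
      using sieve z2 by blast
     define Z where "Z = z ^ b"
     have Z: "Z \<ge> 1" unfolding Z_def using z2 by (intro one_le_power) simp
     define B where "B = 8 * K * L * x powr (- (1 / 8))"
     define c0 where "c0 = 8 * q / sqrt (real D)"
     have c0: "c0 > 0" using q D10400 by (simp add: c0_def)
     have B0: "B \<ge> 0" using K L1 by (simp add: B_def)
     have "128 * K * 1 * x powr (- (1 / 8)) \<le> 128 * K * L\<^sup>2 * x powr (- (1 / 8))"
      using LL K by (intro mult_right_mono mult_left_mono) auto
     hence "128 * K * x powr (- (1 / 8)) \<le> J" using elim(2) unfolding L_def by linarith
     hence "L * (128 * K * x powr (- (1 / 8))) \<le> L * J" using L1 by (intro mult_left_mono) auto
     moreover have "L * (128 * K * x powr (- (1 / 8))) = 16 * B" by (simp add: B_def)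
     ultimately have B16: "B \<le> L * J / 16" by simp
     have LJ: "L * J > 0" using L1 J by simp
     have low: "exp (- 10) / 16 / (ln z)\<^sup>2 * c0 * (L * J / 4 - B) - 11 * Z ^ 3 * B -
       K * (8 * q + 9) * x powr \<nu> / real (D ^ 32) \<le> 2 * prime_class_sum D C f x"
     proof -
      have "B \<le> L * J / 4" using B16 LJ by linarith
      thus ?thesis
       using prime_class_sum_lower_bound[OF tf x(1) C sw[folded Z_def] Z z_def split]
       unfolding L_def B_def c0_def q_def J_def by simp
     qed
     define E where "E = exp (- 10) / 16 / L\<^sup>2"
     have E0: "E \<ge> 0" by (simp add: E_def)
     \<comment> \<open>As z \<le> D^33 and 33 \<theta> < 1, ln z may be replaced by ln x.\<close>
     have EV: "E \<le> exp (- 10) / 16 / (ln z)\<^sup>2"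
     proof -
      have "ln z \<le> ln (N ^ 33)" using z33 z2 N(1) by (subst ln_le_cancel_iff) auto
      also have "... = (33 * \<theta>) * L" unfolding Npow L_def using x by (simp add: ln_powr)
      also have "... \<le> 1 * L" using \<theta> L1 by (intro mult_right_mono) auto
      finally have "ln z \<le> L" by simp
      moreover have "ln z > 0" using z2 by simp
      ultimately have "(ln z)\<^sup>2 \<le> L\<^sup>2" "(ln z)\<^sup>2 > 0" by (auto intro: power_mono)
      thus ?thesis unfolding E_def by (intro frac_le) auto
     qed
     have err1: "11 * Z ^ 3 * B \<le> 88 * K * L * x powr (- (1 / 16))"
     proof -
      have "Z ^ 3 = z ^ (b * 3)" by (simp add: Z_def power_mult)
      also have "... \<le> (N ^ 33) ^ (b * 3)" using z33 z2 by (intro power_mono) auto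
      also have "... = N ^ (99 * b)" by (simp flip: power_mult add: mult_ac)
      also have "... = x powr (real (99 * b) * \<theta>)" by (rule Npow)
      also have "... \<le> x powr (1 / 16)" using \<theta>(3) x by (intro powr_mono) auto
      finally have "Z ^ 3 * B \<le> x powr (1 / 16) * B" using B0 by (rule mult_right_mono)
      also have "... = 8 * K * L * (x powr (1 / 16) * x powr (- (1 / 8)))" by (simp add: B_def)
      also have "x powr (1 / 16) * x powr (- (1 / 8)) = x powr (- (1 / 16))" by (simp flip: powr_add)
      finally have "Z ^ 3 * B \<le> 8 * K * L * x powr (- (1 / 16))" .
      hence "11 * (Z ^ 3 * B) \<le> 11 * (8 * K * L * x powr (- (1 / 16)))" by (rule mult_left_mono) simp
      moreover have "11 * (8 * K * L * x powr (- (1 / 16))) = 88 * K * L * x powr (- (1 / 16))" by simp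
      moreover have "11 * Z ^ 3 * B = 11 * (Z ^ 3 * B)" by (rule mult.assoc)
      ultimately show ?thesis by (simp only:)
     qed
     \<comment> \<open>The factor x^\<nu> is at most D because \<nu> \<le> \<theta>, so it uses up
       only one of the 32 powers of D.\<close>
     have err2: "K * (8 * q + 9) * x powr \<nu> / real (D ^ 32) \<le> K * (8 * q + 9) * x powr (- (31 * \<theta>))"
     proof -
      have "real (D ^ 32) = x powr (32 * \<theta>)" using Npow[of 32] by (simp add: N_def)
      hence "K * (8 * q + 9) * x powr \<nu> / real (D ^ 32) = K * (8 * q + 9) * x powr (\<nu> - 32 * \<theta>)"
       using x by (simp add: powr_diff)
      also have "... \<le> K * (8 * q + 9) * x powr (- (31 * \<theta>))"
       using \<nu> x K q by (intro mult_left_mono powr_mono) auto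
      finally show ?thesis .
     qed
     \<comment> \<open>This is 1 / sqrt D, the size of c0, against which the errors must be
       small.\<close>
     define t where "t = x powr (- (\<theta> / 2))"
     have t0: "t > 0" using x by (simp add: t_def)
     have c0t: "c0 = 8 * q * t"
     proof -
      have "sqrt (real D) = x powr (\<theta> / 2)" unfolding Dx using x by (simp add: powr_half_sqrt[symmetric] powr_powr)
      moreover have "t = inverse (x powr (\<theta> / 2))" unfolding t_def by (rule powr_minus)
      ultimately show ?thesis unfolding c0_def by (simp only: divide_inverse)
     qed
     have err: "88 * K * L * x powr (- (1 / 16)) + K * (8 * q + 9) * x powr (- (31 * \<theta>)) \<le> c6 * J * (t / L)"
     proof -
      have tL: "t / L \<ge> 0" using t0 L1 by simp
      have sq: "L\<^sup>2 * (t / L) = L * t" using L1 by (simp add: power2_eq_square)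
      have "88 * K * L * x powr (- (1 / 16)) \<le> 88 * K * L * (x powr (- (1 / 32)) * t)"
       unfolding t_def powr_add[symmetric] using \<theta> x K L1 by (intro mult_left_mono powr_mono) auto
      also have "... = 88 * K * (L\<^sup>2 * (t / L)) * x powr (- (1 / 32))" unfolding sq by simp
      also have "... = (88 * K * L\<^sup>2 * x powr (- (1 / 32))) * (t / L)" by simp
      also have "... \<le> c6 * J / 2 * (t / L)"
       using elim(3) tL unfolding L_def by (rule mult_right_mono)
      finally have 1: "88 * K * L * x powr (- (1 / 16)) \<le> c6 * J / 2 * (t / L)" .
      have "K * (8 * q + 9) * x powr (- (31 * \<theta>)) \<le> K * (8 * q + 9) * (x powr (- \<theta>) * t)"
       unfolding t_def powr_add[symmetric] using \<theta> x K q by (intro mult_left_mono powr_mono) auto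
      also have "... \<le> K * (8 * q + 9) * (x powr (- \<theta>) * (L * t))"
       using L1 t0 K q by (intro mult_left_mono) auto
      also have "... = (K * (8 * q + 9) * L\<^sup>2 * x powr (- \<theta>)) * (t / L)" unfolding sq[symmetric] by simp
      also have "... \<le> c6 * J / 2 * (t / L)"
       using elim(4) tL unfolding L_def by (rule mult_right_mono)
      finally have 2: "K * (8 * q + 9) * x powr (- (31 * \<theta>)) \<le> c6 * J / 2 * (t / L)" .
      have half: "c6 * J * (t / L) = c6 * J / 2 * (t / L) + c6 * J / 2 * (t / L)"
       by (simp only: distrib_right[symmetric]) simp
      show ?thesis unfolding half by (rule add_mono[OF 1 2])
     qed
     define P where "P = exp (- 10) / 16 / (ln z)\<^sup>2 * c0 * (L * J)"
     have EP: "E * c0 * (L * J) \<le> P"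
      unfolding P_def using EV c0 LJ by (intro mult_right_mono) auto
     define Y where "Y = \<kappa> * (c0 * (J / L))"
     have gen: "s / 16 / L\<^sup>2 * c * (L * J) = 16 * (s / 256 * (c * (J / L)))" for s c :: real
      using L1 by (simp add: field_simps power2_eq_square)
     have Eeq: "E * c0 * (L * J) = 16 * Y" unfolding E_def \<kappa>_def Y_def by (rule gen)
     have c6eq: "c6 * J * (t / L) = Y" unfolding c6_def \<kappa>_def c0t Y_def by simp
     have "exp (- 10) / 16 / (ln z)\<^sup>2 * c0 * (L * J * 3 / 16) \<le> exp (- 10) / 16 / (ln z)\<^sup>2 * c0 * (L * J / 4 - B)"
     proof (rule mult_left_mono)
      show "L * J * 3 / 16 \<le> L * J / 4 - B" using B16 by linarith
     qed (use c0 in simp)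
     moreover have "exp (- 10) / 16 / (ln z)\<^sup>2 * c0 * (L * J * 3 / 16) = P * 3 / 16" by (simp add: P_def)
     ultimately have "P * 3 / 16 - c6 * J * (t / L) \<le> 2 * prime_class_sum D C f x"
      using low err err1 err2 by linarith
     hence S: "Y \<le> prime_class_sum D C f x" using EP unfolding Eeq c6eq by linarith
     \<comment> \<open>The lower bound obtained so far is in terms of c0; here c0 is exchanged for l
       / h.\<close>
     have "l \<le> c0 * h" using class_number_inequality[OF fin sums1] unfolding c0_def q_def h_def .
     hence "l / h \<le> c0" using h0 by (simp add: divide_le_eq)
     hence "(l / h) * (J / L) \<le> c0 * (J / L)" using J L1 by (intro mult_right_mono) auto
     hence "\<kappa> * ((l / h) * (J / L)) \<le> Y" unfolding Y_def by (rule mult_left_mono[OF _ less_imp_le[OF \<kappa>]])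
     moreover have eq: "J / h * (l / L) = (l / h) * (J / L)" by simp
     ultimately show ?thesis unfolding eq using S by linarith
    qed
    thus "\<kappa> * (Re (fourier_transform f 0) / real (class_number D) * (Re (dirichlet_L (chi D) 1) / ln x))
      \<le> prime_class_sum D C f x"
     unfolding JF l_def h_def L_def .
   qed
  qed
 qed
 have \<theta>': "\<theta> < 1" "\<theta> / 400 > 0" using \<theta> by auto
 show ?thesis
 proof (rule exI[of _ \<theta>], intro conjI, rule \<theta>(1), rule \<theta>'(1), rule exI[of _ \<theta>], intro conjI, rule \<theta>(1), rule \<theta>'(1),
   rule exI[of _ "\<theta> / 400"], intro conjI, rule \<theta>'(2), rule exI[of _ \<kappa>], intro conjI, rule \<kappa>, intro allI impI, elim conjE)
  fix \<nu> f
  assume "0 < \<nu>" "\<nu> \<le> \<theta>" "weight_function \<nu> f"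
  thus "\<forall>\<^sub>F x::real in at_top. \<forall>D::nat. \<forall>C.
      prime D \<and> D > 3 \<and> [D = 3] (mod 4) \<and> real D = x powr \<theta> \<and> C \<in> ideal_classes D \<and>
      (\<exists>\<beta>::real. \<beta> > 1 - \<theta> / 400 / ln (real D) \<and> dirichlet_L (chi D) (of_real \<beta>) = 0)
      -->
      prime_class_sum D C f x \<ge>
       \<kappa> * (Re (fourier_transform f 0) / real (class_number D)
         * (Re (dirichlet_L (chi D) 1) / ln x))"
   by (rule main)
 qed
qed

end
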